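(* There exist probability measures $\mu_\beta$ on $\mathbb R$, $\beta=1,2,4$, such that whenever $V$, $a$, $(I_N)_N$ are as in the setting described in the context and the uniform kernel convergence assumption stated there holds, one has for $\beta=1,2,4$ $$\lim_{N\to\infty}\mathbb E_{N,\beta}\left(\sup_{s\ge 0}\left|\int_0^s d\sigma_N(H)-\int_0^s d\mu_\beta\right|\right)=0 .$$
   Context: Ensembles. Let $\beta\in\{1,2,4\}$. For $N\in\mathbb N$ consider random $N\times N$ matrices $H$, real symmetric ($\beta=1$), complex Hermitian ($\beta=2$) or quaternionic self-dual ($\beta=4$), with probability measure $\frac1{Z_{N,\beta}}e^{-N\,\mathrm{tr}(V(M))}dM$, where $dM$ is the product of Lebesgue measures on the algebraically independent entries and $V:\mathbb R\to\mathbb R$ grows sufficiently fast that all moments of $e^{-NV(x)}dx$ are finite. The ordered eigenvalues $\widetilde\lambda_1\le\dots\le\widetilde\lambda_N$ of $H$ have joint density on $\mathcal W_N=\{\lambda\in\mathbb R^N:\lambda_1\le\dots\le\lambda_N\}$ equal to $R^{(\beta)}_{N,N}(\lambda)=\frac1{Z_{N,\beta}}\prod_{j<k}|\lambda_k-\lambda_j|^\beta\prod_{j=1}^N w_\beta^{(N)}(\lambda_j)$ (with normalization constant again denoted $Z_{N,\beta}$), where $w_\beta^{(N)}(x)=e^{-NV(x)}$ for $\beta=1,2$ and $w_4^{(N)}(x)=e^{-2NV(x)}$. $\mathbb E_{N,\beta}$ denotes expectation. Rescaling. It is assumed that a limiting spectral density $\psi$ exists, i.e. $\frac1N\mathbb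 E_{N,\beta}(\#\{j:\widetilde\lambda_j\le s\})\to\int_{-\infty}^s\psi(t)dt$ as $N\to\infty$ for $s\ge0$. The point $a$ is a continuity point of $\psi$ in the interior of its support, with $\psi(a)>0$. $I_N$ is an interval with centre $a$, with $|I_N|\to0$ and $N|I_N|\to\infty$ as $N\to\infty$. Rescaled eigenvalues: $\lambda_i=(\widetilde\lambda_i-a)N\psi(a)$. Set $A_N=N\psi(a)(I_N-a)$, so $\widetilde\lambda_i\in I_N$ iff $\lambda_i\in A_N$. For $t\in\mathbb R$ write $\tilde t=a+\frac{t}{N\psi(a)}$. Spacing measure: $\sigma_N(H)=\frac1{|A_N|}\sum_{\widetilde\lambda_{i+1},\widetilde\lambda_i\in I_N}\delta_{\lambda_{i+1}-\lambda_i}$; $\int_0^s d\nu$ denotes $\nu([0,s])$. Correlation functions. $R^{(\beta)}_{N,N}$ is regarded as a function on $\mathbb R^N$ by the same formula. For $k\le N$, $R^{(\beta)}_{N,k}(\widetilde\lambda_1,\dots,\widetilde\lambda_k)=\frac1{(N-k)!}\int_{\mathbb R^{N-k}}R^{(\beta)}_{N,N}(\widetilde\lambda_1,\dots,\widetilde\lambda_N)\,d\widetilde\lambda_{k+1}\cdots d\widetilde\lambda_N$ and $B^{(\beta)}_{N,k}(t_1,\dots,t_k)=(N\psi(a))^{-k}R^{(\beta)}_{N,k}(\tilde t_1,\dots,\tilde t_k)$. Kernels. $\hat K_{N,2}:\mathbb R^2\to\mathbb R$ and $\hat K_{N,\beta}:\mathbb R^2\to\mathbb R^{2\times2}$ ($\beta=1,4$)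 are the standard (rescaled) kernels of the ensembles, for which, for all $k\le N$, $B^{(2)}_{N,k}(t_1,\dots,t_k)=\det(\hat K_{N,2}(\tilde t_i,\tilde t_j))_{1\le i,j\le k}$ and $B^{(\beta)}_{N,k}(t_1,\dots,t_k)=\mathrm{Pf}\big((\hat K_{N,\beta}(\tilde t_i,\tilde t_j))_{1\le i,j\le k}J\big)$ for $\beta=1,4$, with $J=\mathrm{diag}(\sigma,\dots,\sigma)\in\mathbb R^{2k\times2k}$, $\sigma=\begin{pmatrix}0&1\\-1&0\end{pmatrix}$, and Pf the Pfaffian. Limiting kernels. $K_2(x,y)=\frac{\sin(\pi(x-y))}{\pi(x-y)}$ and, for $\beta=1,4$, $K_\beta=\begin{pmatrix}\mathsf S_\beta&\mathsf D_\beta\\ \mathsf I_\beta&\mathsf S_\beta\end{pmatrix}$ with $\mathsf S_1(x,y)=K_2(x,y)$, $\mathsf S_4(x,y)=K_2(2x,2y)$, $\mathsf D_1(x,y)=\frac{\partial}{\partial x}K_2(x,y)$, $\mathsf D_4(x,y)=\frac{\partial}{\partial x}K_2(2x,2y)$, $\mathsf I_1(x,y)=\int_0^{x-y}K_2(t,0)dt-\frac12\mathrm{sgn}(x-y)$, $\mathsf I_4(x,y)=\int_0^{x-y}K_2(2t,0)dt$. Uniform kernel convergence assumption. There is a sequence $(\kappa_N)_{N\in\mathbb N}$ with $\kappa_N\to0$ such that for $\beta=1,2,4$ and all $x,y\in A_N$: $\hat K_{N,\beta}(\tilde x,\tilde y)=K_\beta(x,y)+\mathcal O(\kappa_N)$,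 with the implicit constant uniform in $x,y\in A_N$ (and in $N$). *)

theory Defs
  imports
    "HOL-Probability.Probability"
    "HOL-Combinatorics.Permutations"
    "HOL-Computational_Algebra.Fundamental_Theorem_Algebra"
    "Jordan_Normal_Form.Determinant"
    "Jordan_Normal_Form.Char_Poly"
begin

section \<open>The matrix ensembles\<close>

text \<open>
  The algebraically independent real entries of a real symmetric (\<open>\<beta> = 1\<close>), complex Hermitian
  (\<open>\<beta> = 2\<close>) or quaternionic self-dual (\<open>\<beta> = 4\<close>) matrix: \<open>(i, j, c)\<close> labels the \<open>c\<close>-th real
  component of the \<open>(i, j)\<close> entry, for \<open>i < j\<close>, and \<open>(i, i, 0)\<close> labels the (real) diagonal.
\<close>

definition coords :: "nat \<Rightarrow> nat \<Rightarrow> (nat \<times> nat \<times> nat) set" where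
  "coords \<beta> N = {(i, j, c). i < N \<and> j < N \<and> (i = j \<and> c = 0 \<or> i < j \<and> c < \<beta>)}"

definition entry :: "nat \<Rightarrow> (nat \<times> nat \<times> nat \<Rightarrow> real) \<Rightarrow> nat \<Rightarrow> nat \<Rightarrow> nat \<Rightarrow> real" where
  "entry \<beta> h i j c =
     (if i = j then (if c = 0 then h (i, i, 0) else 0)
      else if \<beta> \<le> c then 0
      else if i < j then h (i, j, c)
      else if c = 0 then h (j, i, 0) else - h (j, i, c))"

text \<open>
  For \<open>\<beta> = 4\<close> the quaternion \<open>q\<^sub>0 + q\<^sub>1 i + q\<^sub>2 j + q\<^sub>3 k\<close> is represented by the complex \<open>2 \<times> 2\<close>
  block with rows \<open>(q\<^sub>0 + \<i> q\<^sub>1, q\<^sub>2 + \<i> q\<^sub>3)\<close> and \<open>(- q\<^sub>2 + \<i> q\<^sub>3, q\<^sub>0 - \<i> q\<^sub>1)\<close>, so the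
  matrix is a complex Hermitian \<open>2N \<times> 2N\<close> matrix each of whose eigenvalues has even multiplicity.
\<close>

definition quat_block :: "(nat \<Rightarrow> real) \<Rightarrow> complex mat" where
  "quat_block q = mat_of_rows_list 2
     [[Complex (q 0) (q 1), Complex (q 2) (q 3)],
      [Complex (- q 2) (q 3), Complex (q 0) (- q 1)]]"

definition ensemble_matrix :: "nat \<Rightarrow> nat \<Rightarrow> (nat \<times> nat \<times> nat \<Rightarrow> real) \<Rightarrow> complex mat" where
  "ensemble_matrix \<beta> N h =
     (if \<beta> = 4
      then Matrix.mat (2 * N) (2 * N)
             (\<lambda>(r, s). quat_block (entry \<beta> h (r div 2) (s div 2)) $$ (r mod 2, s mod 2))
      else Matrix.mat N N (\<lambda>(i, j). Complex (entry \<beta> h i j 0) (entry \<beta> h i j 1)))"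

text \<open>
  Eigenvalues with algebraic multiplicity. The matrices above are Hermitian, so \<open>Re\<close> is only a
  type conversion.
\<close>

definition spectrum_mset :: "complex mat \<Rightarrow> real multiset" where
  "spectrum_mset H = image_mset Re (proots (char_poly H))"

definition trace_fun :: "(real \<Rightarrow> real) \<Rightarrow> complex mat \<Rightarrow> real" where
  "trace_fun V H = (\<Sum>x\<in>#spectrum_mset H. V x)"

text \<open>
  Ordered eigenvalues, numbered from \<open>0\<close> to \<open>N - 1\<close>. For \<open>\<beta> = 4\<close> every eigenvalue of the
  \<open>2N \<times> 2N\<close> matrix is doubled and only one representative of each pair is kept, whereas
  \<open>trace_fun\<close> counts both of them; this is the origin of the weight \<open>exp (- 2 N V)\<close> below.
\<close>

definition ordered_eigenvalue :: "nat \<Rightarrow> complex mat \<Rightarrow> nat \<Rightarrow> real" where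
  "ordered_eigenvalue \<beta> H i =
     sorted_list_of_multiset (spectrum_mset H) ! ((if \<beta> = 4 then 2 else 1) * i)"

definition unnormalized_ensemble ::
    "nat \<Rightarrow> (real \<Rightarrow> real) \<Rightarrow> nat \<Rightarrow> (nat \<times> nat \<times> nat \<Rightarrow> real) measure" where
  "unnormalized_ensemble \<beta> V N =
     density (PiM (coords \<beta> N) (\<lambda>_. lborel))
       (\<lambda>h. ennreal (exp (- (real N * trace_fun V (ensemble_matrix \<beta> N h)))))"

definition ensemble ::
    "nat \<Rightarrow> (real \<Rightarrow> real) \<Rightarrow> nat \<Rightarrow> (nat \<times> nat \<times> nat \<Rightarrow> real) measure" where
  "ensemble \<beta> V N =
     (let M = unnormalized_ensemble \<beta> V N in scale_measure (inverse (emeasure M (space M))) M)"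

definition eigenvalues :: "nat \<Rightarrow> nat \<Rightarrow> (nat \<times> nat \<times> nat \<Rightarrow> real) \<Rightarrow> nat \<Rightarrow> real" where
  "eigenvalues \<beta> N h = restrict (ordered_eigenvalue \<beta> (ensemble_matrix \<beta> N h)) {..<N}"


section \<open>Eigenvalue density and correlation functions\<close>

definition weyl_chamber :: "nat \<Rightarrow> (nat \<Rightarrow> real) set" where
  "weyl_chamber N = {l. \<forall>i j. i \<le> j \<and> j < N \<longrightarrow> l i \<le> l j}"

definition weight :: "nat \<Rightarrow> (real \<Rightarrow> real) \<Rightarrow> nat \<Rightarrow> real \<Rightarrow> real" where
  "weight \<beta> V N x = exp (- ((if \<beta> = 4 then 2 else 1) * real N * V x))"

definition unnormalized_density ::
    "nat \<Rightarrow> (real \<Rightarrow> real) \<Rightarrow> nat \<Rightarrow> (nat \<Rightarrow> real) \<Rightarrow> real" where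
  "unnormalized_density \<beta> V N l =
     (\<Prod>k<N. \<Prod>j<k. \<bar>l k - l j\<bar> ^ \<beta>) * (\<Prod>j<N. weight \<beta> V N (l j))"

definition eigenvalue_density :: "nat \<Rightarrow> (real \<Rightarrow> real) \<Rightarrow> nat \<Rightarrow> (nat \<Rightarrow> real) \<Rightarrow> real" where
  "eigenvalue_density \<beta> V N l =
     unnormalized_density \<beta> V N l /
     (LINT l:weyl_chamber N|PiM {..<N} (\<lambda>_. lborel). unnormalized_density \<beta> V N l)"

definition has_eigenvalue_density :: "nat \<Rightarrow> (real \<Rightarrow> real) \<Rightarrow> nat \<Rightarrow> bool" where
  "has_eigenvalue_density \<beta> V N \<longleftrightarrow>
     distributed (ensemble \<beta> V N) (PiM {..<N} (\<lambda>_. lborel)) (eigenvalues \<beta> N)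
       (\<lambda>l. ennreal (indicator (weyl_chamber N) l * eigenvalue_density \<beta> V N l))"

definition corr :: "nat \<Rightarrow> (real \<Rightarrow> real) \<Rightarrow> nat \<Rightarrow> nat \<Rightarrow> (nat \<Rightarrow> real) \<Rightarrow> real" where
  "corr \<beta> V N k x =
     (LINT y|PiM {k..<N} (\<lambda>_. lborel).
        eigenvalue_density \<beta> V N (\<lambda>i. if i < k then x i else y i)) / fact (N - k)"


section \<open>Rescaling\<close>

text \<open>\<open>unscale \<psi> a N t\<close> is the point whose rescaled version is \<open>t\<close> (written with a tilde on \<open>t\<close>).\<close>

definition rescale :: "(real \<Rightarrow> real) \<Rightarrow> real \<Rightarrow> nat \<Rightarrow> real \<Rightarrow> real" where
  "rescale \<psi> a N x = (x - a) * (real N * \<psi> a)"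

definition unscale :: "(real \<Rightarrow> real) \<Rightarrow> real \<Rightarrow> nat \<Rightarrow> real \<Rightarrow> real" where
  "unscale \<psi> a N t = a + t / (real N * \<psi> a)"

definition scaled_corr ::
    "nat \<Rightarrow> (real \<Rightarrow> real) \<Rightarrow> (real \<Rightarrow> real) \<Rightarrow> real \<Rightarrow> nat \<Rightarrow> nat \<Rightarrow> (nat \<Rightarrow> real) \<Rightarrow> real" where
  "scaled_corr \<beta> V \<psi> a N k t =
     corr \<beta> V N k (\<lambda>i. unscale \<psi> a N (t i)) / (real N * \<psi> a) ^ k"

text \<open>Bounded intervals of positive length with given centre; end points may or may not belong.\<close>

definition interval_with_centre :: "real \<Rightarrow> real set \<Rightarrow> bool" where
  "interval_with_centre a J \<longleftrightarrow> (\<exists>r>0. {a - r<..<a + r} \<subseteq> J \<and> J \<subseteq> {a - r..a + r})"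

definition spacing_measure ::
    "(real \<Rightarrow> real) \<Rightarrow> real \<Rightarrow> (nat \<Rightarrow> real set) \<Rightarrow> nat \<Rightarrow> (nat \<Rightarrow> real) \<Rightarrow> real measure" where
  "spacing_measure \<psi> a I N l =
     scale_measure (inverse (emeasure lborel (rescale \<psi> a N ` I N)))
       (distr (count_space {i. Suc i < N \<and> l i \<in> I N \<and> l (Suc i) \<in> I N}) borel
          (\<lambda>i. rescale \<psi> a N (l (Suc i)) - rescale \<psi> a N (l i)))"

text \<open>
  \<open>has_eigenvalue_density\<close>, the classical formula for the joint law of the ordered eigenvalues of
  \<open>ensemble \<beta> V N\<close>, is part of the description of the ensemble. The density \<open>\<psi>\<close> may depend on
  \<open>\<beta>\<close>: for the same \<open>V\<close> the ensembles with \<open>\<beta> = 1\<close> and \<open>\<beta> = 2\<close> have different limiting densities.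
\<close>

definition setting ::
    "nat \<Rightarrow> (real \<Rightarrow> real) \<Rightarrow> (real \<Rightarrow> real) \<Rightarrow> real \<Rightarrow> (nat \<Rightarrow> real set) \<Rightarrow> bool" where
  "setting \<beta> V \<psi> a I \<longleftrightarrow>
     (\<forall>N\<ge>1. \<forall>k. integrable lborel (\<lambda>x. x ^ k * exp (- (real N * V x)))) \<and>
     (\<forall>N\<ge>1. has_eigenvalue_density \<beta> V N) \<and>
     (\<forall>x. 0 \<le> \<psi> x) \<and> integrable lborel \<psi> \<and>
     (\<forall>s\<ge>0. (\<lambda>N. (LINT h|ensemble \<beta> V N. real (card {j. j < N \<and> eigenvalues \<beta> N h j \<le> s})) / real N)
        \<longlonglongrightarrow> (LINT t:{..s}|lborel. \<psi> t)) \<and>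
     isCont \<psi> a \<and> a \<in> interior (closure {x. \<psi> x \<noteq> 0}) \<and> 0 < \<psi> a \<and>
     (\<forall>N\<ge>1. interval_with_centre a (I N)) \<and>
     (\<lambda>N. measure lborel (I N)) \<longlonglongrightarrow> 0 \<and>
     filterlim (\<lambda>N. real N * measure lborel (I N)) at_top sequentially"


section \<open>Kernels\<close>

text \<open>
  The usual sum over all permutations, which is the Pfaffian when \<open>A\<close> is skew-symmetric (of even
  dimension) and depends only on the skew-symmetric part of \<open>A\<close> in general.
\<close>

definition pfaffian :: "real mat \<Rightarrow> real" where
  "pfaffian A =
     (let k = dim_row A div 2 in
       (\<Sum>p | p permutes {..<2 * k}. of_int (sign p) * (\<Prod>i<k. A $$ (p (2 * i), p (2 * i + 1))))
       / (2 ^ k * fact k))"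

definition symplectic_J :: "nat \<Rightarrow> real mat" where
  "symplectic_J k = diag_block_mat (replicate k (mat_of_rows_list 2 [[0, 1], [-1, 0]]))"

definition block_matrix :: "(real \<Rightarrow> real \<Rightarrow> real mat) \<Rightarrow> nat \<Rightarrow> (nat \<Rightarrow> real) \<Rightarrow> real mat" where
  "block_matrix K k x =
     Matrix.mat (2 * k) (2 * k) (\<lambda>(r, s). K (x (r div 2)) (x (s div 2)) $$ (r mod 2, s mod 2))"

definition is_det_kernel ::
    "(real \<Rightarrow> real) \<Rightarrow> (real \<Rightarrow> real) \<Rightarrow> real \<Rightarrow> (nat \<Rightarrow> real \<Rightarrow> real \<Rightarrow> real) \<Rightarrow> bool" where
  "is_det_kernel V \<psi> a K \<longleftrightarrow>
     (\<forall>N\<ge>1. \<forall>k\<in>{1..N}. \<forall>t. scaled_corr 2 V \<psi> a N k t =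
        Determinant.det (Matrix.mat k k (\<lambda>(i, j). K N (unscale \<psi> a N (t i)) (unscale \<psi> a N (t j)))))"

definition is_pfaffian_kernel ::
    "nat \<Rightarrow> (real \<Rightarrow> real) \<Rightarrow> (real \<Rightarrow> real) \<Rightarrow> real \<Rightarrow> (nat \<Rightarrow> real \<Rightarrow> real \<Rightarrow> real mat) \<Rightarrow> bool" where
  "is_pfaffian_kernel \<beta> V \<psi> a K \<longleftrightarrow>
     (\<forall>N\<ge>1. \<forall>x y. K N x y \<in> carrier_mat 2 2) \<and>
     (\<forall>N\<ge>1. \<forall>k\<in>{1..N}. \<forall>t. scaled_corr \<beta> V \<psi> a N k t =
        pfaffian (block_matrix (K N) k (\<lambda>i. unscale \<psi> a N (t i)) * symplectic_J k))"

definition K2 :: "real \<Rightarrow> real \<Rightarrow> real" where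
  "K2 x y = sinc (pi * (x - y))"

definition K1_mat :: "real \<Rightarrow> real \<Rightarrow> real mat" where
  "K1_mat x y = mat_of_rows_list 2
     [[K2 x y, deriv (\<lambda>u. K2 u y) x],
      [(LBINT t=0..ereal (x - y). K2 t 0) - sgn (x - y) / 2, K2 x y]]"

definition K4_mat :: "real \<Rightarrow> real \<Rightarrow> real mat" where
  "K4_mat x y = mat_of_rows_list 2
     [[K2 (2 * x) (2 * y), deriv (\<lambda>u. K2 (2 * u) (2 * y)) x],
      [LBINT t=0..ereal (x - y). K2 (2 * t) 0, K2 (2 * x) (2 * y)]]"

definition limit_kernel :: "nat \<Rightarrow> real \<Rightarrow> real \<Rightarrow> real mat" where
  "limit_kernel \<beta> = (if \<beta> = 1 then K1_mat else K4_mat)"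

definition scalar_kernel_convergence ::
    "(real \<Rightarrow> real) \<Rightarrow> real \<Rightarrow> (nat \<Rightarrow> real set) \<Rightarrow> (nat \<Rightarrow> real \<Rightarrow> real \<Rightarrow> real) \<Rightarrow> bool" where
  "scalar_kernel_convergence \<psi> a I K \<longleftrightarrow>
     (\<exists>\<kappa> C. \<kappa> \<longlonglongrightarrow> 0 \<and>
       (\<forall>N\<ge>1. \<forall>x\<in>rescale \<psi> a N ` I N. \<forall>y\<in>rescale \<psi> a N ` I N.
          \<bar>K N (unscale \<psi> a N x) (unscale \<psi> a N y) - K2 x y\<bar> \<le> C * \<bar>\<kappa> N :: real\<bar>))"

definition matrix_kernel_convergence ::
    "nat \<Rightarrow> (real \<Rightarrow> real) \<Rightarrow> real \<Rightarrow> (nat \<Rightarrow> real set) \<Rightarrow> (nat \<Rightarrow> real \<Rightarrow> real \<Rightarrow> real mat) \<Rightarrow> bool" where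
  "matrix_kernel_convergence \<beta> \<psi> a I K \<longleftrightarrow>
     (\<exists>\<kappa> C. \<kappa> \<longlonglongrightarrow> 0 \<and>
       (\<forall>N\<ge>1. \<forall>x\<in>rescale \<psi> a N ` I N. \<forall>y\<in>rescale \<psi> a N ` I N. \<forall>p<2. \<forall>q<2.
          \<bar>K N (unscale \<psi> a N x) (unscale \<psi> a N y) $$ (p, q) - limit_kernel \<beta> x y $$ (p, q)\<bar>
            \<le> C * \<bar>\<kappa> N :: real\<bar>))"


section \<open>Expected Kolmogorov distance\<close>

text \<open>
  The supremum and the expectation are taken in \<open>ennreal\<close>, so neither boundedness nor integrability
  has to be presupposed.
\<close>

definition expected_discrepancy ::
    "nat \<Rightarrow> (real \<Rightarrow> real) \<Rightarrow> (real \<Rightarrow> real) \<Rightarrow> real \<Rightarrow> (nat \<Rightarrow> real set) \<Rightarrow> real measure \<Rightarrow> nat \<Rightarrow> ennreal" where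
  "expected_discrepancy \<beta> V \<psi> a I \<mu> N =
     (\<integral>\<^sup>+ h. (SUP s\<in>{0..}. ennreal
        \<bar>measure (spacing_measure \<psi> a I N (eigenvalues \<beta> N h)) {0..s} - measure \<mu> {0..s}\<bar>)
      \<partial>ensemble \<beta> V N)"

end

theory Submission
  imports Defs
begin

text \<open>
  After rescaling, the eigenvalues in the window \<open>A\<close> of length \<open>2 * r\<close> form
  a point process whose correlation functions are \<open>scaled_corr\<close>. A spacing of consecutive points is
  at most \<open>s\<close> exactly if the left one of them has a \<^emph>\<open>follower\<close>, i.e. another point of the window at
  distance at most \<open>s\<close> to its right. So \<open>\<sigma>\<^sub>N([0, s])\<close> is the number of points in the window minus
  the number of points without followers, divided by the length of the window. Everything is about
  the empirical distribution of the number of followers of a point.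

  \<^item> The \<open>k\<close>-th factorial moment of this distribution is the sum over \<open>(k + 1)\<close>-tuples of distinct
    points of the indicator that all of them lie within \<open>s\<close> to the right of the last one. Its
    expectation is an integral of the \<open>(k + 1)\<close>-point correlation function; the expectation of its
    square is, up to pairs of tuples that are close to each other, an integral of the \<open>(2 * k + 2)\<close>-point function.
    The limiting correlation functions are translation invariant and asymptotically factorise when two
    groups of points are far apart. Hence the variance of each factorial moment tends to \<open>0\<close>, and
    the moments converge in mean to constants (\<open>variance_small\<close>, \<open>total_limit\<close>).
  \<^item> The bound \<open>C ^ m * fact m\<close> for the \<open>m\<close>-point function gives an exponential moment \<open>q ^ n\<close> for
    some \<open>q > 1\<close> (\<open>exponential_moment\<close>). The generating function is therefore analytic in the disc
    of radius \<open>q\<close>, its Taylor coefficients at \<open>1\<close> are the factorial moments, and analytic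
    continuation from \<open>1\<close> to \<open>0\<close> shows that they determine its value at \<open>0\<close>, the fraction of points
    without followers (\<open>determined_empty\<close>). The limit depends on the limiting correlation
    functions only, and this is the universality of \<open>\<mu>\<close>.
  \<^item> The limiting distribution function is Lipschitz continuous and tends to \<open>1\<close>, so pointwise
    convergence of the monotone functions \<open>s \<mapsto> \<sigma>\<^sub>N([0, s])\<close> on a finite grid controls the supremum
    over all \<open>s\<close> (\<open>sup_discrepancy_le\<close>, \<open>gap_distribution_exists\<close>).

  It remains to verify the hypotheses for the three ensembles. Symmetry of the joint density turns
  integrals over the Weyl chamber into correlation functions (\<open>chamber_correlation\<close>). Determinants
  and Pfaffians are bounded, Lipschitz continuous functions of the kernel entries, so convergence of
  the kernels gives convergence of the correlation functions. Factorisation is clear when all kernel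
  entries between the two groups vanish in the limit. For \<open>\<beta> = 4\<close> the entry \<open>\<integral> K2 (2 * t) 0\<close> tends to
  \<open>\<plusminus> 1 / 4\<close> instead; these off-diagonal blocks form an antisymmetric perturbation of the shape
  \<open>v\<^sup>T w - w\<^sup>T v\<close>, and the Pfaffian of a block matrix does not see it (\<open>pfaffian_sum_block\<close>).
\<close>

section \<open>Distributions on the naturals determined by factorial moments\<close>

text \<open>
  Convergence to zero in mean is needed along a sequence of different measures, and the integral is
  taken in \<open>ennreal\<close> so that finiteness for large \<open>N\<close> is part of the notion.
\<close>

definition mean_null :: "(nat \<Rightarrow> 'a measure) \<Rightarrow> (nat \<Rightarrow> 'a \<Rightarrow> real) \<Rightarrow> bool" where
  "mean_null D X \<longleftrightarrow> (\<forall>e>0. \<forall>\<^sub>F N in sequentially. (\<integral>\<^sup>+x. ennreal \<bar>X N x\<bar> \<partial>D N) \<le> ennreal e)"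

text \<open>
  Random weights \<open>w N x n\<close> on \<open>{..N}\<close> (in the application the proportion of points with exactly
  \<open>n\<close> followers) whose factorial moments converge in mean to the constants \<open>g k\<close> and which have a
  uniformly bounded exponential moment of base \<open>q\<close>.
\<close>

definition occupation_data ::
    "real \<Rightarrow> (nat \<Rightarrow> real) \<Rightarrow> (nat \<Rightarrow> 'a measure) \<Rightarrow> (nat \<Rightarrow> 'a \<Rightarrow> nat \<Rightarrow> real) \<Rightarrow> bool" where
  "occupation_data q g D w \<longleftrightarrow>
     (\<forall>N n. (\<lambda>x. w N x n) \<in> borel_measurable (D N)) \<and> (\<forall>N x n. 0 \<le> w N x n) \<and>
     (\<forall>\<^sub>F N in sequentially. prob_space (D N)) \<and>
     (\<forall>k. mean_null D (\<lambda>N x. (\<Sum>n\<le>N. w N x n * real (n choose k)) - g k)) \<and>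
     (\<exists>B::real. \<forall>\<^sub>F N in sequentially. (\<integral>\<^sup>+x. ennreal (\<Sum>n\<le>N. w N x n * q ^ n) \<partial>D N) \<le> ennreal B)"

text \<open>
  The limit \<open>c\<close> of the averages of \<open>f\<close> is chosen before the weights: it depends on \<open>f\<close>, \<open>q\<close> and the
  limiting moments \<open>g\<close> only. The type of the sample spaces has to be fixed for the quantifier.
\<close>

definition determined :: "'a itself \<Rightarrow> real \<Rightarrow> (nat \<Rightarrow> real) \<Rightarrow> (nat \<Rightarrow> real) \<Rightarrow> bool" where
  "determined T q g f \<longleftrightarrow> (\<exists>c. \<forall>(D :: nat \<Rightarrow> 'a measure) w. occupation_data q g D w \<longrightarrow>
     mean_null D (\<lambda>N x. (\<Sum>n\<le>N. w N x n * f n) - c))"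

lemma mean_null_add:
  assumes "mean_null D X" "mean_null D Y"
    and [measurable]: "\<And>N. X N \<in> borel_measurable (D N)" "\<And>N. Y N \<in> borel_measurable (D N)"
  shows "mean_null D (\<lambda>N x. X N x + Y N x)"
  unfolding mean_null_def
proof (intro allI impI)
  fix e :: real assume "0 < e"
  then have "\<forall>\<^sub>F N in sequentially. (\<integral>\<^sup>+x. ennreal \<bar>X N x\<bar> \<partial>D N) \<le> ennreal (e / 2)"
    "\<forall>\<^sub>F N in sequentially. (\<integral>\<^sup>+x. ennreal \<bar>Y N x\<bar> \<partial>D N) \<le> ennreal (e / 2)"
    using assms(1,2) by (auto simp: mean_null_def)
  then show "\<forall>\<^sub>F N in sequentially. (\<integral>\<^sup>+x. ennreal \<bar>X N x + Y N x\<bar> \<partial>D N) \<le> ennreal e"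
  proof eventually_elim
    case (elim N)
    have "(\<integral>\<^sup>+x. ennreal \<bar>X N x + Y N x\<bar> \<partial>D N) \<le> (\<integral>\<^sup>+x. ennreal \<bar>X N x\<bar> + ennreal \<bar>Y N x\<bar> \<partial>D N)"
      by (intro nn_integral_mono) (simp flip: ennreal_plus)
    also have "\<dots> = (\<integral>\<^sup>+x. ennreal \<bar>X N x\<bar> \<partial>D N) + (\<integral>\<^sup>+x. ennreal \<bar>Y N x\<bar> \<partial>D N)"
      by (rule nn_integral_add) auto
    also have "\<dots> \<le> ennreal (e / 2) + ennreal (e / 2)"
      using elim by (intro add_mono)
    also have "\<dots> = ennreal e" using \<open>0 < e\<close> by (simp flip: ennreal_plus)
    finally show ?case .
  qed
qed

lemma mean_null_cmult:
  assumes "mean_null D X" and [measurable]: "\<And>N. X N \<in> borel_measurable (D N)"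
  shows "mean_null D (\<lambda>N x. a * X N x)"
  unfolding mean_null_def
proof (intro allI impI)
  fix e :: real assume "0 < e"
  then have "\<forall>\<^sub>F N in sequentially. (\<integral>\<^sup>+x. ennreal \<bar>X N x\<bar> \<partial>D N) \<le> ennreal (e / (\<bar>a\<bar> + 1))"
    using assms(1) by (auto simp: mean_null_def)
  then show "\<forall>\<^sub>F N in sequentially. (\<integral>\<^sup>+x. ennreal \<bar>a * X N x\<bar> \<partial>D N) \<le> ennreal e"
  proof eventually_elim
    case (elim N)
    have "(\<integral>\<^sup>+x. ennreal \<bar>a * X N x\<bar> \<partial>D N) = ennreal \<bar>a\<bar> * (\<integral>\<^sup>+x. ennreal \<bar>X N x\<bar> \<partial>D N)"
      by (subst nn_integral_cmult[symmetric]) (auto simp: abs_mult ennreal_mult)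
    also have "\<dots> \<le> ennreal \<bar>a\<bar> * ennreal (e / (\<bar>a\<bar> + 1))"
      using elim by (intro mult_left_mono) auto
    also have "\<dots> = ennreal (\<bar>a\<bar> * (e / (\<bar>a\<bar> + 1)))" using \<open>0 < e\<close> by (simp flip: ennreal_mult)
    also have "\<dots> \<le> ennreal e" using \<open>0 < e\<close> by (intro ennreal_leI) (simp add: field_simps)
    finally show ?case .
  qed
qed

lemma determined_add:
  assumes "determined T q g f" "determined T q g h"
  shows "determined T q g (\<lambda>n. f n + h n)"
proof -
  obtain c where c: "\<And>D w. occupation_data q g (D :: nat \<Rightarrow> 'a measure) w \<Longrightarrow> mean_null D (\<lambda>N x. (\<Sum>n\<le>N. w N x n * f n) - c)"
    using assms(1) unfolding determined_def by blast
  obtain d where d: "\<And>D w. occupation_data q g (D :: nat \<Rightarrow> 'a measure) w \<Longrightarrow> mean_null D (\<lambda>N x. (\<Sum>n\<le>N. w N x n * h n) - d)"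
    using assms(2) unfolding determined_def by blast
  show ?thesis unfolding determined_def
  proof (intro exI[of _ "c + d"] allI impI)
    fix D :: "nat \<Rightarrow> 'a measure" and w assume o: "occupation_data q g D w"
    then have [measurable]: "\<And>N n. (\<lambda>x. w N x n) \<in> borel_measurable (D N)" by (simp add: occupation_data_def)
    have "mean_null D (\<lambda>N x. ((\<Sum>n\<le>N. w N x n * f n) - c) + ((\<Sum>n\<le>N. w N x n * h n) - d))"
      by (rule mean_null_add[OF c[OF o] d[OF o]]) auto
    then show "mean_null D (\<lambda>N x. (\<Sum>n\<le>N. w N x n * (f n + h n)) - (c + d))"
      by (simp add: sum.distrib distrib_left algebra_simps)
  qed
qed

lemma determined_cmult:
  assumes "determined T q g f"
  shows "determined T q g (\<lambda>n. a * f n)"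
proof -
  obtain c where c: "\<And>D w. occupation_data q g (D :: nat \<Rightarrow> 'a measure) w \<Longrightarrow> mean_null D (\<lambda>N x. (\<Sum>n\<le>N. w N x n * f n) - c)"
    using assms unfolding determined_def by blast
  show ?thesis unfolding determined_def
  proof (intro exI[of _ "a * c"] allI impI)
    fix D :: "nat \<Rightarrow> 'a measure" and w assume o: "occupation_data q g D w"
    then have [measurable]: "\<And>N n. (\<lambda>x. w N x n) \<in> borel_measurable (D N)" by (simp add: occupation_data_def)
    have "mean_null D (\<lambda>N x. a * ((\<Sum>n\<le>N. w N x n * f n) - c))"
      by (rule mean_null_cmult[OF c[OF o]]) auto
    then show "mean_null D (\<lambda>N x. (\<Sum>n\<le>N. w N x n * (a * f n)) - (a * c))"
      by (simp add: sum_distrib_left algebra_simps)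
  qed
qed

lemma determined_sum:
  assumes "finite I" "\<And>i. i \<in> I \<Longrightarrow> determined T q g (f i)"
  shows "determined T q g (\<lambda>n. \<Sum>i\<in>I. f i n)"
  using assms
proof (induction I rule: finite_induct)
  case empty
  then show ?case
    by (auto simp: determined_def mean_null_def intro!: exI[of _ 0])
next
  case (insert i I)
  then show ?case using determined_add[of T q g "f i" "\<lambda>n. \<Sum>i\<in>I. f i n"] by simp
qed

text \<open>
  The exponential moment makes averages continuous for the norm \<open>sup \<bar>f n\<bar> / q ^ n\<close>. This is what
  allows truncated Taylor series below.
\<close>

lemma occupation_data_weighted:
  assumes o: "occupation_data q g D w" and q: "0 < q"
  shows "\<exists>B>0. \<forall>f h e. 0 \<le> e \<longrightarrow> (\<forall>n. \<bar>f n - h n\<bar> \<le> e * q ^ n) \<longrightarrow> (\<forall>\<^sub>F N in sequentially.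
       (\<integral>\<^sup>+x. ennreal \<bar>(\<Sum>n\<le>N. w N x n * f n) - (\<Sum>n\<le>N. w N x n * h n)\<bar> \<partial>D N) \<le> ennreal (e * B))"
proof -
  obtain B0 :: real where B0: "\<forall>\<^sub>F N in sequentially. (\<integral>\<^sup>+x. ennreal (\<Sum>n\<le>N. w N x n * q ^ n) \<partial>D N) \<le> ennreal B0"
    using o by (auto simp: occupation_data_def)
  have w0: "0 \<le> w N x n" for N x n using o by (simp add: occupation_data_def)
  have [measurable]: "\<And>N n. (\<lambda>x. w N x n) \<in> borel_measurable (D N)" using o by (simp add: occupation_data_def)
  show ?thesis
  proof (intro exI[of _ "max B0 1"] conjI allI impI)
    fix f h :: "nat \<Rightarrow> real" and e :: real assume e: "0 \<le> e" and fh: "\<forall>n. \<bar>f n - h n\<bar> \<le> e * q ^ n"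
    show "\<forall>\<^sub>F N in sequentially.
       (\<integral>\<^sup>+x. ennreal \<bar>(\<Sum>n\<le>N. w N x n * f n) - (\<Sum>n\<le>N. w N x n * h n)\<bar> \<partial>D N) \<le> ennreal (e * max B0 1)"
      using B0
    proof eventually_elim
      case (elim N)
      have "\<bar>(\<Sum>n\<le>N. w N x n * f n) - (\<Sum>n\<le>N. w N x n * h n)\<bar> \<le> e * (\<Sum>n\<le>N. w N x n * q ^ n)" for x
      proof -
        have "\<bar>(\<Sum>n\<le>N. w N x n * f n) - (\<Sum>n\<le>N. w N x n * h n)\<bar> = \<bar>\<Sum>n\<le>N. w N x n * (f n - h n)\<bar>"
          by (simp add: sum_subtractf right_diff_distrib)
        also have "\<dots> \<le> (\<Sum>n\<le>N. \<bar>w N x n * (f n - h n)\<bar>)" by (rule sum_abs)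
        also have "\<dots> \<le> (\<Sum>n\<le>N. w N x n * (e * q ^ n))"
          by (intro sum_mono) (simp add: abs_mult w0 fh mult_left_mono)
        also have "\<dots> = e * (\<Sum>n\<le>N. w N x n * q ^ n)" by (simp add: sum_distrib_left ac_simps)
        finally show ?thesis .
      qed
      then have "(\<integral>\<^sup>+x. ennreal \<bar>(\<Sum>n\<le>N. w N x n * f n) - (\<Sum>n\<le>N. w N x n * h n)\<bar> \<partial>D N) \<le>
          (\<integral>\<^sup>+x. ennreal e * ennreal (\<Sum>n\<le>N. w N x n * q ^ n) \<partial>D N)"
        using e q by (intro nn_integral_mono) (simp flip: ennreal_mult add: sum_nonneg w0)
      also have "\<dots> = ennreal e * (\<integral>\<^sup>+x. ennreal (\<Sum>n\<le>N. w N x n * q ^ n) \<partial>D N)"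
        by (rule nn_integral_cmult) auto
      also have "\<dots> \<le> ennreal e * ennreal (max B0 1)"
        using elim by (intro mult_left_mono order.trans[OF elim]) (auto intro: ennreal_leI)
      also have "\<dots> = ennreal (e * max B0 1)" using e by (simp add: ennreal_mult)
      finally show ?case .
    qed
  qed auto
qed

lemma mean_null_const:
  assumes "\<forall>\<^sub>F N in sequentially. prob_space (D N)"
    and "\<And>e. 0 < e \<Longrightarrow> \<forall>\<^sub>F N in sequentially. (\<integral>\<^sup>+x. ennreal \<bar>c\<bar> \<partial>D N) \<le> ennreal (b + e)"
    and "0 \<le> b"
  shows "\<bar>c\<bar> \<le> b"
proof (rule field_le_epsilon)
  fix e :: real assume "0 < e"
  have "\<forall>\<^sub>F N in sequentially. \<bar>c\<bar> \<le> b + e"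
    using assms(1) assms(2)[OF \<open>0 < e\<close>]
  proof eventually_elim
    case (elim N)
    then interpret prob_space "D N" by simp
    show ?case using elim(2) \<open>0 < e\<close> \<open>0 \<le> b\<close> by (simp add: emeasure_space_1 del: ennreal_plus)
  qed
  then show "\<bar>c\<bar> \<le> b + e" by (auto dest: eventually_happens)
qed

text \<open>
  The functions with a determined average are closed for the norm \<open>sup \<bar>f n\<bar> / q ^ n\<close>. The limits for
  approximating functions form a Cauchy sequence because they can all be compared along one fixed
  family of weights; if there is no such family, there is nothing to prove.
\<close>

lemma determined_limit:
  assumes q: "0 < q"
    and ap: "\<And>e. 0 < e \<Longrightarrow> \<exists>h. determined T q g h \<and> (\<forall>n. \<bar>f n - h n\<bar> \<le> e * q ^ n)"
  shows "determined (T :: 'a itself) q g f"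
proof (cases "\<exists>(D :: nat \<Rightarrow> 'a measure) w. occupation_data q g D w")
  case False
  then show ?thesis by (auto simp: determined_def)
next
  case True
  then obtain D0 :: "nat \<Rightarrow> 'a measure" and w0 where o0: "occupation_data q g D0 w0" by auto
  define eps where "eps j = inverse (real (Suc j))" for j
  have eps0: "0 < eps j" for j by (simp add: eps_def)
  have epslim: "eps \<longlonglongrightarrow> 0" unfolding eps_def by (rule LIMSEQ_inverse_real_of_nat)
  have "\<forall>j. \<exists>h. determined T q g h \<and> (\<forall>n. \<bar>f n - h n\<bar> \<le> eps j * q ^ n)"
    using ap[OF eps0] by (rule allI)
  from choice[OF this] obtain h where h: "\<And>j. determined T q g (h j)" "\<And>j n. \<bar>f n - h j n\<bar> \<le> eps j * q ^ n"
    by blast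
  have "\<forall>j. \<exists>c. \<forall>(D :: nat \<Rightarrow> 'a measure) w. occupation_data q g D w \<longrightarrow>
      mean_null D (\<lambda>N x. (\<Sum>n\<le>N. w N x n * h j n) - c)"
    using h(1) unfolding determined_def by (rule allI)
  from choice[OF this] obtain c where c: "\<And>j D w. occupation_data q g (D :: nat \<Rightarrow> 'a measure) w \<Longrightarrow>
      mean_null D (\<lambda>N x. (\<Sum>n\<le>N. w N x n * h j n) - c j)"
    by blast
  have key: "\<exists>B>0. \<forall>j. \<forall>e>0. \<forall>\<^sub>F N in sequentially.
      (\<integral>\<^sup>+x. ennreal \<bar>(\<Sum>n\<le>N. w N x n * f n) - c j\<bar> \<partial>D N) \<le> ennreal (eps j * B + e)"
    if o: "occupation_data q g (D :: nat \<Rightarrow> 'a measure) w" for D w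
  proof -
    have [measurable]: "\<And>N n. (\<lambda>x. w N x n) \<in> borel_measurable (D N)" using o by (simp add: occupation_data_def)
    obtain B where B: "0 < B" "\<forall>f h e. 0 \<le> e \<longrightarrow> (\<forall>n. \<bar>f n - h n\<bar> \<le> e * q ^ n) \<longrightarrow> (\<forall>\<^sub>F N in sequentially.
       (\<integral>\<^sup>+x. ennreal \<bar>(\<Sum>n\<le>N. w N x n * f n) - (\<Sum>n\<le>N. w N x n * h n)\<bar> \<partial>D N) \<le> ennreal (e * B))"
      using occupation_data_weighted[OF o q] by (elim exE conjE)
    show ?thesis
    proof (intro exI[of _ B] conjI allI impI)
      fix j and e :: real assume e: "0 < e"
      have "\<forall>\<^sub>F N in sequentially. (\<integral>\<^sup>+x. ennreal \<bar>(\<Sum>n\<le>N. w N x n * h j n) - c j\<bar> \<partial>D N) \<le> ennreal e"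
        using c[OF o, of j] e by (auto simp: mean_null_def)
      moreover have "\<forall>\<^sub>F N in sequentially.
          (\<integral>\<^sup>+x. ennreal \<bar>(\<Sum>n\<le>N. w N x n * f n) - (\<Sum>n\<le>N. w N x n * h j n)\<bar> \<partial>D N) \<le> ennreal (eps j * B)"
        using B(2)[rule_format, of "eps j" f "h j"] h(2) eps0[of j] by simp
      ultimately
      show "\<forall>\<^sub>F N in sequentially. (\<integral>\<^sup>+x. ennreal \<bar>(\<Sum>n\<le>N. w N x n * f n) - c j\<bar> \<partial>D N) \<le> ennreal (eps j * B + e)"
      proof eventually_elim
        case (elim N)
        have "(\<integral>\<^sup>+x. ennreal \<bar>(\<Sum>n\<le>N. w N x n * f n) - c j\<bar> \<partial>D N) \<le>
           (\<integral>\<^sup>+x. ennreal \<bar>(\<Sum>n\<le>N. w N x n * f n) - (\<Sum>n\<le>N. w N x n * h j n)\<bar> + ennreal \<bar>(\<Sum>n\<le>N. w N x n * h j n) - c j\<bar> \<partial>D N)"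
          by (intro nn_integral_mono) (simp flip: ennreal_plus)
        also have "\<dots> = (\<integral>\<^sup>+x. ennreal \<bar>(\<Sum>n\<le>N. w N x n * f n) - (\<Sum>n\<le>N. w N x n * h j n)\<bar> \<partial>D N)
            + (\<integral>\<^sup>+x. ennreal \<bar>(\<Sum>n\<le>N. w N x n * h j n) - c j\<bar> \<partial>D N)"
          by (rule nn_integral_add) auto
        also have "\<dots> \<le> ennreal (eps j * B) + ennreal e" using elim by (intro add_mono)
        also have "\<dots> = ennreal (eps j * B + e)" using e B(1) eps0[of j] by (simp add: ennreal_plus)
        finally show ?case .
      qed
    qed fact
  qed
  obtain B0 where B0: "0 < B0" "\<And>j e. 0 < e \<Longrightarrow> \<forall>\<^sub>F N in sequentially.
      (\<integral>\<^sup>+x. ennreal \<bar>(\<Sum>n\<le>N. w0 N x n * f n) - c j\<bar> \<partial>D0 N) \<le> ennreal (eps j * B0 + e)"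
    using key[OF o0] by auto
  have [measurable]: "\<And>N n. (\<lambda>x. w0 N x n) \<in> borel_measurable (D0 N)" using o0 by (simp add: occupation_data_def)
  have cc: "\<bar>c i - c j\<bar> \<le> (eps i + eps j) * B0" for i j
  proof (rule mean_null_const[where D=D0])
    show "\<forall>\<^sub>F N in sequentially. prob_space (D0 N)" using o0 by (simp add: occupation_data_def)
    show "0 \<le> (eps i + eps j) * B0" using eps0[of i] eps0[of j] B0 by simp
    fix e :: real assume e: "0 < e"
    then have "0 < e / 2" by simp
    from B0(2)[OF this, of i] B0(2)[OF this, of j]
    show "\<forall>\<^sub>F N in sequentially. (\<integral>\<^sup>+x. ennreal \<bar>c i - c j\<bar> \<partial>D0 N) \<le> ennreal ((eps i + eps j) * B0 + e)"
    proof eventually_elim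
      case (elim N)
      have "(\<integral>\<^sup>+x. ennreal \<bar>c i - c j\<bar> \<partial>D0 N) \<le>
           (\<integral>\<^sup>+x. ennreal \<bar>(\<Sum>n\<le>N. w0 N x n * f n) - c i\<bar> + ennreal \<bar>(\<Sum>n\<le>N. w0 N x n * f n) - c j\<bar> \<partial>D0 N)"
        by (intro nn_integral_mono) (simp flip: ennreal_plus)
      also have "\<dots> = (\<integral>\<^sup>+x. ennreal \<bar>(\<Sum>n\<le>N. w0 N x n * f n) - c i\<bar> \<partial>D0 N) + (\<integral>\<^sup>+x. ennreal \<bar>(\<Sum>n\<le>N. w0 N x n * f n) - c j\<bar> \<partial>D0 N)"
        by (rule nn_integral_add) auto
      also have "\<dots> \<le> ennreal (eps i * B0 + e / 2) + ennreal (eps j * B0 + e / 2)" using elim by (intro add_mono)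
      also have "\<dots> = ennreal ((eps i + eps j) * B0 + e)"
        using e B0(1) eps0[of j] eps0[of i] by (simp add: algebra_simps flip: ennreal_plus)
      finally show ?case .
    qed
  qed
  have "Cauchy c"
  proof (rule CauchyI)
    fix e :: real assume "0 < e"
    then have "0 < e / (2 * B0)" using B0(1) by simp
    from order_tendstoD(2)[OF epslim this] obtain M where M: "\<And>j. j \<ge> M \<Longrightarrow> eps j < e / (2 * B0)"
      by (auto simp: eventually_sequentially)
    show "\<exists>M. \<forall>m\<ge>M. \<forall>n\<ge>M. norm (c m - c n) < e"
    proof (intro exI[of _ M] allI impI)
      fix m n assume "M \<le> m" "M \<le> n"
      then have "eps m + eps n < e / B0" using M[of m] M[of n] by simp
      then have "(eps m + eps n) * B0 < e" using B0(1) by (simp add: pos_less_divide_eq)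
      then show "norm (c m - c n) < e" using cc[of m n] by simp
    qed
  qed
  then obtain c' where c': "c \<longlonglongrightarrow> c'" by (auto simp: Cauchy_convergent_iff convergent_def)
  show ?thesis unfolding determined_def
  proof (intro exI[of _ c'] allI impI)
    fix D :: "nat \<Rightarrow> 'a measure" and w assume o: "occupation_data q g D w"
    have [measurable]: "\<And>N n. (\<lambda>x. w N x n) \<in> borel_measurable (D N)" using o by (simp add: occupation_data_def)
    obtain B where B: "0 < B" "\<And>j e. 0 < e \<Longrightarrow> \<forall>\<^sub>F N in sequentially.
      (\<integral>\<^sup>+x. ennreal \<bar>(\<Sum>n\<le>N. w N x n * f n) - c j\<bar> \<partial>D N) \<le> ennreal (eps j * B + e)"
      using key[OF o] by auto
    show "mean_null D (\<lambda>N x. (\<Sum>n\<le>N. w N x n * f n) - c')"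
      unfolding mean_null_def
    proof (intro allI impI)
      fix e :: real assume e: "0 < e"
      then have "0 < e / (3 * B)" "0 < e / 3" using B(1) by auto
      have "\<forall>\<^sub>F j in sequentially. eps j < e / (3 * B) \<and> dist (c j) c' < e / 3"
        using order_tendstoD(2)[OF epslim \<open>0 < e / (3 * B)\<close>] tendstoD[OF c' \<open>0 < e / 3\<close>]
        by eventually_elim auto
      then obtain j where j: "eps j < e / (3 * B)" "\<bar>c j - c'\<bar> < e / 3"
        by (auto dest!: eventually_happens simp: dist_real_def)
      have j1: "eps j * B < e / 3" using j(1) B(1) by (simp add: field_simps)
      have "\<forall>\<^sub>F N in sequentially. prob_space (D N)" using o by (simp add: occupation_data_def)
      with B(2)[OF \<open>0 < e / 3\<close>, of j]
      show "\<forall>\<^sub>F N in sequentially. (\<integral>\<^sup>+x. ennreal \<bar>(\<Sum>n\<le>N. w N x n * f n) - c'\<bar> \<partial>D N) \<le> ennreal e"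
      proof eventually_elim
        case (elim N)
        then interpret prob_space "D N" by simp
        have "\<bar>X - c'\<bar> \<le> \<bar>X - c j\<bar> + e / 3" for X :: real
          using j(2) by linarith
        then have "(\<integral>\<^sup>+x. ennreal \<bar>(\<Sum>n\<le>N. w N x n * f n) - c'\<bar> \<partial>D N) \<le>
            (\<integral>\<^sup>+x. ennreal \<bar>(\<Sum>n\<le>N. w N x n * f n) - c j\<bar> + ennreal (e / 3) \<partial>D N)"
          using e by (intro nn_integral_mono) (simp flip: ennreal_plus)
        also have "\<dots> = (\<integral>\<^sup>+x. ennreal \<bar>(\<Sum>n\<le>N. w N x n * f n) - c j\<bar> \<partial>D N) + ennreal (e / 3)"
          by (subst nn_integral_add) (auto simp: emeasure_space_1)
        also have "\<dots> \<le> ennreal (eps j * B + e / 3) + ennreal (e / 3)" using elim by (intro add_mono) auto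
        also have "\<dots> = ennreal (eps j * B + e / 3 + e / 3)" using e B(1) eps0[of j] by (simp flip: ennreal_plus)
        also have "\<dots> \<le> ennreal e" using j1 by (intro ennreal_leI) simp
        finally show ?case .
      qed
    qed
  qed
qed

text \<open>
  The \<open>k\<close>-th Taylor coefficient at \<open>z\<close> of the function \<open>x \<mapsto> x ^ n\<close>. Averaged over \<open>n\<close>, these are
  the Taylor coefficients of the generating function at \<open>z\<close>.
\<close>

definition binom_power :: "real \<Rightarrow> nat \<Rightarrow> nat \<Rightarrow> real" where
  "binom_power z k n = real (n choose k) * z ^ (n - k)"

lemma binom_power_taylor:
  "binom_power (z + h) k n = (\<Sum>i\<le>n. real ((k + i) choose k) * h ^ i * binom_power z (k + i) n)"
proof (cases "k \<le> n")
  case False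
  then show ?thesis by (simp add: binom_power_def binomial_eq_0)
next
  case True
  have "binom_power (z + h) k n = real (n choose k) * (\<Sum>i\<le>n - k. real ((n - k) choose i) * h ^ i * z ^ (n - k - i))"
    unfolding binom_power_def by (subst add.commute, subst binomial_ring) simp
  also have "\<dots> = (\<Sum>i\<le>n - k. real ((k + i) choose k) * h ^ i * binom_power z (k + i) n)"
    unfolding sum_distrib_left
  proof (rule sum.cong[OF refl])
    fix i assume "i \<in> {..n - k}"
    then have "(n choose (k + i)) * ((k + i) choose k) = (n choose k) * ((n - k) choose i)"
      using choose_mult[of k "k + i" n] True by auto
    then have "real (n choose (k + i)) * real ((k + i) choose k) = real (n choose k) * real ((n - k) choose i)"
      by (simp only: of_nat_mult[symmetric])
    then show "real (n choose k) * (real (n - k choose i) * h ^ i * z ^ (n - k - i)) =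
         real (k + i choose k) * h ^ i * binom_power z (k + i) n"
      by (simp add: binom_power_def algebra_simps)
  qed
  also have "\<dots> = (\<Sum>i\<le>n. real ((k + i) choose k) * h ^ i * binom_power z (k + i) n)"
    using True by (intro sum.mono_neutral_left) (auto simp: binom_power_def binomial_eq_0)
  finally show ?thesis .
qed

text \<open>
  Cauchy's estimate: the left-hand side is one term of the binomial expansion of \<open>(Q + (q - Q)) ^ n\<close>.
\<close>

lemma binom_power_le:
  assumes "0 \<le> Q" "Q < q"
  shows "binom_power Q k n \<le> inverse ((q - Q) ^ k) * q ^ n"
proof (cases "k \<le> n")
  case False
  then show ?thesis using assms by (simp add: binom_power_def binomial_eq_0)
next
  case True
  have "real (n choose k) * (q - Q) ^ k * Q ^ (n - k) \<le> (\<Sum>i\<le>n. real (n choose i) * (q - Q) ^ i * Q ^ (n - i))"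
    using assms True by (intro member_le_sum) auto
  also have "\<dots> = q ^ n" by (subst binomial_ring[symmetric]) simp
  finally show ?thesis using assms by (simp add: binom_power_def field_simps)
qed

text \<open>
  One step of analytic continuation. The generating function is analytic in the disc of radius \<open>q\<close>,
  hence its Taylor series at \<open>z0\<close> converges at \<open>z\<close> provided \<open>z0 - z < q - z0\<close>. Quantitatively, the
  remainder is compared with the series at the larger point \<open>Q < q\<close>, from which it differs by a
  factor \<open>r ^ I\<close>.
\<close>

lemma determined_shift:
  assumes z: "0 \<le> z" "z \<le> z0" and q: "2 * z0 - z < q"
    and d: "\<And>k. determined T q g (binom_power z0 k)"
  shows "determined T q g (binom_power z k)"
proof -
  have q0: "0 < q" using z q by linarith
  define h where "h = z0 - z"
  have h0: "0 \<le> h" "z0 + h < q" using z q by (auto simp: h_def)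
  (* r < 1 is chosen such that Q = z0 + h / r is the midpoint of z0 + h and q. *)
  define r where "r = (if h = 0 then 1 / 2 else (2 * h) / (h + (q - z0)))"
  have r: "0 < r" "r < 1" using h0 by (auto simp: r_def divide_less_eq)
  define Q where "Q = z0 + h / r"
  have Q: "0 \<le> Q" "Q < q"
  proof -
    show "0 \<le> Q" using h0 z r by (simp add: Q_def)
    show "Q < q"
    proof (cases "h = 0")
      case True then show ?thesis using h0 by (simp add: Q_def)
    next
      case False
      then have "h / r = (h + (q - z0)) / 2" using h0 by (simp add: r_def field_simps)
      then show ?thesis using h0 by (simp add: Q_def field_simps)
    qed
  qed
  define K where "K = inverse ((q - Q) ^ k)"
  have K: "0 < K" using Q by (simp add: K_def)
  let ?t = "\<lambda>i n. real ((k + i) choose k) * (- h) ^ i * binom_power z0 (k + i) n"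
  show ?thesis
  proof (rule determined_limit[OF q0])
    fix e :: real assume "0 < e"
    then have "0 < e / K" using K by simp
    moreover have "(\<lambda>I. r ^ I) \<longlonglongrightarrow> 0" using r by (intro LIMSEQ_power_zero) auto
    ultimately have "\<forall>\<^sub>F I in sequentially. r ^ I < e / K" by (intro order_tendstoD)
    then obtain I where I: "r ^ I < e / K" by (auto dest: eventually_happens)
    show "\<exists>h. determined T q g h \<and> (\<forall>n. \<bar>binom_power z k n - h n\<bar> \<le> e * q ^ n)"
    proof (intro exI[of _ "\<lambda>n. \<Sum>i\<le>I. ?t i n"] conjI allI)
      show "determined T q g (\<lambda>n. \<Sum>i\<le>I. ?t i n)"
        by (intro determined_sum determined_cmult d) auto
      fix n
      have bp0: "0 \<le> binom_power z0 m n" for m using z by (simp add: binom_power_def)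
      have t0: "?t i n = 0" if "i > n" for i using that by (simp add: binom_power_def binomial_eq_0)
      have "binom_power z k n = (\<Sum>i\<le>n. ?t i n)"
        using binom_power_taylor[of z0 "- h" k n] by (simp add: h_def)
      also have "\<dots> = (\<Sum>i\<le>n + I. ?t i n)"
        using t0 by (intro sum.mono_neutral_left) auto
      also have "\<dots> = (\<Sum>i\<le>I. ?t i n) + (\<Sum>i\<in>{I<..n + I}. ?t i n)"
        by (subst sum.union_disjoint[symmetric]) (auto intro!: sum.cong)
      finally have "\<bar>binom_power z k n - (\<Sum>i\<le>I. ?t i n)\<bar> = \<bar>\<Sum>i\<in>{I<..n + I}. ?t i n\<bar>" by simp
      also have "\<dots> \<le> (\<Sum>i\<in>{I<..n + I}. \<bar>?t i n\<bar>)" by (rule sum_abs)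
      also have "\<dots> \<le> (\<Sum>i\<in>{I<..n + I}. r ^ I * (real ((k + i) choose k) * (h / r) ^ i * binom_power z0 (k + i) n))"
      proof (rule sum_mono)
        fix i assume i: "i \<in> {I<..n + I}"
        have "\<bar>?t i n\<bar> = real ((k + i) choose k) * h ^ i * binom_power z0 (k + i) n"
          using h0 bp0 by (simp add: abs_mult power_abs)
        also have "h ^ i = r ^ i * (h / r) ^ i" using r by (simp add: power_divide)
        also have "real ((k + i) choose k) * (r ^ i * (h / r) ^ i) * binom_power z0 (k + i) n =
           r ^ i * (real ((k + i) choose k) * (h / r) ^ i * binom_power z0 (k + i) n)" by simp
        also have "\<dots> \<le> r ^ I * (real ((k + i) choose k) * (h / r) ^ i * binom_power z0 (k + i) n)"
          using r h0 bp0 i by (intro mult_right_mono power_decreasing mult_nonneg_nonneg) auto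
        finally show "\<bar>?t i n\<bar> \<le> \<dots>" .
      qed
      also have "\<dots> \<le> (\<Sum>i\<le>n + I. r ^ I * (real ((k + i) choose k) * (h / r) ^ i * binom_power z0 (k + i) n))"
        using r h0 bp0 by (intro sum_mono2) auto
      also have "\<dots> = r ^ I * (\<Sum>i\<le>n. real ((k + i) choose k) * (h / r) ^ i * binom_power z0 (k + i) n)"
        unfolding sum_distrib_left
        by (intro sum.mono_neutral_right) (auto simp: binom_power_def binomial_eq_0)
      also have "\<dots> = r ^ I * binom_power Q k n"
        by (simp add: binom_power_taylor Q_def)
      also have "\<dots> \<le> r ^ I * (K * q ^ n)"
        using binom_power_le[OF Q, of k n] r by (intro mult_left_mono) (auto simp: K_def)
      also have "\<dots> \<le> e * q ^ n"
        using I K q0 by (simp add: field_simps)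
      finally show "\<bar>binom_power z k n - (\<Sum>i\<le>I. ?t i n)\<bar> \<le> e * q ^ n" .
    qed
  qed
qed

text \<open>
  Continuation from \<open>1\<close> to \<open>0\<close>. Each step multiplies the distance to \<open>q\<close> by
  \<open>3 / 2\<close>, so finitely many steps suffice.
\<close>

theorem determined_empty:
  assumes q: "1 < q" and d: "\<And>k. determined T q g (\<lambda>n. real (n choose k))"
  shows "determined T q g (\<lambda>n. if n = 0 then 1 else 0)"
proof -
  have main: "determined T q g (binom_power z k)" if "0 \<le> z" "z \<le> 1" "q - z \<le> (3 / 2) ^ j * (q - 1)" for j z k
    using that
  proof (induction j arbitrary: z k)
    case 0
    then have "binom_power z k = (\<lambda>n. real (n choose k))" by (simp add: binom_power_def fun_eq_iff)
    then show ?case using d by metis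
  next
    case (Suc j)
    (* t divides the segment from z to q in the ratio 1 : 2, so that z lies in the disc around t. *)
    define t where "t = (q + 2 * z) / 3"
    define z0 where "z0 = min 1 t"
    have t: "z \<le> t" "2 * t - z < q" using Suc.prems(2) q by (simp_all add: t_def field_simps)
    have z0: "z \<le> z0" "z0 \<le> 1" "2 * z0 - z < q"
      using t Suc.prems(2) q by (auto simp: z0_def min_def)
    have "q - z0 \<le> (3 / 2) ^ j * (q - 1)"
    proof (cases "1 \<le> t")
      case True
      have "1 * (q - 1) \<le> (3 / 2) ^ j * (q - 1)" using q by (intro mult_right_mono) auto
      then show ?thesis using True by (simp add: z0_def)
    next
      case False
      then have "q - z0 = (q - z) * 2 / 3" by (simp add: z0_def t_def field_simps)
      then show ?thesis using Suc.prems(3) by simp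
    qed
    then have "determined T q g (binom_power z0 k)" for k
      using Suc.prems(1) z0 by (intro Suc.IH) auto
    then show ?case using Suc.prems(1) z0 by (intro determined_shift[of z z0 q])
  qed
  obtain j where "q / (q - 1) < (3 / 2 :: real) ^ j"
    using real_arch_pow[of "3 / 2 :: real" "q / (q - 1)"] by auto
  then have "q < (3 / 2) ^ j * (q - 1)" using q by (simp only: pos_divide_less_eq diff_gt_0_iff_gt)
  then have "determined T q g (binom_power 0 0)" by (intro main[of 0 j]) auto
  moreover have "binom_power 0 0 = (\<lambda>n. if n = 0 then 1 else 0)" by (auto simp: binom_power_def fun_eq_iff)
  ultimately show ?thesis by simp
qed

section \<open>Tuples of distinct points and followers\<close>

definition inj_tuples :: "nat \<Rightarrow> nat set \<Rightarrow> (nat \<Rightarrow> nat) set" where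
  "inj_tuples m S = {j \<in> {..<m} \<rightarrow>\<^sub>E S. inj_on j {..<m}}"

definition tuple_sum :: "nat \<Rightarrow> nat \<Rightarrow> ((nat \<Rightarrow> real) \<Rightarrow> 'b :: comm_monoid_add) \<Rightarrow> (nat \<Rightarrow> real) \<Rightarrow> 'b" where
  "tuple_sum m N F x = (\<Sum>j\<in>inj_tuples m {..<N}. F (\<lambda>i\<in>{..<m}. x (j i)))"

definition followers :: "real set \<Rightarrow> nat \<Rightarrow> real \<Rightarrow> (nat \<Rightarrow> real) \<Rightarrow> nat \<Rightarrow> nat set" where
  "followers A N s x i = {j. j < N \<and> j \<noteq> i \<and> x j \<in> A \<and> x i \<le> x j \<and> x j \<le> x i + s}"

definition points_in :: "real set \<Rightarrow> nat \<Rightarrow> (nat \<Rightarrow> real) \<Rightarrow> nat set" where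
  "points_in A N x = {i. i < N \<and> x i \<in> A}"

text \<open>
  A tuple \<open>t 0, \<dots>, t k\<close> belongs to the window if it lies in \<open>A\<close> and its last member, the anchor
  \<open>t k\<close>, is followed by all others within distance \<open>s\<close>. Taking the anchor last makes a tuple of
  length \<open>Suc k\<close> an update of a tuple of length \<open>k\<close> at position \<open>k\<close>.
\<close>

definition window :: "real set \<Rightarrow> real \<Rightarrow> nat \<Rightarrow> (nat \<Rightarrow> real) \<Rightarrow> real" where
  "window A s k t = (if t k \<in> A \<and> (\<forall>j<k. t j \<in> A \<and> t k \<le> t j \<and> t j \<le> t k + s) then 1 else 0)"

definition far_windows :: "real set \<Rightarrow> real \<Rightarrow> nat \<Rightarrow> (nat \<Rightarrow> real) \<Rightarrow> real" where
  "far_windows A s k t = window A s k t * window A s k (\<lambda>i. t (Suc k + i)) *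
     (if 2 * s < \<bar>t k - t (Suc k + k)\<bar> then 1 else 0)"

lemma finite_inj_tuples [simp]: "finite S \<Longrightarrow> finite (inj_tuples m S)"
  by (rule finite_subset[of _ "{..<m} \<rightarrow>\<^sub>E S"]) (auto simp: inj_tuples_def intro: finite_PiE)

lemma finite_followers [simp]: "finite (followers A N s x i)"
  by (simp add: followers_def)

lemma finite_points_in [simp]: "finite (points_in A N x)"
  by (simp add: points_in_def)

lemma sum_inj_tuples_Suc:
  assumes "finite S"
  shows "(\<Sum>j\<in>inj_tuples (Suc k) S. F j) = (\<Sum>i\<in>S. \<Sum>f\<in>inj_tuples k (S - {i}). F (f(k := i)))"
proof -
  have "(\<Sum>i\<in>S. \<Sum>f\<in>inj_tuples k (S - {i}). F (f(k := i))) =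
      (\<Sum>(i, f)\<in>(SIGMA i:S. inj_tuples k (S - {i})). F (f(k := i)))"
    using assms by (subst sum.Sigma) auto
  also have "\<dots> = (\<Sum>j\<in>inj_tuples (Suc k) S. F j)"
  proof (rule sum.reindex_bij_witness[where i = "\<lambda>j. (j k, restrict j {..<k})" and j = "\<lambda>(i, f). f(k := i)"])
    fix a assume "a \<in> (SIGMA i:S. inj_tuples k (S - {i}))"
    then obtain i f where a: "a = (i, f)" "i \<in> S" "f \<in> {..<k} \<rightarrow>\<^sub>E S - {i}" "inj_on f {..<k}"
      by (auto simp: inj_tuples_def)
    have "restrict (f(k := i)) {..<k} = f"
      using a(3) by (auto simp: fun_eq_iff PiE_def extensional_def)
    then show "((case a of (i, f) \<Rightarrow> f(k := i)) k, restrict (case a of (i, f) \<Rightarrow> f(k := i)) {..<k}) = a"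
      using a by simp
    have "inj_on (f(k := i)) {..<Suc k}"
      using a(3,4) by (auto simp: inj_on_def less_Suc_eq PiE_def Pi_iff)
    moreover have "f(k := i) \<in> {..<Suc k} \<rightarrow>\<^sub>E S"
      using a(2,3) by (auto simp: PiE_def extensional_def less_Suc_eq Pi_iff)
    ultimately show "(case a of (i, f) \<Rightarrow> f(k := i)) \<in> inj_tuples (Suc k) S"
      using a(1) by (simp add: inj_tuples_def)
  next
    fix j assume "j \<in> inj_tuples (Suc k) S"
    then have j: "j \<in> {..<Suc k} \<rightarrow>\<^sub>E S" "inj_on j {..<Suc k}" by (auto simp: inj_tuples_def)
    show "(case (j k, restrict j {..<k}) of (i, f) \<Rightarrow> f(k := i)) = j"
      using j(1) by (auto simp: fun_eq_iff PiE_def extensional_def)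
    have "restrict j {..<k} \<in> {..<k} \<rightarrow>\<^sub>E S - {j k}"
      using j by (auto simp: inj_on_def PiE_def Pi_iff dest: spec[of _ k])
    moreover have "inj_on (restrict j {..<k}) {..<k}"
      using j(2) by (auto simp: inj_on_def)
    ultimately show "(j k, restrict j {..<k}) \<in> (SIGMA i:S. inj_tuples k (S - {i}))"
      using j(1) by (auto simp: inj_tuples_def)
  qed auto
  finally show ?thesis by simp
qed

lemma card_inj_tuples:
  assumes "finite S"
  shows "card (inj_tuples k S) = fact k * (card S choose k)"
  using assms
proof (induction k arbitrary: S)
  case 0
  then show ?case by (simp add: inj_tuples_def)
next
  case (Suc k)
  have "card (inj_tuples (Suc k) S) = (\<Sum>j\<in>inj_tuples (Suc k) S. 1)" by simp
  also have "\<dots> = (\<Sum>i\<in>S. \<Sum>f\<in>inj_tuples k (S - {i}). 1)"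
    by (rule sum_inj_tuples_Suc[OF Suc.prems])
  also have "\<dots> = (\<Sum>i\<in>S. fact k * ((card S - 1) choose k))"
    using Suc by (intro sum.cong) (simp_all add: card_Diff_singleton_if)
  also have "\<dots> = fact k * (card S * ((card S - 1) choose k))" by simp
  also have "card S * ((card S - 1) choose k) = Suc k * (card S choose Suc k)"
    by (cases "card S") (simp_all only: Suc_times_binomial diff_Suc_1, simp)
  finally show ?case by (simp only: fact_Suc of_nat_id ac_simps)
qed

lemma fact_binomial_le_power: "fact k * (n choose k) \<le> n ^ k"
proof -
  have "card (inj_tuples k {..<n}) \<le> card ({..<k} \<rightarrow>\<^sub>E {..<n})"
    by (rule card_mono) (auto simp: inj_tuples_def intro: finite_PiE)
  then show ?thesis by (simp add: card_inj_tuples card_PiE)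
qed

text \<open>
  For a fixed anchor the remaining members run through the injective \<open>k\<close>-tuples of its followers.
\<close>

lemma window_anchor_sum:
  assumes i: "i < N"
  shows "(\<Sum>f\<in>inj_tuples k ({..<N} - {i}). window A s k (\<lambda>l\<in>{..<Suc k}. x ((f(k := i)) l))) =
    (if x i \<in> A then real (fact k * (card (followers A N s x i) choose k)) else 0)"
proof -
  have w: "window A s k (\<lambda>l\<in>{..<Suc k}. x ((f(k := i)) l)) =
      (if x i \<in> A \<and> f \<in> inj_tuples k (followers A N s x i) then 1 else 0)"
    if f: "f \<in> inj_tuples k ({..<N} - {i})" for f
  proof -
    have "(\<forall>j<k. x (f j) \<in> A \<and> x i \<le> x (f j) \<and> x (f j) \<le> x i + s) \<longleftrightarrow> f \<in> inj_tuples k (followers A N s x i)"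
      using f by (auto simp: inj_tuples_def followers_def PiE_def Pi_iff)
    then show ?thesis by (simp add: window_def)
  qed
  have "(\<Sum>f\<in>inj_tuples k ({..<N} - {i}). window A s k (\<lambda>l\<in>{..<Suc k}. x ((f(k := i)) l)))
     = (\<Sum>f\<in>inj_tuples k ({..<N} - {i}). if x i \<in> A \<and> f \<in> inj_tuples k (followers A N s x i) then 1 else 0)"
    using w by (rule sum.cong[OF refl])
  also have "\<dots> = (if x i \<in> A then real (card (inj_tuples k (followers A N s x i))) else 0)"
  proof (cases "x i \<in> A")
    case True
    have sub: "inj_tuples k (followers A N s x i) \<subseteq> inj_tuples k ({..<N} - {i})"
      by (auto simp: inj_tuples_def followers_def PiE_def Pi_iff)
    then have "{f \<in> inj_tuples k ({..<N} - {i}). f \<in> inj_tuples k (followers A N s x i)} = inj_tuples k (followers A N s x i)"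
      by auto
    then show ?thesis using True by (simp flip: sum.inter_filter)
  qed simp
  finally show ?thesis by (simp add: card_inj_tuples)
qed

text \<open>
  The link between correlation functions and the number of followers: a sum over tuples is a
  factorial moment.
\<close>

lemma tuple_sum_window:
  "tuple_sum (Suc k) N (window A s k) x =
     (\<Sum>i\<in>points_in A N x. real (fact k * (card (followers A N s x i) choose k)))"
proof -
  have "tuple_sum (Suc k) N (window A s k) x =
      (\<Sum>i<N. \<Sum>f\<in>inj_tuples k ({..<N} - {i}). window A s k (\<lambda>l\<in>{..<Suc k}. x ((f(k := i)) l)))"
    unfolding tuple_sum_def by (subst sum_inj_tuples_Suc) auto
  also have "\<dots> = (\<Sum>i<N. if x i \<in> A then real (fact k * (card (followers A N s x i) choose k)) else 0)"
    using window_anchor_sum by (intro sum.cong[OF refl]) simp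
  also have "\<dots> = (\<Sum>i\<in>points_in A N x. real (fact k * (card (followers A N s x i) choose k)))"
    by (subst sum.inter_filter[symmetric]) (auto simp: points_in_def intro!: sum.cong)
  finally show ?thesis .
qed

text \<open>
  If the anchors are more than \<open>2 * s\<close> apart, two windows have no point in common, and the two tuples
  together form one tuple of distinct points.
\<close>

lemma far_product_le:
  assumes s: "0 \<le> s"
  shows "(\<Sum>(j, j')\<in>{(j, j') \<in> inj_tuples (Suc k) {..<N} \<times> inj_tuples (Suc k) {..<N}. 2 * s < \<bar>x (j k) - x (j' k)\<bar>}.
            window A s k (\<lambda>i\<in>{..<Suc k}. x (j i)) * window A s k (\<lambda>i\<in>{..<Suc k}. x (j' i)))
         \<le> tuple_sum (2 * Suc k) N (far_windows A s k) x" (is "sum ?F ?P \<le> _")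
proof -
  define cat where "cat = (\<lambda>(j :: nat \<Rightarrow> nat, j'). \<lambda>i\<in>{..<2 * Suc k}. if i < Suc k then j i else j' (i - Suc k))"
  define Q where "Q = {p \<in> ?P. ?F p \<noteq> 0}"
  let ?G = "\<lambda>J. far_windows A s k (\<lambda>i\<in>{..<2 * Suc k}. x (J i))"
  have finP: "finite ?P" by (rule finite_subset[of _ "inj_tuples (Suc k) {..<N} \<times> inj_tuples (Suc k) {..<N}"]) auto
  have "sum ?F ?P = sum ?F Q"
    unfolding Q_def using finP by (intro sum.mono_neutral_right) auto
  also have "\<dots> = (\<Sum>p\<in>Q. ?G (cat p))"
  proof (rule sum.cong[OF refl])
    fix p assume "p \<in> Q"
    then obtain j j' where p: "p = (j, j')" "2 * s < \<bar>x (j k) - x (j' k)\<bar>" by (auto simp: Q_def)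
    have 1: "window A s k (\<lambda>i\<in>{..<2 * Suc k}. x (cat p i)) = window A s k (\<lambda>i\<in>{..<Suc k}. x (j i))"
      by (auto simp: window_def cat_def p(1))
    have 2: "window A s k (\<lambda>i. (\<lambda>i\<in>{..<2 * Suc k}. x (cat p i)) (Suc k + i)) = window A s k (\<lambda>i\<in>{..<Suc k}. x (j' i))"
      by (auto simp: window_def cat_def p(1))
    show "?F p = ?G (cat p)"
      unfolding far_windows_def 1 2 using p by (simp add: cat_def)
  qed
  also have "\<dots> = (\<Sum>J\<in>cat ` Q. ?G J)"
  proof (rule sum.reindex[symmetric, unfolded o_def], rule inj_onI)
    fix p p' assume pp: "p \<in> Q" "p' \<in> Q" "cat p = cat p'"
    obtain j j' l l' where p: "p = (j, j')" "p' = (l, l')" by (cases p, cases p')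
    have ext: "j \<in> extensional {..<Suc k}" "j' \<in> extensional {..<Suc k}" "l \<in> extensional {..<Suc k}" "l' \<in> extensional {..<Suc k}"
      using pp p by (auto simp: Q_def inj_tuples_def PiE_def)
    have c: "cat p i = cat p' i" for i using pp(3) by simp
    have "j = l"
    proof (rule extensionalityI[OF ext(1,3)])
      fix i assume "i \<in> {..<Suc k}" then show "j i = l i" using c[of i] by (simp add: cat_def p)
    qed
    moreover have "j' = l'"
    proof (rule extensionalityI[OF ext(2,4)])
      fix i assume "i \<in> {..<Suc k}" then show "j' i = l' i" using c[of "Suc k + i"] by (simp add: cat_def p)
    qed
    ultimately show "p = p'" using p by simp
  qed
  also have "\<dots> \<le> (\<Sum>J\<in>inj_tuples (2 * Suc k) {..<N}. ?G J)"
  proof (rule sum_mono2)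
    show "cat ` Q \<subseteq> inj_tuples (2 * Suc k) {..<N}"
    proof clarify
      fix j j' assume q: "(j, j') \<in> Q"
      then have j: "j \<in> {..<Suc k} \<rightarrow>\<^sub>E {..<N}" "inj_on j {..<Suc k}" "j' \<in> {..<Suc k} \<rightarrow>\<^sub>E {..<N}" "inj_on j' {..<Suc k}"
        and far: "2 * s < \<bar>x (j k) - x (j' k)\<bar>"
        and w: "window A s k (\<lambda>i\<in>{..<Suc k}. x (j i)) \<noteq> 0" "window A s k (\<lambda>i\<in>{..<Suc k}. x (j' i)) \<noteq> 0"
        by (auto simp: Q_def inj_tuples_def)
      have b: "x (j k) \<le> x (j i) \<and> x (j i) \<le> x (j k) + s" "x (j' k) \<le> x (j' i) \<and> x (j' i) \<le> x (j' k) + s" if "i < Suc k" for i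
        using w that s by (cases "i = k"; auto simp: window_def split: if_splits)+
      have ne: "j i \<noteq> j' l" if "i < Suc k" "l < Suc k" for i l
      proof
        assume "j i = j' l"
        then have "\<bar>x (j k) - x (j' k)\<bar> \<le> s" using b(1)[OF that(1)] b(2)[OF that(2)] by auto
        then show False using far s by simp
      qed
      have "cat (j, j') \<in> {..<2 * Suc k} \<rightarrow>\<^sub>E {..<N}"
        using j(1,3) by (auto simp: cat_def PiE_def Pi_iff)
      moreover have "inj_on (cat (j, j')) {..<2 * Suc k}"
      proof (rule inj_onI)
        fix a b assume ab: "a \<in> {..<2 * Suc k}" "b \<in> {..<2 * Suc k}" "cat (j, j') a = cat (j, j') b"
        consider "a < Suc k" "b < Suc k" | "a < Suc k" "\<not> b < Suc k" | "\<not> a < Suc k" "b < Suc k" | "\<not> a < Suc k" "\<not> b < Suc k"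
          by blast
        moreover have lt: "a - Suc k < Suc k" "b - Suc k < Suc k" using ab by auto
        ultimately show "a = b"
        proof cases
          case 1 then show ?thesis using ab j(2) by (auto simp: cat_def inj_on_def)
        next
          case 2 then show ?thesis using ab ne[OF _ lt(2), of a] by (simp add: cat_def)
        next
          case 3 then show ?thesis using ab ne[OF _ lt(1), of b] by (simp add: cat_def)
        next
          case 4
          then have "j' (a - Suc k) = j' (b - Suc k)" using ab by (simp add: cat_def)
          then have "a - Suc k = b - Suc k" by (rule inj_onD[OF j(4)]) (use lt in simp_all)
          then show ?thesis using 4 by simp
        qed
      qed
      ultimately show "cat (j, j') \<in> inj_tuples (2 * Suc k) {..<N}" by (simp add: inj_tuples_def)
    qed
  qed (auto simp: far_windows_def window_def)
  finally show ?thesis by (simp add: tuple_sum_def)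
qed

text \<open>
  If the anchor of the second tuple is at distance at most \<open>2 * s\<close> to the right of the first anchor \<open>i\<close>, then
  both tuples consist of \<open>i\<close> and of followers of \<open>i\<close> at distance at most \<open>3 * s\<close>. Hence there are at
  most \<open>m ^ (2 * k + 1)\<close> such pairs, where \<open>m\<close> counts \<open>i\<close> and these followers.
\<close>

lemma near_product_le:
  assumes s: "0 \<le> s"
  shows "(\<Sum>(i, i')\<in>{(i, i') \<in> points_in A N x \<times> points_in A N x. \<bar>x i - x i'\<bar> \<le> 2 * s}.
            real (fact k * (card (followers A N s x i) choose k)) * real (fact k * (card (followers A N s x i') choose k)))
         \<le> 2 * (\<Sum>i\<in>points_in A N x. (1 + real (card (followers A N (3 * s) x i))) ^ (2 * k + 1))"
proof -
  let ?P = "points_in A N x"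
  let ?a = "\<lambda>i. real (fact k * (card (followers A N s x i) choose k))"
  let ?m = "\<lambda>i. 1 + real (card (followers A N (3 * s) x i))"
  let ?U = "{(i, i') \<in> ?P \<times> ?P. x i \<le> x i' \<and> x i' \<le> x i + 2 * s}"
  have finU: "finite ?U" by (rule finite_subset[of _ "?P \<times> ?P"]) auto
  have up: "(\<Sum>(i, i')\<in>?U. ?a i * ?a i') \<le> (\<Sum>i\<in>?P. ?m i ^ (2 * k + 1))"
  proof -
    have U: "?U = (SIGMA i:?P. {i' \<in> ?P. x i \<le> x i' \<and> x i' \<le> x i + 2 * s})" by auto
    have "(\<Sum>(i, i')\<in>?U. ?a i * ?a i') = (\<Sum>i\<in>?P. \<Sum>i'\<in>{i' \<in> ?P. x i \<le> x i' \<and> x i' \<le> x i + 2 * s}. ?a i * ?a i')"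
      unfolding U by (subst sum.Sigma) auto
    also have "\<dots> \<le> (\<Sum>i\<in>?P. ?m i ^ (2 * k + 1))"
    proof (rule sum_mono)
      fix i assume i: "i \<in> ?P"
      let ?V = "{i' \<in> ?P. x i \<le> x i' \<and> x i' \<le> x i + 2 * s}"
      have a: "?a i' \<le> ?m i ^ k" if "i' \<in> ?V" for i'
      proof -
        have "followers A N s x i' \<subseteq> insert i (followers A N (3 * s) x i)"
          using that s by (auto simp: followers_def points_in_def)
        then have "card (followers A N s x i') \<le> card (insert i (followers A N (3 * s) x i))"
          by (rule card_mono[rotated]) simp
        also have "\<dots> \<le> Suc (card (followers A N (3 * s) x i))" by (rule card_insert_le_m1) auto
        finally have c: "card (followers A N s x i') \<le> Suc (card (followers A N (3 * s) x i))" .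
        have "?a i' \<le> real (card (followers A N s x i') ^ k)"
          by (subst of_nat_le_iff) (rule fact_binomial_le_power)
        also have "\<dots> \<le> ?m i ^ k" using c by (simp, intro power_mono) auto
        finally show ?thesis .
      qed
      have "?V \<subseteq> insert i (followers A N (3 * s) x i)"
        using s by (auto simp: followers_def points_in_def)
      then have "card ?V \<le> card (insert i (followers A N (3 * s) x i))"
        by (rule card_mono[rotated]) simp
      also have "\<dots> \<le> Suc (card (followers A N (3 * s) x i))" by (rule card_insert_le_m1) auto
      finally have cV: "real (card ?V) \<le> ?m i" by simp
      have "(\<Sum>i'\<in>?V. ?a i * ?a i') \<le> (\<Sum>i'\<in>?V. ?m i ^ k * ?m i ^ k)"
        using a i s by (intro sum_mono mult_mono) auto
      also have "\<dots> = real (card ?V) * (?m i ^ k * ?m i ^ k)" by simp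
      also have "\<dots> \<le> ?m i * (?m i ^ k * ?m i ^ k)" using cV by (intro mult_right_mono) auto
      also have "\<dots> = ?m i ^ (2 * k + 1)" by (simp add: mult_2 power_add)
      finally show "(\<Sum>i'\<in>?V. ?a i * ?a i') \<le> ?m i ^ (2 * k + 1)" .
    qed
    finally show ?thesis .
  qed
  let ?U' = "prod.swap ` ?U"
  have down: "(\<Sum>(i, i')\<in>?U'. ?a i * ?a i') = (\<Sum>(i, i')\<in>?U. ?a i * ?a i')"
    by (subst sum.reindex) (auto simp: inj_on_def prod.swap_def case_prod_unfold mult.commute intro!: sum.cong)
  have "{(i, i') \<in> ?P \<times> ?P. \<bar>x i - x i'\<bar> \<le> 2 * s} \<subseteq> ?U \<union> ?U'"
    by (force simp: image_iff abs_le_iff)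
  then have "(\<Sum>(i, i')\<in>{(i, i') \<in> ?P \<times> ?P. \<bar>x i - x i'\<bar> \<le> 2 * s}. ?a i * ?a i') \<le> (\<Sum>(i, i')\<in>?U \<union> ?U'. ?a i * ?a i')"
    using finU by (intro sum_mono2) auto
  also have "\<dots> \<le> (\<Sum>(i, i')\<in>?U. ?a i * ?a i') + (\<Sum>(i, i')\<in>?U'. ?a i * ?a i')"
    using finU by (subst sum.union_inter[symmetric]) (auto intro!: sum_nonneg)
  finally show ?thesis using up down by linarith
qed

text \<open>
  The pathwise second moment estimate. The second term is a single sum over points, so it is of the
  order of the length of the window and negligible compared with its square.
\<close>

lemma square_le:
  assumes s: "0 \<le> s"
  shows "(tuple_sum (Suc k) N (window A s k) x)\<^sup>2 \<le>
     tuple_sum (2 * Suc k) N (far_windows A s k) x +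
     2 * (\<Sum>i\<in>points_in A N x. (1 + real (card (followers A N (3 * s) x i))) ^ (2 * k + 1))"
proof -
  let ?I = "inj_tuples (Suc k) {..<N}"
  let ?w = "\<lambda>j. window A s k (\<lambda>i\<in>{..<Suc k}. x (j i))"
  let ?far = "{(j, j') \<in> ?I \<times> ?I. 2 * s < \<bar>x (j k) - x (j' k)\<bar>}"
  let ?near = "{(j, j') \<in> ?I \<times> ?I. \<bar>x (j k) - x (j' k)\<bar> \<le> 2 * s}"
  let ?P = "points_in A N x"
  let ?a = "\<lambda>i. real (fact k * (card (followers A N s x i) choose k))"
  have fin: "finite (?I \<times> ?I)" by simp
  have "(tuple_sum (Suc k) N (window A s k) x)\<^sup>2 = (\<Sum>(j, j')\<in>?I \<times> ?I. ?w j * ?w j')"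
    by (simp add: tuple_sum_def power2_eq_square sum_product sum.cartesian_product)
  also have "?I \<times> ?I = ?far \<union> ?near" by auto
  also have "(\<Sum>(j, j')\<in>?far \<union> ?near. ?w j * ?w j') = (\<Sum>(j, j')\<in>?far. ?w j * ?w j') + (\<Sum>(j, j')\<in>?near. ?w j * ?w j')"
    by (rule sum.union_disjoint) (auto intro: finite_subset[OF _ fin])
  also have "(\<Sum>(j, j')\<in>?near. ?w j * ?w j') =
     (\<Sum>(i, i')\<in>{(i, i') \<in> ?P \<times> ?P. \<bar>x i - x i'\<bar> \<le> 2 * s}. ?a i * ?a i')"
  proof -
    have a: "(\<Sum>f\<in>{j\<in>?I. j k = i}. ?w f) = (if x i \<in> A then ?a i else 0)" if "i < N" for i
    proof -
      have "(\<Sum>f\<in>{j\<in>?I. j k = i}. ?w f) = (\<Sum>f\<in>?I. if f k = i then ?w f else 0)"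
        by (rule sum.inter_filter) simp
      also have "\<dots> = (\<Sum>l<N. \<Sum>f\<in>inj_tuples k ({..<N} - {l}). if (f(k := l)) k = i then ?w (f(k := l)) else 0)"
        by (rule sum_inj_tuples_Suc) simp
      also have "\<dots> = (\<Sum>l<N. if l = i then (\<Sum>f\<in>inj_tuples k ({..<N} - {i}). ?w (f(k := i))) else 0)"
        by (rule sum.cong) auto
      also have "\<dots> = (\<Sum>f\<in>inj_tuples k ({..<N} - {i}). ?w (f(k := i)))" using that by simp
      finally show ?thesis using window_anchor_sum[OF that] by simp
    qed
    let ?R = "{(i, i') \<in> {..<N} \<times> {..<N}. \<bar>x i - x i'\<bar> \<le> 2 * s}"
    have finR: "finite ?R" by (rule finite_subset[of _ "{..<N} \<times> {..<N}"]) auto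
    have mem: "j k < N" if "j \<in> ?I" for j using that by (auto simp: inj_tuples_def PiE_def Pi_iff)
    have "(\<Sum>(j, j')\<in>?near. ?w j * ?w j') =
        (\<Sum>p\<in>?R. \<Sum>(j, j')\<in>{q \<in> ?near. (\<lambda>(j, j'). (j k, j' k)) q = p}. ?w j * ?w j')"
      by (rule sum.group[symmetric]) (use finR mem in \<open>auto intro: finite_subset[OF _ fin]\<close>)
    also have "\<dots> = (\<Sum>(i, i')\<in>?R. (\<Sum>f\<in>{j\<in>?I. j k = i}. ?w f) * (\<Sum>f\<in>{j\<in>?I. j k = i'}. ?w f))"
    proof (rule sum.cong[OF refl])
      fix p assume "p \<in> ?R"
      then obtain i i' where p: "p = (i, i')" "\<bar>x i - x i'\<bar> \<le> 2 * s" by auto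
      have "{q \<in> ?near. (\<lambda>(j, j'). (j k, j' k)) q = p} = {j\<in>?I. j k = i} \<times> {j\<in>?I. j k = i'}"
        using p by auto
      then show "(\<Sum>(j, j')\<in>{q \<in> ?near. (\<lambda>(j, j'). (j k, j' k)) q = p}. ?w j * ?w j') =
          (case p of (i, i') \<Rightarrow> (\<Sum>f\<in>{j\<in>?I. j k = i}. ?w f) * (\<Sum>f\<in>{j\<in>?I. j k = i'}. ?w f))"
        using p by (simp add: sum_product sum.cartesian_product)
    qed
    also have "\<dots> = (\<Sum>(i, i')\<in>?R. (if x i \<in> A then ?a i else 0) * (if x i' \<in> A then ?a i' else 0))"
      by (rule sum.cong[OF refl]) (auto simp: a)
    also have "\<dots> = (\<Sum>(i, i')\<in>{(i, i') \<in> ?P \<times> ?P. \<bar>x i - x i'\<bar> \<le> 2 * s}. ?a i * ?a i')"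
      using finR by (intro sum.mono_neutral_cong_right) (auto simp: points_in_def split: if_splits)
    finally show ?thesis .
  qed
  finally show ?thesis
    using far_product_le[OF s, where x=x and A=A and k=k and N=N] near_product_le[OF s, where x=x and A=A and k=k and N=N]
    by linarith
qed

section \<open>Integration over tuples\<close>

abbreviation lebesgue_product :: "nat set \<Rightarrow> (nat \<Rightarrow> real) measure" ("\<Lambda>") where
  "\<Lambda> I \<equiv> PiM I (\<lambda>_. lborel)"

interpretation lborel_product: product_sigma_finite "\<lambda>_ :: nat. lborel :: real measure"
  by standard

lemma nn_integral_product_affine:
  fixes f :: "(nat \<Rightarrow> real) \<Rightarrow> ennreal"
  assumes "finite I" "c \<noteq> 0" and f: "f \<in> borel_measurable (\<Lambda> I)"
  shows "(\<integral>\<^sup>+x. f x \<partial>\<Lambda> I) = ennreal (\<bar>c\<bar> ^ card I) * (\<integral>\<^sup>+x. f (\<lambda>i\<in>I. t + c * x i) \<partial>\<Lambda> I)"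
  using assms(1) f
proof (induction I arbitrary: f rule: finite_induct)
  case empty
  then show ?case by (simp add: PiM_empty nn_integral_count_space_finite)
next
  case (insert i I)
  note [measurable] = insert.prems
  have m1[measurable]: "(\<lambda>(x, y). f (x(i := t + c * y))) \<in> borel_measurable (\<Lambda> I \<Otimes>\<^sub>M lborel)"
    by measurable
  have "(\<integral>\<^sup>+x. f x \<partial>\<Lambda> (insert i I)) = (\<integral>\<^sup>+x. (\<integral>\<^sup>+y. f (x(i := y)) \<partial>lborel) \<partial>\<Lambda> I)"
    by (rule lborel_product.product_nn_integral_insert) (use insert in auto)
  also have "\<dots> = (\<integral>\<^sup>+x. ennreal \<bar>c\<bar> * (\<integral>\<^sup>+y. f (x(i := t + c * y)) \<partial>lborel) \<partial>\<Lambda> I)"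
  proof (rule nn_integral_cong)
    fix x assume x: "x \<in> space (\<Lambda> I)"
    have "(\<lambda>y. f (x(i := y))) \<in> borel_measurable borel"
      using measurable_comp[OF measurable_component_update[OF x insert(2)] insert.prems] by (simp add: comp_def)
    then show "(\<integral>\<^sup>+y. f (x(i := y)) \<partial>lborel) = ennreal \<bar>c\<bar> * (\<integral>\<^sup>+y. f (x(i := t + c * y)) \<partial>lborel)"
      by (rule nn_integral_real_affine) fact
  qed
  also have "\<dots> = ennreal \<bar>c\<bar> * (\<integral>\<^sup>+x. (\<integral>\<^sup>+y. f (x(i := t + c * y)) \<partial>lborel) \<partial>\<Lambda> I)"
    by (rule nn_integral_cmult) measurable
  also have "(\<integral>\<^sup>+x. (\<integral>\<^sup>+y. f (x(i := t + c * y)) \<partial>lborel) \<partial>\<Lambda> I) =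
      ennreal (\<bar>c\<bar> ^ card I) * (\<integral>\<^sup>+x. (\<integral>\<^sup>+y. f ((\<lambda>i\<in>I. t + c * x i)(i := t + c * y)) \<partial>lborel) \<partial>\<Lambda> I)"
    by (rule insert.IH) measurable
  also have "(\<integral>\<^sup>+x. (\<integral>\<^sup>+y. f ((\<lambda>i\<in>I. t + c * x i)(i := t + c * y)) \<partial>lborel) \<partial>\<Lambda> I) =
      (\<integral>\<^sup>+x. (\<integral>\<^sup>+y. f (\<lambda>j\<in>insert i I. t + c * (x(i := y)) j) \<partial>lborel) \<partial>\<Lambda> I)"
    using insert(2) by (intro nn_integral_cong arg_cong[where f = f]) (auto simp: fun_eq_iff)
  also have "\<dots> = (\<integral>\<^sup>+x. f (\<lambda>j\<in>insert i I. t + c * x j) \<partial>\<Lambda> (insert i I))"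
    by (rule lborel_product.product_nn_integral_insert[symmetric]) (use insert in auto)
  finally have "(\<integral>\<^sup>+x. f x \<partial>\<Lambda> (insert i I)) = ennreal \<bar>c\<bar> * (ennreal (\<bar>c\<bar> ^ card I) *
      (\<integral>\<^sup>+x. f (\<lambda>j\<in>insert i I. t + c * x j) \<partial>\<Lambda> (insert i I)))" .
  moreover have "ennreal (\<bar>c\<bar> ^ card (insert i I)) = ennreal \<bar>c\<bar> * ennreal (\<bar>c\<bar> ^ card I)"
    using insert(1,2) by (simp add: ennreal_mult)
  ultimately show ?case by (simp only: mult.assoc)
qed

text \<open>
  The product measure is characterised by its values on boxes, and these are permuted.
\<close>

lemma distr_product_reindex:
  fixes p :: "nat \<Rightarrow> nat"
  assumes "finite I" "bij_betw p I K"
  shows "distr (\<Lambda> K) (\<Lambda> I) (\<lambda>x. \<lambda>i\<in>I. x (p i)) = \<Lambda> I"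
proof (rule lborel_product.PiM_eqI[OF assms(1)])
  have finK: "finite K" using assms bij_betw_finite by blast
  have pK: "p i \<in> K" if "i \<in> I" for i using that assms(2) by (auto simp: bij_betw_def)
  have [measurable]: "(\<lambda>x. \<lambda>i\<in>I. x (p i)) \<in> measurable (\<Lambda> K) (\<Lambda> I)"
    by (rule measurable_restrict) (simp add: pK measurable_component_singleton)
  fix A assume A: "\<And>i. i \<in> I \<Longrightarrow> A i \<in> sets (lborel :: real measure)"
  let ?q = "the_inv_into I p"
  have q: "?q (p i) = i" if "i \<in> I" for i using that assms(2) by (auto simp: bij_betw_def the_inv_into_f_f)
  have qK: "?q j \<in> I" "p (?q j) = j" if "j \<in> K" for j
    using that assms(2) by (auto simp: bij_betw_def intro: the_inv_into_into f_the_inv_into_f)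
  have "(\<lambda>x. \<lambda>i\<in>I. x (p i)) -` Pi\<^sub>E I A \<inter> space (\<Lambda> K) = Pi\<^sub>E K (\<lambda>j. A (?q j))"
    (is "?l = ?r")
  proof (intro Set.set_eqI iffI)
    fix x assume x: "x \<in> ?l"
    have "x j \<in> A (?q j)" if "j \<in> K" for j
    proof -
      have "x (p (?q j)) \<in> A (?q j)" using x qK(1)[OF that] by (auto simp: PiE_iff)
      then show ?thesis using qK(2)[OF that] by simp
    qed
    then show "x \<in> ?r" using x by (auto simp: space_PiM PiE_iff)
  next
    fix x assume x: "x \<in> ?r"
    then show "x \<in> ?l" using q pK by (force simp: space_PiM PiE_iff)
  qed
  then have "emeasure (distr (\<Lambda> K) (\<Lambda> I) (\<lambda>x. \<lambda>i\<in>I. x (p i))) (Pi\<^sub>E I A) = emeasure (\<Lambda> K) (Pi\<^sub>E K (\<lambda>j. A (?q j)))"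
    using A assms(1) by (subst emeasure_distr) (auto intro!: sets_PiM_I_finite)
  also have "\<dots> = (\<Prod>j\<in>K. emeasure lborel (A (?q j)))"
    using A qK finK by (intro lborel_product.emeasure_PiM) auto
  also have "\<dots> = (\<Prod>i\<in>I. emeasure lborel (A i))"
    using assms(2) q by (intro prod.reindex_bij_betw[of p I K "\<lambda>j. emeasure lborel (A (?q j))", symmetric, THEN trans] prod.cong) auto
  finally show "emeasure (distr (\<Lambda> K) (\<Lambda> I) (\<lambda>x. \<lambda>i\<in>I. x (p i))) (Pi\<^sub>E I A) = (\<Prod>i\<in>I. emeasure lborel (A i))" .
qed simp

lemma nn_integral_product_reindex:
  fixes p :: "nat \<Rightarrow> nat"
  assumes "finite I" "bij_betw p I K" "f \<in> borel_measurable (\<Lambda> I)"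
  shows "(\<integral>\<^sup>+x. f (\<lambda>i\<in>I. x (p i)) \<partial>\<Lambda> K) = (\<integral>\<^sup>+x. f x \<partial>\<Lambda> I)"
proof -
  have pK: "p i \<in> K" if "i \<in> I" for i using that assms(2) by (auto simp: bij_betw_def)
  have [measurable]: "(\<lambda>x. \<lambda>i\<in>I. x (p i)) \<in> measurable (\<Lambda> K) (\<Lambda> I)"
    by (rule measurable_restrict) (simp add: pK measurable_component_singleton)
  have "(\<integral>\<^sup>+x. f x \<partial>\<Lambda> I) = (\<integral>\<^sup>+x. f x \<partial>distr (\<Lambda> K) (\<Lambda> I) (\<lambda>x. \<lambda>i\<in>I. x (p i)))"
    by (simp add: distr_product_reindex[OF assms(1,2)])
  also have "\<dots> = (\<integral>\<^sup>+x. f (\<lambda>i\<in>I. x (p i)) \<partial>\<Lambda> K)"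
    by (rule nn_integral_distr) (use assms in auto)
  finally show ?thesis by simp
qed

definition concat_tuples :: "nat \<Rightarrow> (nat \<Rightarrow> real) \<Rightarrow> (nat \<Rightarrow> real) \<Rightarrow> nat \<Rightarrow> real" where
  "concat_tuples m t u = (\<lambda>i\<in>{..<2 * m}. if i < m then t i else u (i - m))"

lemma nn_integral_product_concat:
  assumes [measurable]: "f \<in> borel_measurable (\<Lambda> {..<2 * m})"
  shows "(\<integral>\<^sup>+x. f x \<partial>\<Lambda> {..<2 * m}) = (\<integral>\<^sup>+t. (\<integral>\<^sup>+u. f (concat_tuples m t u) \<partial>\<Lambda> {..<m}) \<partial>\<Lambda> {..<m})"
proof -
  have un: "{..<m} \<union> {m..<2 * m} = {..<2 * m}" and dj: "{..<m} \<inter> {m..<2 * m} = {}" by auto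
  have "(\<integral>\<^sup>+x. f x \<partial>\<Lambda> {..<2 * m}) =
     (\<integral>\<^sup>+t. (\<integral>\<^sup>+u. f (merge {..<m} {m..<2 * m} (t, u)) \<partial>\<Lambda> {m..<2 * m}) \<partial>\<Lambda> {..<m})"
    using lborel_product.product_nn_integral_fold[OF dj, of f] assms by (simp add: un)
  also have "\<dots> = (\<integral>\<^sup>+t. (\<integral>\<^sup>+u. f (concat_tuples m t u) \<partial>\<Lambda> {..<m}) \<partial>\<Lambda> {..<m})"
  proof (rule nn_integral_cong)
    fix t assume t: "t \<in> space (\<Lambda> {..<m})"
    have bij: "bij_betw (\<lambda>i. i - m) {m..<2 * m} {..<m}"
      by (rule bij_betwI[where g = "\<lambda>i. i + m"]) auto
    have meas: "(\<lambda>u. f (merge {..<m} {m..<2 * m} (t, u))) \<in> borel_measurable (\<Lambda> {m..<2 * m})"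
    proof -
      have "(\<lambda>u. merge {..<m} {m..<2 * m} (t, u)) \<in> measurable (\<Lambda> {m..<2 * m}) (\<Lambda> ({..<m} \<union> {m..<2 * m}))"
        by (rule measurable_compose[OF measurable_Pair1'[OF t] measurable_merge])
      then show ?thesis unfolding un by (rule measurable_compose) fact
    qed
    have "(\<integral>\<^sup>+u. f (merge {..<m} {m..<2 * m} (t, u)) \<partial>\<Lambda> {m..<2 * m}) =
        (\<integral>\<^sup>+u. f (merge {..<m} {m..<2 * m} (t, \<lambda>i\<in>{m..<2 * m}. u (i - m))) \<partial>\<Lambda> {..<m})"
      by (rule nn_integral_product_reindex[OF _ bij meas, symmetric]) simp
    also have "\<dots> = (\<integral>\<^sup>+u. f (concat_tuples m t u) \<partial>\<Lambda> {..<m})"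
      by (intro nn_integral_cong arg_cong[where f = f]) (auto simp: fun_eq_iff merge_def concat_tuples_def)
    finally show "(\<integral>\<^sup>+u. f (merge {..<m} {m..<2 * m} (t, u)) \<partial>\<Lambda> {m..<2 * m}) = (\<integral>\<^sup>+u. f (concat_tuples m t u) \<partial>\<Lambda> {..<m})" .
  qed
  finally show ?thesis .
qed

lemma concat_tuples_measurable [measurable]:
  "(\<lambda>(t, u). concat_tuples m t u) \<in> measurable (\<Lambda> {..<m} \<Otimes>\<^sub>M \<Lambda> {..<m}) (\<Lambda> {..<2 * m})"
  unfolding concat_tuples_def case_prod_beta
proof (rule measurable_restrict)
  fix i assume i: "i \<in> {..<2 * m}"
  show "(\<lambda>x. if i < m then fst x i else snd x (i - m)) \<in> measurable (\<Lambda> {..<m} \<Otimes>\<^sub>M \<Lambda> {..<m}) lborel"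
  proof (cases "i < m")
    case True
    have "(\<lambda>x. fst x i) \<in> measurable (\<Lambda> {..<m} \<Otimes>\<^sub>M \<Lambda> {..<m}) lborel"
      by (rule measurable_compose[OF measurable_fst measurable_component_singleton]) (use True in simp)
    with True show ?thesis by simp
  next
    case False
    have "(\<lambda>x. snd x (i - m)) \<in> measurable (\<Lambda> {..<m} \<Otimes>\<^sub>M \<Lambda> {..<m}) lborel"
      by (rule measurable_compose[OF measurable_snd measurable_component_singleton]) (use False i in auto)
    with False show ?thesis by simp
  qed
qed

lemma window_measurable [measurable]:
  assumes [measurable]: "A \<in> sets borel" and "{..k} \<subseteq> I"
  shows "window A s k \<in> borel_measurable (\<Lambda> I)"
proof -
  have [measurable]: "(\<lambda>t. t j) \<in> borel_measurable (\<Lambda> I)" if "j \<le> k" for j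
    using that assms(2) measurable_component_singleton[of j I "\<lambda>_. lborel"] by auto
  have ind: "(\<lambda>x. indicator S x :: real) \<in> borel_measurable borel" if "S \<in> sets borel" for S :: "real set"
    using that by measurable
  have "(\<lambda>t. indicator A (t k) * (\<Prod>j<k. indicator A (t j) * indicator {0..s} (t j - t k)) :: real) \<in> borel_measurable (\<Lambda> I)"
    by (intro borel_measurable_times borel_measurable_prod measurable_compose[OF _ ind] borel_measurable_diff) auto
  also have "(\<lambda>t. indicator A (t k) * (\<Prod>j<k. indicator A (t j) * indicator {0..s} (t j - t k)) :: real) = window A s k"
    by (auto simp: window_def indicator_def fun_eq_iff algebra_simps intro!: prod.neutral)
  finally show ?thesis .
qed

text \<open>
  The integral of a translation invariant function \<open>h\<close> over all window tuples with anchor \<open>0\<close>. If the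
  anchor moves over an interval of length \<open>L\<close> and boundary effects are ignored, the integral over
  all windows is \<open>L\<close> times this number.
\<close>

definition shape_integral :: "real \<Rightarrow> nat \<Rightarrow> ((nat \<Rightarrow> real) \<Rightarrow> ennreal) \<Rightarrow> ennreal" where
  "shape_integral s k h = (\<integral>\<^sup>+z. (if \<forall>j<k. 0 \<le> z j \<and> z j \<le> s then 1 else 0) * h (z(k := 0)) \<partial>\<Lambda> {..<k})"

text \<open>
  Fubini with the anchor \<open>y\<close> outside, followed by the translation of the other members by \<open>y\<close>. The
  factor \<open>\<phi>\<close> permits a restriction of the anchor.
\<close>

lemma window_integral:
  fixes h :: "(nat \<Rightarrow> real) \<Rightarrow> ennreal" and \<phi> :: "real \<Rightarrow> ennreal"
  assumes A[measurable]: "A \<in> sets borel" and h[measurable]: "h \<in> borel_measurable (\<Lambda> {..<Suc k})"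
    and inv: "\<And>t c. t \<in> space (\<Lambda> {..<Suc k}) \<Longrightarrow> h (\<lambda>i\<in>{..<Suc k}. c + t i) = h t"
    and \<phi>[measurable]: "\<phi> \<in> borel_measurable borel"
  shows "(\<integral>\<^sup>+t. ennreal (window A s k t) * \<phi> (t k) * h t \<partial>\<Lambda> {..<Suc k}) =
    (\<integral>\<^sup>+y. indicator A y * \<phi> y *
       (\<integral>\<^sup>+z. (if \<forall>j<k. y + z j \<in> A \<and> 0 \<le> z j \<and> z j \<le> s then 1 else 0) * h (z(k := 0)) \<partial>\<Lambda> {..<k}) \<partial>lborel)"
proof -
  have ins: "{..<Suc k} = insert k {..<k}" by auto
  have wm[measurable]: "window A s k \<in> borel_measurable (\<Lambda> (insert k {..<k}))"
    by (rule window_measurable) auto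
  have hm[measurable]: "h \<in> borel_measurable (\<Lambda> (insert k {..<k}))" using h by (simp add: ins)
  have [measurable]: "(\<lambda>t. t k) \<in> borel_measurable (\<Lambda> (insert k {..<k}))"
    using measurable_component_singleton[of k "insert k {..<k}" "\<lambda>_. lborel"] by auto
  have "(\<integral>\<^sup>+t. ennreal (window A s k t) * \<phi> (t k) * h t \<partial>\<Lambda> {..<Suc k}) =
     (\<integral>\<^sup>+y. (\<integral>\<^sup>+x. ennreal (window A s k (x(k := y))) * \<phi> y * h (x(k := y)) \<partial>\<Lambda> {..<k}) \<partial>lborel)"
    unfolding ins by (subst lborel_product.product_nn_integral_insert_rev) auto
  also have "\<dots> = (\<integral>\<^sup>+y. indicator A y * \<phi> y *
       (\<integral>\<^sup>+z. (if \<forall>j<k. y + z j \<in> A \<and> 0 \<le> z j \<and> z j \<le> s then 1 else 0) * h (z(k := 0)) \<partial>\<Lambda> {..<k}) \<partial>lborel)"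
  proof (rule nn_integral_cong)
    fix y :: real
    have upd[measurable]: "(\<lambda>x. x(k := y)) \<in> measurable (\<Lambda> {..<k}) (\<Lambda> (insert k {..<k}))" for y
      by measurable
    have wy[measurable]: "(\<lambda>x. window A s k (x(k := y))) \<in> borel_measurable (\<Lambda> {..<k})"
      by (rule measurable_compose[OF upd wm])
    have hy[measurable]: "(\<lambda>x. h (x(k := y))) \<in> borel_measurable (\<Lambda> {..<k})" for y
      by (rule measurable_compose[OF upd hm])
    have "(\<integral>\<^sup>+x. ennreal (window A s k (x(k := y))) * \<phi> y * h (x(k := y)) \<partial>\<Lambda> {..<k}) =
       (\<integral>\<^sup>+x. ennreal (window A s k ((\<lambda>i\<in>{..<k}. y + 1 * x i)(k := y))) * \<phi> y * h ((\<lambda>i\<in>{..<k}. y + 1 * x i)(k := y)) \<partial>\<Lambda> {..<k})"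
      by (subst nn_integral_product_affine[where c = 1 and t = y]) auto
    also have "\<dots> = (\<integral>\<^sup>+x. indicator A y * \<phi> y * ((if \<forall>j<k. y + x j \<in> A \<and> 0 \<le> x j \<and> x j \<le> s then 1 else 0) * h (x(k := 0))) \<partial>\<Lambda> {..<k})"
    proof (rule nn_integral_cong)
      fix x assume x: "x \<in> space (\<Lambda> {..<k})"
      have "x(k := 0) \<in> space (\<Lambda> {..<Suc k})"
        using x by (auto simp: space_PiM PiE_def extensional_def)
      moreover have "(\<lambda>i\<in>{..<Suc k}. y + (x(k := 0)) i) = (\<lambda>i\<in>{..<k}. y + 1 * x i)(k := y)"
        by (auto simp: fun_eq_iff)
      ultimately have "h ((\<lambda>i\<in>{..<k}. y + 1 * x i)(k := y)) = h (x(k := 0))"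
        using inv[of "x(k := 0)" y] by simp
      moreover have "window A s k ((\<lambda>i\<in>{..<k}. y + 1 * x i)(k := y)) =
          indicator A y * (if \<forall>j<k. y + x j \<in> A \<and> 0 \<le> x j \<and> x j \<le> s then 1 else 0)"
        by (auto simp: window_def indicator_def)
      ultimately show "ennreal (window A s k ((\<lambda>i\<in>{..<k}. y + 1 * x i)(k := y))) * \<phi> y * h ((\<lambda>i\<in>{..<k}. y + 1 * x i)(k := y)) =
        indicator A y * \<phi> y * ((if \<forall>j<k. y + x j \<in> A \<and> 0 \<le> x j \<and> x j \<le> s then 1 else 0) * h (x(k := 0)))"
        by (auto simp: indicator_def)
    qed
    also have "\<dots> = indicator A y * \<phi> y *
       (\<integral>\<^sup>+z. (if \<forall>j<k. y + z j \<in> A \<and> 0 \<le> z j \<and> z j \<le> s then 1 else 0) * h (z(k := 0)) \<partial>\<Lambda> {..<k})"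
    proof (rule nn_integral_cmult)
      have [measurable]: "(\<lambda>t. t j) \<in> borel_measurable (\<Lambda> {..<k})" if "j \<in> {..<k}" for j
        using that measurable_component_singleton[of j "{..<k}" "\<lambda>_. lborel"] by auto
      have "(\<lambda>z. (if \<forall>j\<in>{..<k}. y + z j \<in> A \<and> 0 \<le> z j \<and> z j \<le> s then 1 else 0) * h (z(k := 0))) \<in> borel_measurable (\<Lambda> {..<k})"
        by measurable
      then show "(\<lambda>z. (if \<forall>j<k. y + z j \<in> A \<and> 0 \<le> z j \<and> z j \<le> s then 1 else 0) * h (z(k := 0))) \<in> borel_measurable (\<Lambda> {..<k})"
        by simp
    qed
    finally show "(\<integral>\<^sup>+x. ennreal (window A s k (x(k := y))) * \<phi> y * h (x(k := y)) \<partial>\<Lambda> {..<k}) =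
       indicator A y * \<phi> y * (\<integral>\<^sup>+z. (if \<forall>j<k. y + z j \<in> A \<and> 0 \<le> z j \<and> z j \<le> s then 1 else 0) * h (z(k := 0)) \<partial>\<Lambda> {..<k})" .
  qed
  finally show ?thesis .
qed

lemma window_integral_le:
  fixes h :: "(nat \<Rightarrow> real) \<Rightarrow> ennreal" and \<phi> :: "real \<Rightarrow> ennreal"
  assumes A[measurable]: "A \<in> sets borel" and h[measurable]: "h \<in> borel_measurable (\<Lambda> {..<Suc k})"
    and inv: "\<And>t c. t \<in> space (\<Lambda> {..<Suc k}) \<Longrightarrow> h (\<lambda>i\<in>{..<Suc k}. c + t i) = h t"
    and \<phi>[measurable]: "\<phi> \<in> borel_measurable borel"
  shows "(\<integral>\<^sup>+t. ennreal (window A s k t) * \<phi> (t k) * h t \<partial>\<Lambda> {..<Suc k}) \<le>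
    (\<integral>\<^sup>+y. indicator A y * \<phi> y \<partial>lborel) * shape_integral s k h"
proof -
  have "(\<integral>\<^sup>+t. ennreal (window A s k t) * \<phi> (t k) * h t \<partial>\<Lambda> {..<Suc k}) =
    (\<integral>\<^sup>+y. indicator A y * \<phi> y *
       (\<integral>\<^sup>+z. (if \<forall>j<k. y + z j \<in> A \<and> 0 \<le> z j \<and> z j \<le> s then 1 else 0) * h (z(k := 0)) \<partial>\<Lambda> {..<k}) \<partial>lborel)"
    by (rule window_integral) (use assms in auto)
  also have "\<dots> \<le> (\<integral>\<^sup>+y. indicator A y * \<phi> y * shape_integral s k h \<partial>lborel)"
    unfolding shape_integral_def
    by (intro nn_integral_mono mult_left_mono mult_right_mono) auto
  also have "\<dots> = (\<integral>\<^sup>+y. indicator A y * \<phi> y \<partial>lborel) * shape_integral s k h"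
    by (rule nn_integral_multc) measurable
  finally show ?thesis .
qed

text \<open>
  If the anchor is at distance at least \<open>s\<close> from the right end of the interval, the whole window fits
  in, so at most the length \<open>s\<close> is lost.
\<close>

lemma window_integral_ge:
  fixes h :: "(nat \<Rightarrow> real) \<Rightarrow> ennreal"
  assumes A[measurable]: "A \<in> sets borel" and h[measurable]: "h \<in> borel_measurable (\<Lambda> {..<Suc k})"
    and inv: "\<And>t c. t \<in> space (\<Lambda> {..<Suc k}) \<Longrightarrow> h (\<lambda>i\<in>{..<Suc k}. c + t i) = h t"
    and r: "{- r<..<r} \<subseteq> A" and s: "0 \<le> s"
  shows "ennreal (2 * r - s) * shape_integral s k h \<le> (\<integral>\<^sup>+t. ennreal (window A s k t) * h t \<partial>\<Lambda> {..<Suc k})"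
proof (cases "s \<le> 2 * r")
  case False
  then show ?thesis by (simp add: ennreal_neg)
next
  case True
  have "ennreal (2 * r - s) * shape_integral s k h = (\<integral>\<^sup>+y. indicator {- r<..<r - s} y * shape_integral s k h \<partial>lborel)"
    using True by (subst nn_integral_multc) (auto simp: algebra_simps)
  also have "\<dots> \<le> (\<integral>\<^sup>+y. indicator A y * 1 *
       (\<integral>\<^sup>+z. (if \<forall>j<k. y + z j \<in> A \<and> 0 \<le> z j \<and> z j \<le> s then 1 else 0) * h (z(k := 0)) \<partial>\<Lambda> {..<k}) \<partial>lborel)"
  proof (rule nn_integral_mono)
    fix y :: real
    show "indicator {- r<..<r - s} y * shape_integral s k h \<le> indicator A y * 1 *
       (\<integral>\<^sup>+z. (if \<forall>j<k. y + z j \<in> A \<and> 0 \<le> z j \<and> z j \<le> s then 1 else 0) * h (z(k := 0)) \<partial>\<Lambda> {..<k})"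
    proof (cases "y \<in> {- r<..<r - s}")
      case True
      have "v \<in> A" if "y \<le> v" "v \<le> y + s" for v using that True r by (auto intro!: subsetD[OF r])
      then have eq: "(\<forall>j<k. y + z j \<in> A \<and> 0 \<le> z j \<and> z j \<le> s) \<longleftrightarrow> (\<forall>j<k. 0 \<le> z j \<and> z j \<le> s)" for z :: "nat \<Rightarrow> real"
        by auto
      have "y \<in> A" using True s r by (auto intro!: subsetD[OF r])
      then show ?thesis using True by (simp add: eq shape_integral_def)
    qed simp
  qed
  also have "\<dots> = (\<integral>\<^sup>+t. ennreal (window A s k t) * 1 * h t \<partial>\<Lambda> {..<Suc k})"
    by (rule window_integral[symmetric]) (use assms in auto)
  finally show ?thesis by simp
qed

lemma shape_integral_mono: "(\<And>z. h z \<le> h' z) \<Longrightarrow> shape_integral s k h \<le> shape_integral s k h'"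
  unfolding shape_integral_def by (intro nn_integral_mono mult_left_mono) auto

lemma shape_integral_const:
  assumes "0 \<le> s" shows "shape_integral s k (\<lambda>_. c) = ennreal (s ^ k) * c"
proof -
  have "shape_integral s k (\<lambda>_. c) = (\<integral>\<^sup>+z. indicator ({..<k} \<rightarrow>\<^sub>E {0..s}) z * c \<partial>\<Lambda> {..<k})"
    unfolding shape_integral_def
    by (intro nn_integral_cong) (auto simp: indicator_def space_PiM PiE_iff)
  also have "\<dots> = emeasure (\<Lambda> {..<k}) ({..<k} \<rightarrow>\<^sub>E {0..s}) * c"
    by (subst nn_integral_multc) (auto intro!: borel_measurable_indicator sets_PiM_I_finite)
  also have "emeasure (\<Lambda> {..<k}) ({..<k} \<rightarrow>\<^sub>E {0..s}) = ennreal (s ^ k)"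
    using assms by (subst lborel_product.emeasure_PiM) (auto simp: ennreal_power)
  finally show ?thesis .
qed

section \<open>Clustering point processes\<close>

definition occupation :: "real set \<Rightarrow> nat \<Rightarrow> real \<Rightarrow> (nat \<Rightarrow> real) \<Rightarrow> nat \<Rightarrow> nat" where
  "occupation A N s x n = card {i \<in> points_in A N x. card (followers A N s x i) = n}"

lemma card_followers_less: "i < N \<Longrightarrow> card (followers A N s x i) < N"
proof -
  assume i: "i < N"
  have "followers A N s x i \<subset> {..<N}" using i by (auto simp: followers_def)
  then have "card (followers A N s x i) < card {..<N}" by (intro psubset_card_mono) auto
  then show ?thesis by simp
qed

lemma sum_occupation:
  "(\<Sum>n\<le>N. real (occupation A N s x n) * f n) = (\<Sum>i\<in>points_in A N x. f (card (followers A N s x i)))"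
proof -
  have "(\<Sum>i\<in>points_in A N x. f (card (followers A N s x i))) =
     (\<Sum>n\<le>N. \<Sum>i\<in>{i \<in> points_in A N x. card (followers A N s x i) = n}. f (card (followers A N s x i)))"
    using card_followers_less by (intro sum.group[symmetric]) (auto simp: points_in_def less_imp_le)
  also have "\<dots> = (\<Sum>n\<le>N. real (occupation A N s x n) * f n)"
    by (intro sum.cong) (auto simp: occupation_def)
  finally show ?thesis by simp
qed

lemma linear_geometric_sum_le:
  fixes y :: real assumes "0 \<le> y" "y \<le> 1 / 2"
  shows "(\<Sum>k<n. real (Suc k) * y ^ k) \<le> 4"
proof -
  have "(\<Sum>k<n. real (Suc k) * y ^ k) \<le> (\<Sum>k<n. real (Suc k) * (1 / 2) ^ k)"
    using assms by (intro sum_mono mult_left_mono power_mono) auto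
  also have "\<dots> = 4 - (2 * real n + 4) * (1 / 2) ^ n"
  proof (induction n)
    case (Suc n)
    have "(\<Sum>k<Suc n. real (Suc k) * (1 / 2) ^ k) = 4 - (2 * real n + 4) * (1 / 2) ^ n + (1 + real n) * (1 / 2 :: real) ^ n"
      unfolding sum.lessThan_Suc Suc.IH by simp
    also have "\<dots> = 4 - (2 * real (Suc n) + 4) * (1 / 2) ^ Suc n"
      by (simp add: field_simps)
    finally show ?case .
  qed simp
  finally show ?thesis by (smt (verit) of_nat_0_le_iff mult_nonneg_nonneg zero_le_power divide_nonneg_nonneg)
qed

lemma power_le_exponential:
  fixes q :: real assumes "1 < q"
  shows "\<exists>K>0. \<forall>n::nat. (1 + real n) ^ p \<le> K * q ^ n"
proof -
  have "(\<lambda>n. (1 + real n) ^ p / q ^ n) \<longlonglongrightarrow> 0"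
    using assms by real_asymp
  then have "Bseq (\<lambda>n. (1 + real n) ^ p / q ^ n)" by (intro convergent_imp_Bseq convergentI)
  then obtain K where K: "0 < K" "\<And>n. norm ((1 + real n) ^ p / q ^ n) \<le> K" by (auto simp: Bseq_def)
  have "(1 + real n) ^ p \<le> K * q ^ n" for n
    using K(2)[of n] assms by (simp add: divide_le_eq)
  then show ?thesis using K(1) by blast
qed

text \<open>
  Configurations \<open>x 0 < \<dots> < x (N - 1)\<close> with law \<open>D N\<close> and correlation functions \<open>B N m\<close>, observed in a growing
  interval \<open>A N\<close> of length \<open>2 * r N\<close>. In that interval the correlation functions converge uniformly to
  translation invariant functions \<open>W m\<close> of density \<open>1\<close>, which factorise for distant groups of points. The growth
  bound by \<open>C ^ m * fact m\<close> is what makes exponential moments finite.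
\<close>

locale clustering_process =
  fixes B :: "nat \<Rightarrow> nat \<Rightarrow> (nat \<Rightarrow> real) \<Rightarrow> real" and W :: "nat \<Rightarrow> (nat \<Rightarrow> real) \<Rightarrow> real"
    and D :: "nat \<Rightarrow> (nat \<Rightarrow> real) measure" and A :: "nat \<Rightarrow> real set" and r :: "nat \<Rightarrow> real" and C :: real
  assumes C_pos: "0 < C"
    and sets_D: "\<And>N. sets (D N) = sets (\<Lambda> {..<N})"
    and prob: "\<forall>\<^sub>F N in sequentially. prob_space (D N)"
    and increasing: "\<And>N. 1 \<le> N \<Longrightarrow> AE x in D N. strict_mono_on {..<N} x"
    and B_meas: "\<And>N m. 1 \<le> m \<Longrightarrow> m \<le> N \<Longrightarrow> B N m \<in> borel_measurable (\<Lambda> {..<m})"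
    and correlation: "\<And>N m F. 1 \<le> m \<Longrightarrow> m \<le> N \<Longrightarrow> F \<in> borel_measurable (\<Lambda> {..<m}) \<Longrightarrow>
        (\<integral>\<^sup>+x. tuple_sum m N F x \<partial>D N) = (\<integral>\<^sup>+t. F t * ennreal (B N m t) \<partial>\<Lambda> {..<m})"
    and B_nonneg: "\<And>N m t. 1 \<le> m \<Longrightarrow> m \<le> N \<Longrightarrow> 0 \<le> B N m t"
    and A_sub: "\<And>N. 1 \<le> N \<Longrightarrow> {- r N<..<r N} \<subseteq> A N" "\<And>N. 1 \<le> N \<Longrightarrow> A N \<subseteq> {- r N..r N}"
    and r_pos: "\<And>N. 1 \<le> N \<Longrightarrow> 0 < r N"
    and r_lim: "filterlim r at_top sequentially"
    and B_bound: "\<forall>\<^sub>F N in sequentially. \<forall>m\<in>{1..N}. \<forall>t. (\<forall>i<m. t i \<in> A N) \<longrightarrow> B N m t \<le> C ^ m * fact m"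
    and B_conv: "\<And>m e. 1 \<le> m \<Longrightarrow> 0 < e \<Longrightarrow>
        \<forall>\<^sub>F N in sequentially. \<forall>t. (\<forall>i<m. t i \<in> A N) \<longrightarrow> \<bar>B N m t - W m t\<bar> \<le> e"
    and W_meas: "\<And>m. W m \<in> borel_measurable (\<Lambda> {..<m})"
    and W_one: "\<And>t. W 1 t = 1"
    and W_shift: "\<And>m c t. W m (\<lambda>i\<in>{..<m}. c + t i) = W m t"
    and clustering: "\<And>k s e. 0 \<le> s \<Longrightarrow> 0 < e \<Longrightarrow> \<exists>d\<ge>0. \<forall>t u.
        (\<forall>i<k. t k \<le> t i \<and> t i \<le> t k + s) \<and> (\<forall>i<k. u k \<le> u i \<and> u i \<le> u k + s) \<and> d < \<bar>t k - u k\<bar> \<longrightarrow>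
        \<bar>W (2 * Suc k) (concat_tuples (Suc k) t u) - W (Suc k) t * W (Suc k) u\<bar> \<le> e"
begin

lemma measurable_D: "borel_measurable (D N) = borel_measurable (\<Lambda> {..<N})"
  by (rule measurable_cong_sets[OF sets_D refl])

lemma coord_measurable [measurable]: "i < N \<Longrightarrow> (\<lambda>x. x i) \<in> borel_measurable (D N)"
  unfolding measurable_D using measurable_component_singleton[of i "{..<N}" "\<lambda>_. lborel"] by auto

lemma A_borel [measurable]: "1 \<le> N \<Longrightarrow> A N \<in> sets borel"
proof -
  assume N: "1 \<le> N"
  have "A N = {- r N<..<r N} \<union> (A N \<inter> {- r N, r N})"
    using A_sub[OF N] by force
  also have "\<dots> \<in> sets borel" by (intro sets.Un) (auto intro: sets.countable countable_finite)
  finally show ?thesis .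
qed

lemma emeasure_A: "1 \<le> N \<Longrightarrow> emeasure lborel (A N) = ennreal (2 * r N)"
proof (rule antisym)
  assume N: "1 \<le> N"
  have "emeasure lborel (A N) \<le> emeasure lborel {- r N..r N}"
    using A_sub(2)[OF N] by (intro emeasure_mono) auto
  also have "\<dots> = ennreal (2 * r N)" using r_pos[OF N] by simp
  finally show "emeasure lborel (A N) \<le> ennreal (2 * r N)" .
  have "ennreal (2 * r N) = emeasure lborel {- r N<..<r N}" using r_pos[OF N] by simp
  also have "\<dots> \<le> emeasure lborel (A N)"
    using A_sub(1)[OF N] A_borel[OF N] by (intro emeasure_mono) auto
  finally show "ennreal (2 * r N) \<le> emeasure lborel (A N)" .
qed

text \<open>
  Bounds on \<open>B N m\<close> hold only inside \<open>A N\<close>; they are inherited by \<open>W m\<close> everywhere because \<open>A N\<close> exhausts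
  the line.
\<close>

lemma eventually_in_A: "\<forall>\<^sub>F N in sequentially. \<forall>i<(m::nat). t i \<in> A N"
proof -
  define R where "R = Max ((\<lambda>i. \<bar>t i\<bar>) ` {..<m} \<union> {0})"
  have R: "\<bar>t i\<bar> \<le> R" if "i < m" for i unfolding R_def using that by (intro Max_ge) auto
  have "\<forall>\<^sub>F N in sequentially. R < r N \<and> 1 \<le> N"
    using r_lim eventually_ge_at_top[of 1] by (auto simp: filterlim_at_top_dense intro: eventually_conj)
  then show ?thesis
  proof eventually_elim
    case (elim N)
    then have N: "1 \<le> N" "R < r N" by auto
    show ?case
    proof (intro allI impI)
      fix i assume "i < m"
      then have "t i \<in> {- r N<..<r N}" using R[of i] N(2) by (auto simp: abs_le_iff)
      then show "t i \<in> A N" using A_sub(1)[OF N(1)] by blast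
    qed
  qed
qed

lemma W_bounds:
  assumes "1 \<le> m" shows "0 \<le> W m t" "W m t \<le> C ^ m * fact m"
proof -
  have "0 \<le> W m t + e \<and> W m t \<le> C ^ m * fact m + e" if "0 < e" for e
  proof -
    have "\<forall>\<^sub>F N in sequentially. 0 \<le> W m t + e \<and> W m t \<le> C ^ m * fact m + e"
      using eventually_in_A[of m t] B_conv[OF assms that] B_bound eventually_ge_at_top[of m]
    proof eventually_elim
      case (elim N)
      then have "\<bar>B N m t - W m t\<bar> \<le> e" "B N m t \<le> C ^ m * fact m" using assms by auto
      moreover have "0 \<le> B N m t" using assms elim by (intro B_nonneg) auto
      ultimately show ?case by (auto simp: abs_le_iff)
    qed
    then show ?thesis by (auto dest: eventually_happens)
  qed
  then show "0 \<le> W m t" "W m t \<le> C ^ m * fact m"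
    by (meson field_le_epsilon)+
qed

abbreviation shape :: "real \<Rightarrow> nat \<Rightarrow> ennreal" where
  "shape s k \<equiv> shape_integral s k (\<lambda>t. ennreal (W (Suc k) t))"

definition limit_moment :: "real \<Rightarrow> nat \<Rightarrow> real" where
  "limit_moment s k = enn2real (shape s k)"

lemma shape_eq: "0 \<le> s \<Longrightarrow> shape s k = ennreal (limit_moment s k)"
proof -
  assume s: "0 \<le> s"
  have "shape s k \<le> shape_integral s k (\<lambda>_. ennreal (C ^ Suc k * fact (Suc k)))"
    by (intro shape_integral_mono ennreal_leI W_bounds) auto
  also have "\<dots> < \<infinity>" using s by (subst shape_integral_const) (auto simp: ennreal_mult_less_top)
  finally show ?thesis by (simp add: limit_moment_def)
qed

lemma limit_moment_nonneg: "0 \<le> limit_moment s k"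
  by (simp add: limit_moment_def)

lemma W_inv: "t \<in> space (\<Lambda> {..<m}) \<Longrightarrow> ennreal (W m (\<lambda>i\<in>{..<m}. c + t i)) = ennreal (W m t)"
  by (simp only: W_shift)

text \<open>
  The \<open>k\<close>-th factorial moment of the number of followers, summed over all points in \<open>A N\<close>.
\<close>

definition total :: "nat \<Rightarrow> real \<Rightarrow> nat \<Rightarrow> (nat \<Rightarrow> real) \<Rightarrow> real" where
  "total N s k x = (\<Sum>i\<in>points_in (A N) N x. real (fact k * (card (followers (A N) N s x i) choose k)))"

lemma total_nonneg: "0 \<le> total N s k x"
  by (simp add: total_def sum_nonneg)

lemma total_eq: "total N s k x = tuple_sum (Suc k) N (window (A N) s k) x"
  by (simp add: tuple_sum_window total_def)

lemma tuple_sum_ennreal: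
  "(\<And>t. 0 \<le> F t) \<Longrightarrow> ennreal (tuple_sum m N F x) = tuple_sum m N (\<lambda>t. ennreal (F t)) x"
  by (simp add: tuple_sum_def sum_ennreal)

lemma window_bounds: "0 \<le> window S s k t" "window S s k t \<le> 1"
  by (auto simp: window_def)

lemma far_windows_nonneg: "0 \<le> far_windows S s k t"
  by (auto simp: far_windows_def window_def)

lemma window_borel [measurable]: "1 \<le> N \<Longrightarrow> window (A N) s k \<in> borel_measurable (\<Lambda> {..<Suc k})"
  by (rule window_measurable) auto

lemma expectation_total:
  assumes "1 \<le> N" "Suc k \<le> N"
  shows "(\<integral>\<^sup>+x. ennreal (total N s k x) \<partial>D N) =
    (\<integral>\<^sup>+t. ennreal (window (A N) s k t) * ennreal (B N (Suc k) t) \<partial>\<Lambda> {..<Suc k})"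
proof -
  note [measurable] = window_borel[OF assms(1)]
  show ?thesis unfolding total_eq
    by (subst tuple_sum_ennreal) (auto simp: window_bounds assms intro!: correlation)
qed

lemma window_mass:
  assumes N: "1 \<le> N" and s: "0 \<le> s" and c: "0 \<le> c"
  shows "(\<integral>\<^sup>+t. ennreal (window (A N) s k t) * ennreal c \<partial>\<Lambda> {..<Suc k}) \<le> ennreal (2 * r N * s ^ k * c)"
proof -
  have "(\<integral>\<^sup>+t. ennreal (window (A N) s k t) * 1 * ennreal c \<partial>\<Lambda> {..<Suc k}) \<le>
      (\<integral>\<^sup>+y. indicator (A N) y * 1 \<partial>lborel) * shape_integral s k (\<lambda>_. ennreal c)"
    using N by (intro window_integral_le) auto
  also have "\<dots> = ennreal (2 * r N * s ^ k * c)"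
    using N s c r_pos[OF N] by (simp add: shape_integral_const emeasure_A ennreal_mult mult.assoc)
  finally show ?thesis by simp
qed

lemma expectation_total_le:
  "\<forall>\<^sub>F N in sequentially. \<forall>s\<ge>0. \<forall>k.
     (\<integral>\<^sup>+x. ennreal (total N s k x) \<partial>D N) \<le> ennreal (2 * r N * s ^ k * (C ^ Suc k * fact (Suc k)))"
  using B_bound eventually_ge_at_top[of 1]
proof eventually_elim
  case (elim N)
  show ?case
  proof (intro allI impI)
    fix s :: real and k assume s: "0 \<le> s"
    show "(\<integral>\<^sup>+x. ennreal (total N s k x) \<partial>D N) \<le> ennreal (2 * r N * s ^ k * (C ^ Suc k * fact (Suc k)))"
    proof (cases "Suc k \<le> N")
      case False
      then have "total N s k x = 0" for x
        unfolding total_def using card_followers_less[of _ N "A N" s x]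
        by (intro sum.neutral) (force simp: points_in_def)
      then show ?thesis by simp
    next
      case True
      have "(\<integral>\<^sup>+x. ennreal (total N s k x) \<partial>D N) \<le>
         (\<integral>\<^sup>+t. ennreal (window (A N) s k t) * ennreal (C ^ Suc k * fact (Suc k)) \<partial>\<Lambda> {..<Suc k})"
        unfolding expectation_total[OF elim(2) True]
      proof (rule nn_integral_mono)
        fix t
        show "ennreal (window (A N) s k t) * ennreal (B N (Suc k) t) \<le>
              ennreal (window (A N) s k t) * ennreal (C ^ Suc k * fact (Suc k))"
        proof (cases "window (A N) s k t = 0")
          case False
          then have "\<forall>i<Suc k. t i \<in> A N" by (auto simp: window_def less_Suc_eq split: if_splits)
          then have "B N (Suc k) t \<le> C ^ Suc k * fact (Suc k)"
            using elim(1)[rule_format, of "Suc k" t] True by auto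
          then show ?thesis by (intro mult_left_mono ennreal_leI) auto
        qed simp
      qed
      also have "\<dots> \<le> ennreal (2 * r N * s ^ k * (C ^ Suc k * fact (Suc k)))"
        using C_pos by (intro window_mass elim s) auto
      finally show ?thesis .
    qed
  qed
qed

lemma total_measurable: "1 \<le> N \<Longrightarrow> total N s k \<in> borel_measurable (D N)"
  unfolding total_eq[abs_def] tuple_sum_def measurable_D
proof (intro borel_measurable_sum)
  fix j assume N: "1 \<le> N" and j: "j \<in> inj_tuples (Suc k) {..<N}"
  have "(\<lambda>x. \<lambda>i\<in>{..<Suc k}. x (j i)) \<in> measurable (\<Lambda> {..<N}) (\<Lambda> {..<Suc k})"
    using j by (intro measurable_restrict measurable_component_singleton) (auto simp: inj_tuples_def PiE_def Pi_iff)
  then show "(\<lambda>x. window (A N) s k (\<lambda>i\<in>{..<Suc k}. x (j i))) \<in> borel_measurable (\<Lambda> {..<N})"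
    by (rule measurable_compose[OF _ window_borel[OF N]])
qed

text \<open>
  Expansion of \<open>q ^ n = ((q - 1) + 1) ^ n\<close> in factorial moments. The \<open>k\<close>-th of them grows like
  \<open>(C * s) ^ k * fact (Suc k)\<close>, so the series converges if \<open>q - 1\<close> is small.
\<close>

lemma exponential_moment:
  assumes s: "0 \<le> s" and q: "1 < q" "(q - 1) * C * s \<le> 1 / 2"
  shows "\<forall>\<^sub>F N in sequentially.
    (\<integral>\<^sup>+x. ennreal (\<Sum>i\<in>points_in (A N) N x. q ^ card (followers (A N) N s x i)) \<partial>D N) \<le> ennreal (8 * C * r N)"
  using expectation_total_le eventually_ge_at_top[of 1]
proof eventually_elim
  case (elim N)
  note [measurable] = total_measurable[OF elim(2)]
  have sum_eq: "(\<Sum>i\<in>points_in (A N) N x. q ^ card (followers (A N) N s x i)) = (\<Sum>k<N. (q - 1) ^ k / fact k * total N s k x)" for x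
  proof -
    have "q ^ card (followers (A N) N s x i) = (\<Sum>k<N. (q - 1) ^ k * real (card (followers (A N) N s x i) choose k))"
      if i: "i \<in> points_in (A N) N x" for i
    proof -
      let ?n = "card (followers (A N) N s x i)"
      have n: "?n < N" using i by (intro card_followers_less) (auto simp: points_in_def)
      have "q ^ ?n = ((q - 1) + 1) ^ ?n" by simp
      also have "\<dots> = (\<Sum>k\<le>?n. real (?n choose k) * (q - 1) ^ k)" by (subst binomial_ring) simp
      also have "\<dots> = (\<Sum>k<N. real (?n choose k) * (q - 1) ^ k)"
        using n by (intro sum.mono_neutral_left) (auto simp: binomial_eq_0)
      finally show ?thesis by (simp add: mult.commute)
    qed
    then have "(\<Sum>i\<in>points_in (A N) N x. q ^ card (followers (A N) N s x i)) =
      (\<Sum>i\<in>points_in (A N) N x. \<Sum>k<N. (q - 1) ^ k * real (card (followers (A N) N s x i) choose k))"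
      by simp
    also have "\<dots> = (\<Sum>k<N. \<Sum>i\<in>points_in (A N) N x. (q - 1) ^ k * real (card (followers (A N) N s x i) choose k))"
      by (rule sum.swap)
    also have "\<dots> = (\<Sum>k<N. (q - 1) ^ k / fact k * total N s k x)"
      by (simp add: total_def sum_distrib_left)
    finally show ?thesis .
  qed
  have "(\<integral>\<^sup>+x. ennreal (\<Sum>i\<in>points_in (A N) N x. q ^ card (followers (A N) N s x i)) \<partial>D N) =
    (\<integral>\<^sup>+x. (\<Sum>k<N. ennreal ((q - 1) ^ k / fact k) * ennreal (total N s k x)) \<partial>D N)"
    unfolding sum_eq using q total_nonneg
    by (intro nn_integral_cong) (simp add: sum_ennreal flip: ennreal_mult)
  also have "\<dots> = (\<Sum>k<N. ennreal ((q - 1) ^ k / fact k) * (\<integral>\<^sup>+x. ennreal (total N s k x) \<partial>D N))"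
    by (subst nn_integral_sum) (auto simp: nn_integral_cmult)
  also have "\<dots> \<le> (\<Sum>k<N. ennreal ((q - 1) ^ k / fact k) * ennreal (2 * r N * s ^ k * (C ^ Suc k * fact (Suc k))))"
    using elim(1) s by (intro sum_mono mult_left_mono) auto
  also have "\<dots> = (\<Sum>k<N. ennreal ((q - 1) ^ k / fact k * (2 * r N * s ^ k * (C ^ Suc k * fact (Suc k)))))"
    using q C_pos s r_pos[OF elim(2)] by (intro sum.cong refl ennreal_mult[symmetric]) auto
  also have "\<dots> = ennreal (\<Sum>k<N. (q - 1) ^ k / fact k * (2 * r N * s ^ k * (C ^ Suc k * fact (Suc k))))"
    using q C_pos s r_pos[OF elim(2)] by (intro sum_ennreal) auto
  also have "(\<Sum>k<N. (q - 1) ^ k / fact k * (2 * r N * s ^ k * (C ^ Suc k * fact (Suc k)))) =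
     2 * r N * C * (\<Sum>k<N. real (Suc k) * ((q - 1) * C * s) ^ k)"
    unfolding sum_distrib_left by (intro sum.cong refl) (simp add: power_mult_distrib mult_ac)
  also have "\<dots> \<le> 2 * r N * C * 4"
    using q C_pos s r_pos[OF elim(2)] by (intro mult_left_mono linear_geometric_sum_le) auto
  finally show ?case by (simp add: ennreal_leI mult_ac)
qed

end

section \<open>Concentration of the factorial moments\<close>

lemma ennreal_le_diff: "x + ennreal p \<le> ennreal q \<Longrightarrow> x \<le> ennreal (q - p)"
proof -
  assume le: "x + ennreal p \<le> ennreal q"
  have "x \<le> x + ennreal p" by simp
  also note le
  finally have xq: "x \<le> ennreal q" .
  then obtain y where y: "0 \<le> y" "x = ennreal y" by (cases x) (auto simp: top_unique)
  show ?thesis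
  proof (cases "0 \<le> p")
    case True
    then have "ennreal (y + p) \<le> ennreal q" using le y by simp
    then have "y = 0 \<or> y + p \<le> q" using y True by (auto simp: ennreal_le_iff2 simp del: ennreal_plus)
    then show ?thesis using y by (auto simp: ennreal_leI)
  next
    case False
    then show ?thesis using order_trans[OF xq ennreal_leI[of q "q - p"]] by simp
  qed
qed

context clustering_process
begin

lemma W_borel [measurable]: "W m \<in> borel_measurable (\<Lambda> {..<m})"
  by (rule W_meas)

lemma far_windows_concat:
  "far_windows S s k (concat_tuples (Suc k) t u) =
     window S s k t * window S s k u * (if 2 * s < \<bar>t k - u k\<bar> then 1 else 0)"
proof -
  have "window S s k (concat_tuples (Suc k) t u) = window S s k t"
    by (auto simp: window_def concat_tuples_def)
  moreover have "window S s k (\<lambda>i. concat_tuples (Suc k) t u (Suc k + i)) = window S s k u"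
    by (auto simp: window_def concat_tuples_def)
  ultimately show ?thesis by (simp add: far_windows_def concat_tuples_def)
qed

lemma far_windows_borel: "1 \<le> N \<Longrightarrow> far_windows (A N) s k \<in> borel_measurable (\<Lambda> {..<2 * Suc k})"
proof -
  assume N: "1 \<le> N"
  have c[measurable]: "(\<lambda>t. t i) \<in> borel_measurable (\<Lambda> {..<2 * Suc k})" if "i < 2 * Suc k" for i
    using that measurable_component_singleton[of i "{..<2 * Suc k}" "\<lambda>_. lborel"] by auto
  have [measurable]: "window (A N) s k \<in> borel_measurable (\<Lambda> {..<2 * Suc k})"
    by (rule window_measurable) (use N in auto)
  have "(\<lambda>t. \<lambda>i\<in>{..<Suc k}. t (Suc k + i)) \<in> measurable (\<Lambda> {..<2 * Suc k}) (\<Lambda> {..<Suc k})"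
    by (intro measurable_restrict measurable_component_singleton) auto
  from measurable_compose[OF this window_borel[OF N]]
  have "(\<lambda>t. window (A N) s k (\<lambda>i\<in>{..<Suc k}. t (Suc k + i))) \<in> borel_measurable (\<Lambda> {..<2 * Suc k})" .
  moreover have "window (A N) s k (\<lambda>i\<in>{..<Suc k}. t (Suc k + i)) = window (A N) s k (\<lambda>i. t (Suc k + i))" for t
    by (auto simp: window_def)
  ultimately have [measurable]: "(\<lambda>t. window (A N) s k (\<lambda>i. t (Suc k + i))) \<in> borel_measurable (\<Lambda> {..<2 * Suc k})"
    by simp
  have [measurable]: "(\<lambda>t. t k) \<in> borel_measurable (\<Lambda> {..<2 * Suc k})"
    "(\<lambda>t. t (Suc k + k)) \<in> borel_measurable (\<Lambda> {..<2 * Suc k})"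
    by (rule c; simp)+
  show ?thesis unfolding far_windows_def[abs_def] by measurable
qed

text \<open>
  The correlation function of the combined tuple is bounded by a constant if the anchors are within
  the distance \<open>d\<close> beyond which clustering holds, which contributes \<open>O(r N)\<close>, and by the product
  \<open>W m t * W m u\<close> up to \<open>2 * e1\<close> otherwise, which contributes the square of the first moment.
\<close>

lemma expectation_far_le:
  assumes s: "0 \<le> s" and e: "0 < e"
  shows "\<exists>K\<ge>0. \<forall>\<^sub>F N in sequentially.
    (\<integral>\<^sup>+x. ennreal (tuple_sum (2 * Suc k) N (far_windows (A N) s k) x) \<partial>D N)
      \<le> ennreal ((2 * r N)\<^sup>2 * ((limit_moment s k)\<^sup>2 + e) + K * r N)"
proof -
  define m where "m = Suc k"
  define G where "G = limit_moment s k"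
  define e1 where "e1 = e / (2 * (s ^ k)\<^sup>2 + 1)"
  have e1: "0 < e1" using e by (simp add: e1_def add_nonneg_pos)
  have e1e: "2 * e1 * (s ^ k)\<^sup>2 \<le> e"
  proof -
    have "e * (2 * (s ^ k)\<^sup>2) \<le> e * (2 * (s ^ k)\<^sup>2 + 1)" using e by (intro mult_left_mono) auto
    then show ?thesis unfolding e1_def by (simp add: divide_le_eq add_nonneg_pos mult_ac)
  qed
  define Cb where "Cb = C ^ (2 * m) * fact (2 * m)"
  have Cb: "0 \<le> Cb" using C_pos by (simp add: Cb_def)
  have G: "0 \<le> G" by (simp add: G_def limit_moment_nonneg)
  obtain d where d: "0 \<le> d" "\<And>t u. (\<forall>i<k. t k \<le> t i \<and> t i \<le> t k + s) \<Longrightarrow> (\<forall>i<k. u k \<le> u i \<and> u i \<le> u k + s) \<Longrightarrow>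
      d < \<bar>t k - u k\<bar> \<Longrightarrow> \<bar>W (2 * m) (concat_tuples m t u) - W m t * W m u\<bar> \<le> e1"
    using clustering[OF s e1, of k] unfolding m_def by blast
  have m: "1 \<le> m" "1 \<le> 2 * m" by (auto simp: m_def)
  show ?thesis
  proof (intro exI[of _ "2 * s ^ k * (2 * d * (s ^ k * Cb))"] conjI)
    show "0 \<le> 2 * s ^ k * (2 * d * (s ^ k * Cb))" using s d(1) Cb by simp
    show "\<forall>\<^sub>F N in sequentially.
      (\<integral>\<^sup>+x. ennreal (tuple_sum (2 * Suc k) N (far_windows (A N) s k) x) \<partial>D N)
        \<le> ennreal ((2 * r N)\<^sup>2 * ((limit_moment s k)\<^sup>2 + e) + (2 * s ^ k * (2 * d * (s ^ k * Cb))) * r N)"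
      using B_bound B_conv[OF m(2) e1] eventually_ge_at_top[of "2 * m"]
    proof eventually_elim
      case (elim N)
      have N: "1 \<le> N" using elim(3) m by simp
      note [measurable] = window_borel[OF N] B_meas[OF m(2) elim(3)] far_windows_borel[OF N, of s k, folded m_def]
      let ?w = "\<lambda>t. ennreal (window (A N) s k t)"
      let ?b = "\<lambda>y v. indicator {y - d..y + d} v :: ennreal"
      have wm[measurable]: "?w \<in> borel_measurable (\<Lambda> {..<m})" unfolding m_def by measurable
      have Wm[measurable]: "(\<lambda>t. ennreal (W m t)) \<in> borel_measurable (\<Lambda> {..<m})" by measurable
      have km: "(\<lambda>t. t k) \<in> borel_measurable (\<Lambda> {..<m})"
        using measurable_component_singleton[of k "{..<m}" "\<lambda>_. lborel"] by (auto simp: m_def)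
      note km[measurable]
      (* The three summands: anchors within d, the factorised limit, and the error of convergence
         and clustering. *)
      have pt: "ennreal (far_windows (A N) s k (concat_tuples m t u)) * ennreal (B N (2 * m) (concat_tuples m t u)) \<le>
         ?w t * (?w u * ?b (t k) (u k) * ennreal Cb) + (?w t * ennreal (W m t)) * (?w u * ennreal (W m u)) + ?w t * (?w u * ennreal (2 * e1))"
        for t u
      proof (cases "far_windows (A N) s k (concat_tuples m t u) = 0")
        case False
        have wt: "window (A N) s k t \<noteq> 0" and wu: "window (A N) s k u \<noteq> 0"
          and far1: "far_windows (A N) s k (concat_tuples m t u) = 1"
          using False unfolding m_def far_windows_concat by (auto simp: window_def split: if_splits)
        have w1: "?w t = 1" "?w u = 1" using wt wu by (simp_all add: window_def split: if_splits)
        have tA: "\<forall>i\<le>k. t i \<in> A N" "\<forall>i<k. t k \<le> t i \<and> t i \<le> t k + s"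
          using wt by (auto simp: window_def le_less split: if_splits)
        have uA: "\<forall>i\<le>k. u i \<in> A N" "\<forall>i<k. u k \<le> u i \<and> u i \<le> u k + s"
          using wu by (auto simp: window_def le_less split: if_splits)
        have cA: "\<forall>i<2 * m. concat_tuples m t u i \<in> A N"
          using tA(1) uA(1) by (auto simp: concat_tuples_def m_def)
        show ?thesis
        proof (cases "\<bar>t k - u k\<bar> \<le> d")
          case True
          then have b1: "?b (t k) (u k) = 1" by (auto simp: abs_le_iff)
          have "B N (2 * m) (concat_tuples m t u) \<le> Cb"
            unfolding Cb_def using elim(1)[rule_format, of "2 * m" "concat_tuples m t u"] cA elim(3) m by auto
          then have "ennreal (B N (2 * m) (concat_tuples m t u)) \<le> ennreal Cb" by (rule ennreal_leI)
          then show ?thesis unfolding w1 far1 b1 by (simp add: add_increasing2)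
        next
          case False
          have "B N (2 * m) (concat_tuples m t u) \<le> W (2 * m) (concat_tuples m t u) + e1"
            using elim(2)[rule_format, of "concat_tuples m t u"] cA by (auto simp: abs_le_iff)
          also have "\<dots> \<le> W m t * W m u + 2 * e1"
            using d(2)[OF tA(2) uA(2)] False by (auto simp: abs_le_iff)
          finally have "ennreal (B N (2 * m) (concat_tuples m t u)) \<le> ennreal (W m t * W m u + 2 * e1)" by (rule ennreal_leI)
          also have "\<dots> = ennreal (W m t) * ennreal (W m u) + ennreal (2 * e1)"
            using W_bounds(1)[OF m(1)] e1 by (simp add: ennreal_plus ennreal_mult del: ennreal_plus_if)
          finally show ?thesis unfolding w1 far1 by (simp add: add_increasing add.assoc)
        qed
      qed simp
      have iw: "(\<integral>\<^sup>+t. ?w t \<partial>\<Lambda> {..<m}) \<le> ennreal (2 * r N * s ^ k)"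
        using window_mass[OF N s, of 1 k] by (simp add: m_def)
      have iW: "(\<integral>\<^sup>+t. ?w t * ennreal (W m t) \<partial>\<Lambda> {..<m}) \<le> ennreal (2 * r N * G)"
      proof -
        have "(\<integral>\<^sup>+t. ?w t * 1 * ennreal (W (Suc k) t) \<partial>\<Lambda> {..<Suc k}) \<le> (\<integral>\<^sup>+y. indicator (A N) y * 1 \<partial>lborel) * shape s k"
          using N by (intro window_integral_le W_inv) auto
        also have "\<dots> = ennreal (2 * r N * G)"
          using N s r_pos[OF N] G by (simp add: shape_eq emeasure_A G_def ennreal_mult)
        finally show ?thesis by (simp add: m_def)
      qed
      have ib: "(\<integral>\<^sup>+u. ?w u * ?b y (u k) * ennreal Cb \<partial>\<Lambda> {..<m}) \<le> ennreal (2 * d * (s ^ k * Cb))" for y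
      proof -
        have "(\<integral>\<^sup>+u. ?w u * ?b y (u k) * ennreal Cb \<partial>\<Lambda> {..<Suc k}) \<le>
            (\<integral>\<^sup>+v. indicator (A N) v * ?b y v \<partial>lborel) * shape_integral s k (\<lambda>_. ennreal Cb)"
          using N by (intro window_integral_le) auto
        also have "\<dots> \<le> (\<integral>\<^sup>+v. ?b y v \<partial>lborel) * shape_integral s k (\<lambda>_. ennreal Cb)"
          by (intro mult_right_mono nn_integral_mono) (auto simp: indicator_def)
        also have "\<dots> = ennreal (2 * d * (s ^ k * Cb))"
          using s d(1) Cb by (simp add: shape_integral_const flip: ennreal_mult)
        finally show ?thesis by (simp add: m_def)
      qed
      have "(\<integral>\<^sup>+x. ennreal (tuple_sum (2 * m) N (far_windows (A N) s k) x) \<partial>D N) =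
         (\<integral>\<^sup>+t. ennreal (far_windows (A N) s k t) * ennreal (B N (2 * m) t) \<partial>\<Lambda> {..<2 * m})"
        using m elim(3) by (subst tuple_sum_ennreal) (auto simp: far_windows_nonneg intro!: correlation)
      also have "\<dots> = (\<integral>\<^sup>+t. (\<integral>\<^sup>+u. ennreal (far_windows (A N) s k (concat_tuples m t u)) * ennreal (B N (2 * m) (concat_tuples m t u))
           \<partial>\<Lambda> {..<m}) \<partial>\<Lambda> {..<m})"
        by (rule nn_integral_product_concat) measurable
      also have "\<dots> \<le> (\<integral>\<^sup>+t. (\<integral>\<^sup>+u. ?w t * (?w u * ?b (t k) (u k) * ennreal Cb) +
           (?w t * ennreal (W m t)) * (?w u * ennreal (W m u)) + ?w t * (?w u * ennreal (2 * e1)) \<partial>\<Lambda> {..<m}) \<partial>\<Lambda> {..<m})"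
        by (intro nn_integral_mono pt)
      also have "\<dots> = (\<integral>\<^sup>+t. ?w t * (\<integral>\<^sup>+u. ?w u * ?b (t k) (u k) * ennreal Cb \<partial>\<Lambda> {..<m}) +
           (?w t * ennreal (W m t)) * (\<integral>\<^sup>+u. ?w u * ennreal (W m u) \<partial>\<Lambda> {..<m}) +
           ?w t * ((\<integral>\<^sup>+u. ?w u \<partial>\<Lambda> {..<m}) * ennreal (2 * e1)) \<partial>\<Lambda> {..<m})"
        by (intro nn_integral_cong) (simp add: nn_integral_add nn_integral_cmult nn_integral_multc)
      also have "\<dots> \<le> (\<integral>\<^sup>+t. ?w t * ennreal (2 * d * (s ^ k * Cb)) +
           (?w t * ennreal (W m t)) * ennreal (2 * r N * G) +
           ?w t * (ennreal (2 * r N * s ^ k) * ennreal (2 * e1)) \<partial>\<Lambda> {..<m})"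
        by (intro nn_integral_mono add_mono mult_left_mono mult_right_mono iw iW ib) auto
      also have "\<dots> = (\<integral>\<^sup>+t. ?w t \<partial>\<Lambda> {..<m}) * ennreal (2 * d * (s ^ k * Cb)) +
           (\<integral>\<^sup>+t. ?w t * ennreal (W m t) \<partial>\<Lambda> {..<m}) * ennreal (2 * r N * G) +
           (\<integral>\<^sup>+t. ?w t \<partial>\<Lambda> {..<m}) * (ennreal (2 * r N * s ^ k) * ennreal (2 * e1))"
        by (simp add: nn_integral_add nn_integral_multc)
      also have "\<dots> \<le> ennreal (2 * r N * s ^ k) * ennreal (2 * d * (s ^ k * Cb)) +
           ennreal (2 * r N * G) * ennreal (2 * r N * G) +
           ennreal (2 * r N * s ^ k) * (ennreal (2 * r N * s ^ k) * ennreal (2 * e1))"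
        by (intro add_mono mult_right_mono iw iW) auto
      also have "\<dots> = ennreal (2 * r N * s ^ k * (2 * d * (s ^ k * Cb)) + 2 * r N * G * (2 * r N * G) +
           2 * r N * s ^ k * (2 * r N * s ^ k * (2 * e1)))"
      proof -
        have "ennreal a * ennreal b + ennreal c * ennreal c + ennreal a * (ennreal a * ennreal d) = ennreal (a * b + c * c + a * (a * d))"
          if "0 \<le> a" "0 \<le> b" "0 \<le> c" "0 \<le> d" for a b c d
          using that by (simp add: ennreal_mult)
        from this[of "2 * r N * s ^ k" "2 * d * (s ^ k * Cb)" "2 * r N * G" "2 * e1"]
        show ?thesis using s d(1) Cb G e1 r_pos[OF N] by simp
      qed
      also have "\<dots> \<le> ennreal ((2 * r N)\<^sup>2 * (G\<^sup>2 + e) + (2 * s ^ k * (2 * d * (s ^ k * Cb))) * r N)"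
      proof (rule ennreal_leI)
        have "(2 * r N)\<^sup>2 * (2 * e1 * (s ^ k)\<^sup>2) \<le> (2 * r N)\<^sup>2 * e" using e1e by (intro mult_left_mono) auto
        then show "2 * r N * s ^ k * (2 * d * (s ^ k * Cb)) + 2 * r N * G * (2 * r N * G) +
           2 * r N * s ^ k * (2 * r N * s ^ k * (2 * e1)) \<le> (2 * r N)\<^sup>2 * (G\<^sup>2 + e) + (2 * s ^ k * (2 * d * (s ^ k * Cb))) * r N"
          by (simp add: power2_eq_square algebra_simps)
      qed
      finally show ?case by (simp add: m_def G_def)
    qed
  qed
qed

lemma followers_count_eq:
  "real (card (followers S N s x i)) = (\<Sum>j<N. if j \<noteq> i \<and> x j \<in> S \<and> x i \<le> x j \<and> x j \<le> x i + s then 1 else 0)"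
proof -
  have "followers S N s x i = {j \<in> {..<N}. j \<noteq> i \<and> x j \<in> S \<and> x i \<le> x j \<and> x j \<le> x i + s}"
    by (auto simp: followers_def)
  then show ?thesis by (simp add: sum.If_cases Int_def)
qed

lemma followers_measurable:
  assumes N: "1 \<le> N" and i: "i < N"
  shows "(\<lambda>x. card (followers (A N) N s x i)) \<in> measurable (D N) (count_space UNIV)"
proof -
  have "(\<lambda>x. real (card (followers (A N) N s x i))) \<in> borel_measurable (D N)"
    unfolding followers_count_eq
  proof (intro borel_measurable_sum)
    fix j assume "j \<in> {..<N}"
    then have j: "(\<lambda>x. x j) \<in> borel_measurable (D N)" by (auto intro: coord_measurable)
    have ind: "(\<lambda>v. indicator S v :: real) \<in> borel_measurable borel" if "S \<in> sets borel" for S :: "real set"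
      using that by measurable
    have "(\<lambda>x. of_bool (j \<noteq> i) * (indicator (A N) (x j) * indicator {0..s} (x j - x i)) :: real) \<in> borel_measurable (D N)"
      using A_borel[OF N]
      by (intro borel_measurable_times measurable_const measurable_compose[OF _ ind] borel_measurable_diff j
          coord_measurable[OF i]) auto
    also have "(\<lambda>x. of_bool (j \<noteq> i) * (indicator (A N) (x j) * indicator {0..s} (x j - x i)) :: real) =
        (\<lambda>x. if j \<noteq> i \<and> x j \<in> A N \<and> x i \<le> x j \<and> x j \<le> x i + s then 1 else 0)"
      by (auto simp: fun_eq_iff indicator_def)
    finally show "(\<lambda>x. if j \<noteq> i \<and> x j \<in> A N \<and> x i \<le> x j \<and> x j \<le> x i + s then 1 else 0 :: real) \<in> borel_measurable (D N)" .
  qed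
  then have "(\<lambda>x. nat \<lfloor>real (card (followers (A N) N s x i))\<rfloor>) \<in> measurable (D N) (count_space UNIV)"
    by measurable
  then show ?thesis by simp
qed

lemma points_sum_measurable:
  assumes N: "1 \<le> N"
  shows "(\<lambda>x. \<Sum>i\<in>points_in (A N) N x. f (card (followers (A N) N s x i)) :: real) \<in> borel_measurable (D N)"
proof -
  have eq: "(\<Sum>i\<in>points_in (A N) N x. f (card (followers (A N) N s x i))) =
      (\<Sum>i<N. if x i \<in> A N then f (card (followers (A N) N s x i)) else 0)" for x
    by (subst sum.inter_filter[symmetric]) (auto simp: points_in_def intro!: sum.cong)
  show ?thesis unfolding eq
  proof (intro borel_measurable_sum)
    fix i assume "i \<in> {..<N}"
    then have i: "i < N" by simp
    have [measurable]: "(\<lambda>x. f (card (followers (A N) N s x i))) \<in> borel_measurable (D N)"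
      by (rule measurable_compose[OF followers_measurable[OF N i]]) simp
    have [measurable]: "{x \<in> space (D N). x i \<in> A N} \<in> sets (D N)"
      using measurable_sets[OF coord_measurable[OF i] A_borel[OF N]] by (simp add: vimage_def Int_def conj_commute)
    show "(\<lambda>x. if x i \<in> A N then f (card (followers (A N) N s x i)) else 0) \<in> borel_measurable (D N)"
      by measurable
  qed
qed

text \<open>
  \<open>square_le\<close> in expectation. The base \<open>q\<close> is chosen such that the exponential moment for followers at
  distance \<open>3 * s\<close> is finite; it dominates the power \<open>2 * k + 1\<close>.
\<close>

lemma second_moment_le:
  assumes s: "0 \<le> s" and e: "0 < e"
  shows "\<exists>K\<ge>0. \<forall>\<^sub>F N in sequentially.
    (\<integral>\<^sup>+x. ennreal ((total N s k x)\<^sup>2) \<partial>D N) \<le> ennreal ((2 * r N)\<^sup>2 * ((limit_moment s k)\<^sup>2 + e) + K * r N)"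
proof -
  define w where "w = 3 * s + 1"
  define q where "q = 1 + 1 / (2 * C * w)"
  have w: "0 < w" "3 * s \<le> w" using s by (simp_all add: w_def)
  have q: "1 < q" using C_pos w by (simp add: q_def)
  have "(q - 1) * C * (3 * s) \<le> (q - 1) * C * w" using q C_pos w by (intro mult_left_mono) auto
  also have "\<dots> = 1 / 2" using C_pos w by (simp add: q_def)
  finally have q2: "(q - 1) * C * (3 * s) \<le> 1 / 2" .
  obtain K0 where K0: "0 < K0" "\<And>n::nat. (1 + real n) ^ (2 * k + 1) \<le> K0 * q ^ n"
    using power_le_exponential[OF q] by blast
  obtain K1 where K1: "0 \<le> K1" "\<forall>\<^sub>F N in sequentially.
    (\<integral>\<^sup>+x. ennreal (tuple_sum (2 * Suc k) N (far_windows (A N) s k) x) \<partial>D N)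
      \<le> ennreal ((2 * r N)\<^sup>2 * ((limit_moment s k)\<^sup>2 + e) + K1 * r N)"
    using expectation_far_le[OF s e] by blast
  show ?thesis
  proof (intro exI[of _ "K1 + 2 * K0 * (8 * C)"] conjI)
    show "0 \<le> K1 + 2 * K0 * (8 * C)" using K0 K1 C_pos by simp
    have s3: "0 \<le> 3 * s" using s by simp
    show "\<forall>\<^sub>F N in sequentially. (\<integral>\<^sup>+x. ennreal ((total N s k x)\<^sup>2) \<partial>D N)
      \<le> ennreal ((2 * r N)\<^sup>2 * ((limit_moment s k)\<^sup>2 + e) + (K1 + 2 * K0 * (8 * C)) * r N)"
      using K1(2) exponential_moment[OF s3 q q2] eventually_ge_at_top[of 1]
    proof eventually_elim
      case (elim N)
      let ?far = "\<lambda>x. tuple_sum (2 * Suc k) N (far_windows (A N) s k) x"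
      let ?near = "\<lambda>x. \<Sum>i\<in>points_in (A N) N x. q ^ card (followers (A N) N (3 * s) x i)"
      have [measurable]: "?far \<in> borel_measurable (D N)"
        unfolding tuple_sum_def measurable_D
      proof (intro borel_measurable_sum)
        fix j assume j: "j \<in> inj_tuples (2 * Suc k) {..<N}"
        have "(\<lambda>x. \<lambda>i\<in>{..<2 * Suc k}. x (j i)) \<in> measurable (\<Lambda> {..<N}) (\<Lambda> {..<2 * Suc k})"
          using j by (intro measurable_restrict measurable_component_singleton) (auto simp: inj_tuples_def PiE_def Pi_iff)
        then show "(\<lambda>x. far_windows (A N) s k (\<lambda>i\<in>{..<2 * Suc k}. x (j i))) \<in> borel_measurable (\<Lambda> {..<N})"
          by (rule measurable_compose[OF _ far_windows_borel[OF elim(3)]])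
      qed
      have near_measurable[measurable]: "?near \<in> borel_measurable (D N)"
        by (rule points_sum_measurable[OF elim(3)])
      have far0: "0 \<le> ?far x" for x by (simp add: tuple_sum_def sum_nonneg far_windows_nonneg)
      have near0: "0 \<le> ?near x" for x using q by (simp add: sum_nonneg)
      have pt: "(total N s k x)\<^sup>2 \<le> ?far x + 2 * K0 * ?near x" for x
      proof -
        have "(total N s k x)\<^sup>2 \<le> ?far x + 2 * (\<Sum>i\<in>points_in (A N) N x. (1 + real (card (followers (A N) N (3 * s) x i))) ^ (2 * k + 1))"
          unfolding total_eq by (rule square_le[OF s])
        also have "\<dots> \<le> ?far x + 2 * (\<Sum>i\<in>points_in (A N) N x. K0 * q ^ card (followers (A N) N (3 * s) x i))"
          by (intro add_left_mono mult_left_mono sum_mono K0(2)) auto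
        also have "\<dots> = ?far x + 2 * K0 * ?near x" by (simp add: sum_distrib_left mult.assoc)
        finally show ?thesis .
      qed
      have "(\<integral>\<^sup>+x. ennreal ((total N s k x)\<^sup>2) \<partial>D N) \<le> (\<integral>\<^sup>+x. ennreal (?far x) + ennreal (2 * K0) * ennreal (?near x) \<partial>D N)"
        using far0 near0 K0(1) by (intro nn_integral_mono order_trans[OF ennreal_leI[OF pt]]) (simp add: ennreal_plus ennreal_mult)
      also have "\<dots> = (\<integral>\<^sup>+x. ennreal (?far x) \<partial>D N) + (\<integral>\<^sup>+x. ennreal (2 * K0) * ennreal (?near x) \<partial>D N)"
        by (rule nn_integral_add) measurable
      also have "(\<integral>\<^sup>+x. ennreal (2 * K0) * ennreal (?near x) \<partial>D N) = ennreal (2 * K0) * (\<integral>\<^sup>+x. ennreal (?near x) \<partial>D N)"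
        by (rule nn_integral_cmult) measurable
      also have "(\<integral>\<^sup>+x. ennreal (?far x) \<partial>D N) + ennreal (2 * K0) * (\<integral>\<^sup>+x. ennreal (?near x) \<partial>D N) \<le>
          ennreal ((2 * r N)\<^sup>2 * ((limit_moment s k)\<^sup>2 + e) + K1 * r N) + ennreal (2 * K0) * ennreal (8 * C * r N)"
        using elim by (intro add_mono mult_left_mono) auto
      also have "\<dots> = ennreal ((2 * r N)\<^sup>2 * ((limit_moment s k)\<^sup>2 + e) + K1 * r N + 2 * K0 * (8 * C * r N))"
      proof -
        have "ennreal p + ennreal a * ennreal b = ennreal (p + a * b)" if "0 \<le> p" "0 \<le> a" "0 \<le> b" for p a b
          using that by (simp add: ennreal_mult)
        then show ?thesis using K0(1) K1(1) C_pos r_pos[OF elim(3)] e by simp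
      qed
      finally show ?case by (simp add: algebra_simps)
    qed
  qed
qed

text \<open>
  An upper bound for the second moment and a lower bound for the first one: with
  \<open>T = total N s k / (2 * r N)\<close> and \<open>G\<close> its limit, \<open>(T - G)\<^sup>2 + 2 * G * T = T\<^sup>2 + G\<^sup>2\<close>.
\<close>

lemma variance_small:
  assumes s: "0 \<le> s" and \<eta>: "0 < \<eta>"
  shows "\<forall>\<^sub>F N in sequentially.
    (\<integral>\<^sup>+x. ennreal ((total N s k x / (2 * r N) - limit_moment s k)\<^sup>2) \<partial>D N) \<le> ennreal \<eta>"
proof -
  define G where "G = limit_moment s k"
  have G: "0 \<le> G" by (simp add: G_def limit_moment_nonneg)
  define v where "v = 1 + 2 * G * s ^ k"
  define e where "e = \<eta> / (2 * v)"
  have den: "0 < v" using G s by (simp add: v_def add_pos_nonneg)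
  have e: "0 < e" using \<eta> den by (simp add: e_def)
  have e2: "e + 2 * G * (e * s ^ k) = \<eta> / 2"
  proof -
    have "e + 2 * G * (e * s ^ k) = e * v" by (simp add: v_def algebra_simps)
    also have "\<dots> = \<eta> / 2" using den by (simp add: e_def)
    finally show ?thesis .
  qed
  obtain K where K: "0 \<le> K" "\<forall>\<^sub>F N in sequentially.
    (\<integral>\<^sup>+x. ennreal ((total N s k x)\<^sup>2) \<partial>D N) \<le> ennreal ((2 * r N)\<^sup>2 * (G\<^sup>2 + e) + K * r N)"
    using second_moment_le[OF s e] unfolding G_def by blast
  have k1: "1 \<le> Suc k" by simp
  have "\<forall>\<^sub>F N in sequentially. (K / 4 + s * G\<^sup>2) * (2 / \<eta>) < r N"
    using r_lim by (auto simp: filterlim_at_top_dense)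
  with K(2) B_conv[OF k1 e] eventually_ge_at_top[of "Suc k"] prob show ?thesis
    unfolding G_def[symmetric]
  proof eventually_elim
    case (elim N)
    then interpret prob_space "D N" by simp
    have N: "1 \<le> N" using elim(3) by simp
    note rp = r_pos[OF N]
    note [measurable] = total_measurable[OF N] window_borel[OF N] B_meas[OF _ elim(3), simplified]
    let ?w = "\<lambda>t. ennreal (window (A N) s k t)"
    let ?ET = "\<integral>\<^sup>+x. ennreal (total N s k x) \<partial>D N"
    have conv: "\<And>t. (\<forall>i<Suc k. t i \<in> A N) \<Longrightarrow> \<bar>B N (Suc k) t - W (Suc k) t\<bar> \<le> e"
      using elim(2) by blast
    have "ennreal (2 * r N - s) * ennreal G \<le> (\<integral>\<^sup>+t. ?w t * ennreal (W (Suc k) t) \<partial>\<Lambda> {..<Suc k})"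
      unfolding G_def shape_eq[OF s, symmetric] using A_sub(1)[OF N] N s
      by (intro window_integral_ge W_inv) auto
    also have "\<dots> \<le> (\<integral>\<^sup>+t. ?w t * ennreal (B N (Suc k) t) + ?w t * ennreal e \<partial>\<Lambda> {..<Suc k})"
    proof (rule nn_integral_mono)
      fix t
      show "?w t * ennreal (W (Suc k) t) \<le> ?w t * ennreal (B N (Suc k) t) + ?w t * ennreal e"
      proof (cases "window (A N) s k t = 0")
        case False
        then have "\<forall>i<Suc k. t i \<in> A N" by (auto simp: window_def less_Suc_eq split: if_splits)
        then have "W (Suc k) t \<le> B N (Suc k) t + e" using conv[of t] by (auto simp: abs_le_iff)
        then have "ennreal (W (Suc k) t) \<le> ennreal (B N (Suc k) t) + ennreal e"
          using e B_nonneg[of "Suc k" N t] elim(3) by (simp flip: ennreal_plus)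
        then show ?thesis by (simp add: mult_left_mono flip: distrib_left)
      qed simp
    qed
    also have "\<dots> = ?ET + (\<integral>\<^sup>+t. ?w t * ennreal e \<partial>\<Lambda> {..<Suc k})"
      unfolding expectation_total[OF N elim(3)] by (rule nn_integral_add) auto
    also have "\<dots> \<le> ?ET + ennreal (2 * r N * s ^ k * e)"
      using e by (intro add_left_mono window_mass N s) auto
    (* Finiteness of the first moment is not available yet, so subtraction is postponed. *)
    finally have low: "ennreal ((2 * r N - s) * G) \<le> ?ET + ennreal (2 * r N * s ^ k * e)"
      using G by (cases "s \<le> 2 * r N") (simp_all add: ennreal_mult ennreal_neg mult_nonpos_nonneg)
    let ?a = "((2 * r N - s) * G - 2 * r N * s ^ k * e)"
    have low': "ennreal ?a \<le> ?ET"
    proof (cases "?ET = \<infinity>")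
      case False
      then obtain y where y: "0 \<le> y" "?ET = ennreal y" by (cases ?ET) auto
      have "0 \<le> 2 * r N * s ^ k * e" using rp s e by simp
      then have "ennreal ((2 * r N - s) * G) \<le> ennreal (y + 2 * r N * s ^ k * e)" using low y by simp
      then have "?a \<le> y \<or> (2 * r N - s) * G \<le> 0" using y(1) by (auto simp: ennreal_le_iff2)
      then have "?a \<le> y" using \<open>0 \<le> 2 * r N * s ^ k * e\<close> y(1) by linarith
      then show ?thesis using y by (simp add: ennreal_leI)
    qed simp
    have "(\<integral>\<^sup>+x. ennreal ((total N s k x / (2 * r N) - G)\<^sup>2) \<partial>D N) + ennreal (G / r N) * ?ET =
       (\<integral>\<^sup>+x. ennreal ((total N s k x / (2 * r N) - G)\<^sup>2) + ennreal (G / r N) * ennreal (total N s k x) \<partial>D N)"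
      by (simp add: nn_integral_add nn_integral_cmult)
    also have "\<dots> = (\<integral>\<^sup>+x. ennreal (1 / (2 * r N)\<^sup>2) * ennreal ((total N s k x)\<^sup>2) + ennreal (G\<^sup>2) \<partial>D N)"
    proof (rule nn_integral_cong)
      fix x
      have "(total N s k x / (2 * r N) - G)\<^sup>2 + G / r N * total N s k x = 1 / (2 * r N)\<^sup>2 * (total N s k x)\<^sup>2 + G\<^sup>2"
        using rp by (simp add: power2_eq_square field_simps)
      then have "ennreal ((total N s k x / (2 * r N) - G)\<^sup>2 + G / r N * total N s k x) = ennreal (1 / (2 * r N)\<^sup>2 * (total N s k x)\<^sup>2 + G\<^sup>2)"
        by simp
      then show "ennreal ((total N s k x / (2 * r N) - G)\<^sup>2) + ennreal (G / r N) * ennreal (total N s k x) =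
        ennreal (1 / (2 * r N)\<^sup>2) * ennreal ((total N s k x)\<^sup>2) + ennreal (G\<^sup>2)"
        using rp G total_nonneg[of N s k x] by (simp add: ennreal_mult' flip: ennreal_plus ennreal_mult)
    qed
    also have "\<dots> = ennreal (1 / (2 * r N)\<^sup>2) * (\<integral>\<^sup>+x. ennreal ((total N s k x)\<^sup>2) \<partial>D N) + ennreal (G\<^sup>2)"
      by (simp add: nn_integral_add nn_integral_cmult emeasure_space_1)
    also have "\<dots> \<le> ennreal (1 / (2 * r N)\<^sup>2) * ennreal ((2 * r N)\<^sup>2 * (G\<^sup>2 + e) + K * r N) + ennreal (G\<^sup>2)"
      using elim(1) by (intro add_right_mono mult_left_mono) auto
    also have "\<dots> = ennreal (1 / (2 * r N)\<^sup>2 * ((2 * r N)\<^sup>2 * (G\<^sup>2 + e) + K * r N) + G\<^sup>2)"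
      using rp e K(1) by (simp add: ennreal_mult' flip: ennreal_plus ennreal_mult)
    finally have up: "(\<integral>\<^sup>+x. ennreal ((total N s k x / (2 * r N) - G)\<^sup>2) \<partial>D N) + ennreal (G / r N) * ?ET
        \<le> ennreal (1 / (2 * r N)\<^sup>2 * ((2 * r N)\<^sup>2 * (G\<^sup>2 + e) + K * r N) + G\<^sup>2)" .
    have "ennreal (G / r N * ?a) \<le> ennreal (G / r N) * ?ET"
      using G rp low' by (subst ennreal_mult') (auto intro: mult_left_mono)
    with up have "(\<integral>\<^sup>+x. ennreal ((total N s k x / (2 * r N) - G)\<^sup>2) \<partial>D N) + ennreal (G / r N * ?a)
        \<le> ennreal (1 / (2 * r N)\<^sup>2 * ((2 * r N)\<^sup>2 * (G\<^sup>2 + e) + K * r N) + G\<^sup>2)"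
      by (meson add_left_mono order_trans)
    then have "(\<integral>\<^sup>+x. ennreal ((total N s k x / (2 * r N) - G)\<^sup>2) \<partial>D N)
        \<le> ennreal (1 / (2 * r N)\<^sup>2 * ((2 * r N)\<^sup>2 * (G\<^sup>2 + e) + K * r N) + G\<^sup>2 - G / r N * ?a)"
      by (rule ennreal_le_diff)
    also have "\<dots> \<le> ennreal \<eta>"
    proof (rule ennreal_leI)
      have "1 / (2 * r N)\<^sup>2 * ((2 * r N)\<^sup>2 * (G\<^sup>2 + e) + K * r N) + G\<^sup>2 - G / r N * ?a =
          (e + 2 * G * (e * s ^ k)) + (K / 4 + s * G\<^sup>2) / r N"
        using rp by (simp add: power2_eq_square field_simps)
      also have "\<dots> \<le> \<eta> / 2 + \<eta> / 2"
        using elim(5) \<eta> rp unfolding e2 by (intro add_left_mono) (simp add: field_simps)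
      finally show "1 / (2 * r N)\<^sup>2 * ((2 * r N)\<^sup>2 * (G\<^sup>2 + e) + K * r N) + G\<^sup>2 - G / r N * ?a \<le> \<eta>" by simp
    qed
    finally show ?case .
  qed
qed

end

section \<open>The limiting gap distribution\<close>

definition gap_fraction :: "real set \<Rightarrow> nat \<Rightarrow> real \<Rightarrow> real \<Rightarrow> (nat \<Rightarrow> real) \<Rightarrow> real" where
  "gap_fraction S N L s x =
     real (card {i. Suc i < N \<and> x i \<in> S \<and> x (Suc i) \<in> S \<and> x (Suc i) - x i \<le> s}) / L"

text \<open>
  Inequalities between random variables pass to limits in mean: integrate \<open>a - b \<le> (a - X) + (Y - b)\<close>.
\<close>

lemma mean_limit_mono:
  assumes prob: "\<forall>\<^sub>F N in sequentially. prob_space (D N)"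
    and X: "mean_null D (\<lambda>N x. X N x - a)" and Y: "mean_null D (\<lambda>N x. Y N x - b)"
    and le: "\<forall>\<^sub>F N in sequentially. AE x in D N. X N x \<le> Y N x"
    and [measurable]: "\<And>N. X N \<in> borel_measurable (D N)" "\<And>N. Y N \<in> borel_measurable (D N)"
  shows "a \<le> b"
proof (rule field_le_epsilon)
  fix e :: real assume "0 < e"
  then have "0 < e / 2" by simp
  then have "\<forall>\<^sub>F N in sequentially. (\<integral>\<^sup>+x. ennreal \<bar>X N x - a\<bar> \<partial>D N) \<le> ennreal (e / 2)"
    "\<forall>\<^sub>F N in sequentially. (\<integral>\<^sup>+x. ennreal \<bar>Y N x - b\<bar> \<partial>D N) \<le> ennreal (e / 2)"
    using X Y by (auto simp: mean_null_def)
  with prob le have "\<forall>\<^sub>F N in sequentially. a \<le> b + e"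
  proof eventually_elim
    case (elim N)
    then interpret prob_space "D N" by simp
    have "ennreal (a - b) = (\<integral>\<^sup>+x. ennreal (a - b) \<partial>D N)" by (simp add: emeasure_space_1)
    also have "\<dots> \<le> (\<integral>\<^sup>+x. ennreal \<bar>X N x - a\<bar> + ennreal \<bar>Y N x - b\<bar> \<partial>D N)"
      using elim(2) by (intro nn_integral_mono_AE) (auto elim!: eventually_mono intro!: ennreal_leI simp flip: ennreal_plus)
    also have "\<dots> = (\<integral>\<^sup>+x. ennreal \<bar>X N x - a\<bar> \<partial>D N) + (\<integral>\<^sup>+x. ennreal \<bar>Y N x - b\<bar> \<partial>D N)"
      by (rule nn_integral_add) auto
    also have "\<dots> \<le> ennreal (e / 2) + ennreal (e / 2)" using elim by (intro add_mono) auto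
    also have "\<dots> = ennreal e" using \<open>0 < e\<close> by (simp flip: ennreal_plus)
    finally show ?case using \<open>0 < e\<close> by (auto simp: ennreal_le_iff2)
  qed
  then show "a \<le> b + e" by (auto dest: eventually_happens)
qed

text \<open>
  Points without followers are more than \<open>s\<close> apart, so there is at most one of them in each cell of
  length \<open>s\<close>.
\<close>

lemma isolated_points_le:
  assumes s: "0 < s" and S: "S \<subseteq> {- \<rho>..\<rho>}" and \<rho>: "0 \<le> \<rho>"
  shows "real (occupation S N s x 0) \<le> 2 * \<rho> / s + 1"
proof -
  let ?E = "{i \<in> points_in S N x. card (followers S N s x i) = 0}"
  let ?f = "\<lambda>i. \<lfloor>(x i + \<rho>) / s\<rfloor>"
  have far: "x i + s < x j" if "i \<in> ?E" "j \<in> ?E" "i \<noteq> j" "x i \<le> x j" for i j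
    using that by (force simp: followers_def points_in_def)
  have "inj_on ?f ?E"
  proof (rule inj_onI, rule ccontr)
    fix i j assume ij: "i \<in> ?E" "j \<in> ?E" "?f i = ?f j" "i \<noteq> j"
    have *: False if "x i + s < x j" "?f i = ?f j" for i j
    proof -
      have "(x i + \<rho>) / s + 1 < (x j + \<rho>) / s"
        using divide_strict_right_mono[of "x i + \<rho> + s" "x j + \<rho>" s] that(1) s by (simp add: add_divide_distrib)
      then have "?f i + 1 \<le> ?f j" by linarith
      then show False using that(2) by simp
    qed
    show False
      using far[of i j] far[of j i] ij *[of i j] *[of j i] by fastforce
  qed
  moreover have "?f ` ?E \<subseteq> {0..\<lfloor>2 * \<rho> / s\<rfloor>}"
  proof clarify
    fix i assume "i \<in> points_in S N x"
    then have "- \<rho> \<le> x i" "x i \<le> \<rho>" using S by (auto simp: points_in_def)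
    then have "0 \<le> (x i + \<rho>) / s" "(x i + \<rho>) / s \<le> 2 * \<rho> / s" using s by (auto intro!: divide_right_mono)
    then show "?f i \<in> {0..\<lfloor>2 * \<rho> / s\<rfloor>}" by (auto intro: floor_mono)
  qed
  ultimately have "card ?E \<le> card {0..\<lfloor>2 * \<rho> / s\<rfloor>}" by (intro card_inj_on_le) auto
  also have "\<dots> = nat (\<lfloor>2 * \<rho> / s\<rfloor> + 1)" by simp
  finally have "real (card ?E) \<le> real_of_int (\<lfloor>2 * \<rho> / s\<rfloor> + 1)"
    using s \<rho> by (simp add: le_nat_iff)
  also have "\<dots> \<le> 2 * \<rho> / s + 1" by simp
  finally show ?thesis by (simp add: occupation_def)
qed

text \<open>
  If a point has a follower, then the next point is one, too. It lies in \<open>S\<close> because \<open>S\<close> is an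
  interval up to its end points.
\<close>

lemma consecutive_iff_followers:
  assumes x: "strict_mono_on {..<N} x" and S: "{- \<rho><..<\<rho>} \<subseteq> S" "S \<subseteq> {- \<rho>..\<rho>}"
  shows "{i. Suc i < N \<and> x i \<in> S \<and> x (Suc i) \<in> S \<and> x (Suc i) - x i \<le> s} =
     {i \<in> points_in S N x. card (followers S N s x i) \<noteq> 0}"
proof (intro Set.set_eqI iffI)
  fix i assume "i \<in> {i. Suc i < N \<and> x i \<in> S \<and> x (Suc i) \<in> S \<and> x (Suc i) - x i \<le> s}"
  then have i: "Suc i < N" "x i \<in> S" "x (Suc i) \<in> S" "x (Suc i) - x i \<le> s" by auto
  then have "x i < x (Suc i)" by (intro strict_mono_onD[OF x]) auto
  then have "Suc i \<in> followers S N s x i" using i by (auto simp: followers_def)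
  then show "i \<in> {i \<in> points_in S N x. card (followers S N s x i) \<noteq> 0}"
    using i by (auto simp: points_in_def)
next
  fix i assume "i \<in> {i \<in> points_in S N x. card (followers S N s x i) \<noteq> 0}"
  then have i: "i < N" "x i \<in> S" "followers S N s x i \<noteq> {}" by (auto simp: points_in_def)
  then obtain j where j: "j < N" "j \<noteq> i" "x j \<in> S" "x i \<le> x j" "x j \<le> x i + s"
    by (auto simp: followers_def)
  have ij: "i < j"
  proof (rule ccontr)
    assume "\<not> i < j"
    then have "x j < x i" using j i by (intro strict_mono_onD[OF x]) auto
    then show False using j by simp
  qed
  have lt: "x i < x (Suc i)" using ij j by (intro strict_mono_onD[OF x]) auto
  have le: "x (Suc i) \<le> x j"
  proof (cases "Suc i = j")
    case False
    then have "x (Suc i) < x j" using ij j by (intro strict_mono_onD[OF x]) auto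
    then show ?thesis by simp
  qed simp
  have "x (Suc i) \<in> S"
  proof (cases "x (Suc i) = x j")
    case False
    then have "x (Suc i) \<in> {- \<rho><..<\<rho>}" using lt le i(2) j(3) S(2) by force
    then show ?thesis using S(1) by blast
  qed (use j in simp)
  then show "i \<in> {i. Suc i < N \<and> x i \<in> S \<and> x (Suc i) \<in> S \<and> x (Suc i) - x i \<le> s}"
    using i ij j lt le by auto
qed

lemma gap_fraction_eq:
  assumes "strict_mono_on {..<N} x" "{- \<rho><..<\<rho>} \<subseteq> S" "S \<subseteq> {- \<rho>..\<rho>}"
  shows "gap_fraction S N L s x = real (card (points_in S N x)) / L - real (occupation S N s x 0) / L"
proof -
  have "points_in S N x = {i \<in> points_in S N x. card (followers S N s x i) \<noteq> 0} \<union> {i \<in> points_in S N x. card (followers S N s x i) = 0}"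
    by auto
  then have "card (points_in S N x) = card {i \<in> points_in S N x. card (followers S N s x i) \<noteq> 0} + occupation S N s x 0"
    unfolding occupation_def by (subst card_Un_disjoint[symmetric]) auto
  then show ?thesis
    unfolding gap_fraction_def consecutive_iff_followers[OF assms] by (simp add: diff_divide_distrib[symmetric])
qed

lemma gap_fraction_mono: "0 \<le> L \<Longrightarrow> s \<le> s' \<Longrightarrow> gap_fraction S N L s x \<le> gap_fraction S N L s' x"
  unfolding gap_fraction_def
  by (intro divide_right_mono of_nat_mono card_mono) (auto intro: finite_subset[of _ "{..<N}"])

lemma gap_fraction_nonneg: "0 \<le> L \<Longrightarrow> 0 \<le> gap_fraction S N L s x"
  by (simp add: gap_fraction_def)

lemma gap_fraction_le_points: "0 \<le> L \<Longrightarrow> gap_fraction S N L s x \<le> real (card (points_in S N x)) / L"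
  unfolding gap_fraction_def by (intro divide_right_mono of_nat_mono card_mono) (auto simp: points_in_def)

text \<open>
  A point that has a follower within \<open>s'\<close> but none within \<open>s\<close> gains at least one follower. So the increment of the
  gap fraction is bounded by that of the first factorial moment, whose limit is easy to control.
\<close>

lemma gap_increment_le:
  assumes "strict_mono_on {..<N} x" "{- \<rho><..<\<rho>} \<subseteq> S" "S \<subseteq> {- \<rho>..\<rho>}" "0 \<le> L" "s \<le> s'"
  shows "gap_fraction S N L s' x + (\<Sum>i\<in>points_in S N x. real (card (followers S N s x i))) / L \<le>
    gap_fraction S N L s x + (\<Sum>i\<in>points_in S N x. real (card (followers S N s' x i))) / L"
proof -
  have g: "real (card {i \<in> points_in S N x. card (followers S N u x i) \<noteq> 0}) =
      (\<Sum>i\<in>points_in S N x. of_bool (card (followers S N u x i) \<noteq> 0))" for u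
    by (simp add: of_bool_def sum.If_cases Int_def)
  have "of_bool (card (followers S N s' x i) \<noteq> 0) + real (card (followers S N s x i)) \<le>
      of_bool (card (followers S N s x i) \<noteq> 0) + real (card (followers S N s' x i))" for i
  proof -
    have "card (followers S N s x i) \<le> card (followers S N s' x i)"
      using assms(5) by (intro card_mono) (auto simp: followers_def)
    moreover have "of_bool (b \<noteq> 0) + real a \<le> of_bool (a \<noteq> 0) + real b" if "a \<le> b" for a b :: nat
      using that by (cases a; cases b) auto
    ultimately show ?thesis by blast
  qed
  then have "(\<Sum>i\<in>points_in S N x. of_bool (card (followers S N s' x i) \<noteq> 0) + real (card (followers S N s x i))) \<le>
    (\<Sum>i\<in>points_in S N x. of_bool (card (followers S N s x i) \<noteq> 0) + real (card (followers S N s' x i)))"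
    by (rule sum_mono)
  then show ?thesis
    unfolding gap_fraction_def consecutive_iff_followers[OF assms(1-3)] g
    using assms(4) by (simp add: sum.distrib add_divide_distrib[symmetric] divide_right_mono)
qed

context clustering_process
begin

definition occ :: "real \<Rightarrow> nat \<Rightarrow> (nat \<Rightarrow> real) \<Rightarrow> nat \<Rightarrow> real" where
  "occ s N x n = real (occupation (A N) N s x n) / (2 * r N)"

lemma occ_nonneg: "0 \<le> occ s N x n"
  using r_pos[of N] by (cases "1 \<le> N") (auto simp: occ_def occupation_def points_in_def)

lemma sum_occ: "(\<Sum>n\<le>N. occ s N x n * f n) = (\<Sum>i\<in>points_in (A N) N x. f (card (followers (A N) N s x i))) / (2 * r N)"
  by (simp add: occ_def sum_divide_distrib[symmetric] sum_occupation[symmetric])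

lemma points_sum_measurable': "(\<lambda>x. (\<Sum>i\<in>points_in (A N) N x. f (card (followers (A N) N s x i)) :: real) / L) \<in> borel_measurable (D N)"
proof (cases "1 \<le> N")
  case True
  show ?thesis by (intro borel_measurable_divide points_sum_measurable True measurable_const) auto
next
  case False
  then show ?thesis by (simp add: points_in_def)
qed

lemma occ_measurable: "(\<lambda>x. occ s N x n) \<in> borel_measurable (D N)"
proof -
  have "occ s N x n = (\<Sum>i\<in>points_in (A N) N x. (\<lambda>m. if m = n then 1 else 0) (card (followers (A N) N s x i))) / (2 * r N)" for x
    by (simp add: occ_def occupation_def sum.If_cases Int_def)
  then show ?thesis
    using points_sum_measurable'[where N = N and f = "\<lambda>m. if m = n then 1 else 0" and s = s and L = "2 * r N"] by simp
qed

lemma total_fraction_eq: "total N s k x / (2 * r N) / fact k = (\<Sum>n\<le>N. occ s N x n * real (n choose k))"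
  by (simp add: sum_occ total_def sum_distrib_left[symmetric])

lemma total_fraction_measurable: "(\<lambda>x. total N s k x / (2 * r N)) \<in> borel_measurable (D N)"
  unfolding total_def using points_sum_measurable'[where N = N and f = "\<lambda>n. real (fact k * (n choose k))" and s = s and L = "2 * r N"] by simp

lemma total_limit:
  assumes s: "0 \<le> s"
  shows "mean_null D (\<lambda>N x. total N s k x / (2 * r N) - limit_moment s k)"
  unfolding mean_null_def
proof (intro allI impI)
  fix e :: real assume e: "0 < e"
  then have "0 < (e / 2)\<^sup>2" by simp
  from variance_small[OF s this, of k] prob
  show "\<forall>\<^sub>F N in sequentially. (\<integral>\<^sup>+x. ennreal \<bar>total N s k x / (2 * r N) - limit_moment s k\<bar> \<partial>D N) \<le> ennreal e"
  proof eventually_elim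
    case (elim N)
    then interpret prob_space "D N" by simp
    note [measurable] = total_fraction_measurable[of N s k]
    let ?Z = "\<lambda>x. total N s k x / (2 * r N) - limit_moment s k"
    have am: "\<bar>z\<bar> \<le> e / 2 + 2 / e * z\<^sup>2" for z :: real
    proof (cases "\<bar>z\<bar> \<le> e / 2")
      case True
      then show ?thesis using e by (simp add: add_increasing2)
    next
      case False
      then have "e / 2 * \<bar>z\<bar> \<le> \<bar>z\<bar> * \<bar>z\<bar>" by (intro mult_right_mono) auto
      then have "\<bar>z\<bar> \<le> 2 / e * z\<^sup>2" using e by (simp add: field_simps power2_eq_square)
      then show ?thesis using e by simp
    qed
    have "(\<integral>\<^sup>+x. ennreal \<bar>?Z x\<bar> \<partial>D N) \<le> (\<integral>\<^sup>+x. ennreal (e / 2) + ennreal (2 / e) * ennreal ((?Z x)\<^sup>2) \<partial>D N)"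
      using e by (intro nn_integral_mono order_trans[OF ennreal_leI[OF am]]) (simp add: ennreal_mult[symmetric] flip: ennreal_plus)
    also have "\<dots> = ennreal (e / 2) + ennreal (2 / e) * (\<integral>\<^sup>+x. ennreal ((?Z x)\<^sup>2) \<partial>D N)"
      by (simp add: nn_integral_add nn_integral_cmult emeasure_space_1)
    also have "\<dots> \<le> ennreal (e / 2) + ennreal (2 / e) * ennreal ((e / 2)\<^sup>2)"
      using elim by (intro add_left_mono mult_left_mono) auto
    also have "\<dots> = ennreal (e / 2 + 2 / e * (e / 2)\<^sup>2)" using e by (simp add: ennreal_mult[symmetric] flip: ennreal_plus)
    also have "e / 2 + 2 / e * (e / 2)\<^sup>2 = e" using e by (simp add: power2_eq_square)
    finally show ?case .
  qed
qed

text \<open>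
  This is where the probabilistic part meets \<open>determined_empty\<close>: dividing \<open>total\<close> by \<open>fact k\<close> turns
  falling factorials into binomial coefficients.
\<close>

lemma occupation_data_occ:
  assumes s: "0 \<le> s" and q: "1 < q" "(q - 1) * C * s \<le> 1 / 2"
  shows "occupation_data q (\<lambda>k. limit_moment s k / fact k) D (occ s)"
  unfolding occupation_data_def
proof (intro conjI allI)
  show "(\<lambda>x. occ s N x n) \<in> borel_measurable (D N)" for N n by (rule occ_measurable)
  show "0 \<le> occ s N x n" for N x n by (rule occ_nonneg)
  show "\<forall>\<^sub>F N in sequentially. prob_space (D N)" by (rule prob)
  show "mean_null D (\<lambda>N x. (\<Sum>n\<le>N. occ s N x n * real (n choose k)) - limit_moment s k / fact k)" for k
  proof -
    have "mean_null D (\<lambda>N x. 1 / fact k * (total N s k x / (2 * r N) - limit_moment s k))"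
      by (intro mean_null_cmult total_limit s borel_measurable_diff total_fraction_measurable measurable_const) auto
    then show ?thesis unfolding total_fraction_eq[symmetric] by (simp add: diff_divide_distrib)
  qed
  show "\<exists>B::real. \<forall>\<^sub>F N in sequentially. (\<integral>\<^sup>+x. ennreal (\<Sum>n\<le>N. occ s N x n * q ^ n) \<partial>D N) \<le> ennreal B"
  proof
    show "\<forall>\<^sub>F N in sequentially. (\<integral>\<^sup>+x. ennreal (\<Sum>n\<le>N. occ s N x n * q ^ n) \<partial>D N) \<le> ennreal (4 * C)"
      using exponential_moment[OF s q] eventually_ge_at_top[of 1]
    proof eventually_elim
      case (elim N)
      note rp = r_pos[OF elim(2)]
      have [measurable]: "(\<lambda>x. \<Sum>i\<in>points_in (A N) N x. q ^ card (followers (A N) N s x i)) \<in> borel_measurable (D N)"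
        by (rule points_sum_measurable[OF elim(2)])
      have "(\<integral>\<^sup>+x. ennreal (\<Sum>n\<le>N. occ s N x n * q ^ n) \<partial>D N) =
        (\<integral>\<^sup>+x. ennreal (1 / (2 * r N)) * ennreal (\<Sum>i\<in>points_in (A N) N x. q ^ card (followers (A N) N s x i)) \<partial>D N)"
        unfolding sum_occ using rp q by (intro nn_integral_cong) (simp add: sum_nonneg flip: ennreal_mult)
      also have "\<dots> = ennreal (1 / (2 * r N)) * (\<integral>\<^sup>+x. ennreal (\<Sum>i\<in>points_in (A N) N x. q ^ card (followers (A N) N s x i)) \<partial>D N)"
        by (rule nn_integral_cmult) measurable
      also have "\<dots> \<le> ennreal (1 / (2 * r N)) * ennreal (8 * C * r N)"
        using elim(1) by (intro mult_left_mono) auto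
      also have "\<dots> = ennreal (1 / (2 * r N) * (8 * C * r N))"
        using rp C_pos by (intro ennreal_mult[symmetric]) auto
      also have "1 / (2 * r N) * (8 * C * r N) = 4 * C" using rp by simp
      finally show ?case .
    qed
  qed
qed

lemma limit_moment_0: assumes "0 \<le> s" shows "limit_moment s 0 = 1"
proof -
  have "shape s 0 = shape_integral s 0 (\<lambda>_. 1)" using W_one by simp
  also have "\<dots> = 1" using shape_integral_const[of s 0 1] assms by simp
  finally show ?thesis by (simp add: limit_moment_def)
qed

text \<open>
  The first moment is the integral of the two-point function over \<open>[0, s]\<close>, and the two-point function
  is bounded by \<open>2 * C\<^sup>2\<close>.
\<close>

lemma limit_moment_1_lipschitz:
  assumes s: "0 \<le> s" "s \<le> s'"
  shows "limit_moment s' 1 \<le> limit_moment s 1 + 2 * C\<^sup>2 * (s' - s)"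
proof -
  let ?h = "\<lambda>z :: nat \<Rightarrow> real. ennreal (W (Suc 1) (z(1 := 0)))"
  have "(\<lambda>z. z(1 := 0)) \<in> measurable (\<Lambda> {..<1}) (\<Lambda> (insert 1 {..<1}))" by measurable
  from measurable_compose[OF this] W_meas[of "Suc 1"]
  have "(\<lambda>z. W (Suc 1) (z(1 := 0))) \<in> borel_measurable (\<Lambda> {..<1})"
    by (simp add: lessThan_Suc)
  then have [measurable]: "?h \<in> borel_measurable (\<Lambda> {..<1})" by measurable
  have "(\<lambda>z. z 0) \<in> measurable (\<Lambda> {..<1}) lborel"
    by (rule measurable_component_singleton) simp
  then have [measurable]: "(\<lambda>z. z 0) \<in> borel_measurable (\<Lambda> {..<1})" by simp
  have W2: "?h z \<le> ennreal (2 * C\<^sup>2)" for z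
    using W_bounds(2)[of "Suc 1" "z(1 := 0)"] by (intro ennreal_leI) (simp add: power2_eq_square mult.commute)
  have "shape s' 1 = (\<integral>\<^sup>+z. indicator {0..s'} (z 0) * ?h z \<partial>\<Lambda> {..<1})"
    unfolding shape_integral_def by (intro nn_integral_cong) (auto simp: indicator_def)
  also have "\<dots> \<le> (\<integral>\<^sup>+z. indicator {0..s} (z 0) * ?h z + indicator {s..s'} (z 0) * ennreal (2 * C\<^sup>2) \<partial>\<Lambda> {..<1})"
    using s W2 by (intro nn_integral_mono) (auto simp: indicator_def)
  also have "\<dots> = (\<integral>\<^sup>+z. indicator {0..s} (z 0) * ?h z \<partial>\<Lambda> {..<1}) + (\<integral>\<^sup>+z. indicator {s..s'} (z 0) \<partial>\<Lambda> {..<1}) * ennreal (2 * C\<^sup>2)"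
  proof -
    have 1: "(\<lambda>z. indicator {0..s} (z 0) * ?h z) \<in> borel_measurable (\<Lambda> {..<1})" by measurable
    have 2: "(\<lambda>z. indicator {s..s'} (z 0) :: ennreal) \<in> borel_measurable (\<Lambda> {..<1})" by measurable
    have 3: "(\<lambda>z. indicator {s..s'} (z 0) * ennreal (2 * C\<^sup>2)) \<in> borel_measurable (\<Lambda> {..<1})" by measurable
    show ?thesis unfolding nn_integral_add[OF 1 3] nn_integral_multc[OF 2] ..
  qed
  also have "(\<integral>\<^sup>+z. indicator {0..s} (z 0) * ?h z \<partial>\<Lambda> {..<1}) = shape s 1"
    unfolding shape_integral_def by (intro nn_integral_cong) (auto simp: indicator_def)
  also have "(\<integral>\<^sup>+z. indicator {s..s'} (z 0) \<partial>\<Lambda> {..<1}) = (\<integral>\<^sup>+v. indicator {s..s'} v \<partial>(lborel :: real measure))"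
    using lborel_product.product_nn_integral_singleton[of "indicator {s..s'}" 0] by (simp add: lessThan_Suc)
  also have "\<dots> = ennreal (s' - s)" using s by simp
  also have "shape s 1 + ennreal (s' - s) * ennreal (2 * C\<^sup>2) = ennreal (limit_moment s 1 + 2 * C\<^sup>2 * (s' - s))"
    using s limit_moment_nonneg by (simp add: shape_eq ennreal_mult[symmetric] mult_ac flip: ennreal_plus)
  finally have "ennreal (limit_moment s' 1) \<le> ennreal (limit_moment s 1 + 2 * C\<^sup>2 * (s' - s))"
    using s shape_eq[of s' 1] by simp
  moreover have "0 \<le> limit_moment s 1 + 2 * C\<^sup>2 * (s' - s)"
    using s limit_moment_nonneg[of s 1] by simp
  ultimately show ?thesis by (simp only: ennreal_le_iff)
qed

text \<open>
  The gap fraction written in terms of the number of points and of the points without followers. The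
  two agree for increasing configurations; the measurability of this version is immediate.
\<close>

definition gapf :: "real \<Rightarrow> nat \<Rightarrow> (nat \<Rightarrow> real) \<Rightarrow> real" where
  "gapf s N x = total N 0 0 x / (2 * r N) - occ s N x 0"

lemma total_0: "total N s 0 x = real (card (points_in (A N) N x))"
  by (simp add: total_def)

lemma gap_fraction_AE:
  assumes N: "1 \<le> N"
  shows "AE x in D N. strict_mono_on {..<N} x \<and> (\<forall>s. gap_fraction (A N) N (2 * r N) s x = gapf s N x)"
  using increasing[OF N]
proof eventually_elim
  case (elim x)
  then show ?case
    using gap_fraction_eq[OF elim A_sub[OF N]] by (simp add: gapf_def occ_def total_0)
qed

lemma gapf_measurable [measurable]: "gapf s N \<in> borel_measurable (D N)"
  unfolding gapf_def[abs_def] by (intro borel_measurable_diff total_fraction_measurable occ_measurable)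

lemma points_limit: "mean_null D (\<lambda>N x. total N 0 0 x / (2 * r N) - 1)"
  using total_limit[of 0 0] limit_moment_0[of 0] by simp

lemma gapf_limit:
  assumes "mean_null D (\<lambda>N x. occ s N x 0 - c)"
  shows "mean_null D (\<lambda>N x. gapf s N x - (1 - c))"
proof -
  have [measurable]: "(\<lambda>x. occ s N x 0) \<in> borel_measurable (D N)" "(\<lambda>x. total N 0 0 x / (2 * r N)) \<in> borel_measurable (D N)" for N
    by (intro occ_measurable total_fraction_measurable)+
  have "mean_null D (\<lambda>N x. (total N 0 0 x / (2 * r N) - 1) + - 1 * (occ s N x 0 - c))"
    by (intro mean_null_add mean_null_cmult points_limit assms) measurable
  then show ?thesis by (simp add: gapf_def algebra_simps)
qed

text \<open>
  Properties of a limit \<open>F\<close> of the gap fractions that make it a continuous distribution function on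
  the positive half line.
\<close>

context
  fixes F :: "real \<Rightarrow> real"
  assumes lim: "\<And>s. 0 \<le> s \<Longrightarrow> mean_null D (\<lambda>N x. gapf s N x - F s)"
begin

lemma limit_mono:
  assumes s: "0 \<le> s" "s \<le> s'" shows "F s \<le> F s'"
proof (rule mean_limit_mono[OF prob lim lim])
  show "\<forall>\<^sub>F N in sequentially. AE x in D N. gapf s N x \<le> gapf s' N x"
    using eventually_ge_at_top[of 1]
  proof eventually_elim
    case (elim N)
    show ?case using gap_fraction_AE[OF elim]
    proof eventually_elim
      case (elim x)
      then show ?case using gap_fraction_mono[of "2 * r N" s s' "A N" N x] s(2) r_pos[OF \<open>1 \<le> N\<close>] by simp
    qed
  qed
qed (use s in auto)

lemma limit_nonneg:
  assumes s: "0 \<le> s" shows "0 \<le> F s"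
proof (rule mean_limit_mono[OF prob _ lim[OF s], where X = "\<lambda>_ _. 0"])
  show "mean_null D (\<lambda>N x. 0 - 0)" by (simp add: mean_null_def)
  show "\<forall>\<^sub>F N in sequentially. AE x in D N. 0 \<le> gapf s N x"
    using eventually_ge_at_top[of 1]
  proof eventually_elim
    case (elim N)
    show ?case using gap_fraction_AE[OF elim]
    proof eventually_elim
      case (elim x)
      then show ?case using gap_fraction_nonneg[of "2 * r N" "A N" N s x] r_pos[OF \<open>1 \<le> N\<close>] by simp
    qed
  qed
qed auto

lemma limit_le_1:
  assumes s: "0 \<le> s" shows "F s \<le> 1"
proof (rule mean_limit_mono[OF prob lim[OF s] points_limit])
  show "\<forall>\<^sub>F N in sequentially. AE x in D N. gapf s N x \<le> total N 0 0 x / (2 * r N)"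
    using occ_nonneg by (simp add: gapf_def)
  show "(\<lambda>x. total N 0 0 x / (2 * r N)) \<in> borel_measurable (D N)" for N
    by (rule total_fraction_measurable)
qed auto

lemma limit_lipschitz:
  assumes s: "0 \<le> s" "s \<le> s'" shows "F s' \<le> F s + 2 * C\<^sup>2 * (s' - s)"
proof -
  note [measurable] = total_fraction_measurable
  have s': "0 \<le> s'" using s by simp
  have "F s' + limit_moment s 1 \<le> F s + limit_moment s' 1"
  proof (rule mean_limit_mono[OF prob])
    show "mean_null D (\<lambda>N x. (gapf s' N x + total N s 1 x / (2 * r N)) - (F s' + limit_moment s 1))"
    proof -
      have "mean_null D (\<lambda>N x. (gapf s' N x - F s') + (total N s 1 x / (2 * r N) - limit_moment s 1))"
        by (intro mean_null_add lim total_limit s s' borel_measurable_diff total_fraction_measurable gapf_measurable measurable_const) auto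
      then show ?thesis by (simp add: algebra_simps)
    qed
    show "mean_null D (\<lambda>N x. (gapf s N x + total N s' 1 x / (2 * r N)) - (F s + limit_moment s' 1))"
    proof -
      have "mean_null D (\<lambda>N x. (gapf s N x - F s) + (total N s' 1 x / (2 * r N) - limit_moment s' 1))"
        by (intro mean_null_add lim total_limit s s' borel_measurable_diff total_fraction_measurable gapf_measurable measurable_const) auto
      then show ?thesis by (simp add: algebra_simps)
    qed
    show "\<forall>\<^sub>F N in sequentially. AE x in D N. gapf s' N x + total N s 1 x / (2 * r N) \<le> gapf s N x + total N s' 1 x / (2 * r N)"
      using eventually_ge_at_top[of 1]
    proof eventually_elim
      case (elim N)
      note N = elim
      show ?case using gap_fraction_AE[OF N]
      proof eventually_elim
        case (elim x)
        then show ?case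
          using gap_increment_le[OF _ A_sub[OF N] _ s(2), where N = N and x = x and L = "2 * r N"] r_pos[OF N] by (simp add: total_def)
      qed
    qed
    show "(\<lambda>x. gapf s' N x + total N s 1 x / (2 * r N)) \<in> borel_measurable (D N)"
      "(\<lambda>x. gapf s N x + total N s' 1 x / (2 * r N)) \<in> borel_measurable (D N)" for N
      by (intro borel_measurable_add gapf_measurable total_fraction_measurable)+
  qed
  then show ?thesis using limit_moment_1_lipschitz[OF s] by simp
qed

lemma limit_at_0: "F 0 = 0"
proof -
  have "F 0 \<le> limit_moment 0 1"
  proof (rule mean_limit_mono[OF prob lim total_limit])
    show "\<forall>\<^sub>F N in sequentially. AE x in D N. gapf 0 N x \<le> total N 0 1 x / (2 * r N)"
      using eventually_ge_at_top[of 1]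
    proof eventually_elim
      case (elim N)
      note N = elim
      show ?case using gap_fraction_AE[OF N]
      proof eventually_elim
        case (elim x)
        have none: "{i. Suc i < N \<and> x i \<in> A N \<and> x (Suc i) \<in> A N \<and> x (Suc i) - x i \<le> 0} = {}"
        proof -
          have "x i < x (Suc i)" if "Suc i < N" for i using elim that by (intro strict_mono_onD[of "{..<N}" x]) auto
          then show ?thesis by force
        qed
        then have "gap_fraction (A N) N (2 * r N) 0 x = 0" unfolding gap_fraction_def none by simp
        then show ?case using elim total_nonneg[of N 0 1 x] r_pos[OF N] by simp
      qed
    qed
    show "(\<lambda>x. total N 0 1 x / (2 * r N)) \<in> borel_measurable (D N)" for N by (rule total_fraction_measurable)
  qed auto
  also have "limit_moment 0 1 = 0"
  proof -
    have "shape 0 1 \<le> shape_integral 0 1 (\<lambda>_. ennreal (C ^ Suc 1 * fact (Suc 1)))"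
      by (intro shape_integral_mono ennreal_leI W_bounds) auto
    then have "shape 0 1 \<le> 0" by (simp add: shape_integral_const)
    then show ?thesis by (simp add: limit_moment_def)
  qed
  finally show ?thesis using limit_nonneg[of 0] by simp
qed

text \<open>
  Points without followers within \<open>s\<close> make up at most \<open>2 / s\<close> of the expected number of points, as
  they are \<open>s\<close> apart.
\<close>

lemma limit_tail:
  assumes s: "0 < s" shows "1 - 2 / s \<le> F s"
proof -
  have "1 - F s \<le> 2 / s"
  proof (rule mean_limit_mono[OF prob, where X = "\<lambda>N x. occ s N x 0" and Y = "\<lambda>_ _. 2 / s"])
    note [measurable] = total_fraction_measurable
    have "mean_null D (\<lambda>N x. (total N 0 0 x / (2 * r N) - 1) + - 1 * (gapf s N x - F s))"
      using s by (intro mean_null_add mean_null_cmult points_limit lim borel_measurable_diff borel_measurable_times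
          total_fraction_measurable gapf_measurable measurable_const) auto
    then show "mean_null D (\<lambda>N x. occ s N x 0 - (1 - F s))" by (simp add: gapf_def algebra_simps)
    show "mean_null D (\<lambda>N x. 2 / s - 2 / s)" by (simp add: mean_null_def)
    have "\<forall>\<^sub>F N in sequentially. s < r N" using r_lim by (auto simp: filterlim_at_top_dense)
    then show "\<forall>\<^sub>F N in sequentially. AE x in D N. occ s N x 0 \<le> 2 / s"
      using eventually_ge_at_top[of 1]
    proof eventually_elim
      case (elim N)
      have "occ s N x 0 \<le> 2 / s" for x
      proof -
        have "real (occupation (A N) N s x 0) \<le> 2 * r N / s + 1"
          using isolated_points_le[OF s A_sub(2)[OF elim(2)], of N x] elim(1) s by simp
        also have "1 \<le> 2 * r N / s" using elim(1) s by simp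
        finally have "real (occupation (A N) N s x 0) \<le> 2 / s * (2 * r N)" by simp
        then show ?thesis unfolding occ_def using r_pos[OF elim(2)] by (subst pos_divide_le_eq) auto
      qed
      then show ?case by simp
    qed
    show "(\<lambda>x. occ s N x 0) \<in> borel_measurable (D N)" for N by (rule occ_measurable)
  qed auto
  then show ?thesis by simp
qed

text \<open>
  Both functions are monotone in \<open>s\<close> and \<open>F\<close> varies by at most \<open>e\<close> between neighbouring points of the grid
  \<open>j * \<delta>\<close>, so the discrepancy between two grid points is controlled at the grid points. Beyond the grid
  \<open>F\<close> is at least \<open>1 - e\<close> and the gap fraction is at most the normalised number of points.
\<close>

lemma sup_discrepancy_le:
  assumes N: "1 \<le> N" and \<delta>: "0 < \<delta>" "2 * C\<^sup>2 * \<delta> \<le> e" and J: "1 - e \<le> F (real J * \<delta>)"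
  shows "AE x in D N. (SUP s\<in>{0..}. ennreal \<bar>gap_fraction (A N) N (2 * r N) s x - F s\<bar>) \<le>
    (\<Sum>j\<le>J. ennreal \<bar>gapf (real j * \<delta>) N x - F (real j * \<delta>)\<bar>) +
    ennreal \<bar>total N 0 0 x / (2 * r N) - 1\<bar> + ennreal e"
  using gap_fraction_AE[OF N]
proof eventually_elim
  case (elim x)
  let ?g = "\<lambda>s. gap_fraction (A N) N (2 * r N) s x"
  let ?P = "total N 0 0 x / (2 * r N)"
  define \<Delta> where "\<Delta> = (\<Sum>j\<le>J. \<bar>gapf (real j * \<delta>) N x - F (real j * \<delta>)\<bar>)"
  have e: "0 \<le> e" using \<delta> by (smt (verit) mult_nonneg_nonneg zero_le_power2)
  have gm: "?g s \<le> ?g s'" if "s \<le> s'" for s s'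
    using that r_pos[OF N] by (intro gap_fraction_mono) auto
  have gP: "?g s \<le> ?P" for s
    using gap_fraction_le_points[of "2 * r N" "A N" N s x] r_pos[OF N] by (simp add: total_0)
  have D: "\<bar>?g (real j * \<delta>) - F (real j * \<delta>)\<bar> \<le> \<Delta>" if "j \<le> J" for j
  proof -
    have "\<bar>gapf (real j * \<delta>) N x - F (real j * \<delta>)\<bar> \<le> \<Delta>"
      unfolding \<Delta>_def using that by (intro member_le_sum) auto
    then show ?thesis using elim by simp
  qed
  have "\<bar>?g s - F s\<bar> \<le> \<Delta> + \<bar>?P - 1\<bar> + e" if s: "0 \<le> s" for s
  proof (cases "s < real J * \<delta>")
    case True
    define j where "j = nat \<lfloor>s / \<delta>\<rfloor>"
    have fl: "real j \<le> s / \<delta>" "s / \<delta> < real j + 1" unfolding j_def using s \<delta>(1) by (simp_all add: floor_le_iff)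
    have j: "real j * \<delta> \<le> s" "s \<le> real (Suc j) * \<delta>" using fl \<delta>(1) by (simp_all add: field_simps)
    have "real j * \<delta> < real J * \<delta>" using j(1) True by simp
    then have jJ: "Suc j \<le> J" using \<delta>(1) by simp
    have a1: "?g s \<le> ?g (real (Suc j) * \<delta>)" using j by (intro gm)
    have a2: "?g (real j * \<delta>) \<le> ?g s" using j by (intro gm)
    have F1: "F (real j * \<delta>) \<le> F s" using j \<delta>(1) by (intro limit_mono) auto
    have F2: "F s \<le> F (real (Suc j) * \<delta>)" using j s by (intro limit_mono) auto
    have F3: "F (real (Suc j) * \<delta>) \<le> F (real j * \<delta>) + e"
    proof -
      have "F (real (Suc j) * \<delta>) \<le> F (real j * \<delta>) + 2 * C\<^sup>2 * (real (Suc j) * \<delta> - real j * \<delta>)"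
        using \<delta>(1) by (intro limit_lipschitz) auto
      then show ?thesis using \<delta>(2) by (simp add: algebra_simps)
    qed
    show ?thesis using a1 a2 F1 F2 F3 D[OF Suc_leD[OF jJ]] D[OF jJ] abs_ge_zero[of "?P - 1"]
      unfolding abs_le_iff by linarith
  next
    case False
    have "0 \<le> real J * \<delta>" using \<delta>(1) by simp
    then have "F (real J * \<delta>) \<le> F s" using False by (intro limit_mono) auto
    moreover have "F s \<le> 1" using s by (rule limit_le_1)
    moreover have "?g (real J * \<delta>) \<le> ?g s" using False by (intro gm) auto
    moreover have "?g s \<le> ?P" by (rule gP)
    ultimately show ?thesis using J D[of J] by (auto simp: abs_le_iff)
  qed
  then have "(SUP s\<in>{0..}. ennreal \<bar>?g s - F s\<bar>) \<le> ennreal (\<Delta> + \<bar>?P - 1\<bar> + e)"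
    by (intro SUP_least ennreal_leI) auto
  also have "\<dots> = ennreal \<Delta> + ennreal \<bar>?P - 1\<bar> + ennreal e"
  proof -
    have "0 \<le> \<Delta>" by (simp add: \<Delta>_def sum_nonneg)
    then show ?thesis using e by simp
  qed
  also have "ennreal \<Delta> = (\<Sum>j\<le>J. ennreal \<bar>gapf (real j * \<delta>) N x - F (real j * \<delta>)\<bar>)"
    unfolding \<Delta>_def by (rule sum_ennreal[symmetric]) simp
  finally show ?case .
qed

lemma sup_discrepancy_limit:
  assumes e0: "0 < e0"
  shows "\<forall>\<^sub>F N in sequentially. \<exists>g\<in>borel_measurable (D N).
    (AE x in D N. (SUP s\<in>{0..}. ennreal \<bar>gap_fraction (A N) N (2 * r N) s x - F s\<bar>) \<le> g x) \<and>
    (\<integral>\<^sup>+x. g x \<partial>D N) \<le> ennreal e0"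
proof -
    define e where "e = e0 / 3"
    have e: "0 < e" using e0 by (simp add: e_def)
    define \<delta> where "\<delta> = e / (2 * C\<^sup>2)"
    have \<delta>: "0 < \<delta>" "2 * C\<^sup>2 * \<delta> \<le> e" using e C_pos by (simp_all add: \<delta>_def)
    obtain J :: nat where J0: "2 / (e * \<delta>) < real J" using reals_Archimedean2 by blast
    have Jp: "0 < real J * \<delta>" using J0 e \<delta> by (smt (verit) divide_nonneg_pos mult_pos_pos)
    have "2 / (real J * \<delta>) \<le> e" using J0 Jp e \<delta>(1) by (simp add: field_simps)
    then have J: "1 - e \<le> F (real J * \<delta>)" using limit_tail[OF Jp] by simp
    have "\<forall>\<^sub>F N in sequentially. \<forall>j\<in>{..J}. (\<integral>\<^sup>+x. ennreal \<bar>gapf (real j * \<delta>) N x - F (real j * \<delta>)\<bar> \<partial>D N) \<le> ennreal (e / real (Suc J))"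
    proof (rule eventually_ball_finite)
      show "\<forall>j\<in>{..J}. \<forall>\<^sub>F N in sequentially. (\<integral>\<^sup>+x. ennreal \<bar>gapf (real j * \<delta>) N x - F (real j * \<delta>)\<bar> \<partial>D N) \<le> ennreal (e / real (Suc J))"
      proof
        fix j
        have "0 < e / real (Suc J)" "0 \<le> real j * \<delta>" using e \<delta>(1) by simp_all
        then show "\<forall>\<^sub>F N in sequentially. (\<integral>\<^sup>+x. ennreal \<bar>gapf (real j * \<delta>) N x - F (real j * \<delta>)\<bar> \<partial>D N) \<le> ennreal (e / real (Suc J))"
          using lim[of "real j * \<delta>"] unfolding mean_null_def by blast
      qed
    qed simp
    moreover have "\<forall>\<^sub>F N in sequentially. (\<integral>\<^sup>+x. ennreal \<bar>total N 0 0 x / (2 * r N) - 1\<bar> \<partial>D N) \<le> ennreal e"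
      using points_limit e unfolding mean_null_def by blast
    ultimately show ?thesis using prob eventually_ge_at_top[of 1]
    proof eventually_elim
      case (elim N)
      interpret prob_space "D N" by (rule elim)
      have m1[measurable]: "(\<lambda>x. ennreal \<bar>gapf (real j * \<delta>) N x - F (real j * \<delta>)\<bar>) \<in> borel_measurable (D N)" for j
        by measurable
      have m2[measurable]: "(\<lambda>x. ennreal \<bar>total N 0 0 x / (2 * r N) - 1\<bar>) \<in> borel_measurable (D N)"
        using total_fraction_measurable[of N 0 0] by measurable
      let ?g = "\<lambda>x. (\<Sum>j\<le>J. ennreal \<bar>gapf (real j * \<delta>) N x - F (real j * \<delta>)\<bar>) +
          ennreal \<bar>total N 0 0 x / (2 * r N) - 1\<bar> + ennreal e"
      have "(\<integral>\<^sup>+x. ?g x \<partial>D N) = (\<integral>\<^sup>+x. (\<Sum>j\<le>J. ennreal \<bar>gapf (real j * \<delta>) N x - F (real j * \<delta>)\<bar>) +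
          ennreal \<bar>total N 0 0 x / (2 * r N) - 1\<bar> \<partial>D N) + (\<integral>\<^sup>+x. ennreal e \<partial>D N)"
        by (rule nn_integral_add) measurable
      also have "(\<integral>\<^sup>+x. (\<Sum>j\<le>J. ennreal \<bar>gapf (real j * \<delta>) N x - F (real j * \<delta>)\<bar>) +
          ennreal \<bar>total N 0 0 x / (2 * r N) - 1\<bar> \<partial>D N) =
          (\<integral>\<^sup>+x. (\<Sum>j\<le>J. ennreal \<bar>gapf (real j * \<delta>) N x - F (real j * \<delta>)\<bar>) \<partial>D N) +
          (\<integral>\<^sup>+x. ennreal \<bar>total N 0 0 x / (2 * r N) - 1\<bar> \<partial>D N)"
        by (rule nn_integral_add) measurable
      also have "(\<integral>\<^sup>+x. (\<Sum>j\<le>J. ennreal \<bar>gapf (real j * \<delta>) N x - F (real j * \<delta>)\<bar>) \<partial>D N) =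
          (\<Sum>j\<le>J. \<integral>\<^sup>+x. ennreal \<bar>gapf (real j * \<delta>) N x - F (real j * \<delta>)\<bar> \<partial>D N)"
        by (rule nn_integral_sum) measurable
      also have "(\<integral>\<^sup>+x. ennreal e \<partial>D N) = ennreal e" by (simp add: emeasure_space_1)
      also have "(\<Sum>j\<le>J. \<integral>\<^sup>+x. ennreal \<bar>gapf (real j * \<delta>) N x - F (real j * \<delta>)\<bar> \<partial>D N) +
          (\<integral>\<^sup>+x. ennreal \<bar>total N 0 0 x / (2 * r N) - 1\<bar> \<partial>D N) + ennreal e \<le>
          (\<Sum>j\<le>J. ennreal (e / real (Suc J))) + ennreal e + ennreal e"
        using elim by (intro add_mono sum_mono order_refl) auto
      also have "(\<Sum>j\<le>J. ennreal (e / real (Suc J))) = ennreal (\<Sum>j\<le>J. e / real (Suc J))"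
        using e by (intro sum_ennreal) simp
      also have "(\<Sum>j\<le>J. e / real (Suc J)) = e" by simp
      also have "ennreal e + ennreal e + ennreal e = ennreal e0" using e by (simp add: e_def flip: ennreal_plus)
      finally have int: "(\<integral>\<^sup>+x. ?g x \<partial>D N) \<le> ennreal e0" .
      show ?case
      proof (intro bexI[of _ ?g] conjI)
        show "AE x in D N. (SUP s\<in>{0..}. ennreal \<bar>gap_fraction (A N) N (2 * r N) s x - F s\<bar>) \<le> ?g x"
          by (intro sup_discrepancy_le \<delta> J elim)
        show "?g \<in> borel_measurable (D N)" by measurable
      qed (rule int)
    qed
qed

end

end

text \<open>
  The constant is chosen uniformly for all processes with the same limiting correlation functions.
  The base \<open>q\<close> tends to \<open>1\<close> as \<open>s\<close> grows, which is why the factorial moment series at \<open>1\<close> need not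
  reach \<open>0\<close> and analytic continuation is used.
\<close>

lemma isolated_fraction_converges:
  assumes s: "0 \<le> s"
  shows "\<exists>c. \<forall>B D A r. clustering_process B W D A r C \<longrightarrow>
    mean_null D (\<lambda>N x. clustering_process.occ A r s N x 0 - c)"
proof (cases "0 < C")
  case False
  then show ?thesis by (auto simp: clustering_process_def)
next
  case True
  define q where "q = 1 + 1 / (2 * C * (s + 1))"
  have q: "1 < q" using True s by (simp add: q_def)
  have "(q - 1) * C * s \<le> (q - 1) * C * (s + 1)" using True q by (intro mult_left_mono) auto
  also have "\<dots> = 1 / 2" using True s by (simp add: q_def)
  finally have q2: "(q - 1) * C * s \<le> 1 / 2" .
  let ?g = "\<lambda>k. clustering_process.limit_moment W s k / fact k"
  have "determined TYPE(nat \<Rightarrow> real) q ?g (\<lambda>n. if n = 0 then 1 else 0)"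
    by (rule determined_empty[OF q]) (auto simp: determined_def occupation_data_def)
  then obtain c where c: "\<And>D w. occupation_data q ?g (D :: nat \<Rightarrow> (nat \<Rightarrow> real) measure) w \<Longrightarrow>
     mean_null D (\<lambda>N x. (\<Sum>n\<le>N. w N x n * (if n = 0 then 1 else 0)) - c)"
    unfolding determined_def by blast
  show ?thesis
  proof (intro exI[of _ c] allI impI)
    fix B D A r assume "clustering_process B W D A r C"
    then interpret clustering_process B W D A r C .
    show "mean_null D (\<lambda>N x. occ s N x 0 - c)"
      using c[OF occupation_data_occ[OF s q q2]] by (simp add: if_distrib sum.delta cong: if_cong)
  qed
qed

text \<open>
  The measure depends on \<open>W\<close> and \<open>C\<close> only. Measurability of the supremum over \<open>s\<close> is avoided by an
  integrable majorant \<open>g\<close>. If there is no process at all with these data, any probability measure will do.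
\<close>

theorem gap_distribution_exists:
  "\<exists>\<mu> :: real measure. prob_space \<mu> \<and> sets \<mu> = sets borel \<and>
    (\<forall>B D A r. clustering_process B W D A r C \<longrightarrow>
      (\<forall>e>0. \<forall>\<^sub>F N in sequentially. \<exists>g\<in>borel_measurable (D N).
        (AE x in D N. (SUP s\<in>{0..}. ennreal \<bar>gap_fraction (A N) N (2 * r N) s x - measure \<mu> {0..s}\<bar>) \<le> g x) \<and>
        (\<integral>\<^sup>+x. g x \<partial>D N) \<le> ennreal e))"
proof (cases "\<exists>B D A r. clustering_process B W D A r C")
  case False
  have "prob_space (return borel (0 :: real))" by (rule prob_space_return) simp
  then show ?thesis using False by (intro exI[of _ "return borel 0"]) auto
next
  case True
  have "\<forall>s. \<exists>c. 0 \<le> s \<longrightarrow> (\<forall>B D A r. clustering_process B W D A r C \<longrightarrow>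
    mean_null D (\<lambda>N x. clustering_process.occ A r s N x 0 - c))"
    using isolated_fraction_converges by blast
  from choice[OF this] obtain c where c: "\<And>s B D A r. 0 \<le> s \<Longrightarrow> clustering_process B W D A r C \<Longrightarrow>
    mean_null D (\<lambda>N x. clustering_process.occ A r s N x 0 - c s)"
    by blast
  define F where "F s = (if s < 0 then 0 else 1 - c s)" for s
  have lim: "mean_null D (\<lambda>N x. clustering_process.gapf A r s N x - F s)"
    if p: "clustering_process B W D A r C" and s: "0 \<le> s" for B D A r s
    using clustering_process.gapf_limit[OF p c[OF s p]] s by (simp add: F_def)
  obtain B0 D0 A0 r0 where p0: "clustering_process B0 W D0 A0 r0 C" using True by blast
  note P = clustering_process.limit_mono[OF p0 lim[OF p0]] clustering_process.limit_nonneg[OF p0 lim[OF p0]]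
    clustering_process.limit_le_1[OF p0 lim[OF p0]] clustering_process.limit_lipschitz[OF p0 lim[OF p0]]
    clustering_process.limit_at_0[OF p0 lim[OF p0]] clustering_process.limit_tail[OF p0 lim[OF p0]]
  have C0: "0 < C" using p0 by (simp add: clustering_process_def)
  have neg: "F s = 0" if "s \<le> 0" for s using that P(5) by (cases "s = 0") (auto simp: F_def)
  have mono: "F s \<le> F t" if "s \<le> t" for s t
  proof (cases "0 \<le> s")
    case True then show ?thesis using P(1) that by blast
  next
    case False
    then show ?thesis using neg[of s] P(2)[of t] neg[of t] by (cases "0 \<le> t") auto
  qed
  have lip: "F t \<le> F s + 2 * C\<^sup>2 * (t - s)" if "s \<le> t" for s t
  proof (cases "0 \<le> s")
    case True then show ?thesis using P(4) that by blast
  next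
    case False
    have nn: "0 \<le> 2 * C\<^sup>2 * (t - s)" using that by simp
    show ?thesis
    proof (cases "0 \<le> t")
      case True
      have "F t \<le> F 0 + 2 * C\<^sup>2 * (t - 0)" by (rule P(4)) (use True in auto)
      also have "\<dots> \<le> 2 * C\<^sup>2 * (t - s)" using False P(5) by (auto intro!: mult_left_mono)
      finally show ?thesis using False neg[of s] by simp
    next
      case False
      then show ?thesis using neg[of t] neg[of s] that nn by simp
    qed
  qed
  have cont: "continuous (at_right a) F" for a
  proof -
    have "(F \<longlongrightarrow> F a) (at_right a)"
    proof (rule tendsto_sandwich)
      show "\<forall>\<^sub>F t in at_right a. F a \<le> F t" using mono by (auto simp: eventually_at_filter)
      show "\<forall>\<^sub>F t in at_right a. F t \<le> F a + 2 * C\<^sup>2 * (t - a)" using lip by (auto simp: eventually_at_filter)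
      show "((\<lambda>t. F a + 2 * C\<^sup>2 * (t - a)) \<longlongrightarrow> F a) (at_right a)"
        by (auto intro!: tendsto_eq_intros)
    qed auto
    then show ?thesis by (simp add: continuous_within)
  qed
  have bot: "(F \<longlongrightarrow> 0) at_bot"
    by (rule tendsto_eventually) (auto simp: eventually_at_bot_linorder intro!: exI[of _ 0] neg)
  have top: "(F \<longlongrightarrow> 1) at_top"
  proof (rule tendsto_sandwich)
    show "\<forall>\<^sub>F s in at_top. 1 - 2 / s \<le> F s" using eventually_gt_at_top[of 0] by eventually_elim (rule P(6))
    show "\<forall>\<^sub>F s in at_top. F s \<le> 1" using eventually_ge_at_top[of 0] by eventually_elim (rule P(3))
    show "((\<lambda>s :: real. 1 - 2 / s) \<longlongrightarrow> 1) at_top" by real_asymp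
  qed auto
  let ?\<mu> = "interval_measure F"
  interpret \<mu>: real_distribution ?\<mu>
    by (rule real_distribution_interval_measure[OF mono cont bot top])
  have Iic: "measure ?\<mu> {..s} = F s" for s
    by (rule measure_interval_measure_Iic[OF mono cont bot])
  have meas: "measure ?\<mu> {0..s} = F s" if "0 \<le> s" for s
  proof -
    have "measure ?\<mu> {..<0} \<le> measure ?\<mu> {..0}" by (intro \<mu>.finite_measure_mono) auto
    then have z: "measure ?\<mu> {..<0} = 0" using Iic[of 0] neg[of 0] measure_nonneg[of ?\<mu> "{..<0}"] by simp
    have "{..s} = {..<0} \<union> {0..s}" using that by auto
    then have "measure ?\<mu> {..s} = measure ?\<mu> {..<0} + measure ?\<mu> {0..s}"
      by (simp only:) (intro \<mu>.finite_measure_Union, auto)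
    then show ?thesis using z Iic[of s] by simp
  qed
  show ?thesis
  proof (intro exI[of _ ?\<mu>] conjI allI impI)
    show "prob_space ?\<mu>" by (rule \<mu>.prob_space_axioms)
    show "sets ?\<mu> = sets borel" by simp
    fix B D A r and e :: real assume p: "clustering_process B W D A r C" and e: "0 < e"
    have eq: "(SUP s\<in>{0..}. ennreal \<bar>gap_fraction (A N) N (2 * r N) s x - measure ?\<mu> {0..s}\<bar>) =
       (SUP s\<in>{0..}. ennreal \<bar>gap_fraction (A N) N (2 * r N) s x - F s\<bar>)" for N x
      by (rule SUP_cong) (auto simp: meas)
    show "\<forall>\<^sub>F N in sequentially. \<exists>g\<in>borel_measurable (D N).
        (AE x in D N. (SUP s\<in>{0..}. ennreal \<bar>gap_fraction (A N) N (2 * r N) s x - measure ?\<mu> {0..s}\<bar>) \<le> g x) \<and>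
        (\<integral>\<^sup>+x. g x \<partial>D N) \<le> ennreal e"
      unfolding eq by (rule clustering_process.sup_discrepancy_limit[OF p lim[OF p] e])
  qed
qed

section \<open>Pfaffians of block matrices\<close>

lemma inj_extends_to_permutation:
  fixes j :: "nat \<Rightarrow> nat"
  assumes "inj_on j {..<k}" "j ` {..<k} \<subseteq> {..<n}"
  shows "\<exists>p. p permutes {..<n} \<and> (\<forall>i<k. p i = j i)"
proof -
  have kn: "k \<le> n" using card_inj_on_le[OF assms] by simp
  have "card ({..<n} - {..<k}) = card ({..<n} - j ` {..<k})"
    using assms kn by (simp add: card_Diff_subset card_image)
  then obtain g where g: "bij_betw g ({..<n} - {..<k}) ({..<n} - j ` {..<k})"
    by (meson finite_Diff finite_lessThan finite_same_card_bij)
  define p where "p i = (if i < k then j i else if i < n then g i else i)" for i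
  have "bij_betw p {..<k} (j ` {..<k})"
    using assms(1) by (auto simp: p_def bij_betw_def inj_on_def)
  moreover have "bij_betw p ({..<n} - {..<k}) ({..<n} - j ` {..<k})"
    using g by (rule bij_betw_cong[THEN iffD1, rotated]) (auto simp: p_def)
  ultimately have "bij_betw p ({..<k} \<union> ({..<n} - {..<k})) (j ` {..<k} \<union> ({..<n} - j ` {..<k}))"
    by (rule bij_betw_combine) auto
  moreover have "{..<k} \<union> ({..<n} - {..<k}) = {..<n}" "j ` {..<k} \<union> ({..<n} - j ` {..<k}) = {..<n}"
    using kn assms(2) by auto
  ultimately have "bij_betw p {..<n} {..<n}" by simp
  then have "p permutes {..<n}" by (rule bij_imp_permutes) (use kn in \<open>auto simp: p_def\<close>)
  then show ?thesis by (intro exI[of _ p]) (auto simp: p_def)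
qed

text \<open>
  The Pfaffian up to the factor \<open>2 ^ k * fact k\<close>. A permutation \<open>p\<close> is read as the sequence of pairs
  \<open>(p (2 * i), p (2 * i + 1))\<close>.
\<close>

definition pfaffian_sum :: "nat \<Rightarrow> (nat \<Rightarrow> nat \<Rightarrow> real) \<Rightarrow> real" where
  "pfaffian_sum k f = (\<Sum>p | p permutes {..<2 * k}. of_int (sign p) * (\<Prod>i<k. f (p (2 * i)) (p (2 * i + 1))))"

definition crossing :: "nat \<Rightarrow> nat \<Rightarrow> (nat \<Rightarrow> nat) \<Rightarrow> nat set" where
  "crossing n b p = {i. i < n \<and> (p (2 * i) < b) \<noteq> (p (2 * i + 1) < b)}"

lemma sum_pairs: "(\<Sum>j<2 * n. g j) = (\<Sum>i<n. g (2 * i) + g (2 * i + 1))" for g :: "nat \<Rightarrow> 'a :: comm_monoid_add"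
  by (induction n) (simp_all add: add.assoc)

text \<open>
  The non-crossing pairs use up an even number of the \<open>2 * b\<close> low indices.
\<close>

lemma even_card_crossing:
  assumes p: "p permutes {..<2 * n}" and b: "b \<le> n"
  shows "even (card (crossing n (2 * b) p))"
proof -
  have "(\<Sum>j<2 * n. of_bool (p j < 2 * b) :: nat) = (\<Sum>j<2 * n. of_bool (j < 2 * b))"
    by (rule sum.permute[OF p, symmetric, unfolded o_def])
  also have "\<dots> = card ({..<2 * n} \<inter> {j. j < 2 * b})" by (simp add: of_bool_def sum.If_cases)
  also have "{..<2 * n} \<inter> {j. j < 2 * b} = {..<2 * b}" using b by auto
  finally have 1: "(\<Sum>i<n. of_bool (p (2 * i) < 2 * b) + of_bool (p (2 * i + 1) < 2 * b) :: nat) = 2 * b"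
    by (simp add: sum_pairs)
  have "card (crossing n (2 * b) p) = (\<Sum>i<n. of_bool ((p (2 * i) < 2 * b) \<noteq> (p (2 * i + 1) < 2 * b)))"
    by (simp add: crossing_def of_bool_def sum.If_cases Int_def)
  then have "card (crossing n (2 * b) p) + 2 * (\<Sum>i<n. of_bool (p (2 * i) < 2 * b \<and> p (2 * i + 1) < 2 * b)) =
     (\<Sum>i<n. of_bool (p (2 * i) < 2 * b) + of_bool (p (2 * i + 1) < 2 * b))"
    unfolding sum_distrib_left by (simp only: sum.distrib[symmetric]) (auto intro!: sum.cong)
  then have "card (crossing n (2 * b) p) + 2 * (\<Sum>i<n. of_bool (p (2 * i) < 2 * b \<and> p (2 * i + 1) < 2 * b)) = 2 * b"
    using 1 by simp
  then have "even (card (crossing n (2 * b) p) + 2 * (\<Sum>i<n. of_bool (p (2 * i) < 2 * b \<and> p (2 * i + 1) < 2 * b)))"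
    by simp
  then show ?thesis by (simp only: even_add even_mult_iff even_numeral) simp
qed

definition low_position :: "nat \<Rightarrow> (nat \<Rightarrow> nat) \<Rightarrow> nat \<Rightarrow> nat" where
  "low_position b p i = (if p (2 * i) < b then 2 * i else 2 * i + 1)"

text \<open>
  Exchange the low members of the first two crossing pairs. This leaves the set of crossing pairs and
  the positions of low members unchanged, hence it is an involution.
\<close>

definition swap_low :: "nat \<Rightarrow> nat \<Rightarrow> (nat \<Rightarrow> nat) \<Rightarrow> nat \<Rightarrow> nat" where
  "swap_low n b p = (let i = Min (crossing n b p); j = Min (crossing n b p - {i}) in
     p \<circ> Transposition.transpose (low_position b p i) (low_position b p j))"

text \<open>
  If the off-diagonal block is \<open>v x * w y\<close>, exchanging the low members of two crossing pairs does not
  change the product of their entries but reverses the sign of the permutation. As the number of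
  crossing pairs is even, there are at least two of them, and the terms cancel in pairs.
\<close>

lemma crossing_terms_cancel:
  assumes b: "b \<le> n"
    and f1: "\<And>x y. x < 2 * b \<Longrightarrow> 2 * b \<le> y \<Longrightarrow> y < 2 * n \<Longrightarrow> f x y = v x * w y"
    and f2: "\<And>x y. x < 2 * b \<Longrightarrow> 2 * b \<le> y \<Longrightarrow> y < 2 * n \<Longrightarrow> f y x = - (v x * w y)"
  shows "(\<Sum>p | p permutes {..<2 * n} \<and> crossing n (2 * b) p \<noteq> {}.
     of_int (sign p) * (\<Prod>i<n. f (p (2 * i)) (p (2 * i + 1)))) = (0 :: real)" (is "sum ?g ?X = 0")
proof -
  let ?c = "crossing n (2 * b)"
  let ?\<phi> = "swap_low n (2 * b)"
  have main: "?\<phi> p \<in> ?X \<and> ?\<phi> (?\<phi> p) = p \<and> ?g (?\<phi> p) = - ?g p" if pX: "p \<in> ?X" for p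
  proof -
    have p: "p permutes {..<2 * n}" and ne: "?c p \<noteq> {}" using pX by auto
    have fin: "finite (?c p)" by (simp add: crossing_def)
    define i where "i = Min (?c p)"
    define j where "j = Min (?c p - {i})"
    have i: "i \<in> ?c p" unfolding i_def using fin ne by (rule Min_in)
    have "card (?c p) \<noteq> 1" using even_card_crossing[OF p b] by auto
    then have "?c p - {i} \<noteq> {}" using i fin by (metis card_1_singleton_iff insert_Diff One_nat_def)
    then have "j \<in> ?c p - {i}" unfolding j_def using fin by (intro Min_in) auto
    then have j: "j \<in> ?c p" "j \<noteq> i" by auto
    define s where "s = low_position (2 * b) p i"
    define t where "t = low_position (2 * b) p j"
    have \<phi>: "?\<phi> p = p \<circ> Transposition.transpose s t" by (simp add: swap_low_def i_def j_def s_def t_def Let_def)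
    have in': "i < n" "j < n" using i j by (auto simp: crossing_def)
    have s: "s = 2 * i \<or> s = 2 * i + 1" and t: "t = 2 * j \<or> t = 2 * j + 1"
      by (auto simp: s_def t_def low_position_def)
    have st: "s \<noteq> t" "s < 2 * n" "t < 2 * n" using s t in' j(2) by presburger+
    have pst: "p s < 2 * b" "p t < 2 * b"
      using i j by (auto simp: s_def t_def low_position_def crossing_def)
    have tr: "Transposition.transpose s t m = m" if "m \<noteq> s" "m \<noteq> t" for m using that by (simp add: Transposition.transpose_def)
    have low: "(?\<phi> p m < 2 * b) = (p m < 2 * b)" for m
      using pst by (cases "m = s"; cases "m = t") (auto simp: \<phi> tr)
    have c: "?c (?\<phi> p) = ?c p" by (simp add: crossing_def low)
    have lp: "low_position (2 * b) (?\<phi> p) m = low_position (2 * b) p m" for m by (simp add: low_position_def low)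
    have perm: "?\<phi> p permutes {..<2 * n}"
      unfolding \<phi> using st by (intro permutes_compose p permutes_swap_id) auto
    have 1: "?\<phi> p \<in> ?X" using perm c ne by simp
    have "?\<phi> (?\<phi> p) = ?\<phi> p \<circ> Transposition.transpose s t"
      unfolding swap_low_def[of n "2 * b" "?\<phi> p"] c lp by (simp add: i_def j_def s_def t_def Let_def)
    then have 2: "?\<phi> (?\<phi> p) = p" unfolding \<phi> by (simp add: comp_assoc)
    have "sign (?\<phi> p) = sign p * sign (Transposition.transpose s t)"
      unfolding \<phi> using p by (intro sign_compose permutation_swap_id) (auto simp: permutation_permutes)
    then have sgn: "sign (?\<phi> p) = - sign p" using st by (simp add: sign_swap_id)
    have prod: "(\<Prod>l<n. f (?\<phi> p (2 * l)) (?\<phi> p (2 * l + 1))) = (\<Prod>l<n. f (p (2 * l)) (p (2 * l + 1)))"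
    proof -
      have rest: "f (?\<phi> p (2 * l)) (?\<phi> p (2 * l + 1)) = f (p (2 * l)) (p (2 * l + 1))" if "l \<in> {..<n} - {i, j}" for l
      proof -
        have "l \<noteq> i" "l \<noteq> j" using that by auto
        then have "2 * l \<noteq> s" "2 * l \<noteq> t" "2 * l + 1 \<noteq> s" "2 * l + 1 \<noteq> t"
          using s t by presburger+
        then show ?thesis by (simp add: \<phi> tr)
      qed
      define s' where "s' = (if s = 2 * i then 2 * i + 1 else 2 * i)"
      define t' where "t' = (if t = 2 * j then 2 * j + 1 else 2 * j)"
      have s'n: "s' < 2 * n" "t' < 2 * n" using in' by (auto simp: s'_def t'_def)
      have hi: "2 * b \<le> p s'" "2 * b \<le> p t'"
        using i j by (auto simp: s'_def t'_def s_def t_def low_position_def crossing_def)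
      have hi2: "p s' < 2 * n" "p t' < 2 * n" using permutes_in_image[OF p] s'n by auto
      have ns: "s' \<noteq> s" "s' \<noteq> t" "t' \<noteq> s" "t' \<noteq> t" using s t j(2) unfolding s'_def t'_def by presburger+
      have ph: "?\<phi> p s = p t" "?\<phi> p t = p s" "?\<phi> p s' = p s'" "?\<phi> p t' = p t'"
        using ns by (simp_all add: \<phi> tr)
      have pi: "f (q (2 * i)) (q (2 * i + 1)) = (if s = 2 * i then f (q s) (q s') else f (q s') (q s))" for q
        using s by (auto simp: s'_def)
      have pj: "f (q (2 * j)) (q (2 * j + 1)) = (if t = 2 * j then f (q t) (q t') else f (q t') (q t))" for q
        using t by (auto simp: t'_def)
      have "f (?\<phi> p (2 * i)) (?\<phi> p (2 * i + 1)) * f (?\<phi> p (2 * j)) (?\<phi> p (2 * j + 1)) =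
        f (p (2 * i)) (p (2 * i + 1)) * f (p (2 * j)) (p (2 * j + 1))"
        unfolding pi pj ph
        unfolding f1[OF pst(1) hi(1) hi2(1)] f1[OF pst(1) hi(2) hi2(2)] f1[OF pst(2) hi(1) hi2(1)] f1[OF pst(2) hi(2) hi2(2)]
          f2[OF pst(1) hi(1) hi2(1)] f2[OF pst(1) hi(2) hi2(2)] f2[OF pst(2) hi(1) hi2(1)] f2[OF pst(2) hi(2) hi2(2)]
        by (simp add: mult_ac)
      moreover have "(\<Prod>l<n. h l) = (h i * h j) * (\<Prod>l\<in>{..<n} - {i, j}. h l)" for h :: "nat \<Rightarrow> real"
      proof -
        have "(\<Prod>l<n. h l) = (\<Prod>l\<in>{i, j}. h l) * (\<Prod>l\<in>{..<n} - {i, j}. h l)"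
          using in' by (intro prod.subset_diff[THEN trans[OF _ mult.commute]]) auto
        then show ?thesis using j(2) by simp
      qed
      ultimately show ?thesis using rest by simp
    qed
    show ?thesis using 1 2 prod sgn by simp
  qed
  have "sum ?g ?X = (\<Sum>p\<in>?X. ?g (?\<phi> p))"
    by (rule sum.reindex_bij_witness[of _ ?\<phi> ?\<phi>]) (use main in auto)
  also have "\<dots> = - sum ?g ?X" using main by (simp add: sum_negf[symmetric] del: of_int_minus)
  finally show ?thesis by simp
qed

text \<open>
  The permutation of indices that moves the pair \<open>(2 * i, 2 * i + 1)\<close> as a whole.
\<close>

definition pair_lift :: "(nat \<Rightarrow> nat) \<Rightarrow> nat \<Rightarrow> nat" where
  "pair_lift \<tau> m = 2 * \<tau> (m div 2) + m mod 2"

lemma pair_lift_compose: "pair_lift (\<sigma> \<circ> \<tau>) = pair_lift \<sigma> \<circ> pair_lift \<tau>"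
  by (simp add: pair_lift_def fun_eq_iff)

lemma pair_lift_simps [simp]: "pair_lift \<tau> (2 * i) = 2 * \<tau> i" "pair_lift \<tau> (Suc (2 * i)) = 2 * \<tau> i + 1"
  by (simp_all add: pair_lift_def)

lemma pair_lift_transpose:
  "pair_lift (Transposition.transpose a b) = Transposition.transpose (2 * a) (2 * b) \<circ> Transposition.transpose (2 * a + 1) (2 * b + 1)"
proof
  fix m :: nat
  have "m = 2 * (m div 2) + m mod 2" by simp
  then obtain l where "m = 2 * l \<or> m = 2 * l + 1" by (metis mod2_eq_if add.right_neutral)
  then show "pair_lift (Transposition.transpose a b) m = (Transposition.transpose (2 * a) (2 * b) \<circ> Transposition.transpose (2 * a + 1) (2 * b + 1)) m"
    by (elim disjE) (auto simp: Transposition.transpose_def; presburger)+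
qed

text \<open>
  A transposition of pairs is a product of two transpositions, hence even.
\<close>

lemma pair_lift_permutes_sign:
  assumes "\<tau> permutes {..<n}"
  shows "pair_lift \<tau> permutes {..<2 * n} \<and> sign (pair_lift \<tau>) = 1"
  using assms finite_lessThan
proof (induction rule: permutes_induct)
  case id
  have "pair_lift id = id" by (simp add: pair_lift_def fun_eq_iff)
  then show ?case by (simp only: permutes_id sign_id simp_thms)
next
  case (swap a b p)
  let ?t = "Transposition.transpose (2 * a) (2 * b) \<circ> Transposition.transpose (2 * a + 1) (2 * b + 1)"
  have t: "?t permutes {..<2 * n}" using swap(1,2) by (intro permutes_compose permutes_swap_id) auto
  have "sign ?t = sign (Transposition.transpose (2 * a) (2 * b)) * sign (Transposition.transpose (2 * a + 1) (2 * b + 1))"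
    by (intro sign_compose permutation_swap_id)
  then have st: "sign ?t = 1" by (simp add: sign_swap_id)
  have "sign (pair_lift (Transposition.transpose a b \<circ> p)) = sign ?t * sign (pair_lift p)"
    unfolding pair_lift_compose pair_lift_transpose using swap.IH swap t
    by (intro sign_compose) (auto simp: permutation_permutes)
  moreover have "pair_lift (Transposition.transpose a b \<circ> p) permutes {..<2 * n}"
    unfolding pair_lift_compose pair_lift_transpose
    by (rule permutes_compose[OF _ t]) (use swap.IH in auto)
  ultimately show ?case using st swap.IH by (simp add: comp_def)
qed

definition low_pairs :: "nat \<Rightarrow> nat \<Rightarrow> (nat \<Rightarrow> nat) \<Rightarrow> nat set" where
  "low_pairs n b p = {i. i < n \<and> p (2 * i) < b}"

lemma card_low_pairs:
  assumes p: "p permutes {..<2 * n}" and b: "b \<le> n" and nc: "crossing n (2 * b) p = {}"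
  shows "card (low_pairs n (2 * b) p) = b"
proof -
  have same: "(p (2 * i) < 2 * b) = (p (2 * i + 1) < 2 * b)" if "i < n" for i
    using nc that by (auto simp: crossing_def)
  have "(\<Sum>j<2 * n. of_bool (p j < 2 * b) :: nat) = (\<Sum>j<2 * n. of_bool (j < 2 * b))"
    by (rule sum.permute[OF p, symmetric, unfolded o_def])
  also have "\<dots> = card ({..<2 * n} \<inter> {j. j < 2 * b})" by (simp add: of_bool_def sum.If_cases)
  also have "{..<2 * n} \<inter> {j. j < 2 * b} = {..<2 * b}" using b by auto
  finally have "(\<Sum>i<n. of_bool (p (2 * i) < 2 * b) + of_bool (p (2 * i + 1) < 2 * b) :: nat) = 2 * b"
    by (simp add: sum_pairs)
  moreover have "(\<Sum>i<n. of_bool (p (2 * i) < 2 * b) + of_bool (p (2 * i + 1) < 2 * b) :: nat) =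
      (\<Sum>i<n. 2 * of_bool (p (2 * i) < 2 * b))"
    using same by (intro sum.cong) auto
  ultimately have "(\<Sum>i<n. 2 * of_bool (p (2 * i) < 2 * b) :: nat) = 2 * b" by simp
  then have "(\<Sum>i<n. of_bool (p (2 * i) < 2 * b) :: nat) = b" by (simp add: sum_distrib_left[symmetric])
  then show ?thesis by (simp add: low_pairs_def of_bool_def sum.If_cases Int_def)
qed

text \<open>
  Reordering the pairs changes neither the sign nor the product, so the low pairs may be assumed to come
  first. The number of choices for the set \<open>S\<close> of their positions produces the binomial coefficient in the
  block formula.
\<close>

lemma sum_low_pairs_eq:
  assumes S: "S \<subseteq> {..<n}" "card S = b"
  shows "(\<Sum>p | p permutes {..<2 * n} \<and> crossing n (2 * b) p = {} \<and> low_pairs n (2 * b) p = S.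
      of_int (sign p) * (\<Prod>i<n. f (p (2 * i)) (p (2 * i + 1)))) =
    (\<Sum>p | p permutes {..<2 * n} \<and> crossing n (2 * b) p = {} \<and> low_pairs n (2 * b) p = {..<b}.
      of_int (sign p) * (\<Prod>i<n. f (p (2 * i)) (p (2 * i + 1)) :: real))"
proof -
  have "finite S" using S(1) finite_subset by blast
  then obtain j where j: "bij_betw j {..<b} S"
    using ex_bij_betw_nat_finite[of S] S(2) by (auto simp: atLeast0LessThan)
  then have "inj_on j {..<b}" "j ` {..<b} \<subseteq> {..<n}" using S(1) by (auto simp: bij_betw_def)
  then obtain \<tau> where \<tau>: "\<tau> permutes {..<n}" "\<And>i. i < b \<Longrightarrow> \<tau> i = j i"
    using inj_extends_to_permutation by blast
  have tS: "\<tau> ` {..<b} = S" using j \<tau>(2) by (auto simp: bij_betw_def image_def)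
  define \<sigma> where "\<sigma> = inv_into UNIV \<tau>"
  have \<sigma>: "\<sigma> permutes {..<n}" unfolding \<sigma>_def by (rule permutes_inv[OF \<tau>(1)])
  have st: "\<sigma> \<circ> \<tau> = id" "\<tau> \<circ> \<sigma> = id" unfolding \<sigma>_def using permutes_inv_o[OF \<tau>(1)] by auto
  have lift: "pair_lift \<tau> permutes {..<2 * n}" "sign (pair_lift \<tau>) = 1"
    "pair_lift \<sigma> permutes {..<2 * n}" "sign (pair_lift \<sigma>) = 1"
    using pair_lift_permutes_sign \<tau>(1) \<sigma> by blast+
  have lid: "pair_lift id = id" by (simp add: pair_lift_def fun_eq_iff)
  have bn: "b \<le> n" using S by (metis card_lessThan card_mono finite_lessThan)
  have cr: "crossing n c (p \<circ> pair_lift \<rho>) = {}" if "crossing n c p = {}" "\<rho> permutes {..<n}" for p \<rho> c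
    using that permutes_in_image[OF that(2)] by (auto simp: crossing_def)
  have lo: "low_pairs n c (p \<circ> pair_lift \<rho>) = {i. \<rho> i \<in> low_pairs n c p}" if "\<rho> permutes {..<n}" for p \<rho> c
    using permutes_in_image[OF that] by (auto simp: low_pairs_def)
  have pr: "(\<Prod>i<n. f (p (2 * \<tau> i)) (p (2 * \<tau> i + 1))) = (\<Prod>i<n. f (p (2 * i)) (p (2 * i + 1)))" for p
    by (rule prod.permute[OF \<tau>(1), of "\<lambda>i. f (p (2 * i)) (p (2 * i + 1))", symmetric, unfolded o_def])
  show ?thesis
  proof (rule sum.reindex_bij_witness[where i = "\<lambda>p. p \<circ> pair_lift \<sigma>" and j = "\<lambda>p. p \<circ> pair_lift \<tau>"])
    fix p assume "p \<in> {p. p permutes {..<2 * n} \<and> crossing n (2 * b) p = {} \<and> low_pairs n (2 * b) p = S}"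
    then have p: "p permutes {..<2 * n}" "crossing n (2 * b) p = {}" "low_pairs n (2 * b) p = S" by auto
    show "(p \<circ> pair_lift \<tau>) \<circ> pair_lift \<sigma> = p"
      unfolding comp_assoc pair_lift_compose[symmetric] st lid by simp
    have "{i. \<tau> i \<in> S} = {..<b}"
      using permutes_inj[OF \<tau>(1)] unfolding tS[symmetric] by (auto simp: inj_def)
    then show "p \<circ> pair_lift \<tau> \<in> {p. p permutes {..<2 * n} \<and> crossing n (2 * b) p = {} \<and> low_pairs n (2 * b) p = {..<b}}"
      using p lift \<tau>(1) by (simp add: permutes_compose cr lo)
    have "sign (p \<circ> pair_lift \<tau>) = sign p * sign (pair_lift \<tau>)"
      using p lift by (intro sign_compose) (auto simp: permutation_permutes)
    then show "of_int (sign (p \<circ> pair_lift \<tau>)) * (\<Prod>i<n. f ((p \<circ> pair_lift \<tau>) (2 * i)) ((p \<circ> pair_lift \<tau>) (2 * i + 1))) =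
         of_int (sign p) * (\<Prod>i<n. f (p (2 * i)) (p (2 * i + 1)))"
      using lift(2) pr[of p] by simp
  next
    fix p assume "p \<in> {p. p permutes {..<2 * n} \<and> crossing n (2 * b) p = {} \<and> low_pairs n (2 * b) p = {..<b}}"
    then have p: "p permutes {..<2 * n}" "crossing n (2 * b) p = {}" "low_pairs n (2 * b) p = {..<b}" by auto
    show "(p \<circ> pair_lift \<sigma>) \<circ> pair_lift \<tau> = p"
      unfolding comp_assoc pair_lift_compose[symmetric] st lid by simp
    have "{i. \<sigma> i \<in> {..<b}} = S"
    proof -
      have "\<sigma> (\<tau> i) = i" "\<tau> (\<sigma> i) = i" for i using st by (simp_all add: fun_eq_iff)
      moreover from this have "i \<in> \<tau> ` {..<b}" if "\<sigma> i < b" for i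
        using that image_eqI[of i \<tau> "\<sigma> i" "{..<b}"] by simp
      ultimately show ?thesis unfolding tS[symmetric] by auto
    qed
    then show "p \<circ> pair_lift \<sigma> \<in> {p. p permutes {..<2 * n} \<and> crossing n (2 * b) p = {} \<and> low_pairs n (2 * b) p = S}"
      using p lift \<sigma> by (simp add: permutes_compose cr lo)
  qed
qed

lemma sum_permutations_split:
  assumes "finite T" "finite U" "T \<inter> U = {}"
  shows "(\<Sum>p | p permutes (T \<union> U) \<and> p ` T = T. g p) =
    (\<Sum>p | p permutes T. \<Sum>q | q permutes U. g (p \<circ> q))"
proof -
  have "(\<Sum>p | p permutes T. \<Sum>q | q permutes U. g (p \<circ> q)) =
     (\<Sum>(p, q)\<in>{p. p permutes T} \<times> {q. q permutes U}. g (p \<circ> q))"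
    by (rule sum.cartesian_product)
  also have "\<dots> = (\<Sum>p | p permutes (T \<union> U) \<and> p ` T = T. g p)"
  proof (rule sum.reindex_bij_witness[where i = "\<lambda>p. (\<lambda>x. if x \<in> T then p x else x, \<lambda>x. if x \<in> U then p x else x)"
        and j = "\<lambda>(p, q). p \<circ> q"])
    fix a assume "a \<in> {p. p permutes T} \<times> {q. q permutes U}"
    then obtain p q where a: "a = (p, q)" "p permutes T" "q permutes U" by auto
    have pU: "p x = x" if "x \<in> U" for x using a(2) that assms(3) by (auto intro: permutes_not_in)
    have qT: "q x = x" if "x \<notin> U" for x using a(3) that by (auto intro: permutes_not_in)
    have qU: "q x \<in> U" if "x \<in> U" for x using permutes_in_image[OF a(3)] that by simp
    have "(\<lambda>x. if x \<in> T then (p \<circ> q) x else x) = p"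
    proof
      fix x
      have "q x = x" if "x \<in> T" using qT[of x] that assms(3) by auto
      then show "(if x \<in> T then (p \<circ> q) x else x) = p x" using permutes_not_in[OF a(2)] by auto
    qed
    moreover have "(\<lambda>x. if x \<in> U then (p \<circ> q) x else x) = q"
      using pU qU qT by (auto simp: fun_eq_iff)
    ultimately show "(\<lambda>x. if x \<in> T then (case a of (p, q) \<Rightarrow> p \<circ> q) x else x, \<lambda>x. if x \<in> U then (case a of (p, q) \<Rightarrow> p \<circ> q) x else x) = a"
      unfolding a(1) prod.case by simp
    have "(p \<circ> q) ` T = p ` T" using qT assms(3) by (force simp: image_iff)
    moreover have "p ` T = T" by (rule permutes_image[OF a(2)])
    moreover have "p \<circ> q permutes T \<union> U"
      by (intro permutes_compose permutes_subset[OF a(2)] permutes_subset[OF a(3)]) auto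
    ultimately show "(case a of (p, q) \<Rightarrow> p \<circ> q) \<in> {p. p permutes (T \<union> U) \<and> p ` T = T}" by (simp add: a(1))
    show "g (case a of (p, q) \<Rightarrow> p \<circ> q) = (case a of (p, q) \<Rightarrow> g (p \<circ> q))" by (simp add: a(1))
  next
    fix p assume "p \<in> {p. p permutes (T \<union> U) \<and> p ` T = T}"
    then have p: "p permutes (T \<union> U)" "p ` T = T" by auto
    have inj: "inj p" by (rule permutes_inj[OF p(1)])
    have "p ` (T \<union> U) = T \<union> U" by (rule permutes_image[OF p(1)])
    then have "p ` T \<union> p ` U = T \<union> U" by (simp add: image_Un)
    moreover have "p ` T \<inter> p ` U = {}" using inj assms(3) by (metis image_Int image_empty)
    ultimately have "p ` U = (T \<union> U) - T" using p(2) by auto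
    then have pU: "p ` U = U" using assms(3) by auto
    show "(case (\<lambda>x. if x \<in> T then p x else x, \<lambda>x. if x \<in> U then p x else x) of (p, q) \<Rightarrow> p \<circ> q) = p"
    proof
      fix x
      have "p x \<notin> T" if "x \<in> U" using pU that assms(3) by blast
      then show "(case (\<lambda>x. if x \<in> T then p x else x, \<lambda>x. if x \<in> U then p x else x) of (p, q) \<Rightarrow> p \<circ> q) x = p x"
        using permutes_not_in[OF p(1), of x] assms(3) by auto
    qed
    have "(\<lambda>x. if x \<in> T then p x else x) permutes T"
    proof (rule bij_imp_permutes)
      have "bij_betw p T T" using p(2) inj by (auto simp: bij_betw_def inj_on_def inj_def)
      then show "bij_betw (\<lambda>x. if x \<in> T then p x else x) T T"
        by (rule bij_betw_cong[THEN iffD1, rotated]) simp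
    qed simp
    moreover have "(\<lambda>x. if x \<in> U then p x else x) permutes U"
    proof (rule bij_imp_permutes)
      have "bij_betw p U U" using pU inj by (auto simp: bij_betw_def inj_on_def inj_def)
      then show "bij_betw (\<lambda>x. if x \<in> U then p x else x) U U"
        by (rule bij_betw_cong[THEN iffD1, rotated]) simp
    qed simp
    ultimately show "(\<lambda>x. if x \<in> T then p x else x, \<lambda>x. if x \<in> U then p x else x) \<in> {p. p permutes T} \<times> {q. q permutes U}"
      by simp
  qed
  finally show ?thesis by simp
qed

text \<open>
  A permutation without crossing pairs whose low pairs come first preserves both halves of the index set,
  so it is a product of a permutation of each half.
\<close>

lemma low_sum_factor:
  "(\<Sum>p | p permutes {..<2 * (2 * m)} \<and> crossing (2 * m) (2 * m) p = {} \<and> low_pairs (2 * m) (2 * m) p = {..<m}.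
      of_int (sign p) * (\<Prod>i<2 * m. f (p (2 * i)) (p (2 * i + 1)))) =
    pfaffian_sum m f * pfaffian_sum m (\<lambda>x y. f (2 * m + x) (2 * m + y))"
proof -
  let ?T = "{..<2 * m}" and ?U = "{2 * m..<2 * (2 * m)}"
  let ?g = "\<lambda>p. of_int (sign p) * (\<Prod>i<2 * m. f (p (2 * i)) (p (2 * i + 1))) :: real"
  have TU: "?T \<union> ?U = {..<2 * (2 * m)}" by auto
  define rot :: "nat \<Rightarrow> nat" where "rot x = (if x < 2 * m then x + 2 * m else if x < 2 * (2 * m) then x - 2 * m else x)" for x
  have rr: "rot (rot x) = x" for x by (auto simp: rot_def)
  have rot: "rot permutes {..<2 * (2 * m)}"
    by (rule bij_imp_permutes[OF bij_betwI[where g = rot]]) (auto simp: rot_def)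
  have sgn: "sign (rot \<circ> q \<circ> rot) = sign q" if "q permutes {..<2 * (2 * m)}" for q
  proof -
    have pm: "permutation rot" "permutation q" using rot that by (auto simp: permutation_permutes)
    have "sign (rot \<circ> q \<circ> rot) = sign rot * sign q * sign rot"
      using pm by (simp add: sign_compose permutation_compose)
    then show ?thesis by simp
  qed
  have "{p. p permutes {..<2 * (2 * m)} \<and> crossing (2 * m) (2 * m) p = {} \<and> low_pairs (2 * m) (2 * m) p = {..<m}} =
     {p. p permutes (?T \<union> ?U) \<and> p ` ?T = ?T}"
    (is "?L = ?R")
  proof (rule Set.set_eqI, rule iffI)
    fix p assume "p \<in> ?L"
    then have p: "p permutes {..<2 * (2 * m)}" "crossing (2 * m) (2 * m) p = {}" "low_pairs (2 * m) (2 * m) p = {..<m}" by auto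
    have "p x < 2 * m" if "x < 2 * m" for x
    proof -
      have "x div 2 \<in> low_pairs (2 * m) (2 * m) p" using p(3) that by auto
      then have 1: "p (2 * (x div 2)) < 2 * m" "x div 2 < 2 * m" by (auto simp: low_pairs_def)
      then have 2: "p (2 * (x div 2) + 1) < 2 * m" using p(2) by (auto simp: crossing_def)
      have "x = 2 * (x div 2) \<or> x = 2 * (x div 2) + 1" by presburger
      then show ?thesis using 1(1) 2 by metis
    qed
    then have "p ` ?T \<subseteq> ?T" by auto
    moreover have "card (p ` ?T) = card ?T" using permutes_inj_on[OF p(1)] by (rule card_image)
    ultimately have "p ` ?T = ?T" by (intro card_subset_eq) auto
    then show "p \<in> ?R" using p(1) TU by simp
  next
    fix p assume "p \<in> ?R"
    then have p: "p permutes (?T \<union> ?U)" "p ` ?T = ?T" by auto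
    have low: "p x < 2 * m \<longleftrightarrow> x < 2 * m" for x
    proof
      assume "p x < 2 * m"
      then have "p x \<in> p ` ?T" using p(2) by auto
      then show "x < 2 * m" using permutes_inj[OF p(1)] by (auto simp: inj_def)
    next
      assume "x < 2 * m" then show "p x < 2 * m" using p(2) by blast
    qed
    have "crossing (2 * m) (2 * m) p = {}" unfolding crossing_def low by auto
    moreover have "low_pairs (2 * m) (2 * m) p = {..<m}" unfolding low_pairs_def low by auto
    ultimately show "p \<in> ?L" using p(1) unfolding TU by blast
  qed
  then have "(\<Sum>p | p permutes {..<2 * (2 * m)} \<and> crossing (2 * m) (2 * m) p = {} \<and> low_pairs (2 * m) (2 * m) p = {..<m}. ?g p) =
     (\<Sum>p | p permutes ?T. \<Sum>q | q permutes ?U. ?g (p \<circ> q))"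
    by (simp only:) (rule sum_permutations_split; auto)
  also have "\<dots> = (\<Sum>p | p permutes ?T. \<Sum>q | q permutes ?U.
     (of_int (sign p) * (\<Prod>i<m. f (p (2 * i)) (p (2 * i + 1)))) *
     (of_int (sign q) * (\<Prod>i<m. f (q (2 * m + 2 * i)) (q (2 * m + (2 * i + 1))))))"
  proof (intro sum.cong refl)
    fix p q assume "p \<in> {p. p permutes ?T}" "q \<in> {q. q permutes ?U}"
    then have p: "p permutes ?T" and q: "q permutes ?U" by auto
    have "sign (p \<circ> q) = sign p * sign q"
      using p q by (intro sign_compose) (auto simp: permutation_permutes)
    moreover have "(\<Prod>i<2 * m. f ((p \<circ> q) (2 * i)) ((p \<circ> q) (2 * i + 1))) =
       (\<Prod>i<m. f (p (2 * i)) (p (2 * i + 1))) * (\<Prod>i<m. f (q (2 * m + 2 * i)) (q (2 * m + (2 * i + 1))))"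
    proof -
      have "(\<Prod>i<2 * m. f ((p \<circ> q) (2 * i)) ((p \<circ> q) (2 * i + 1))) =
        (\<Prod>i<m. f ((p \<circ> q) (2 * i)) ((p \<circ> q) (2 * i + 1))) * (\<Prod>i\<in>{m..<2 * m}. f ((p \<circ> q) (2 * i)) ((p \<circ> q) (2 * i + 1)))"
        by (simp only: lessThan_atLeast0) (rule prod.atLeastLessThan_concat[symmetric]; simp)
      also have "(\<Prod>i<m. f ((p \<circ> q) (2 * i)) ((p \<circ> q) (2 * i + 1))) = (\<Prod>i<m. f (p (2 * i)) (p (2 * i + 1)))"
        using permutes_not_in[OF q] by (intro prod.cong) auto
      also have "(\<Prod>i\<in>{m..<2 * m}. f ((p \<circ> q) (2 * i)) ((p \<circ> q) (2 * i + 1))) =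
         (\<Prod>i<m. f ((p \<circ> q) (2 * m + 2 * i)) ((p \<circ> q) (2 * m + (2 * i + 1))))"
        by (rule prod.reindex_bij_witness[where i = "\<lambda>i. m + i" and j = "\<lambda>i. i - m"]) (auto simp: diff_mult_distrib2)
      also have "\<dots> = (\<Prod>i<m. f (q (2 * m + 2 * i)) (q (2 * m + (2 * i + 1))))"
      proof (rule prod.cong[OF refl])
        fix i assume i: "i \<in> {..<m}"
        have "q x \<in> ?U" if "x \<in> ?U" for x using permutes_in_image[OF q] that by simp
        then have "q (2 * m + 2 * i) \<in> ?U" "q (2 * m + (2 * i + 1)) \<in> ?U" using i by auto
        then show "f ((p \<circ> q) (2 * m + 2 * i)) ((p \<circ> q) (2 * m + (2 * i + 1))) = f (q (2 * m + 2 * i)) (q (2 * m + (2 * i + 1)))"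
          using permutes_not_in[OF p] by auto
      qed
      finally show ?thesis .
    qed
    ultimately show "?g (p \<circ> q) = of_int (sign p) * (\<Prod>i<m. f (p (2 * i)) (p (2 * i + 1))) *
         (of_int (sign q) * (\<Prod>i<m. f (q (2 * m + 2 * i)) (q (2 * m + (2 * i + 1)))))"
      by simp
  qed
  also have "\<dots> = pfaffian_sum m f *
     (\<Sum>q | q permutes ?U. of_int (sign q) * (\<Prod>i<m. f (q (2 * m + 2 * i)) (q (2 * m + (2 * i + 1)))))"
    by (simp add: pfaffian_sum_def sum_product)
  also have "(\<Sum>q | q permutes ?U. of_int (sign q) * (\<Prod>i<m. f (q (2 * m + 2 * i)) (q (2 * m + (2 * i + 1))))) =
     pfaffian_sum m (\<lambda>x y. f (2 * m + x) (2 * m + y))"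
    unfolding pfaffian_sum_def
  proof (rule sum.reindex_bij_witness[where i = "\<lambda>q. rot \<circ> q \<circ> rot" and j = "\<lambda>q. rot \<circ> q \<circ> rot"])
    fix q assume "q \<in> {q. q permutes ?U}"
    then have q: "q permutes ?U" by simp
    show "rot \<circ> (rot \<circ> q \<circ> rot) \<circ> rot = q" by (simp add: fun_eq_iff rr)
    show "rot \<circ> q \<circ> rot \<in> {q. q permutes ?T}"
    proof -
      have "rot \<circ> q \<circ> rot permutes {..<2 * (2 * m)}"
        by (intro permutes_compose rot permutes_subset[OF q]) auto
      moreover have "(rot \<circ> q \<circ> rot) x = x" if "x \<in> {..<2 * (2 * m)} - ?T" for x
      proof -
        have "rot x \<notin> ?U" using that by (auto simp: rot_def)
        then show ?thesis using permutes_not_in[OF q] by (simp add: rr)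
      qed
      ultimately have "rot \<circ> q \<circ> rot permutes ?T" by (rule permutes_superset)
      then show ?thesis by simp
    qed
    have "rot (2 * i) = 2 * m + 2 * i" "rot (2 * i + 1) = 2 * m + (2 * i + 1)" if "i < m" for i
      using that by (simp_all add: rot_def)
    moreover have "2 * m + rot x = x" if "x \<in> ?U" for x using that by (simp add: rot_def)
    moreover have "q x \<in> ?U" if "x \<in> ?U" for x using permutes_in_image[OF q] that by simp
    ultimately have "(\<Prod>i<m. f (2 * m + (rot \<circ> q \<circ> rot) (2 * i)) (2 * m + (rot \<circ> q \<circ> rot) (2 * i + 1))) =
       (\<Prod>i<m. f (q (2 * m + 2 * i)) (q (2 * m + (2 * i + 1))))"
      by (intro prod.cong) auto
    moreover have "sign (rot \<circ> q \<circ> rot) = sign q" by (rule sgn[OF permutes_subset[OF q]]) auto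
    ultimately show "of_int (sign (rot \<circ> q \<circ> rot)) * (\<Prod>i<m. f (2 * m + (rot \<circ> q \<circ> rot) (2 * i)) (2 * m + (rot \<circ> q \<circ> rot) (2 * i + 1))) =
      of_int (sign q) * (\<Prod>i<m. f (q (2 * m + 2 * i)) (q (2 * m + (2 * i + 1))))"
      by simp
  next
    fix q assume "q \<in> {q. q permutes ?T}"
    then have q: "q permutes ?T" by simp
    show "rot \<circ> (rot \<circ> q \<circ> rot) \<circ> rot = q" by (simp add: fun_eq_iff rr)
    have "rot \<circ> q \<circ> rot permutes {..<2 * (2 * m)}"
      by (intro permutes_compose rot permutes_subset[OF q]) auto
    moreover have "(rot \<circ> q \<circ> rot) x = x" if "x \<in> {..<2 * (2 * m)} - ?U" for x
    proof -
      have "rot x \<notin> ?T" using that by (auto simp: rot_def)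
      then show ?thesis using permutes_not_in[OF q] by (simp add: rr)
    qed
    ultimately have "rot \<circ> q \<circ> rot permutes ?U" by (rule permutes_superset)
    then show "rot \<circ> q \<circ> rot \<in> {q. q permutes ?U}" by simp
  qed
  finally show ?thesis .
qed

text \<open>
  After division by the factors \<open>2 ^ k * fact k\<close> the binomial coefficient disappears and the Pfaffian is
  multiplicative, although the off-diagonal blocks need not vanish.
\<close>

theorem pfaffian_sum_block:
  assumes f1: "\<And>x y. x < 2 * m \<Longrightarrow> 2 * m \<le> y \<Longrightarrow> y < 2 * (2 * m) \<Longrightarrow> f x y = v x * w y"
    and f2: "\<And>x y. x < 2 * m \<Longrightarrow> 2 * m \<le> y \<Longrightarrow> y < 2 * (2 * m) \<Longrightarrow> f y x = - (v x * w y)"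
  shows "pfaffian_sum (2 * m) f =
    real (2 * m choose m) * (pfaffian_sum m f * pfaffian_sum m (\<lambda>x y. f (2 * m + x) (2 * m + y)))"
proof -
  let ?P = "{p. p permutes {..<2 * (2 * m)}}"
  let ?g = "\<lambda>p. of_int (sign p) * (\<Prod>i<2 * m. f (p (2 * i)) (p (2 * i + 1))) :: real"
  let ?X = "{p. p permutes {..<2 * (2 * m)} \<and> crossing (2 * m) (2 * m) p \<noteq> {}}"
  let ?Y = "{p. p permutes {..<2 * (2 * m)} \<and> crossing (2 * m) (2 * m) p = {}}"
  let ?S = "{S. S \<subseteq> {..<2 * m} \<and> card S = m}"
  have fin: "finite ?P" by (rule finite_permutations) simp
  have "pfaffian_sum (2 * m) f = sum ?g (?X \<union> ?Y)"
    unfolding pfaffian_sum_def by (rule sum.cong) auto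
  also have "\<dots> = sum ?g ?X + sum ?g ?Y"
    by (rule sum.union_disjoint) (auto intro: finite_subset[OF _ fin])
  also have "sum ?g ?X = 0"
    by (rule crossing_terms_cancel[of m "2 * m" f v w]) (use f1 f2 in auto)
  also have "sum ?g ?Y = (\<Sum>S\<in>?S. sum ?g {p \<in> ?Y. low_pairs (2 * m) (2 * m) p = S})"
  proof (rule sum.group[symmetric])
    show "finite ?Y" by (rule finite_subset[OF _ fin]) auto
    show "finite ?S" by (rule finite_subset[of _ "Pow {..<2 * m}"]) auto
    show "low_pairs (2 * m) (2 * m) ` ?Y \<subseteq> ?S"
    proof (rule image_subsetI)
      fix p assume "p \<in> ?Y"
      then have "card (low_pairs (2 * m) (2 * m) p) = m" by (intro card_low_pairs) auto
      then show "low_pairs (2 * m) (2 * m) p \<in> ?S" by (auto simp: low_pairs_def)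
    qed
  qed
  also have "\<dots> = (\<Sum>S\<in>?S. pfaffian_sum m f * pfaffian_sum m (\<lambda>x y. f (2 * m + x) (2 * m + y)))"
  proof (rule sum.cong[OF refl])
    fix S assume "S \<in> ?S"
    then have S: "S \<subseteq> {..<2 * m}" "card S = m" by auto
    have "sum ?g {p \<in> ?Y. low_pairs (2 * m) (2 * m) p = S} =
      (\<Sum>p | p permutes {..<2 * (2 * m)} \<and> crossing (2 * m) (2 * m) p = {} \<and> low_pairs (2 * m) (2 * m) p = S. ?g p)"
      by (rule sum.cong) auto
    also have "\<dots> = pfaffian_sum m f * pfaffian_sum m (\<lambda>x y. f (2 * m + x) (2 * m + y))"
      unfolding sum_low_pairs_eq[OF S] by (rule low_sum_factor)
    finally show "sum ?g {p \<in> ?Y. low_pairs (2 * m) (2 * m) p = S} =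
      pfaffian_sum m f * pfaffian_sum m (\<lambda>x y. f (2 * m + x) (2 * m + y))" .
  qed
  also have "\<dots> = real (2 * m choose m) * (pfaffian_sum m f * pfaffian_sum m (\<lambda>x y. f (2 * m + x) (2 * m + y)))"
    using n_subsets[of "{..<2 * m}" m] by simp
  finally show ?thesis by simp
qed

section \<open>Symmetrisation over the Weyl chamber\<close>

lemma card_permutations_extending:
  assumes j: "j \<in> inj_tuples m {..<N}"
  shows "card {p. p permutes {..<N} \<and> restrict p {..<m} = j} = fact (N - m)"
proof -
  have jj: "inj_on j {..<m}" "j ` {..<m} \<subseteq> {..<N}" "j \<in> extensional {..<m}"
    using j by (auto simp: inj_tuples_def PiE_def)
  have mN: "m \<le> N" using card_inj_on_le[OF jj(1,2)] by simp
  obtain p0 where p0: "p0 permutes {..<N}" "\<And>i. i < m \<Longrightarrow> p0 i = j i"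
    using inj_extends_to_permutation[OF jj(1,2)] by blast
  let ?Q = "{q. q permutes {m..<N}}"
  have inj: "inj p0" by (rule permutes_inj[OF p0(1)])
  have "(\<lambda>q. p0 \<circ> q) ` ?Q = {p. p permutes {..<N} \<and> restrict p {..<m} = j}"
  proof (intro equalityI subsetI)
    fix p assume "p \<in> (\<lambda>q. p0 \<circ> q) ` ?Q"
    then obtain q where q: "q permutes {m..<N}" "p = p0 \<circ> q" by auto
    have "p permutes {..<N}" unfolding q(2)
      by (rule permutes_compose[OF permutes_subset[OF q(1)] p0(1)]) auto
    moreover have "restrict p {..<m} = j"
    proof (rule extensionalityI[OF _ jj(3)])
      fix i assume i: "i \<in> {..<m}"
      then have "q i = i" by (intro permutes_not_in[OF q(1)]) auto
      then show "restrict p {..<m} i = j i" using i p0(2) by (simp add: q(2))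
    qed simp
    ultimately show "p \<in> {p. p permutes {..<N} \<and> restrict p {..<m} = j}" by simp
  next
    fix p assume "p \<in> {p. p permutes {..<N} \<and> restrict p {..<m} = j}"
    then have p: "p permutes {..<N}" "restrict p {..<m} = j" by auto
    define q where "q = inv_into UNIV p0 \<circ> p"
    have p0q: "p0 \<circ> q = p" unfolding q_def using permutes_inv_o(1)[OF p0(1)] by (simp add: comp_assoc[symmetric])
    have "q permutes {..<N}" unfolding q_def by (intro permutes_compose p permutes_inv p0)
    moreover have "q i = i" if "i \<in> {..<N} - {m..<N}" for i
    proof -
      have "p i = p0 i" using that p(2) p0(2)[of i] by (auto simp: fun_eq_iff restrict_def split: if_splits)
      then have "p0 (q i) = p0 i" using p0q by (auto simp: fun_eq_iff)
      then show ?thesis using inj by (simp add: inj_def)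
    qed
    ultimately have "q permutes {m..<N}" by (rule permutes_superset)
    then show "p \<in> (\<lambda>q. p0 \<circ> q) ` ?Q" using p0q by auto
  qed
  moreover have "inj_on (\<lambda>q. p0 \<circ> q) ?Q" using inj by (auto simp: inj_on_def fun_eq_iff inj_def)
  from card_image[OF this] have "card ((\<lambda>q. p0 \<circ> q) ` ?Q) = card ?Q" .
  ultimately have "card {p. p permutes {..<N} \<and> restrict p {..<m} = j} = card ?Q" by simp
  then show ?thesis using card_permutations[of "{m..<N}" "N - m"] by simp
qed

lemma sum_permutations_tuple_sum:
  fixes F :: "(nat \<Rightarrow> real) \<Rightarrow> ennreal"
  assumes mN: "m \<le> N"
  shows "(\<Sum>p | p permutes {..<N}. F (\<lambda>i\<in>{..<m}. x (p i))) = of_nat (fact (N - m)) * tuple_sum m N F x"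
proof -
  have "(\<Sum>p | p permutes {..<N}. F (\<lambda>i\<in>{..<m}. x (p i))) =
    (\<Sum>j\<in>inj_tuples m {..<N}. \<Sum>p\<in>{p \<in> {p. p permutes {..<N}}. restrict p {..<m} = j}. F (\<lambda>i\<in>{..<m}. x (p i)))"
  proof (rule sum.group[symmetric])
    show "(\<lambda>p. restrict p {..<m}) ` {p. p permutes {..<N}} \<subseteq> inj_tuples m {..<N}"
    proof clarify
      fix p assume p: "p permutes {..<N}"
      then show "restrict p {..<m} \<in> inj_tuples m {..<N}"
        using mN permutes_in_image[OF p] permutes_inj_on[OF p, of "{..<m}"] by (auto simp: inj_tuples_def inj_on_restrict_eq)
    qed
  qed (auto intro: finite_permutations)
  also have "\<dots> = (\<Sum>j\<in>inj_tuples m {..<N}. of_nat (fact (N - m)) * F (\<lambda>i\<in>{..<m}. x (j i)))"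
  proof (rule sum.cong[OF refl])
    fix j assume j: "j \<in> inj_tuples m {..<N}"
    have "(\<Sum>p\<in>{p \<in> {p. p permutes {..<N}}. restrict p {..<m} = j}. F (\<lambda>i\<in>{..<m}. x (p i))) =
      (\<Sum>p\<in>{p. p permutes {..<N} \<and> restrict p {..<m} = j}. F (\<lambda>i\<in>{..<m}. x (j i)))"
      by (rule sum.cong) (auto intro!: arg_cong[where f = F] restrict_ext)
    then show "(\<Sum>p\<in>{p \<in> {p. p permutes {..<N}}. restrict p {..<m} = j}. F (\<lambda>i\<in>{..<m}. x (p i))) =
       of_nat (fact (N - m)) * F (\<lambda>i\<in>{..<m}. x (j i))"
      by (simp add: card_permutations_extending[OF j])
  qed
  also have "\<dots> = of_nat (fact (N - m)) * tuple_sum m N F x"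
    by (simp add: tuple_sum_def sum_distrib_left)
  finally show ?thesis .
qed

text \<open>
  Off the diagonals the images of the Weyl chamber under permutations of coordinates are a partition
  of the space.
\<close>

lemma unique_sorting_permutation:
  fixes l :: "nat \<Rightarrow> real"
  assumes l: "inj_on l {..<N}"
  shows "\<exists>!p. p permutes {..<N} \<and> (\<lambda>i\<in>{..<N}. l (p i)) \<in> weyl_chamber N"
proof (rule ex_ex1I)
  define xs where "xs = sorted_list_of_set (l ` {..<N})"
  have xs: "set xs = l ` {..<N}" "sorted xs" "distinct xs" "length xs = N"
    unfolding xs_def using card_image[OF l] by auto
  define p where "p i = (if i < N then the_inv_into {..<N} l (xs ! i) else i)" for i
  have lp: "l (p i) = xs ! i" "p i < N" if "i < N" for i
  proof -
    have "xs ! i \<in> l ` {..<N}" using that xs by (metis nth_mem)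
    then show "l (p i) = xs ! i" "p i < N"
      using that f_the_inv_into_f[OF l] the_inv_into_into[OF l, of "xs ! i" "{..<N}"] by (auto simp: p_def)
  qed
  have "inj_on p {..<N}"
  proof (rule inj_onI)
    fix i k assume ik: "i \<in> {..<N}" "k \<in> {..<N}" "p i = p k"
    then have "xs ! i = xs ! k" using lp(1)[of i] lp(1)[of k] by simp
    then show "i = k" using ik xs by (simp add: nth_eq_iff_index_eq)
  qed
  then have "bij_betw p {..<N} {..<N}"
    using lp(2) by (intro bij_betw_imageI endo_inj_surj) auto
  then have "p permutes {..<N}" by (rule bij_imp_permutes) (simp add: p_def)
  moreover have "(\<lambda>i\<in>{..<N}. l (p i)) \<in> weyl_chamber N"
    using xs lp(1) by (auto simp: weyl_chamber_def sorted_iff_nth_mono)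
  ultimately show "\<exists>p. p permutes {..<N} \<and> (\<lambda>i\<in>{..<N}. l (p i)) \<in> weyl_chamber N" by blast
next
  fix p q
  assume p: "p permutes {..<N} \<and> (\<lambda>i\<in>{..<N}. l (p i)) \<in> weyl_chamber N"
    and q: "q permutes {..<N} \<and> (\<lambda>i\<in>{..<N}. l (q i)) \<in> weyl_chamber N"
  have srt: "sorted (map (l \<circ> p) [0..<N])" "distinct (map (l \<circ> p) [0..<N])" "set (map (l \<circ> p) [0..<N]) = l ` {..<N}"
    if "p permutes {..<N} \<and> (\<lambda>i\<in>{..<N}. l (p i)) \<in> weyl_chamber N" for p
  proof -
    have pp: "p permutes {..<N}" using that by simp
    show "sorted (map (l \<circ> p) [0..<N])"
      using that by (auto simp: weyl_chamber_def sorted_iff_nth_mono)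
    have "inj_on (l \<circ> p) {..<N}"
      using l permutes_inj_on[OF pp, of "{..<N}"] permutes_image[OF pp] by (intro comp_inj_on) auto
    then show "distinct (map (l \<circ> p) [0..<N])" by (simp add: distinct_map lessThan_atLeast0)
    have "(l \<circ> p) ` {..<N} = l ` {..<N}" using permutes_image[OF pp] by (simp only: image_comp[symmetric])
    then show "set (map (l \<circ> p) [0..<N]) = l ` {..<N}" by (simp add: lessThan_atLeast0)
  qed
  have "map (l \<circ> p) [0..<N] = map (l \<circ> q) [0..<N]"
    using srt[OF p] srt[OF q] by (intro sorted_distinct_set_unique) auto
  then have eq: "l (p i) = l (q i)" if "i < N" for i using that by (auto simp: map_eq_conv)
  show "p = q"
  proof
    fix i
    show "p i = q i"
    proof (cases "i < N")
      case True
      then show ?thesis using eq[OF True] permutes_in_image[of p "{..<N}" i] permutes_in_image[of q "{..<N}" i] p q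
        by (intro inj_onD[OF l]) auto
    next
      case False
      then show ?thesis using permutes_not_in[of p "{..<N}" i] permutes_not_in[of q "{..<N}" i] p q by simp
    qed
  qed
qed

lemma weyl_chamber_measurable:
  "(\<lambda>l. indicator (weyl_chamber N) l :: ennreal) \<in> borel_measurable (\<Lambda> {..<N})"
proof -
  have [measurable]: "(\<lambda>l. l i) \<in> borel_measurable (\<Lambda> {..<N})" if "i < N" for i
    using that measurable_component_singleton[of i "{..<N}" "\<lambda>_. lborel"] by auto
  have "{l \<in> space (\<Lambda> {..<N}). l \<in> weyl_chamber N} =
      (\<Inter>i\<in>{..<N}. \<Inter>j\<in>{i..<N}. {l \<in> space (\<Lambda> {..<N}). l i \<le> l j}) \<inter> space (\<Lambda> {..<N})"
    by (auto simp: weyl_chamber_def)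
  also have "\<dots> \<in> sets (\<Lambda> {..<N})"
  proof (cases "N = 0")
    case False
    then show ?thesis
      by (intro sets.Int sets.finite_INT sets.top) auto
  qed simp
  finally have "{l \<in> space (\<Lambda> {..<N}). l \<in> weyl_chamber N} \<in> sets (\<Lambda> {..<N})" .
  then have "(\<lambda>l. if l \<in> weyl_chamber N then 1 else 0 :: ennreal) \<in> borel_measurable (\<Lambda> {..<N})"
    by measurable
  then show ?thesis by (simp add: indicator_def[abs_def] of_bool_def)
qed

lemma restrict_measurable: "m \<le> N \<Longrightarrow> (\<lambda>l. \<lambda>i\<in>{..<m}. l i) \<in> measurable (\<Lambda> {..<N}) (\<Lambda> {..<m})"
  by (rule measurable_restrict_subset) auto

lemma tuple_sum_measurable:
  fixes F :: "(nat \<Rightarrow> real) \<Rightarrow> ennreal"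
  assumes "F \<in> borel_measurable (\<Lambda> {..<m})"
  shows "tuple_sum m N F \<in> borel_measurable (\<Lambda> {..<N})"
  unfolding tuple_sum_def
proof (intro borel_measurable_sum)
  fix j assume j: "j \<in> inj_tuples m {..<N}"
  have "(\<lambda>x. \<lambda>i\<in>{..<m}. x (j i)) \<in> measurable (\<Lambda> {..<N}) (\<Lambda> {..<m})"
    using j by (intro measurable_restrict measurable_component_singleton) (auto simp: inj_tuples_def PiE_def Pi_iff)
  then show "(\<lambda>x. F (\<lambda>i\<in>{..<m}. x (j i))) \<in> borel_measurable (\<Lambda> {..<N})"
    by (rule measurable_compose[OF _ assms])
qed

text \<open>
  For symmetric \<open>\<rho>\<close> the integral of \<open>\<rho> l * F l\<close> over the whole space is the sum of the integrals over all
  permuted chambers. Transported to the Weyl chamber, \<open>F\<close> is summed over all permutations, i.e.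
  \<open>fact (N - m)\<close> times over all injective tuples.
\<close>

lemma chamber_tuple_sum_integral:
  fixes F \<rho> :: "(nat \<Rightarrow> real) \<Rightarrow> ennreal"
  assumes \<rho>[measurable]: "\<rho> \<in> borel_measurable (\<Lambda> {..<N})" and F: "F \<in> borel_measurable (\<Lambda> {..<m})" and mN: "m \<le> N"
    and sym: "\<And>p l. p permutes {..<N} \<Longrightarrow> \<rho> (\<lambda>i\<in>{..<N}. l (p i)) = \<rho> l"
    and van: "\<And>l. \<not> inj_on l {..<N} \<Longrightarrow> \<rho> l = 0"
  shows "of_nat (fact (N - m)) * (\<integral>\<^sup>+l. indicator (weyl_chamber N) l * \<rho> l * tuple_sum m N F l \<partial>\<Lambda> {..<N}) =
    (\<integral>\<^sup>+l. \<rho> l * F (\<lambda>i\<in>{..<m}. l i) \<partial>\<Lambda> {..<N})"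
proof -
  let ?P = "{p. p permutes {..<N}}"
  let ?c = "\<lambda>l. indicator (weyl_chamber N) l :: ennreal"
  note [measurable] = weyl_chamber_measurable F tuple_sum_measurable[OF F, of N]
  have finP: "finite ?P" by (rule finite_permutations) simp
  have perm_meas: "(\<lambda>l. \<lambda>i\<in>{..<N}. l (p i)) \<in> measurable (\<Lambda> {..<N}) (\<Lambda> {..<N})" if "p permutes {..<N}" for p
    using permutes_in_image[OF that] by (intro measurable_restrict measurable_component_singleton) auto
  have [measurable]: "(\<lambda>l. F (\<lambda>i\<in>{..<m}. l i)) \<in> borel_measurable (\<Lambda> {..<N})"
    by (rule measurable_compose[OF restrict_measurable[OF mN] F])
  have one: "\<rho> l = (\<Sum>p\<in>?P. ?c (\<lambda>i\<in>{..<N}. l (p i)) * \<rho> l)" for l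
  proof (cases "inj_on l {..<N}")
    case True
    from unique_sorting_permutation[OF this] obtain p where p0: "p permutes {..<N} \<and> (\<lambda>i\<in>{..<N}. l (p i)) \<in> weyl_chamber N"
      and u: "\<forall>q. q permutes {..<N} \<and> (\<lambda>i\<in>{..<N}. l (q i)) \<in> weyl_chamber N \<longrightarrow> q = p"
      by (rule ex1E)
    have p: "p \<in> ?P" "(\<lambda>i\<in>{..<N}. l (p i)) \<in> weyl_chamber N" using p0 by (rule conjE, simp)+
    have uq: "q = p" if "q \<in> ?P" "(\<lambda>i\<in>{..<N}. l (q i)) \<in> weyl_chamber N" for q
      by (rule u[rule_format]) (use that in simp)
    have "(\<Sum>q\<in>?P. ?c (\<lambda>i\<in>{..<N}. l (q i)) * \<rho> l) = (\<Sum>q\<in>?P. if q = p then \<rho> l else 0)"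
    proof (rule sum.cong[OF refl])
      fix q assume q: "q \<in> ?P"
      show "?c (\<lambda>i\<in>{..<N}. l (q i)) * \<rho> l = (if q = p then \<rho> l else 0)"
      proof (cases "q = p")
        case True
        then show ?thesis using p(2) by simp
      next
        case False
        then have "(\<lambda>i\<in>{..<N}. l (q i)) \<notin> weyl_chamber N" using uq[OF q] by blast
        then show ?thesis using False by simp
      qed
    qed
    then show ?thesis using p(1) finP by (simp add: sum.delta)
  qed (simp add: van)
  have "(\<integral>\<^sup>+l. \<rho> l * F (\<lambda>i\<in>{..<m}. l i) \<partial>\<Lambda> {..<N}) =
     (\<integral>\<^sup>+l. (\<Sum>p\<in>?P. ?c (\<lambda>i\<in>{..<N}. l (p i)) * \<rho> l * F (\<lambda>i\<in>{..<m}. l i)) \<partial>\<Lambda> {..<N})"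
    by (intro nn_integral_cong) (subst one, simp add: sum_distrib_right)
  also have "\<dots> = (\<Sum>p\<in>?P. \<integral>\<^sup>+l. ?c (\<lambda>i\<in>{..<N}. l (p i)) * \<rho> l * F (\<lambda>i\<in>{..<m}. l i) \<partial>\<Lambda> {..<N})"
  proof (rule nn_integral_sum)
    fix p assume "p \<in> ?P"
    then have [measurable]: "(\<lambda>l. ?c (\<lambda>i\<in>{..<N}. l (p i))) \<in> borel_measurable (\<Lambda> {..<N})"
      by (intro measurable_compose[OF perm_meas weyl_chamber_measurable]) simp
    show "(\<lambda>l. ?c (\<lambda>i\<in>{..<N}. l (p i)) * \<rho> l * F (\<lambda>i\<in>{..<m}. l i)) \<in> borel_measurable (\<Lambda> {..<N})" by measurable
  qed
  also have "\<dots> = (\<Sum>p\<in>?P. \<integral>\<^sup>+l. ?c l * \<rho> l * F (\<lambda>i\<in>{..<m}. l (inv_into UNIV p i)) \<partial>\<Lambda> {..<N})"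
  proof (rule sum.cong[OF refl])
    fix p assume "p \<in> ?P"
    then have p: "p permutes {..<N}" by simp
    define q where "q = inv_into UNIV p"
    have q: "q permutes {..<N}" unfolding q_def by (rule permutes_inv[OF p])
    have qp: "q (p i) = i" for i using permutes_inverses[OF p] by (simp add: q_def)
    have [measurable]: "(\<lambda>l. ?c (\<lambda>i\<in>{..<N}. l (p i))) \<in> borel_measurable (\<Lambda> {..<N})"
      by (rule measurable_compose[OF perm_meas[OF p] weyl_chamber_measurable])
    let ?G = "\<lambda>l. ?c (\<lambda>i\<in>{..<N}. l (p i)) * \<rho> l * F (\<lambda>i\<in>{..<m}. l i)"
    have "(\<integral>\<^sup>+l. ?G l \<partial>\<Lambda> {..<N}) = (\<integral>\<^sup>+l. ?G (\<lambda>i\<in>{..<N}. l (q i)) \<partial>\<Lambda> {..<N})"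
      by (rule nn_integral_product_reindex[OF _ permutes_imp_bij[OF q], symmetric]) measurable
    also have "\<dots> = (\<integral>\<^sup>+l. ?c l * \<rho> l * F (\<lambda>i\<in>{..<m}. l (q i)) \<partial>\<Lambda> {..<N})"
    proof (rule nn_integral_cong)
      fix l assume l: "l \<in> space (\<Lambda> {..<N})"
      have "(\<lambda>i\<in>{..<N}. (\<lambda>i\<in>{..<N}. l (q i)) (p i)) = l"
        using l permutes_in_image[OF p] qp by (auto simp: fun_eq_iff space_PiM PiE_def extensional_def)
      moreover have "(\<lambda>i\<in>{..<m}. (\<lambda>i\<in>{..<N}. l (q i)) i) = (\<lambda>i\<in>{..<m}. l (q i))"
        using mN by (auto simp: fun_eq_iff)
      ultimately show "?G (\<lambda>i\<in>{..<N}. l (q i)) = ?c l * \<rho> l * F (\<lambda>i\<in>{..<m}. l (q i))"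
        by (simp only: sym[OF q])
    qed
    finally show "(\<integral>\<^sup>+l. ?G l \<partial>\<Lambda> {..<N}) = (\<integral>\<^sup>+l. ?c l * \<rho> l * F (\<lambda>i\<in>{..<m}. l (inv_into UNIV p i)) \<partial>\<Lambda> {..<N})"
      unfolding q_def .
  qed
  also have "\<dots> = (\<Sum>p\<in>?P. \<integral>\<^sup>+l. ?c l * \<rho> l * F (\<lambda>i\<in>{..<m}. l (p i)) \<partial>\<Lambda> {..<N})"
    by (rule sum_permutations_inverse[symmetric])
  also have "\<dots> = (\<integral>\<^sup>+l. (\<Sum>p\<in>?P. ?c l * \<rho> l * F (\<lambda>i\<in>{..<m}. l (p i))) \<partial>\<Lambda> {..<N})"
  proof (rule nn_integral_sum[symmetric])
    fix p assume "p \<in> ?P"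
    then have p: "p permutes {..<N}" by simp
    have "(\<lambda>l. \<lambda>i\<in>{..<m}. l (p i)) \<in> measurable (\<Lambda> {..<N}) (\<Lambda> {..<m})"
      using permutes_in_image[OF p] mN by (intro measurable_restrict measurable_component_singleton) auto
    from measurable_compose[OF this F]
    have [measurable]: "(\<lambda>l. F (\<lambda>i\<in>{..<m}. l (p i))) \<in> borel_measurable (\<Lambda> {..<N})" .
    show "(\<lambda>l. ?c l * \<rho> l * F (\<lambda>i\<in>{..<m}. l (p i))) \<in> borel_measurable (\<Lambda> {..<N})" by measurable
  qed
  also have "\<dots> = (\<integral>\<^sup>+l. of_nat (fact (N - m)) * (?c l * \<rho> l * tuple_sum m N F l) \<partial>\<Lambda> {..<N})"
    by (intro nn_integral_cong) (simp only: sum_distrib_left[symmetric] sum_permutations_tuple_sum[OF mN] mult_ac)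
  also have "\<dots> = of_nat (fact (N - m)) * (\<integral>\<^sup>+l. ?c l * \<rho> l * tuple_sum m N F l \<partial>\<Lambda> {..<N})"
    by (rule nn_integral_cmult) measurable
  finally show ?thesis by simp
qed

section \<open>Correlation functions of the eigenvalue density\<close>

lemma double_product_square:
  fixes a :: "nat \<Rightarrow> nat \<Rightarrow> real"
  assumes sym: "\<And>i j. a i j = a j i"
  shows "(\<Prod>k<n. \<Prod>j<k. a k j)\<^sup>2 = (\<Prod>k<n. \<Prod>j\<in>{..<n} - {k}. a k j)"
proof -
  have "(\<Prod>k<n. \<Prod>j\<in>{..<n} - {k}. a k j) = (\<Prod>k<n. (\<Prod>j<k. a k j) * (\<Prod>j\<in>{k<..<n}. a k j))"
  proof (rule prod.cong[OF refl])
    fix k assume "k \<in> {..<n}"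
    then have "{..<n} - {k} = {..<k} \<union> {k<..<n}" by auto
    then have "(\<Prod>j\<in>{..<n} - {k}. a k j) = (\<Prod>j\<in>{..<k} \<union> {k<..<n}. a k j)" by (rule arg_cong)
    also have "\<dots> = (\<Prod>j<k. a k j) * (\<Prod>j\<in>{k<..<n}. a k j)" by (rule prod.union_disjoint) auto
    finally show "(\<Prod>j\<in>{..<n} - {k}. a k j) = (\<Prod>j<k. a k j) * (\<Prod>j\<in>{k<..<n}. a k j)" .
  qed
  also have "\<dots> = (\<Prod>k<n. \<Prod>j<k. a k j) * (\<Prod>k<n. \<Prod>j\<in>{k<..<n}. a k j)" by (rule prod.distrib)
  also have "(\<Prod>k<n. \<Prod>j\<in>{k<..<n}. a k j) = (\<Prod>(k, j)\<in>(SIGMA k:{..<n}. {k<..<n}). a k j)"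
    by (rule prod.Sigma) auto
  also have "\<dots> = (\<Prod>(k, j)\<in>(SIGMA k:{..<n}. {..<k}). a k j)"
    by (rule prod.reindex_bij_witness[where i = prod.swap and j = prod.swap]) (auto simp: sym)
  also have "\<dots> = (\<Prod>k<n. \<Prod>j<k. a k j)" by (rule prod.Sigma[symmetric]) auto
  finally show ?thesis by (simp add: power2_eq_square)
qed

text \<open>
  The square of the product runs over all ordered pairs and is visibly invariant; nonnegativity permits
  taking the root.
\<close>

lemma double_product_permute:
  fixes a :: "nat \<Rightarrow> nat \<Rightarrow> real"
  assumes sym: "\<And>i j. a i j = a j i" and nn: "\<And>i j. 0 \<le> a i j" and p: "p permutes {..<n}"
  shows "(\<Prod>k<n. \<Prod>j<k. a (p k) (p j)) = (\<Prod>k<n. \<Prod>j<k. a k j)"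
proof -
  have "(\<Prod>k<n. \<Prod>j<k. a (p k) (p j))\<^sup>2 = (\<Prod>k<n. \<Prod>j\<in>{..<n} - {k}. a (p k) (p j))"
    by (rule double_product_square) (rule sym)
  also have "\<dots> = (\<Prod>k<n. \<Prod>j\<in>{..<n} - {p k}. a (p k) j)"
  proof (rule prod.cong[OF refl])
    fix k assume k: "k \<in> {..<n}"
    have "p ` ({..<n} - {k}) = p ` {..<n} - p ` {k}" by (rule image_set_diff[OF permutes_inj[OF p]])
    then have "bij_betw p ({..<n} - {k}) ({..<n} - {p k})"
      using permutes_inj_on[OF p] permutes_image[OF p] by (simp add: bij_betw_def)
    then show "(\<Prod>j\<in>{..<n} - {k}. a (p k) (p j)) = (\<Prod>j\<in>{..<n} - {p k}. a (p k) j)"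
      by (rule prod.reindex_bij_betw)
  qed
  also have "\<dots> = (\<Prod>k<n. \<Prod>j\<in>{..<n} - {k}. a k j)"
    by (rule prod.permute[OF p, of "\<lambda>k. \<Prod>j\<in>{..<n} - {k}. a k j", symmetric, unfolded o_def])
  also have "\<dots> = (\<Prod>k<n. \<Prod>j<k. a k j)\<^sup>2" by (rule double_product_square[symmetric]) (rule sym)
  finally show ?thesis
    by (rule power2_eq_imp_eq) (auto intro!: prod_nonneg nn)
qed

lemma unnormalized_density_permute:
  assumes p: "p permutes {..<N}"
  shows "unnormalized_density \<beta> V N (\<lambda>i\<in>{..<N}. l (p i)) = unnormalized_density \<beta> V N l"
proof -
  have pN: "p i < N" if "i < N" for i using permutes_in_image[OF p] that by simp
  have "(\<Prod>k<N. \<Prod>j<k. \<bar>(\<lambda>i\<in>{..<N}. l (p i)) k - (\<lambda>i\<in>{..<N}. l (p i)) j\<bar> ^ \<beta>) = (\<Prod>k<N. \<Prod>j<k. \<bar>l (p k) - l (p j)\<bar> ^ \<beta>)"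
    by (intro prod.cong refl) auto
  also have "\<dots> = (\<Prod>k<N. \<Prod>j<k. \<bar>l k - l j\<bar> ^ \<beta>)"
    by (rule double_product_permute[where a = "\<lambda>i j. \<bar>l i - l j\<bar> ^ \<beta>"]) (simp_all add: p abs_minus_commute)
  finally have 1: "(\<Prod>k<N. \<Prod>j<k. \<bar>(\<lambda>i\<in>{..<N}. l (p i)) k - (\<lambda>i\<in>{..<N}. l (p i)) j\<bar> ^ \<beta>) = (\<Prod>k<N. \<Prod>j<k. \<bar>l k - l j\<bar> ^ \<beta>)" .
  have "(\<Prod>j<N. weight \<beta> V N ((\<lambda>i\<in>{..<N}. l (p i)) j)) = (\<Prod>j<N. weight \<beta> V N (l (p j)))"
    by (intro prod.cong refl) auto
  also have "\<dots> = (\<Prod>j<N. weight \<beta> V N (l j))"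
    by (rule prod.permute[OF p, of "\<lambda>j. weight \<beta> V N (l j)", symmetric, unfolded o_def])
  finally show ?thesis using 1 by (simp add: unnormalized_density_def)
qed

lemma unnormalized_density_nonneg: "0 \<le> unnormalized_density \<beta> V N l"
proof -
  have "0 \<le> (\<Prod>k<N. \<Prod>j<k. \<bar>l k - l j\<bar> ^ \<beta>)" by (intro prod_nonneg) simp
  moreover have "0 \<le> (\<Prod>j<N. weight \<beta> V N (l j))" by (intro prod_nonneg) (simp add: weight_def)
  ultimately show ?thesis by (simp add: unnormalized_density_def)
qed

lemma unnormalized_density_cong:
  "(\<And>i. i < N \<Longrightarrow> l i = l' i) \<Longrightarrow> unnormalized_density \<beta> V N l = unnormalized_density \<beta> V N l'"
proof -
  assume eq: "\<And>i. i < N \<Longrightarrow> l i = l' i"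
  have "(\<Prod>k<N. \<Prod>j<k. \<bar>l k - l j\<bar> ^ \<beta>) = (\<Prod>k<N. \<Prod>j<k. \<bar>l' k - l' j\<bar> ^ \<beta>)"
  proof (rule prod.cong[OF refl], rule prod.cong[OF refl])
    fix k j assume "k \<in> {..<N}" "j \<in> {..<k}"
    then show "\<bar>l k - l j\<bar> ^ \<beta> = \<bar>l' k - l' j\<bar> ^ \<beta>" using eq[of k] eq[of j] by simp
  qed
  moreover have "(\<Prod>j<N. weight \<beta> V N (l j)) = (\<Prod>j<N. weight \<beta> V N (l' j))"
    by (rule prod.cong[OF refl]) (simp add: eq)
  ultimately show ?thesis by (simp add: unnormalized_density_def)
qed

lemma unnormalized_density_coincident:
  assumes "1 \<le> \<beta>" "\<not> inj_on l {..<N}" shows "unnormalized_density \<beta> V N l = 0"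
proof -
  obtain i k where "i < N" "k < N" "l i = l k" "i \<noteq> k" using assms(2) by (auto simp: inj_on_def)
  then have "(i < k \<and> k < N \<and> l i = l k) \<or> (k < i \<and> i < N \<and> l k = l i)" by auto
  then obtain i k where ik: "i < k" "k < N" "l i = l k" by blast
  have inner: "(\<Prod>j<k. \<bar>l k - l j\<bar> ^ \<beta>) = 0"
    using ik assms(1) by (intro prod_zero) (auto intro!: bexI[of _ i])
  have "(\<Prod>k<N. \<Prod>j<k. \<bar>l k - l j\<bar> ^ \<beta>) = 0"
  proof (rule prod_zero)
    show "\<exists>k\<in>{..<N}. (\<Prod>j<k. \<bar>l k - l j\<bar> ^ \<beta>) = 0"
      by (rule bexI[of _ k]) (use inner ik(2) in simp_all)
  qed simp
  then show ?thesis by (simp add: unnormalized_density_def)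
qed

text \<open>
  Measurability of the weight is assumed rather than that of \<open>V\<close>: integrability of the weight provides it.
\<close>

locale eigenvalue_weight =
  fixes \<beta> :: nat and V :: "real \<Rightarrow> real" and N :: nat
  assumes \<beta>: "1 \<le> \<beta>" and V: "(\<lambda>x. exp (- (real N * V x))) \<in> borel_measurable borel"
begin

abbreviation "U \<equiv> unnormalized_density \<beta> V N"

abbreviation "\<rho> \<equiv> eigenvalue_density \<beta> V N"

definition normalization :: real where
  "normalization = (LINT l:weyl_chamber N|\<Lambda> {..<N}. U l)"

lemma density_eq: "\<rho> l = U l / normalization"
  by (simp add: eigenvalue_density_def normalization_def)

lemma weight_measurable: "weight \<beta> V N \<in> borel_measurable borel"
proof -
  have "weight \<beta> V N x = exp (- (real N * V x)) ^ (if \<beta> = 4 then 2 else 1)" for x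
    by (simp add: weight_def exp_of_nat_mult[symmetric] power2_eq_square exp_add[symmetric] algebra_simps)
  then have "weight \<beta> V N = (\<lambda>x. exp (- (real N * V x)) ^ (if \<beta> = 4 then 2 else 1))" by blast
  then show ?thesis using V by simp
qed

lemma U_measurable [measurable]: "U \<in> borel_measurable (\<Lambda> {..<N})"
proof -
  have [measurable]: "(\<lambda>l. l i) \<in> borel_measurable (\<Lambda> {..<N})" if "i < N" for i
    using that measurable_component_singleton[of i "{..<N}" "\<lambda>_. lborel"] by auto
  show ?thesis unfolding unnormalized_density_def[abs_def]
  proof (intro borel_measurable_times borel_measurable_prod)
    fix k j assume "k \<in> {..<N}" "j \<in> {..<k}"
    then have [measurable]: "(\<lambda>l. l k) \<in> borel_measurable (\<Lambda> {..<N})" "(\<lambda>l. l j) \<in> borel_measurable (\<Lambda> {..<N})" by auto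
    show "(\<lambda>l. \<bar>l k - l j\<bar> ^ \<beta>) \<in> borel_measurable (\<Lambda> {..<N})" by measurable
  next
    fix j assume "j \<in> {..<N}"
    then have "(\<lambda>l. l j) \<in> borel_measurable (\<Lambda> {..<N})" by auto
    then show "(\<lambda>l. weight \<beta> V N (l j)) \<in> borel_measurable (\<Lambda> {..<N})"
      by (rule measurable_compose[OF _ weight_measurable])
  qed
qed

lemma density_measurable [measurable]: "\<rho> \<in> borel_measurable (\<Lambda> {..<N})"
  unfolding density_eq[abs_def] by measurable

lemma normalization_nonneg: "0 \<le> normalization"
  unfolding normalization_def set_lebesgue_integral_def
  by (intro integral_nonneg_AE) (auto simp: unnormalized_density_nonneg)

lemma density_nonneg: "0 \<le> \<rho> l"
  by (simp add: density_eq normalization_nonneg unnormalized_density_nonneg)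

lemma density_permute: "p permutes {..<N} \<Longrightarrow> \<rho> (\<lambda>i\<in>{..<N}. l (p i)) = \<rho> l"
  by (simp only: density_eq unnormalized_density_permute)

lemma density_coincident: "\<not> inj_on l {..<N} \<Longrightarrow> \<rho> l = 0"
  using \<beta> by (simp add: density_eq unnormalized_density_coincident)

lemma density_cong: "(\<And>i. i < N \<Longrightarrow> l i = l' i) \<Longrightarrow> \<rho> l = \<rho> l'"
  unfolding density_eq using unnormalized_density_cong[of N l l'] by simp

text \<open>
  The density is defined by a division by the normalization constant, which may be \<open>0\<close> by convention when the
  integral diverges; then the density vanishes identically.
\<close>

lemma chamber_mass:
  "(\<integral>\<^sup>+l. indicator (weyl_chamber N) l * ennreal (\<rho> l) \<partial>\<Lambda> {..<N}) = (if normalization = 0 then 0 else 1)"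
proof (cases "normalization = 0")
  case True
  then show ?thesis by (simp add: density_eq)
next
  case False
  let ?f = "\<lambda>l. indicator (weyl_chamber N) l *\<^sub>R U l"
  have int: "integrable (\<Lambda> {..<N}) ?f"
    using False not_integrable_integral_eq unfolding normalization_def set_lebesgue_integral_def by blast
  have "(\<integral>\<^sup>+l. ennreal (?f l) \<partial>\<Lambda> {..<N}) = ennreal normalization"
    unfolding normalization_def set_lebesgue_integral_def
    by (rule nn_integral_eq_integral[OF int]) (simp add: unnormalized_density_nonneg)
  have eq: "indicator (weyl_chamber N) l * ennreal (\<rho> l) = ennreal (1 / normalization) * ennreal (?f l)" for l
    using normalization_nonneg False unnormalized_density_nonneg[of \<beta> V N l]
    by (auto simp: density_eq indicator_def simp flip: ennreal_mult)
  have "(\<integral>\<^sup>+l. indicator (weyl_chamber N) l * ennreal (\<rho> l) \<partial>\<Lambda> {..<N}) =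
     ennreal (1 / normalization) * (\<integral>\<^sup>+l. ennreal (?f l) \<partial>\<Lambda> {..<N})"
    unfolding eq by (rule nn_integral_cmult) (use int in auto)
  also have "\<dots> = ennreal (1 / normalization) * ennreal normalization"
    unfolding \<open>(\<integral>\<^sup>+l. ennreal (?f l) \<partial>\<Lambda> {..<N}) = ennreal normalization\<close> ..
  also have "\<dots> = ennreal (1 / normalization * normalization)"
    using normalization_nonneg by (intro ennreal_mult[symmetric]) auto
  finally show ?thesis using False by simp
qed

lemma density_mass_finite: "(\<integral>\<^sup>+l. ennreal (\<rho> l) \<partial>\<Lambda> {..<N}) \<noteq> \<infinity>"
proof -
  have m: "(\<lambda>l. ennreal (\<rho> l)) \<in> borel_measurable (\<Lambda> {..<N})" by measurable
  have t: "tuple_sum 0 N (\<lambda>_. 1) l = (1 :: ennreal)" for l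
    by (simp add: tuple_sum_def card_inj_tuples)
  have "of_nat (fact (N - 0)) * (\<integral>\<^sup>+l. indicator (weyl_chamber N) l * ennreal (\<rho> l) * tuple_sum 0 N (\<lambda>_. 1) l \<partial>\<Lambda> {..<N}) =
    (\<integral>\<^sup>+l. ennreal (\<rho> l) * 1 \<partial>\<Lambda> {..<N})"
    by (rule chamber_tuple_sum_integral[OF m]) (auto simp: density_permute density_coincident)
  then have "(\<integral>\<^sup>+l. ennreal (\<rho> l) \<partial>\<Lambda> {..<N}) = of_nat (fact N) * (if normalization = 0 then 0 else 1)"
    using chamber_mass by (simp add: t)
  then show ?thesis by (simp add: ennreal_mult_eq_top_iff)
qed

lemma corr_eq_merge:
  "m \<le> N \<Longrightarrow> corr \<beta> V N m t = (LINT y|\<Lambda> {m..<N}. \<rho> (merge {..<m} {m..<N} (t, y))) / fact (N - m)"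
  unfolding corr_def
  by (intro arg_cong2[where f = "(/)"] refl Bochner_Integration.integral_cong density_cong) (auto simp: merge_def)

lemma merge_density_measurable:
  assumes "m \<le> N"
  shows "(\<lambda>(t, y). \<rho> (merge {..<m} {m..<N} (t, y))) \<in> borel_measurable (\<Lambda> {..<m} \<Otimes>\<^sub>M \<Lambda> {m..<N})"
proof -
  have un: "{..<m} \<union> {m..<N} = {..<N}" using assms by auto
  have "merge {..<m} {m..<N} \<in> measurable (\<Lambda> {..<m} \<Otimes>\<^sub>M \<Lambda> {m..<N}) (\<Lambda> ({..<m} \<union> {m..<N}))"
    by (rule measurable_merge)
  then have "merge {..<m} {m..<N} \<in> measurable (\<Lambda> {..<m} \<Otimes>\<^sub>M \<Lambda> {m..<N}) (\<Lambda> {..<N})" unfolding un .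
  from measurable_compose[OF this density_measurable] show ?thesis by (simp add: case_prod_unfold)
qed

lemma corr_measurable:
  assumes "m \<le> N" shows "corr \<beta> V N m \<in> borel_measurable (\<Lambda> {..<m})"
proof -
  interpret sigma_finite_measure "\<Lambda> {m..<N}" by (rule lborel_product.sigma_finite) simp
  have "(\<lambda>t. LINT y|\<Lambda> {m..<N}. \<rho> (merge {..<m} {m..<N} (t, y))) \<in> borel_measurable (\<Lambda> {..<m})"
    by (rule borel_measurable_lebesgue_integral[OF merge_density_measurable[OF assms]])
  then show ?thesis unfolding corr_eq_merge[OF assms, abs_def] by measurable
qed

lemma corr_nonneg: "m \<le> N \<Longrightarrow> 0 \<le> corr \<beta> V N m t"
  unfolding corr_eq_merge by (intro divide_nonneg_nonneg integral_nonneg_AE) (auto simp: density_nonneg)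

text \<open>
  The defining property of correlation functions for the ordered eigenvalues. It follows from symmetry
  and Fubini, the integral over the remaining coordinates being \<open>fact (N - m) * corr\<close>.
\<close>

theorem chamber_correlation:
  assumes mN: "m \<le> N" and F: "F \<in> borel_measurable (\<Lambda> {..<m})"
  shows "(\<integral>\<^sup>+l. indicator (weyl_chamber N) l * ennreal (\<rho> l) * tuple_sum m N F l \<partial>\<Lambda> {..<N}) =
    (\<integral>\<^sup>+t. F t * ennreal (corr \<beta> V N m t) \<partial>\<Lambda> {..<m})" (is "?L = ?R")
proof -
  note [measurable] = F corr_measurable[OF mN]
  interpret S: sigma_finite_measure "\<Lambda> {m..<N}" by (rule lborel_product.sigma_finite) simp
  have un: "{..<m} \<union> {m..<N} = {..<N}" and dj: "{..<m} \<inter> {m..<N} = {}" using mN by auto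
  let ?\<rho> = "\<lambda>t y. \<rho> (merge {..<m} {m..<N} (t, y))"
  let ?I = "\<lambda>t. \<integral>\<^sup>+y. ennreal (?\<rho> t y) \<partial>\<Lambda> {m..<N}"
  have mm: "(\<lambda>(t, y). ennreal (?\<rho> t y)) \<in> borel_measurable (\<Lambda> {..<m} \<Otimes>\<^sub>M \<Lambda> {m..<N})"
    using merge_density_measurable[OF mN] by (simp add: case_prod_unfold)
  have I_meas[measurable]: "?I \<in> borel_measurable (\<Lambda> {..<m})"
    by (rule S.borel_measurable_nn_integral[OF mm])
  have fact_ennreal: "(of_nat (fact (N - m)) :: ennreal) = ennreal (fact (N - m))"
    by (subst ennreal_of_nat_eq_real_of_nat, subst of_nat_fact, rule refl)
  have sec: "(\<lambda>y. ?\<rho> t y) \<in> borel_measurable (\<Lambda> {m..<N})" if "t \<in> space (\<Lambda> {..<m})" for t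
    using measurable_Pair2[OF merge_density_measurable[OF mN] that] by simp
  have fold: "(\<integral>\<^sup>+l. f l \<partial>\<Lambda> {..<N}) = (\<integral>\<^sup>+t. (\<integral>\<^sup>+y. f (merge {..<m} {m..<N} (t, y)) \<partial>\<Lambda> {m..<N}) \<partial>\<Lambda> {..<m})"
    if "f \<in> borel_measurable (\<Lambda> {..<N})" for f
    using lborel_product.product_nn_integral_fold[OF dj, of f] that by (simp add: un)
  have fm[measurable]: "(\<lambda>l. F (\<lambda>i\<in>{..<m}. l i)) \<in> borel_measurable (\<Lambda> {..<N})"
    by (rule measurable_compose[OF restrict_measurable[OF mN] F])
  have "of_nat (fact (N - m)) * ?L = (\<integral>\<^sup>+l. ennreal (\<rho> l) * F (\<lambda>i\<in>{..<m}. l i) \<partial>\<Lambda> {..<N})"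
    by (rule chamber_tuple_sum_integral[OF _ F mN]) (auto simp: density_permute density_coincident)
  also have "\<dots> = (\<integral>\<^sup>+t. (\<integral>\<^sup>+y. ennreal (?\<rho> t y) * F (\<lambda>i\<in>{..<m}. merge {..<m} {m..<N} (t, y) i) \<partial>\<Lambda> {m..<N}) \<partial>\<Lambda> {..<m})"
    by (rule fold) measurable
  also have "\<dots> = (\<integral>\<^sup>+t. ?I t * F t \<partial>\<Lambda> {..<m})"
  proof (rule nn_integral_cong)
    fix t assume t: "t \<in> space (\<Lambda> {..<m})"
    have "(\<lambda>i\<in>{..<m}. merge {..<m} {m..<N} (t, y) i) = t" for y
      using t by (auto simp: merge_def fun_eq_iff space_PiM PiE_def extensional_def)
    then have "(\<integral>\<^sup>+y. ennreal (?\<rho> t y) * F (\<lambda>i\<in>{..<m}. merge {..<m} {m..<N} (t, y) i) \<partial>\<Lambda> {m..<N}) =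
        (\<integral>\<^sup>+y. ennreal (?\<rho> t y) * F t \<partial>\<Lambda> {m..<N})" by simp
    also have "\<dots> = ?I t * F t" by (rule nn_integral_multc) (use sec[OF t] in measurable)
    finally show "(\<integral>\<^sup>+y. ennreal (?\<rho> t y) * F (\<lambda>i\<in>{..<m}. merge {..<m} {m..<N} (t, y) i) \<partial>\<Lambda> {m..<N}) = ?I t * F t" .
  qed
  also have "\<dots> = (\<integral>\<^sup>+t. of_nat (fact (N - m)) * (F t * ennreal (corr \<beta> V N m t)) \<partial>\<Lambda> {..<m})"
  proof (rule nn_integral_cong_AE)
    have "(\<integral>\<^sup>+t. ?I t \<partial>\<Lambda> {..<m}) \<noteq> \<infinity>"
      using fold[of "\<lambda>l. ennreal (\<rho> l)"] density_mass_finite by simp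
    then have "AE t in \<Lambda> {..<m}. ?I t \<noteq> \<infinity>" by (rule nn_integral_PInf_AE[OF I_meas])
    moreover have "AE t in \<Lambda> {..<m}. t \<in> space (\<Lambda> {..<m})" by (rule AE_space)
    ultimately show "AE t in \<Lambda> {..<m}. ?I t * F t = of_nat (fact (N - m)) * (F t * ennreal (corr \<beta> V N m t))"
    proof eventually_elim
      case (elim t)
      have "integrable (\<Lambda> {m..<N}) (\<lambda>y. ?\<rho> t y)"
        using elim(1) sec[OF elim(2)] by (intro integrableI_nonneg) (auto simp: density_nonneg top.not_eq_extremum)
      then have "?I t = ennreal (LINT y|\<Lambda> {m..<N}. ?\<rho> t y)"
        by (rule nn_integral_eq_integral) (simp add: density_nonneg)
      also have "(LINT y|\<Lambda> {m..<N}. ?\<rho> t y) = fact (N - m) * corr \<beta> V N m t"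
        by (simp add: corr_eq_merge[OF mN])
      also have "ennreal (fact (N - m) * corr \<beta> V N m t) = of_nat (fact (N - m)) * ennreal (corr \<beta> V N m t)"
        unfolding fact_ennreal by (rule ennreal_mult) (simp_all add: corr_nonneg mN)
      finally show ?case by (simp add: mult_ac)
    qed
  qed
  also have "\<dots> = of_nat (fact (N - m)) * ?R" by (rule nn_integral_cmult) measurable
  finally have eq: "of_nat (fact (N - m)) * ?L = of_nat (fact (N - m)) * ?R" .
  have cancel: "b = c" if "a * b = a * c" "a \<noteq> 0" "a \<noteq> \<infinity>" for a b c :: ennreal
    using that unfolding ennreal_mult_cancel_left infinity_ennreal_def by blast
  show ?thesis by (rule cancel[OF eq]) simp_all
qed

end

section \<open>The rescaled spectrum as a point process\<close>

lemma interval_rescaled: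
  assumes J: "interval_with_centre a J" and k: "0 < real N * \<psi> a"
  defines "\<rho> \<equiv> real N * \<psi> a * measure lborel J / 2"
  shows "0 < \<rho>" "{- \<rho><..<\<rho>} \<subseteq> rescale \<psi> a N ` J" "rescale \<psi> a N ` J \<subseteq> {- \<rho>..\<rho>}"
proof -
  obtain q where q: "q > 0" "{a - q<..<a + q} \<subseteq> J" "J \<subseteq> {a - q..a + q}"
    using J by (auto simp: interval_with_centre_def)
  have Jb: "J \<in> sets borel"
  proof -
    have "J = {a - q<..<a + q} \<union> (J \<inter> {a - q, a + q})" using q by force
    also have "\<dots> \<in> sets borel" by (intro sets.Un) (auto intro: sets.countable countable_finite)
    finally show ?thesis .
  qed
  have J_meas: "J \<in> fmeasurable lborel"
  proof (rule fmeasurableI)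
    have "emeasure lborel J \<le> emeasure lborel {a - q..a + q}" using q Jb by (intro emeasure_mono) auto
    also have "\<dots> < \<infinity>" using q by simp
    finally show "emeasure lborel J < \<infinity>" .
  qed (use Jb in simp)
  have "measure lborel {a - q<..<a + q} \<le> measure lborel J"
    using q J_meas by (intro measure_mono_fmeasurable) auto
  moreover have "measure lborel J \<le> measure lborel {a - q..a + q}"
    using q Jb by (intro measure_mono_fmeasurable) (auto intro!: fmeasurableI)
  ultimately have mJ: "measure lborel J = 2 * q" using q by simp
  define c where "c = real N * \<psi> a"
  have c: "0 < c" using k by (simp add: c_def)
  have \<rho>: "\<rho> = c * q" by (simp add: \<rho>_def mJ c_def)
  show "0 < \<rho>" using c q by (simp add: \<rho>)
  show "rescale \<psi> a N ` J \<subseteq> {- \<rho>..\<rho>}"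
  proof clarify
    fix x assume "x \<in> J"
    then have "- q \<le> x - a" "x - a \<le> q" using q(3) by auto
    then have "(- q) * c \<le> (x - a) * c" "(x - a) * c \<le> q * c" using c by (intro mult_right_mono; simp)+
    then show "rescale \<psi> a N x \<in> {- \<rho>..\<rho>}" by (simp add: rescale_def c_def[symmetric] \<rho> mult.commute)
  qed
  show "{- \<rho><..<\<rho>} \<subseteq> rescale \<psi> a N ` J"
  proof
    fix y assume y: "y \<in> {- \<rho><..<\<rho>}"
    have "- q < y / c" "y / c < q" using y c by (simp_all add: \<rho> pos_less_divide_eq pos_divide_less_eq mult.commute)
    then have "a + y / c \<in> J" using q(2) by auto
    moreover have "rescale \<psi> a N (a + y / c) = y" using c by (simp add: rescale_def c_def[symmetric])
    ultimately show "y \<in> rescale \<psi> a N ` J" by (metis imageI)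
  qed
qed

definition rescaled_spectrum_law ::
    "nat \<Rightarrow> (real \<Rightarrow> real) \<Rightarrow> (real \<Rightarrow> real) \<Rightarrow> real \<Rightarrow> nat \<Rightarrow> (nat \<Rightarrow> real) measure" where
  "rescaled_spectrum_law \<beta> V \<psi> a N =
     distr (ensemble \<beta> V N) (\<Lambda> {..<N}) (\<lambda>h. \<lambda>i\<in>{..<N}. rescale \<psi> a N (eigenvalues \<beta> N h i))"

locale ensemble_setting =
  fixes \<beta> :: nat and V \<psi> :: "real \<Rightarrow> real" and a :: real and I :: "nat \<Rightarrow> real set"
  assumes \<beta>: "1 \<le> \<beta>" and setting: "setting \<beta> V \<psi> a I"
begin

lemma \<psi>_pos: "0 < \<psi> a"
  using setting by (simp add: setting_def)

lemma scale_pos: "1 \<le> N \<Longrightarrow> 0 < real N * \<psi> a"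
  using \<psi>_pos by simp

lemma eigenvalue_weight: "1 \<le> N \<Longrightarrow> eigenvalue_weight \<beta> V N"
proof
  assume N: "1 \<le> N"
  then have "integrable lborel (\<lambda>x. x ^ 0 * exp (- (real N * V x)))"
    using setting unfolding setting_def by blast
  then show "(\<lambda>x. exp (- (real N * V x))) \<in> borel_measurable borel" by simp
qed (rule \<beta>)

lemma law: "1 \<le> N \<Longrightarrow> distributed (ensemble \<beta> V N) (\<Lambda> {..<N}) (eigenvalues \<beta> N)
    (\<lambda>l. ennreal (indicator (weyl_chamber N) l * eigenvalue_density \<beta> V N l))"
proof -
  assume N: "1 \<le> N"
  then have "has_eigenvalue_density \<beta> V N" using setting by (simp add: setting_def)
  then show ?thesis by (simp only: has_eigenvalue_density_def)
qed

abbreviation "A N \<equiv> rescale \<psi> a N ` I N"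

abbreviation "r N \<equiv> real N * \<psi> a * measure lborel (I N) / 2"

abbreviation "D \<equiv> rescaled_spectrum_law \<beta> V \<psi> a"

abbreviation "X N \<equiv> (\<lambda>l. \<lambda>i\<in>{..<N}. rescale \<psi> a N (l i))"

lemma A_interval:
  assumes "1 \<le> N"
  shows "0 < r N" "{- r N<..<r N} \<subseteq> A N" "A N \<subseteq> {- r N..r N}"
proof -
  have "interval_with_centre a (I N)" using setting assms unfolding setting_def by blast
  note * = this scale_pos[OF assms]
  show "0 < r N" by (rule interval_rescaled(1)[of a "I N" N \<psi>, OF *])
  show "{- r N<..<r N} \<subseteq> A N" by (rule interval_rescaled(2)[of a "I N" N \<psi>, OF *])
  show "A N \<subseteq> {- r N..r N}" by (rule interval_rescaled(3)[of a "I N" N \<psi>, OF *])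
qed

lemma r_lim: "filterlim r at_top sequentially"
proof -
  have "filterlim (\<lambda>N. real N * measure lborel (I N)) at_top sequentially"
    using setting unfolding setting_def by blast
  then have "filterlim (\<lambda>N. \<psi> a / 2 * (real N * measure lborel (I N))) at_top sequentially"
    using \<psi>_pos by (intro filterlim_tendsto_pos_mult_at_top[OF tendsto_const]) auto
  then show ?thesis by (simp add: mult_ac)
qed

lemma X_measurable [measurable]: "X N \<in> measurable (\<Lambda> {..<N}) (\<Lambda> {..<N})"
proof (rule measurable_restrict)
  fix i assume i: "i \<in> {..<N}"
  have [measurable]: "(\<lambda>l. l i) \<in> borel_measurable (\<Lambda> {..<N})"
    using i measurable_component_singleton[of i "{..<N}" "\<lambda>_. lborel"] by auto
  have "(\<lambda>l. rescale \<psi> a N (l i)) \<in> borel_measurable (\<Lambda> {..<N})" unfolding rescale_def by measurable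
  then show "(\<lambda>l. rescale \<psi> a N (l i)) \<in> measurable (\<Lambda> {..<N}) lborel" by simp
qed

lemma XE_measurable: "1 \<le> N \<Longrightarrow> (\<lambda>h. X N (eigenvalues \<beta> N h)) \<in> measurable (ensemble \<beta> V N) (\<Lambda> {..<N})"
proof -
  assume "1 \<le> N"
  then have "eigenvalues \<beta> N \<in> measurable (ensemble \<beta> V N) (\<Lambda> {..<N})"
    using law by (simp add: distributed_def)
  then show ?thesis by (rule measurable_compose[OF _ X_measurable])
qed

lemma nn_integral_law:
  assumes N: "1 \<le> N" and G: "G \<in> borel_measurable (\<Lambda> {..<N})"
  shows "(\<integral>\<^sup>+x. G x \<partial>D N) =
    (\<integral>\<^sup>+l. indicator (weyl_chamber N) l * ennreal (eigenvalue_density \<beta> V N l) * G (X N l) \<partial>\<Lambda> {..<N})"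
proof -
  have "(\<integral>\<^sup>+x. G x \<partial>D N) = (\<integral>\<^sup>+h. G (X N (eigenvalues \<beta> N h)) \<partial>ensemble \<beta> V N)"
    unfolding rescaled_spectrum_law_def by (rule nn_integral_distr[OF XE_measurable[OF N]]) (use G in simp)
  also have "\<dots> = (\<integral>\<^sup>+l. ennreal (indicator (weyl_chamber N) l * eigenvalue_density \<beta> V N l) * G (X N l) \<partial>\<Lambda> {..<N})"
    by (rule distributed_nn_integral[OF law[OF N], symmetric]) (rule measurable_compose[OF X_measurable G])
  also have "\<dots> = (\<integral>\<^sup>+l. indicator (weyl_chamber N) l * ennreal (eigenvalue_density \<beta> V N l) * G (X N l) \<partial>\<Lambda> {..<N})"
    by (intro nn_integral_cong) (auto simp: indicator_def)
  finally show ?thesis .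
qed

lemma law_mass:
  assumes N: "1 \<le> N"
  shows "emeasure (D N) (space (D N)) = (if eigenvalue_weight.normalization \<beta> V N = 0 then 0 else 1)"
proof -
  have "emeasure (D N) (space (D N)) = (\<integral>\<^sup>+x. 1 \<partial>D N)" by simp
  also have "\<dots> = (\<integral>\<^sup>+l. indicator (weyl_chamber N) l * ennreal (eigenvalue_density \<beta> V N l) * 1 \<partial>\<Lambda> {..<N})"
    by (rule nn_integral_law[OF N]) simp
  also have "\<dots> = (if eigenvalue_weight.normalization \<beta> V N = 0 then 0 else 1)"
    using eigenvalue_weight.chamber_mass[OF eigenvalue_weight[OF N]] by simp
  finally show ?thesis .
qed

lemma corr_restrict: "corr \<beta> V N m (\<lambda>i\<in>{..<m}. t i) = corr \<beta> V N m t"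
proof -
  have "(\<lambda>i. if i < m then (\<lambda>i\<in>{..<m}. t i) i else y i) = (\<lambda>i. if i < m then t i else y i)" for y :: "nat \<Rightarrow> real"
    by (auto simp: fun_eq_iff)
  then show ?thesis by (simp add: corr_def)
qed

lemma scaled_corr_measurable:
  assumes "1 \<le> N" "m \<le> N"
  shows "scaled_corr \<beta> V \<psi> a N m \<in> borel_measurable (\<Lambda> {..<m})"
proof -
  have "(\<lambda>t. \<lambda>i\<in>{..<m}. unscale \<psi> a N (t i)) \<in> measurable (\<Lambda> {..<m}) (\<Lambda> {..<m})"
  proof (rule measurable_restrict)
    fix i assume i: "i \<in> {..<m}"
    have [measurable]: "(\<lambda>l. l i) \<in> borel_measurable (\<Lambda> {..<m})"
      using i measurable_component_singleton[of i "{..<m}" "\<lambda>_. lborel"] by auto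
    have "(\<lambda>l. unscale \<psi> a N (l i)) \<in> borel_measurable (\<Lambda> {..<m})" unfolding unscale_def by measurable
    then show "(\<lambda>l. unscale \<psi> a N (l i)) \<in> measurable (\<Lambda> {..<m}) lborel" by simp
  qed
  from measurable_compose[OF this eigenvalue_weight.corr_measurable[OF eigenvalue_weight[OF assms(1)] assms(2)]]
  have "(\<lambda>t. corr \<beta> V N m (\<lambda>i. unscale \<psi> a N (t i))) \<in> borel_measurable (\<Lambda> {..<m})"
    by (simp only: corr_restrict)
  then show ?thesis unfolding scaled_corr_def[abs_def] by measurable
qed

lemma scaled_corr_nonneg: "1 \<le> N \<Longrightarrow> m \<le> N \<Longrightarrow> 0 \<le> scaled_corr \<beta> V \<psi> a N m t"
proof -
  assume N: "1 \<le> N" and m: "m \<le> N"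
  have "0 \<le> corr \<beta> V N m (\<lambda>i. unscale \<psi> a N (t i))"
    by (rule eigenvalue_weight.corr_nonneg[OF eigenvalue_weight[OF N] m])
  moreover have "0 \<le> (real N * \<psi> a) ^ m" using scale_pos[OF N] by simp
  ultimately show ?thesis unfolding scaled_corr_def by (rule divide_nonneg_nonneg)
qed

text \<open>
  Change of variables: the Jacobian of the affine map is the power of \<open>N * \<psi> a\<close> in \<open>scaled_corr\<close>.
\<close>

lemma correlation_formula:
  assumes N: "1 \<le> N" and m: "m \<le> N" and F: "F \<in> borel_measurable (\<Lambda> {..<m})"
  shows "(\<integral>\<^sup>+x. tuple_sum m N F x \<partial>D N) = (\<integral>\<^sup>+t. F t * ennreal (scaled_corr \<beta> V \<psi> a N m t) \<partial>\<Lambda> {..<m})"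
proof -
  define c where "c = 1 / (real N * \<psi> a)"
  have c: "0 < c" using scale_pos[OF N] by (simp add: c_def)
  let ?Y = "\<lambda>t. \<lambda>i\<in>{..<m}. rescale \<psi> a N (t i)"
  have Y: "?Y \<in> measurable (\<Lambda> {..<m}) (\<Lambda> {..<m})"
  proof (rule measurable_restrict)
    fix i assume i: "i \<in> {..<m}"
    have [measurable]: "(\<lambda>l. l i) \<in> borel_measurable (\<Lambda> {..<m})"
      using i measurable_component_singleton[of i "{..<m}" "\<lambda>_. lborel"] by auto
    have "(\<lambda>l. rescale \<psi> a N (l i)) \<in> borel_measurable (\<Lambda> {..<m})" unfolding rescale_def by measurable
    then show "(\<lambda>l. rescale \<psi> a N (l i)) \<in> measurable (\<Lambda> {..<m}) lborel" by simp
  qed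
  have FY: "(\<lambda>t. F (?Y t)) \<in> borel_measurable (\<Lambda> {..<m})" by (rule measurable_compose[OF Y F])
  note W = eigenvalue_weight[OF N]
  note cm = eigenvalue_weight.corr_measurable[OF W m]
  have [measurable]: "(\<lambda>t. F (?Y t) * ennreal (corr \<beta> V N m t)) \<in> borel_measurable (\<Lambda> {..<m})"
    using FY cm by measurable
  have ts: "tuple_sum m N F (X N l) = tuple_sum m N (\<lambda>t. F (?Y t)) l" for l
    unfolding tuple_sum_def
  proof (rule sum.cong[OF refl])
    fix j assume j: "j \<in> inj_tuples m {..<N}"
    have "(\<lambda>i\<in>{..<m}. X N l (j i)) = ?Y (\<lambda>i\<in>{..<m}. l (j i))"
      using j by (auto simp: fun_eq_iff inj_tuples_def PiE_def Pi_iff)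
    then show "F (\<lambda>i\<in>{..<m}. X N l (j i)) = F (?Y (\<lambda>i\<in>{..<m}. l (j i)))" by simp
  qed
  have "(\<integral>\<^sup>+x. tuple_sum m N F x \<partial>D N) =
    (\<integral>\<^sup>+l. indicator (weyl_chamber N) l * ennreal (eigenvalue_density \<beta> V N l) * tuple_sum m N (\<lambda>t. F (?Y t)) l \<partial>\<Lambda> {..<N})"
    by (subst nn_integral_law[OF N tuple_sum_measurable[OF F]]) (simp only: ts)
  also have "\<dots> = (\<integral>\<^sup>+t. F (?Y t) * ennreal (corr \<beta> V N m t) \<partial>\<Lambda> {..<m})"
    by (rule eigenvalue_weight.chamber_correlation[OF W m FY])
  also have "\<dots> = ennreal (\<bar>c\<bar> ^ card {..<m}) *
     (\<integral>\<^sup>+u. F (?Y (\<lambda>i\<in>{..<m}. a + c * u i)) * ennreal (corr \<beta> V N m (\<lambda>i\<in>{..<m}. a + c * u i)) \<partial>\<Lambda> {..<m})"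
    by (rule nn_integral_product_affine) (use c in auto)
  also have "(\<integral>\<^sup>+u. F (?Y (\<lambda>i\<in>{..<m}. a + c * u i)) * ennreal (corr \<beta> V N m (\<lambda>i\<in>{..<m}. a + c * u i)) \<partial>\<Lambda> {..<m}) =
     (\<integral>\<^sup>+u. F u * ennreal (corr \<beta> V N m (\<lambda>i. unscale \<psi> a N (u i))) \<partial>\<Lambda> {..<m})"
  proof (rule nn_integral_cong)
    fix u assume u: "u \<in> space (\<Lambda> {..<m})"
    have "?Y (\<lambda>i\<in>{..<m}. a + c * u i) = u"
      using u scale_pos[OF N] by (auto simp: fun_eq_iff rescale_def c_def space_PiM PiE_def extensional_def)
    moreover have "(\<lambda>i. a + c * u i) = (\<lambda>i. unscale \<psi> a N (u i))"
      by (simp add: unscale_def c_def)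
    ultimately show "F (?Y (\<lambda>i\<in>{..<m}. a + c * u i)) * ennreal (corr \<beta> V N m (\<lambda>i\<in>{..<m}. a + c * u i)) =
       F u * ennreal (corr \<beta> V N m (\<lambda>i. unscale \<psi> a N (u i)))"
      by (simp only: corr_restrict)
  qed
  also have "ennreal (\<bar>c\<bar> ^ card {..<m}) * (\<integral>\<^sup>+u. F u * ennreal (corr \<beta> V N m (\<lambda>i. unscale \<psi> a N (u i))) \<partial>\<Lambda> {..<m}) =
     (\<integral>\<^sup>+u. ennreal (\<bar>c\<bar> ^ card {..<m}) * (F u * ennreal (corr \<beta> V N m (\<lambda>i. unscale \<psi> a N (u i)))) \<partial>\<Lambda> {..<m})"
  proof (rule nn_integral_cmult[symmetric])
    have "corr \<beta> V N m (\<lambda>i. unscale \<psi> a N (u i)) = scaled_corr \<beta> V \<psi> a N m u * (real N * \<psi> a) ^ m" for u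
      using N \<psi>_pos by (simp add: scaled_corr_def)
    then have "(\<lambda>u. corr \<beta> V N m (\<lambda>i. unscale \<psi> a N (u i))) \<in> borel_measurable (\<Lambda> {..<m})"
      using scaled_corr_measurable[OF N m] by simp
    then show "(\<lambda>u. F u * ennreal (corr \<beta> V N m (\<lambda>i. unscale \<psi> a N (u i)))) \<in> borel_measurable (\<Lambda> {..<m})"
      using F by measurable
  qed
  also have "\<dots> = (\<integral>\<^sup>+t. F t * ennreal (scaled_corr \<beta> V \<psi> a N m t) \<partial>\<Lambda> {..<m})"
  proof (rule nn_integral_cong)
    fix u
    have "scaled_corr \<beta> V \<psi> a N m u = \<bar>c\<bar> ^ card {..<m} * corr \<beta> V N m (\<lambda>i. unscale \<psi> a N (u i))"
      using N \<psi>_pos by (simp add: scaled_corr_def c_def power_divide)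
    then have "ennreal (scaled_corr \<beta> V \<psi> a N m u) = ennreal (\<bar>c\<bar> ^ card {..<m}) * ennreal (corr \<beta> V N m (\<lambda>i. unscale \<psi> a N (u i)))"
      by (simp add: ennreal_mult eigenvalue_weight.corr_nonneg[OF W m])
    then show "ennreal (\<bar>c\<bar> ^ card {..<m}) * (F u * ennreal (corr \<beta> V N m (\<lambda>i. unscale \<psi> a N (u i)))) =
      F u * ennreal (scaled_corr \<beta> V \<psi> a N m u)" by (simp only: mult_ac)
  qed
  finally show ?thesis .
qed

text \<open>
  Coinciding eigenvalues have density \<open>0\<close> because of the Vandermonde factor.
\<close>

lemma strictly_increasing_AE:
  assumes N: "1 \<le> N"
  shows "AE x in D N. strict_mono_on {..<N} x"
proof -
  note W = eigenvalue_weight[OF N]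
  let ?f = "\<lambda>l. ennreal (indicator (weyl_chamber N) l * eigenvalue_density \<beta> V N l)"
  have law_f: "distr (ensemble \<beta> V N) (\<Lambda> {..<N}) (eigenvalues \<beta> N) = density (\<Lambda> {..<N}) ?f"
    "?f \<in> borel_measurable (\<Lambda> {..<N})" "eigenvalues \<beta> N \<in> measurable (ensemble \<beta> V N) (\<Lambda> {..<N})"
    using law[OF N] by (auto simp: distributed_def)
  have "AE l in density (\<Lambda> {..<N}) ?f. strict_mono_on {..<N} l"
  proof (subst AE_density[OF law_f(2)], rule AE_I2, rule impI)
    fix l assume "0 < ?f l"
    then have ch: "l \<in> weyl_chamber N" and "eigenvalue_density \<beta> V N l \<noteq> 0"
      by (cases "l \<in> weyl_chamber N"; simp)+
    then have inj: "inj_on l {..<N}" using eigenvalue_weight.density_coincident[OF W] by blast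
    show "strict_mono_on {..<N} l"
    proof (rule strict_mono_onI)
      fix i j :: nat assume ij: "i \<in> {..<N}" "j \<in> {..<N}" "i < j"
      then have "l i \<le> l j" using ch by (simp add: weyl_chamber_def)
      moreover have "l i \<noteq> l j" using inj ij by (auto simp: inj_on_def)
      ultimately show "l i < l j" by simp
    qed
  qed
  then have ae: "AE h in ensemble \<beta> V N. strict_mono_on {..<N} (eigenvalues \<beta> N h)"
    unfolding law_f(1)[symmetric] by (rule AE_distrD[OF law_f(3)])
  have meas: "{x \<in> space (\<Lambda> {..<N}). strict_mono_on {..<N} x} \<in> sets (\<Lambda> {..<N})"
  proof -
    have [measurable]: "(\<lambda>l. l i) \<in> borel_measurable (\<Lambda> {..<N})" if "i \<in> {..<N}" for i
      using that measurable_component_singleton[of i "{..<N}" "\<lambda>_. lborel"] by auto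
    have "{x \<in> space (\<Lambda> {..<N}). strict_mono_on {..<N} x} =
       (\<Inter>i\<in>{..<N}. \<Inter>j\<in>{..<N}. {x \<in> space (\<Lambda> {..<N}). i < j \<longrightarrow> x i < x j})"
      using N by (force simp: strict_mono_on_def)
    also have "\<dots> \<in> sets (\<Lambda> {..<N})"
    proof -
      have "{..<N} \<noteq> {}" using N lessThan_empty_iff[of N] by linarith
      then show ?thesis by (intro sets.finite_INT) auto
    qed
    finally show ?thesis .
  qed
  show ?thesis unfolding rescaled_spectrum_law_def
  proof (subst AE_distr_iff[OF XE_measurable[OF N] meas])
    show "AE h in ensemble \<beta> V N. strict_mono_on {..<N} (X N (eigenvalues \<beta> N h))"
      using ae
    proof eventually_elim
      case (elim h)
      show ?case
      proof (rule strict_mono_onI)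
        fix i j assume ij: "i \<in> {..<N}" "j \<in> {..<N}" "i < j"
        then have "eigenvalues \<beta> N h i < eigenvalues \<beta> N h j" by (rule strict_mono_onD[OF elim])
        then show "X N (eigenvalues \<beta> N h) i < X N (eigenvalues \<beta> N h) j"
          using ij N \<psi>_pos by (simp add: rescale_def)
      qed
    qed
  qed
qed

lemma spacing_measure_eq:
  assumes N: "1 \<le> N" and s: "0 \<le> s" and x: "strict_mono_on {..<N} (X N l)"
  shows "measure (spacing_measure \<psi> a I N l) {0..s} = gap_fraction (A N) N (2 * r N) s (X N l)"
proof -
  let ?S = "{i. Suc i < N \<and> l i \<in> I N \<and> l (Suc i) \<in> I N}"
  let ?d = "\<lambda>i. rescale \<psi> a N (l (Suc i)) - rescale \<psi> a N (l i)"
  have fin: "finite ?S" by (rule finite_subset[of _ "{..<N}"]) auto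
  have mem: "rescale \<psi> a N y \<in> A N \<longleftrightarrow> y \<in> I N" for y
  proof (rule inj_image_mem_iff)
    show "inj (rescale \<psi> a N)" using N \<psi>_pos by (intro injI) (simp add: rescale_def)
  qed
  have pre: "?d -` {0..s} \<inter> space (count_space ?S) =
     {i. Suc i < N \<and> X N l i \<in> A N \<and> X N l (Suc i) \<in> A N \<and> X N l (Suc i) - X N l i \<le> s}"
  proof -
    have d: "0 \<le> ?d i" if "Suc i < N" for i
    proof -
      have "X N l i < X N l (Suc i)" using that by (intro strict_mono_onD[OF x]) auto
      then show ?thesis using that by simp
    qed
    show ?thesis
    proof (rule Set.set_eqI)
      fix i
      show "i \<in> ?d -` {0..s} \<inter> space (count_space ?S) \<longleftrightarrow>
          i \<in> {i. Suc i < N \<and> X N l i \<in> A N \<and> X N l (Suc i) \<in> A N \<and> X N l (Suc i) - X N l i \<le> s}"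
        using d[of i] by (cases "Suc i < N") (simp_all add: mem conj_commute)
    qed
  qed
  have eA: "emeasure lborel (A N) = ennreal (2 * r N)"
  proof (rule antisym)
    have Ab: "A N \<in> sets borel"
    proof -
      have "A N = {- r N<..<r N} \<union> (A N \<inter> {- r N, r N})" using A_interval(2,3)[OF N] by force
      also have "\<dots> \<in> sets borel" by (intro sets.Un) (auto intro: sets.countable countable_finite)
      finally show ?thesis .
    qed
    have "emeasure lborel (A N) \<le> emeasure lborel {- r N..r N}"
      using A_interval(3)[OF N] by (intro emeasure_mono) auto
    also have "\<dots> = ennreal (2 * r N)" using A_interval(1)[OF N] by simp
    finally show "emeasure lborel (A N) \<le> ennreal (2 * r N)" .
    have "ennreal (2 * r N) = emeasure lborel {- r N<..<r N}" using A_interval(1)[OF N] by simp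
    also have "\<dots> \<le> emeasure lborel (A N)" using A_interval(2)[OF N] Ab by (intro emeasure_mono) auto
    finally show "ennreal (2 * r N) \<le> emeasure lborel (A N)" .
  qed
  have "emeasure (distr (count_space ?S) borel ?d) {0..s} = emeasure (count_space ?S) (?d -` {0..s} \<inter> space (count_space ?S))"
    by (rule emeasure_distr) auto
  also have "\<dots> = of_nat (card (?d -` {0..s} \<inter> space (count_space ?S)))"
    using fin by (intro emeasure_count_space_finite) auto
  finally have "emeasure (spacing_measure \<psi> a I N l) {0..s} =
     inverse (ennreal (2 * r N)) * of_nat (card {i. Suc i < N \<and> X N l i \<in> A N \<and> X N l (Suc i) \<in> A N \<and> X N l (Suc i) - X N l i \<le> s})"
    unfolding spacing_measure_def emeasure_scale_measure eA pre by simp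
  also have "\<dots> = ennreal (gap_fraction (A N) N (2 * r N) s (X N l))"
    using A_interval(1)[OF N] unfolding gap_fraction_def
    by (subst inverse_ennreal) (simp_all add: ennreal_of_nat_eq_real_of_nat ennreal_mult[symmetric] field_simps)
  finally show ?thesis
    using A_interval(1)[OF N] gap_fraction_nonneg[of "2 * r N" "A N" N s "X N l"] by (simp add: measure_def)
qed

text \<open>
  What is left to check concerns the correlation functions alone. That \<open>D N\<close> is a probability measure
  for large \<open>N\<close> is a consequence: the one-point function at the centre converges to \<open>1\<close>, so the density does
  not vanish identically.
\<close>

lemma clustering_process_ensemble:
  assumes C: "0 < C"
    and bound: "\<forall>\<^sub>F N in sequentially. \<forall>m\<in>{1..N}. \<forall>t. (\<forall>i<m. t i \<in> A N) \<longrightarrow> scaled_corr \<beta> V \<psi> a N m t \<le> C ^ m * fact m"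
    and conv: "\<And>m e. 1 \<le> m \<Longrightarrow> 0 < e \<Longrightarrow>
        \<forall>\<^sub>F N in sequentially. \<forall>t. (\<forall>i<m. t i \<in> A N) \<longrightarrow> \<bar>scaled_corr \<beta> V \<psi> a N m t - W m t\<bar> \<le> e"
    and W_meas: "\<And>m. W m \<in> borel_measurable (\<Lambda> {..<m})"
    and W_one: "\<And>t. W 1 t = 1"
    and W_shift: "\<And>m c t. W m (\<lambda>i\<in>{..<m}. c + t i) = W m t"
    and cluster: "\<And>k s e. 0 \<le> s \<Longrightarrow> 0 < e \<Longrightarrow> \<exists>d\<ge>0. \<forall>t u.
        (\<forall>i<k. t k \<le> t i \<and> t i \<le> t k + s) \<and> (\<forall>i<k. u k \<le> u i \<and> u i \<le> u k + s) \<and> d < \<bar>t k - u k\<bar> \<longrightarrow>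
        \<bar>W (2 * Suc k) (concat_tuples (Suc k) t u) - W (Suc k) t * W (Suc k) u\<bar> \<le> e"
  shows "clustering_process (scaled_corr \<beta> V \<psi> a) W D A r C"
proof
  show "0 < C" by fact
  show "sets (D N) = sets (\<Lambda> {..<N})" for N by (simp add: rescaled_spectrum_law_def)
  show "\<forall>\<^sub>F N in sequentially. prob_space (D N)"
  proof -
    have "\<forall>\<^sub>F N in sequentially. \<forall>t. (\<forall>i<1. t i \<in> A N) \<longrightarrow> \<bar>scaled_corr \<beta> V \<psi> a N 1 t - W 1 t\<bar> \<le> 1 / 2"
      by (rule conv) auto
    then show ?thesis using eventually_ge_at_top[of 1]
    proof eventually_elim
      case (elim N)
      have "0 \<in> A N" using A_interval(1,2)[OF elim(2)] by (intro subsetD[OF A_interval(2)[OF elim(2)]]) auto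
      then have ne: "\<bar>scaled_corr \<beta> V \<psi> a N 1 (\<lambda>_. 0) - 1\<bar> \<le> 1 / 2" using elim(1) W_one by auto
      have "eigenvalue_weight.normalization \<beta> V N \<noteq> 0"
      proof
        assume "eigenvalue_weight.normalization \<beta> V N = 0"
        then have "eigenvalue_density \<beta> V N l = 0" for l
          using eigenvalue_weight.density_eq[OF eigenvalue_weight[OF elim(2)]] by simp
        then have "scaled_corr \<beta> V \<psi> a N 1 (\<lambda>_. 0) = 0" by (simp add: scaled_corr_def corr_def)
        then show False using ne by simp
      qed
      then show ?case using law_mass[OF elim(2)] by (intro prob_spaceI) simp
    qed
  qed
  show "AE x in D N. strict_mono_on {..<N} x" if "1 \<le> N" for N by (rule strictly_increasing_AE[OF that])
  show "scaled_corr \<beta> V \<psi> a N m \<in> borel_measurable (\<Lambda> {..<m})" if "1 \<le> m" "m \<le> N" for N m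
    using that by (intro scaled_corr_measurable) auto
  show "(\<integral>\<^sup>+x. tuple_sum m N F x \<partial>D N) = (\<integral>\<^sup>+t. F t * ennreal (scaled_corr \<beta> V \<psi> a N m t) \<partial>\<Lambda> {..<m})"
    if "1 \<le> m" "m \<le> N" "F \<in> borel_measurable (\<Lambda> {..<m})" for N m F
    using that by (intro correlation_formula) auto
  show "0 \<le> scaled_corr \<beta> V \<psi> a N m t" if "1 \<le> m" "m \<le> N" for N m t
    using that by (intro scaled_corr_nonneg) auto
  show "{- r N<..<r N} \<subseteq> A N" "A N \<subseteq> {- r N..r N}" "0 < r N" if "1 \<le> N" for N
    using A_interval[OF that] by auto
  show "filterlim r at_top sequentially" by (rule r_lim)
qed (fact bound conv W_meas W_one W_shift cluster)+

lemma expected_discrepancy_limit: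
  assumes lim: "\<And>e. 0 < e \<Longrightarrow> \<forall>\<^sub>F N in sequentially. \<exists>g\<in>borel_measurable (D N).
        (AE x in D N. (SUP s\<in>{0..}. ennreal \<bar>gap_fraction (A N) N (2 * r N) s x - measure \<mu> {0..s}\<bar>) \<le> g x) \<and>
        (\<integral>\<^sup>+x. g x \<partial>D N) \<le> ennreal e"
  shows "expected_discrepancy \<beta> V \<psi> a I \<mu> \<longlonglongrightarrow> 0"
proof -
  have small: "\<forall>\<^sub>F N in sequentially. expected_discrepancy \<beta> V \<psi> a I \<mu> N \<le> ennreal e" if "0 < e" for e
    using lim[OF that] eventually_ge_at_top[of 1]
  proof eventually_elim
    case (elim N)
    then obtain g where g: "g \<in> borel_measurable (D N)" "(\<integral>\<^sup>+x. g x \<partial>D N) \<le> ennreal e"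
      "AE x in D N. (SUP s\<in>{0..}. ennreal \<bar>gap_fraction (A N) N (2 * r N) s x - measure \<mu> {0..s}\<bar>) \<le> g x"
      by blast
    note XE = XE_measurable[OF elim(2)]
    have "AE x in D N. strict_mono_on {..<N} x \<and> (SUP s\<in>{0..}. ennreal \<bar>gap_fraction (A N) N (2 * r N) s x - measure \<mu> {0..s}\<bar>) \<le> g x"
      using strictly_increasing_AE[OF elim(2)] g(3) by eventually_elim simp
    then have "AE h in ensemble \<beta> V N. strict_mono_on {..<N} (X N (eigenvalues \<beta> N h)) \<and>
       (SUP s\<in>{0..}. ennreal \<bar>gap_fraction (A N) N (2 * r N) s (X N (eigenvalues \<beta> N h)) - measure \<mu> {0..s}\<bar>) \<le> g (X N (eigenvalues \<beta> N h))"
      unfolding rescaled_spectrum_law_def by (rule AE_distrD[OF XE])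
    then have "AE h in ensemble \<beta> V N.
       (SUP s\<in>{0..}. ennreal \<bar>measure (spacing_measure \<psi> a I N (eigenvalues \<beta> N h)) {0..s} - measure \<mu> {0..s}\<bar>) \<le> g (X N (eigenvalues \<beta> N h))"
    proof eventually_elim
      case (elim h)
      have "(SUP s\<in>{0..}. ennreal \<bar>measure (spacing_measure \<psi> a I N (eigenvalues \<beta> N h)) {0..s} - measure \<mu> {0..s}\<bar>) =
        (SUP s\<in>{0..}. ennreal \<bar>gap_fraction (A N) N (2 * r N) s (X N (eigenvalues \<beta> N h)) - measure \<mu> {0..s}\<bar>)"
        using spacing_measure_eq[OF \<open>1 \<le> N\<close> _ conjunct1[OF elim]] by (intro SUP_cong) auto
      then show ?case using elim by simp
    qed
    then have "expected_discrepancy \<beta> V \<psi> a I \<mu> N \<le> (\<integral>\<^sup>+h. g (X N (eigenvalues \<beta> N h)) \<partial>ensemble \<beta> V N)"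
      unfolding expected_discrepancy_def by (rule nn_integral_mono_AE)
    also have "\<dots> = (\<integral>\<^sup>+x. g x \<partial>D N)"
      unfolding rescaled_spectrum_law_def
      by (rule nn_integral_distr[OF XE, symmetric]) (use g(1) in \<open>simp add: rescaled_spectrum_law_def\<close>)
    finally show ?case using g(2) by (rule order_trans)
  qed
  show ?thesis
  proof (rule order_tendstoI)
    fix b :: ennreal assume "0 < b"
    then obtain e where e: "0 < e" "ennreal e < b"
    proof (cases b)
      case (real b')
      then have "0 < b' / 2" "ennreal (b' / 2) < b" using \<open>0 < b\<close> by (auto simp: ennreal_less_iff)
      then show ?thesis by (rule that)
    next
      case top
      then show ?thesis by (intro that[of 1]) auto
    qed
    from small[OF e(1)] show "\<forall>\<^sub>F N in sequentially. expected_discrepancy \<beta> V \<psi> a I \<mu> N < b"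
      by eventually_elim (use e(2) in auto)
  qed simp
qed

end

section \<open>Determinants and Pfaffians as functions of the entries\<close>

lemma abs_prod_le_power:
  fixes f :: "'a \<Rightarrow> real"
  assumes "\<And>i. i \<in> S \<Longrightarrow> \<bar>f i\<bar> \<le> M"
  shows "\<bar>prod f S\<bar> \<le> M ^ card S"
proof -
  have "\<bar>prod f S\<bar> = (\<Prod>i\<in>S. \<bar>f i\<bar>)" by (rule abs_prod)
  also have "\<dots> \<le> (\<Prod>i\<in>S. M)" using assms by (intro prod_mono) auto
  finally show ?thesis by simp
qed

lemma abs_prod_diff_le:
  fixes f g :: "'a \<Rightarrow> real"
  assumes M: "1 \<le> M" and "finite S"
    and "\<And>i. i \<in> S \<Longrightarrow> \<bar>f i\<bar> \<le> M" "\<And>i. i \<in> S \<Longrightarrow> \<bar>g i\<bar> \<le> M" "\<And>i. i \<in> S \<Longrightarrow> \<bar>f i - g i\<bar> \<le> \<delta>"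
  shows "\<bar>prod f S - prod g S\<bar> \<le> real (card S) * M ^ card S * \<delta>"
  using assms(2-)
proof (induction S)
  case (insert a S)
  have d: "0 \<le> \<delta>" using insert.prems(3)[of a] by simp
  have "prod f (insert a S) - prod g (insert a S) = f a * (prod f S - prod g S) + (f a - g a) * prod g S"
    using insert.hyps by (simp add: algebra_simps)
  also have "\<bar>\<dots>\<bar> \<le> \<bar>f a\<bar> * \<bar>prod f S - prod g S\<bar> + \<bar>f a - g a\<bar> * \<bar>prod g S\<bar>"
    by (rule order_trans[OF abs_triangle_ineq]) (simp add: abs_mult)
  also have "\<dots> \<le> M * (real (card S) * M ^ card S * \<delta>) + \<delta> * M ^ card S"
    using insert M d by (intro add_mono mult_mono abs_prod_le_power) auto
  also have "\<delta> * M ^ card S \<le> \<delta> * M ^ Suc (card S)"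
    using M d by (intro mult_left_mono power_increasing) auto
  also have "M * (real (card S) * M ^ card S * \<delta>) + \<delta> * M ^ Suc (card S) = real (card (insert a S)) * M ^ card (insert a S) * \<delta>"
    using insert.hyps by (simp add: algebra_simps)
  finally show ?case by simp
qed simp

lemma abs_signed_sum_le:
  fixes T :: "(nat \<Rightarrow> nat) \<Rightarrow> real"
  assumes "\<And>p. p permutes S \<Longrightarrow> \<bar>T p\<bar> \<le> b" "finite S"
  shows "\<bar>\<Sum>p | p permutes S. of_int (sign p) * T p\<bar> \<le> fact (card S) * b"
proof -
  have "\<bar>\<Sum>p | p permutes S. of_int (sign p) * T p\<bar> \<le> (\<Sum>p | p permutes S. b)"
  proof (rule order_trans[OF sum_abs sum_mono])
    fix p assume "p \<in> {p. p permutes S}"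
    then show "\<bar>of_int (sign p) * T p\<bar> \<le> b" using assms(1)[of p] by (simp add: abs_mult sign_def)
  qed
  also have "\<dots> = fact (card S) * b" using card_permutations[OF refl assms(2)] by simp
  finally show ?thesis .
qed

text \<open>
  The common properties of determinants (\<open>\<iota> = 1\<close>) and normalised Pfaffians (\<open>\<iota> = 2\<close>) of \<open>m\<close> points with
  \<open>\<iota>\<close> indices for each point. The block property allows an antisymmetric constant \<open>c\<close> between the odd
  indices of different blocks. For \<open>\<iota> = 1\<close> the condition \<open>x mod \<iota> = 1\<close> is never true, so the
  off-diagonal blocks are zero in this case.
\<close>

locale kernel_functional =
  fixes \<Phi> :: "nat \<Rightarrow> (nat \<Rightarrow> nat \<Rightarrow> real) \<Rightarrow> real" and \<iota> :: nat
  assumes \<iota>: "1 \<le> \<iota>"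
    and cong: "\<And>m f g. (\<And>x y. x < \<iota> * m \<Longrightarrow> y < \<iota> * m \<Longrightarrow> f x y = g x y) \<Longrightarrow> \<Phi> m f = \<Phi> m g"
    and bounded: "\<And>m f M. 1 \<le> M \<Longrightarrow> (\<And>x y. x < \<iota> * m \<Longrightarrow> y < \<iota> * m \<Longrightarrow> \<bar>f x y\<bar> \<le> M) \<Longrightarrow>
        \<bar>\<Phi> m f\<bar> \<le> (real \<iota> * M) ^ m * fact m"
    and lipschitz: "\<And>m f g M \<delta>. 1 \<le> M \<Longrightarrow> 0 \<le> \<delta> \<Longrightarrow>
        (\<And>x y. x < \<iota> * m \<Longrightarrow> y < \<iota> * m \<Longrightarrow> \<bar>f x y\<bar> \<le> M \<and> \<bar>g x y\<bar> \<le> M \<and> \<bar>f x y - g x y\<bar> \<le> \<delta>) \<Longrightarrow>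
        \<bar>\<Phi> m f - \<Phi> m g\<bar> \<le> real m * (real \<iota> * M) ^ m * fact m * \<delta>"
    and measurable: "\<And>m f S. (\<And>x y. x < \<iota> * m \<Longrightarrow> y < \<iota> * m \<Longrightarrow> (\<lambda>t. f t x y) \<in> borel_measurable S) \<Longrightarrow>
        (\<lambda>t. \<Phi> m (f t)) \<in> borel_measurable (S :: (nat \<Rightarrow> real) measure)"
    and block: "\<And>m f c. (\<And>x y. x < \<iota> * m \<Longrightarrow> \<iota> * m \<le> y \<Longrightarrow> y < \<iota> * (2 * m) \<Longrightarrow>
          f x y = (if x mod \<iota> = 1 \<and> y mod \<iota> = 1 then c else 0) \<and>
          f y x = (if x mod \<iota> = 1 \<and> y mod \<iota> = 1 then - c else 0)) \<Longrightarrow>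
        \<Phi> (2 * m) f = \<Phi> m f * \<Phi> m (\<lambda>x y. f (\<iota> * m + x) (\<iota> * m + y))"

definition det_form :: "nat \<Rightarrow> (nat \<Rightarrow> nat \<Rightarrow> real) \<Rightarrow> real" where
  "det_form m f = Determinant.det (Matrix.mat m m (\<lambda>(i, j). f i j))"

lemma det_form_eq: "det_form m f = (\<Sum>p | p permutes {0..<m}. of_int (sign p) * (\<Prod>i = 0..<m. f i (p i)))"
proof -
  have "det_form m f = (\<Sum>p | p permutes {0..<m}. of_int (sign p) * (\<Prod>i = 0..<m. Matrix.mat m m (\<lambda>(i, j). f i j) $$ (i, p i)))"
    unfolding det_form_def by (rule det_def') simp
  also have "\<dots> = (\<Sum>p | p permutes {0..<m}. of_int (sign p) * (\<Prod>i = 0..<m. f i (p i)))"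
  proof (rule sum.cong[OF refl])
    fix p assume "p \<in> {p. p permutes {0..<m}}"
    then have p: "p i < m" if "i < m" for i using that permutes_in_image[of p "{0..<m}" i] by simp
    have "(\<Prod>i = 0..<m. Matrix.mat m m (\<lambda>(i, j). f i j) $$ (i, p i)) = (\<Prod>i = 0..<m. f i (p i))"
      by (rule prod.cong[OF refl]) (simp add: p)
    then show "of_int (sign p) * (\<Prod>i = 0..<m. Matrix.mat m m (\<lambda>(i, j). f i j) $$ (i, p i)) = of_int (sign p) * (\<Prod>i = 0..<m. f i (p i))"
      by simp
  qed
  finally show ?thesis .
qed

lemma kernel_functional_det: "kernel_functional det_form 1"
proof
  fix m :: nat and f g :: "nat \<Rightarrow> nat \<Rightarrow> real" assume eq: "\<And>x y. x < 1 * m \<Longrightarrow> y < 1 * m \<Longrightarrow> f x y = g x y"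
  have "Matrix.mat m m (\<lambda>(i, j). f i j) = Matrix.mat m m (\<lambda>(i, j). g i j)"
    by (rule eq_matI) (simp_all add: eq)
  then show "det_form m f = det_form m g" by (simp add: det_form_def)
next
  fix m :: nat and f :: "nat \<Rightarrow> nat \<Rightarrow> real" and M :: real assume M: "1 \<le> M" and f: "\<And>x y. x < 1 * m \<Longrightarrow> y < 1 * m \<Longrightarrow> \<bar>f x y\<bar> \<le> M"
  have "\<bar>det_form m f\<bar> \<le> fact (card {0..<m}) * M ^ m" unfolding det_form_eq
  proof (rule abs_signed_sum_le)
    fix p assume "p permutes {0..<m}"
    then have p: "p i < m" if "i < m" for i using that permutes_in_image[of p "{0..<m}" i] by simp
    then show "\<bar>\<Prod>i = 0..<m. f i (p i)\<bar> \<le> M ^ m"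
      using abs_prod_le_power[of "{0..<m}" "\<lambda>i. f i (p i)" M] f by simp
  qed simp
  then show "\<bar>det_form m f\<bar> \<le> (real 1 * M) ^ m * fact m" by (simp add: mult.commute)
next
  fix m :: nat and f g :: "nat \<Rightarrow> nat \<Rightarrow> real" and M \<delta> :: real
  assume M: "1 \<le> M" and f: "\<And>x y. x < 1 * m \<Longrightarrow> y < 1 * m \<Longrightarrow> \<bar>f x y\<bar> \<le> M \<and> \<bar>g x y\<bar> \<le> M \<and> \<bar>f x y - g x y\<bar> \<le> \<delta>"
  have "det_form m f - det_form m g =
      (\<Sum>p | p permutes {0..<m}. of_int (sign p) * ((\<Prod>i = 0..<m. f i (p i)) - (\<Prod>i = 0..<m. g i (p i))))"
    unfolding det_form_eq by (simp add: sum_subtractf right_diff_distrib)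
  also have "\<bar>\<dots>\<bar> \<le> fact (card {0..<m}) * (real m * M ^ m * \<delta>)"
  proof (rule abs_signed_sum_le)
    fix p assume "p permutes {0..<m}"
    then have p: "p i < m" if "i < m" for i using that permutes_in_image[of p "{0..<m}" i] by simp
    then show "\<bar>(\<Prod>i = 0..<m. f i (p i)) - (\<Prod>i = 0..<m. g i (p i))\<bar> \<le> real m * M ^ m * \<delta>"
      using abs_prod_diff_le[OF M, of "{0..<m}" "\<lambda>i. f i (p i)" "\<lambda>i. g i (p i)" \<delta>] f by simp
  qed simp
  finally show "\<bar>det_form m f - det_form m g\<bar> \<le> real m * (real 1 * M) ^ m * fact m * \<delta>"
    by (simp add: mult_ac)
next
  fix m :: nat and f :: "(nat \<Rightarrow> real) \<Rightarrow> nat \<Rightarrow> nat \<Rightarrow> real" and S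
  assume f: "\<And>x y. x < 1 * m \<Longrightarrow> y < 1 * m \<Longrightarrow> (\<lambda>t. f t x y) \<in> borel_measurable S"
  show "(\<lambda>t. det_form m (f t)) \<in> borel_measurable S" unfolding det_form_eq
  proof (intro borel_measurable_sum borel_measurable_times borel_measurable_const borel_measurable_prod)
    fix p i assume "p \<in> {p. p permutes {0..<m}}" "i \<in> {0..<m}"
    then have "i < m" "p i < m" using permutes_in_image[of p "{0..<m}" i] by auto
    then show "(\<lambda>t. f t i (p i)) \<in> borel_measurable S" using f by simp
  qed
next
  fix m :: nat and f :: "nat \<Rightarrow> nat \<Rightarrow> real" and c :: real
  assume f: "\<And>x y. x < 1 * m \<Longrightarrow> 1 * m \<le> y \<Longrightarrow> y < 1 * (2 * m) \<Longrightarrow>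
          f x y = (if x mod 1 = 1 \<and> y mod 1 = 1 then c else 0) \<and>
          f y x = (if x mod 1 = 1 \<and> y mod 1 = 1 then - c else 0)"
  let ?A = "Matrix.mat m m (\<lambda>(i, j). f i j)" and ?D = "Matrix.mat m m (\<lambda>(i, j). f (1 * m + i) (1 * m + j))"
  have "Matrix.mat (2 * m) (2 * m) (\<lambda>(i, j). f i j) = four_block_mat ?A (0\<^sub>m m m) (0\<^sub>m m m) ?D"
  proof (rule eq_matI)
    fix i j assume "i < dim_row (four_block_mat ?A (0\<^sub>m m m) (0\<^sub>m m m) ?D)" "j < dim_col (four_block_mat ?A (0\<^sub>m m m) (0\<^sub>m m m) ?D)"
    then have ij: "i < 2 * m" "j < 2 * m" by simp_all
    then show "Matrix.mat (2 * m) (2 * m) (\<lambda>(i, j). f i j) $$ (i, j) = four_block_mat ?A (0\<^sub>m m m) (0\<^sub>m m m) ?D $$ (i, j)"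
      using f[of i j] f[of j i] by (cases "i < m"; cases "j < m") simp_all
  qed simp_all
  then have "det_form (2 * m) f = Determinant.det (four_block_mat ?A (0\<^sub>m m m) (0\<^sub>m m m) ?D)"
    by (simp add: det_form_def)
  also have "\<dots> = Determinant.det ?A * Determinant.det ?D"
    by (rule det_four_block_mat_upper_right_zero[of _ m _ m]) auto
  finally show "det_form (2 * m) f = det_form m f * det_form m (\<lambda>x y. f (1 * m + x) (1 * m + y))"
    by (simp add: det_form_def)
qed simp

definition pfaffian_form :: "nat \<Rightarrow> (nat \<Rightarrow> nat \<Rightarrow> real) \<Rightarrow> real" where
  "pfaffian_form m f = pfaffian_sum m f / (2 ^ m * fact m)"

text \<open>
  The number of perfect matchings of \<open>2 * m\<close> indices. The bound replaces the factorial of \<open>2 * m\<close> by that of \<open>m\<close>,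
  which is essential for exponential moments.
\<close>

lemma fact_double_le: "fact (2 * m) / (2 ^ m * fact m) \<le> (2 ^ m * fact m :: real)"
proof -
  have "real (2 * m choose m) = fact (2 * m) / (fact m * fact m)"
    using binomial_fact[of m "2 * m", where 'a = real] by (simp add: mult_2)
  moreover have "real (2 * m choose m) \<le> 2 ^ (2 * m)"
    using binomial_le_pow2[of "2 * m" m] of_nat_le_iff[of "2 * m choose m" "2 ^ (2 * m)", where 'a = real] by simp
  ultimately have "fact (2 * m) \<le> (2 ^ (2 * m) * (fact m * fact m) :: real)" by (simp add: divide_le_eq)
  also have "\<dots> = (2 ^ m * fact m) * (2 ^ m * fact m :: real)"
    unfolding mult_2 power_add by (simp only: mult_ac)
  finally show ?thesis by (simp add: divide_le_eq)
qed

lemma pair_indices_less: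
  fixes m :: nat
  shows "p permutes {..<2 * m} \<Longrightarrow> i < m \<Longrightarrow> p (2 * i) < 2 * m \<and> p (2 * i + 1) < 2 * m"
  using permutes_in_image[of p "{..<2 * m}" "2 * i"] permutes_in_image[of p "{..<2 * m}" "2 * i + 1"] by simp

lemma kernel_functional_pfaffian: "kernel_functional pfaffian_form 2"
proof
  fix m :: nat and f g :: "nat \<Rightarrow> nat \<Rightarrow> real" assume eq: "\<And>x y. x < 2 * m \<Longrightarrow> y < 2 * m \<Longrightarrow> f x y = g x y"
  have "pfaffian_sum m f = pfaffian_sum m g" unfolding pfaffian_sum_def
  proof (rule sum.cong[OF refl])
    fix p assume "p \<in> {p. p permutes {..<2 * m}}"
    then have "(\<Prod>i<m. f (p (2 * i)) (p (2 * i + 1))) = (\<Prod>i<m. g (p (2 * i)) (p (2 * i + 1)))"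
      using pair_indices_less[of p m] by (intro prod.cong refl eq) auto
    then show "of_int (sign p) * (\<Prod>i<m. f (p (2 * i)) (p (2 * i + 1))) = of_int (sign p) * (\<Prod>i<m. g (p (2 * i)) (p (2 * i + 1)))"
      by simp
  qed
  then show "pfaffian_form m f = pfaffian_form m g" by (simp add: pfaffian_form_def)
next
  fix m :: nat and f :: "nat \<Rightarrow> nat \<Rightarrow> real" and M :: real assume M: "1 \<le> M" and f: "\<And>x y. x < 2 * m \<Longrightarrow> y < 2 * m \<Longrightarrow> \<bar>f x y\<bar> \<le> M"
  have "\<bar>pfaffian_sum m f\<bar> \<le> fact (card {..<2 * m}) * M ^ m" unfolding pfaffian_sum_def
  proof (rule abs_signed_sum_le)
    fix p assume "p permutes {..<2 * m}"
    then show "\<bar>\<Prod>i<m. f (p (2 * i)) (p (2 * i + 1))\<bar> \<le> M ^ m"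
      using abs_prod_le_power[of "{..<m}" "\<lambda>i. f (p (2 * i)) (p (2 * i + 1))" M] f pair_indices_less[of p m] by simp
  qed simp
  then have "\<bar>pfaffian_form m f\<bar> \<le> fact (2 * m) * M ^ m / (2 ^ m * fact m)"
    by (simp add: pfaffian_form_def divide_right_mono)
  also have "\<dots> = fact (2 * m) / (2 ^ m * fact m) * M ^ m" by simp
  also have "\<dots> \<le> 2 ^ m * fact m * M ^ m" using M by (intro mult_right_mono fact_double_le) simp
  finally show "\<bar>pfaffian_form m f\<bar> \<le> (real 2 * M) ^ m * fact m" by (simp add: power_mult_distrib mult_ac)
next
  fix m :: nat and f g :: "nat \<Rightarrow> nat \<Rightarrow> real" and M \<delta> :: real
  assume M: "1 \<le> M" and \<delta>: "0 \<le> \<delta>"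
    and f: "\<And>x y. x < 2 * m \<Longrightarrow> y < 2 * m \<Longrightarrow> \<bar>f x y\<bar> \<le> M \<and> \<bar>g x y\<bar> \<le> M \<and> \<bar>f x y - g x y\<bar> \<le> \<delta>"
  have "pfaffian_sum m f - pfaffian_sum m g =
      (\<Sum>p | p permutes {..<2 * m}. of_int (sign p) *
        ((\<Prod>i<m. f (p (2 * i)) (p (2 * i + 1))) - (\<Prod>i<m. g (p (2 * i)) (p (2 * i + 1)))))"
    unfolding pfaffian_sum_def by (simp add: sum_subtractf right_diff_distrib)
  also have "\<bar>\<dots>\<bar> \<le> fact (card {..<2 * m}) * (real m * M ^ m * \<delta>)"
  proof (rule abs_signed_sum_le)
    fix p assume "p permutes {..<2 * m}"
    then show "\<bar>(\<Prod>i<m. f (p (2 * i)) (p (2 * i + 1))) - (\<Prod>i<m. g (p (2 * i)) (p (2 * i + 1)))\<bar> \<le> real m * M ^ m * \<delta>"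
      using abs_prod_diff_le[OF M, of "{..<m}" "\<lambda>i. f (p (2 * i)) (p (2 * i + 1))" "\<lambda>i. g (p (2 * i)) (p (2 * i + 1))" \<delta>]
        f pair_indices_less[of p m] by simp
  qed simp
  finally have "\<bar>pfaffian_form m f - pfaffian_form m g\<bar> \<le> fact (2 * m) * (real m * M ^ m * \<delta>) / (2 ^ m * fact m)"
    by (simp add: pfaffian_form_def divide_right_mono flip: diff_divide_distrib)
  also have "\<dots> = fact (2 * m) / (2 ^ m * fact m) * (real m * M ^ m * \<delta>)" by simp
  also have "\<dots> \<le> 2 ^ m * fact m * (real m * M ^ m * \<delta>)"
    using M \<delta> by (intro mult_right_mono fact_double_le) simp
  finally show "\<bar>pfaffian_form m f - pfaffian_form m g\<bar> \<le> real m * (real 2 * M) ^ m * fact m * \<delta>"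
    by (simp add: power_mult_distrib mult_ac)
next
  fix m :: nat and f :: "(nat \<Rightarrow> real) \<Rightarrow> nat \<Rightarrow> nat \<Rightarrow> real" and S
  assume f: "\<And>x y. x < 2 * m \<Longrightarrow> y < 2 * m \<Longrightarrow> (\<lambda>t. f t x y) \<in> borel_measurable S"
  show "(\<lambda>t. pfaffian_form m (f t)) \<in> borel_measurable S" unfolding pfaffian_form_def pfaffian_sum_def
  proof (intro borel_measurable_divide borel_measurable_sum borel_measurable_times borel_measurable_const borel_measurable_prod)
    fix p i assume "p \<in> {p. p permutes {..<2 * m}}" "i \<in> {..<m}"
    then show "(\<lambda>t. f t (p (2 * i)) (p (2 * i + 1))) \<in> borel_measurable S"
      using pair_indices_less[of p m i] f by simp
  qed
next
  fix m :: nat and f :: "nat \<Rightarrow> nat \<Rightarrow> real" and c :: real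
  assume f: "\<And>x y. x < 2 * m \<Longrightarrow> 2 * m \<le> y \<Longrightarrow> y < 2 * (2 * m) \<Longrightarrow>
          f x y = (if x mod 2 = 1 \<and> y mod 2 = 1 then c else 0) \<and>
          f y x = (if x mod 2 = 1 \<and> y mod 2 = 1 then - c else 0)"
  let ?a = "pfaffian_sum m f" and ?b = "pfaffian_sum m (\<lambda>x y. f (2 * m + x) (2 * m + y))"
  have "pfaffian_sum (2 * m) f = real (2 * m choose m) * (?a * ?b)"
    by (rule pfaffian_sum_block[where v = "\<lambda>x. if x mod 2 = 1 then c else 0" and w = "\<lambda>y. if y mod 2 = 1 then 1 else 0"])
      (use f in auto)
  also have "real (2 * m choose m) = fact (2 * m) / (fact m * fact m)"
    using binomial_fact[of m "2 * m", where 'a = real] by (simp add: mult_2)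
  finally have "pfaffian_form (2 * m) f = fact (2 * m) / (fact m * fact m) * (?a * ?b) / (2 ^ (2 * m) * fact (2 * m))"
    by (simp add: pfaffian_form_def)
  also have "\<dots> = ?a / (2 ^ m * fact m) * (?b / (2 ^ m * fact m))"
    by (simp add: mult_2 power_add)
  finally show "pfaffian_form (2 * m) f = pfaffian_form m f * pfaffian_form m (\<lambda>x y. f (2 * m + x) (2 * m + y))"
    by (simp add: pfaffian_form_def)
qed simp

section \<open>Universality for stationary kernels\<close>

text \<open>
  Limiting kernels depend on the difference \<open>d\<close> of the points. Entry \<open>(p, q)\<close> tends to \<open>0\<close> at infinity
  except that \<open>(1, 1)\<close> may tend to \<open>c\<close> and \<open>- c\<close>.
\<close>

locale stationary_kernel = kernel_functional \<Phi> \<iota> for \<Phi> and \<iota> :: nat +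
  fixes H :: "nat \<Rightarrow> nat \<Rightarrow> real \<Rightarrow> real" and M c :: real
  assumes M: "1 \<le> M"
    and H_bound: "\<And>p q d. p < \<iota> \<Longrightarrow> q < \<iota> \<Longrightarrow> \<bar>H p q d\<bar> \<le> M"
    and H_measurable: "\<And>p q. p < \<iota> \<Longrightarrow> q < \<iota> \<Longrightarrow> H p q \<in> borel_measurable borel"
    and H_limit: "\<And>p q. p < \<iota> \<Longrightarrow> q < \<iota> \<Longrightarrow>
        ((\<lambda>d. H p q d - (if p = 1 \<and> q = 1 then c * sgn d else 0)) \<longlongrightarrow> 0) at_infinity"
    and diagonal: "\<Phi> 1 (\<lambda>x y. H (x mod \<iota>) (y mod \<iota>) 0) = 1"
begin

definition kernel_entry :: "(nat \<Rightarrow> real) \<Rightarrow> nat \<Rightarrow> nat \<Rightarrow> real" where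
  "kernel_entry t x y = H (x mod \<iota>) (y mod \<iota>) (t (x div \<iota>) - t (y div \<iota>))"

definition limit_corr :: "nat \<Rightarrow> (nat \<Rightarrow> real) \<Rightarrow> real" where
  "limit_corr m t = \<Phi> m (kernel_entry t)"

lemma mod_less: "x mod \<iota> < \<iota>"
  using \<iota> by simp

lemma div_less: "x < \<iota> * m \<Longrightarrow> x div \<iota> < m"
  using \<iota> by (simp add: div_less_iff_less_mult mult.commute)

lemma kernel_entry_bound: "\<bar>kernel_entry t x y\<bar> \<le> M"
  unfolding kernel_entry_def by (rule H_bound[OF mod_less mod_less])

lemma limit_corr_one: "limit_corr 1 t = 1"
proof -
  have "limit_corr 1 t = \<Phi> 1 (\<lambda>x y. H (x mod \<iota>) (y mod \<iota>) 0)" unfolding limit_corr_def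
  proof (rule cong)
    fix x y assume "x < \<iota> * 1" "y < \<iota> * 1"
    then have "x div \<iota> = y div \<iota>" by simp
    then show "kernel_entry t x y = H (x mod \<iota>) (y mod \<iota>) 0" by (simp add: kernel_entry_def)
  qed
  then show ?thesis using diagonal by simp
qed

lemma limit_corr_shift: "limit_corr m (\<lambda>i\<in>{..<m}. c' + t i) = limit_corr m t"
  unfolding limit_corr_def by (rule cong) (simp add: kernel_entry_def div_less)

lemma limit_corr_measurable: "limit_corr m \<in> borel_measurable (\<Lambda> {..<m})"
  unfolding limit_corr_def[abs_def]
proof (rule measurable)
  fix x y assume "x < \<iota> * m" "y < \<iota> * m"
  then have "x div \<iota> < m" "y div \<iota> < m" by (simp_all add: div_less)
  then have [measurable]: "(\<lambda>t. t (x div \<iota>)) \<in> borel_measurable (\<Lambda> {..<m})" "(\<lambda>t. t (y div \<iota>)) \<in> borel_measurable (\<Lambda> {..<m})"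
    using measurable_component_singleton[of "x div \<iota>" "{..<m}" "\<lambda>_. lborel"]
      measurable_component_singleton[of "y div \<iota>" "{..<m}" "\<lambda>_. lborel"] by auto
  have "(\<lambda>t. t (x div \<iota>) - t (y div \<iota>)) \<in> borel_measurable (\<Lambda> {..<m})" by measurable
  from measurable_compose[OF this H_measurable[OF mod_less mod_less]]
  show "(\<lambda>t. kernel_entry t x y) \<in> borel_measurable (\<Lambda> {..<m})" by (simp only: kernel_entry_def)
qed

lemma H_tail:
  assumes "0 < e"
  shows "\<exists>d>0. \<forall>p<\<iota>. \<forall>q<\<iota>. \<forall>z. d < \<bar>z\<bar> \<longrightarrow> \<bar>H p q z - (if p = 1 \<and> q = 1 then c * sgn z else 0)\<bar> < e"
proof -
  have "\<forall>\<^sub>F z in at_infinity. \<forall>p\<in>{..<\<iota>}. \<forall>q\<in>{..<\<iota>}. \<bar>H p q z - (if p = 1 \<and> q = 1 then c * sgn z else 0)\<bar> < e"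
  proof (intro eventually_ball_finite ballI)
    fix p q assume "p \<in> {..<\<iota>}" "q \<in> {..<\<iota>}"
    then show "\<forall>\<^sub>F z in at_infinity. \<bar>H p q z - (if p = 1 \<and> q = 1 then c * sgn z else 0)\<bar> < e"
      using tendstoD[OF H_limit[of p q] assms] by simp
  qed simp_all
  then obtain b where b: "\<And>z. b \<le> norm z \<Longrightarrow> \<forall>p\<in>{..<\<iota>}. \<forall>q\<in>{..<\<iota>}. \<bar>H p q z - (if p = 1 \<and> q = 1 then c * sgn z else 0)\<bar> < e"
    unfolding eventually_at_infinity by blast
  show ?thesis
  proof (intro exI[of _ "\<bar>b\<bar> + 1"] conjI allI impI)
    fix p q z assume "p < \<iota>" "q < \<iota>" "\<bar>b\<bar> + 1 < \<bar>z\<bar>"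
    then show "\<bar>H p q z - (if p = 1 \<and> q = 1 then c * sgn z else 0)\<bar> < e" using b[of z] by simp
  qed simp
qed

lemma block_index:
  assumes "x < \<iota> * (2 * m)"
  shows "concat_tuples m t u (x div \<iota>) = (if x < \<iota> * m then t (x div \<iota>) else u (x div \<iota> - m))"
proof -
  have "x div \<iota> < m \<longleftrightarrow> x < \<iota> * m" using \<iota> by (simp add: div_less_iff_less_mult mult.commute)
  then show ?thesis using div_less[OF assms] by (simp add: concat_tuples_def)
qed

lemma kernel_entry_cross:
  assumes tail: "\<And>p q z. p < \<iota> \<Longrightarrow> q < \<iota> \<Longrightarrow> d < \<bar>z\<bar> \<Longrightarrow>
      \<bar>H p q z - (if p = 1 \<and> q = 1 then c * sgn z else 0)\<bar> < \<delta>"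
    and far: "\<And>i j. i < m \<Longrightarrow> j < m \<Longrightarrow> d < \<bar>t i - u j\<bar> \<and> sgn (t i - u j) = \<sigma>"
    and xy: "x < \<iota> * m" "\<iota> * m \<le> y" "y < \<iota> * (2 * m)"
  shows "\<bar>kernel_entry (concat_tuples m t u) x y - (if x mod \<iota> = 1 \<and> y mod \<iota> = 1 then c * \<sigma> else 0)\<bar> < \<delta>"
    "\<bar>kernel_entry (concat_tuples m t u) y x - (if x mod \<iota> = 1 \<and> y mod \<iota> = 1 then - (c * \<sigma>) else 0)\<bar> < \<delta>"
proof -
  have ij: "x div \<iota> < m" "y div \<iota> - m < m"
    using xy div_less[of x m] div_less[of y "2 * m"] by linarith+
  define z where "z = t (x div \<iota>) - u (y div \<iota> - m)"
  have z: "d < \<bar>z\<bar>" "sgn z = \<sigma>" using far[OF ij] by (simp_all add: z_def)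
  have "x < \<iota> * (2 * m)" using xy by linarith
  then have e: "kernel_entry (concat_tuples m t u) x y = H (x mod \<iota>) (y mod \<iota>) z"
    "kernel_entry (concat_tuples m t u) y x = H (y mod \<iota>) (x mod \<iota>) (- z)"
    using xy by (simp_all add: kernel_entry_def block_index z_def)
  show "\<bar>kernel_entry (concat_tuples m t u) x y - (if x mod \<iota> = 1 \<and> y mod \<iota> = 1 then c * \<sigma> else 0)\<bar> < \<delta>"
    using tail[OF mod_less mod_less z(1), of x y] unfolding e z(2) .
  have "d < \<bar>- z\<bar>" using z(1) by simp
  from tail[OF mod_less mod_less this, of y x]
  show "\<bar>kernel_entry (concat_tuples m t u) y x - (if x mod \<iota> = 1 \<and> y mod \<iota> = 1 then - (c * \<sigma>) else 0)\<bar> < \<delta>"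
    unfolding e sgn_minus z(2) by (cases "x mod \<iota> = 1"; cases "y mod \<iota> = 1") simp_all
qed

text \<open>
  For distant groups of points the sign of all differences between them is the same, so the off-diagonal blocks are
  close to those admitted in \<open>block\<close>. Replacing them exactly changes the functional by little.
\<close>

lemma limit_corr_cluster:
  assumes s: "0 \<le> s" and e: "0 < e"
  shows "\<exists>d\<ge>0. \<forall>t u.
        (\<forall>i<k. t k \<le> t i \<and> t i \<le> t k + s) \<and> (\<forall>i<k. u k \<le> u i \<and> u i \<le> u k + s) \<and> d < \<bar>t k - u k\<bar> \<longrightarrow>
        \<bar>limit_corr (2 * Suc k) (concat_tuples (Suc k) t u) - limit_corr (Suc k) t * limit_corr (Suc k) u\<bar> \<le> e"
proof -
  define m where "m = Suc k"
  define M' where "M' = M + \<bar>c\<bar>"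
  define L where "L = real (2 * m) * (real \<iota> * M') ^ (2 * m) * fact (2 * m)"
  have M': "1 \<le> M'" using M by (simp add: M'_def)
  have L: "0 < L" unfolding L_def using M' \<iota> by (intro mult_pos_pos zero_less_power) (auto simp: m_def)
  obtain d where d: "0 < d" and tail: "\<And>p q z. p < \<iota> \<Longrightarrow> q < \<iota> \<Longrightarrow> d < \<bar>z\<bar> \<Longrightarrow>
      \<bar>H p q z - (if p = 1 \<and> q = 1 then c * sgn z else 0)\<bar> < e / L"
    using H_tail[of "e / L"] e L by auto
  have "\<bar>limit_corr (2 * m) (concat_tuples m t u) - limit_corr m t * limit_corr m u\<bar> \<le> e"
    if t: "\<forall>i<k. t k \<le> t i \<and> t i \<le> t k + s" and u: "\<forall>i<k. u k \<le> u i \<and> u i \<le> u k + s"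
      and far: "d + s < \<bar>t k - u k\<bar>" for t u
  proof -
    define \<sigma> where "\<sigma> = sgn (t k - u k)"
    have \<sigma>: "\<bar>\<sigma>\<bar> \<le> 1" by (simp add: \<sigma>_def abs_sgn_eq)
    have sep: "d < \<bar>t i - u j\<bar> \<and> sgn (t i - u j) = \<sigma>" if "i < m" "j < m" for i j
    proof -
      have ti: "t k \<le> t i \<and> t i \<le> t k + s" using t s that(1) by (cases "i = k") (auto simp: m_def less_Suc_eq)
      have uj: "u k \<le> u j \<and> u j \<le> u k + s" using u s that(2) by (cases "j = k") (auto simp: m_def less_Suc_eq)
      show ?thesis
      proof (cases "u k < t k")
        case True
        then have "d < t i - u j" using ti uj far by linarith
        then show ?thesis using True d by (simp add: \<sigma>_def)
      next
        case False
        then have "d < u j - t i" "t k < u k" using ti uj far d s by linarith+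
        then show ?thesis using d by (simp add: \<sigma>_def)
      qed
    qed
    let ?f = "kernel_entry (concat_tuples m t u)"
    define g where "g x y = (if x < \<iota> * m \<longleftrightarrow> y < \<iota> * m then ?f x y
      else if x mod \<iota> = 1 \<and> y mod \<iota> = 1 then (if x < \<iota> * m then c * \<sigma> else - (c * \<sigma>)) else 0)" for x y
    have close: "\<bar>?f x y\<bar> \<le> M' \<and> \<bar>g x y\<bar> \<le> M' \<and> \<bar>?f x y - g x y\<bar> \<le> e / L"
      if xy: "x < \<iota> * (2 * m)" "y < \<iota> * (2 * m)" for x y
    proof -
      have f: "\<bar>?f x y\<bar> \<le> M" by (rule kernel_entry_bound)
      have "\<bar>c * \<sigma>\<bar> \<le> \<bar>c\<bar>" using \<sigma> by (simp add: abs_mult mult_left_le)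
      then have "\<bar>g x y\<bar> \<le> M'" using f M by (auto simp: g_def M'_def)
      moreover have "\<bar>?f x y - g x y\<bar> \<le> e / L"
      proof (cases "x < \<iota> * m"; cases "y < \<iota> * m")
        assume "x < \<iota> * m" "\<not> y < \<iota> * m"
        then show ?thesis using kernel_entry_cross(1)[where m = m and t = t and u = u and x = x and y = y, OF tail sep] xy
          by (cases "x mod \<iota> = 1"; cases "y mod \<iota> = 1") (simp_all add: g_def)
      next
        assume "\<not> x < \<iota> * m" "y < \<iota> * m"
        then show ?thesis using kernel_entry_cross(2)[where m = m and t = t and u = u and x = y and y = x, OF tail sep] xy
          by (cases "x mod \<iota> = 1"; cases "y mod \<iota> = 1") (simp_all add: g_def)
      qed (use e L in \<open>simp_all add: g_def\<close>)
      ultimately show ?thesis using f by (simp add: M'_def)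
    qed
    have "\<bar>\<Phi> (2 * m) ?f - \<Phi> (2 * m) g\<bar> \<le> real (2 * m) * (real \<iota> * M') ^ (2 * m) * fact (2 * m) * (e / L)"
      using e L by (intro lipschitz M' close) auto
    also have "\<dots> = e" using L unfolding L_def[symmetric] by simp
    finally have approx: "\<bar>\<Phi> (2 * m) ?f - \<Phi> (2 * m) g\<bar> \<le> e" .
    have "\<Phi> (2 * m) g = \<Phi> m g * \<Phi> m (\<lambda>x y. g (\<iota> * m + x) (\<iota> * m + y))"
      by (rule block[where c = "c * \<sigma>"]) (auto simp: g_def)
    also have "\<Phi> m g = limit_corr m t" unfolding limit_corr_def
    proof (rule cong)
      fix x y assume xy: "x < \<iota> * m" "y < \<iota> * m"
      then have "x < \<iota> * (2 * m)" "y < \<iota> * (2 * m)" by linarith+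
      then show "g x y = kernel_entry t x y" using xy by (simp add: g_def kernel_entry_def block_index)
    qed
    also have "\<Phi> m (\<lambda>x y. g (\<iota> * m + x) (\<iota> * m + y)) = limit_corr m u" unfolding limit_corr_def
    proof (rule cong)
      fix x y assume xy: "x < \<iota> * m" "y < \<iota> * m"
      then have "\<iota> * m + x < \<iota> * (2 * m)" "\<iota> * m + y < \<iota> * (2 * m)" by (simp_all add: mult_2 algebra_simps)
      moreover have "concat_tuples m t u (m + z div \<iota>) = u (z div \<iota>)" if "z < \<iota> * m" for z
        using div_less[OF that] by (simp add: concat_tuples_def)
      ultimately show "g (\<iota> * m + x) (\<iota> * m + y) = kernel_entry u x y" using \<iota> xy by (simp add: g_def kernel_entry_def)
    qed
    finally show ?thesis using approx unfolding limit_corr_def by simp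
  qed
  then show ?thesis using d s unfolding m_def by (intro exI[of _ "d + s"]) auto
qed

text \<open>
  Uniform convergence of the entries in \<open>A N\<close> gives the bound on correlation functions with \<open>M + 1\<close> in
  place of \<open>M\<close>, and convergence by the Lipschitz estimate.
\<close>

lemma clustering_process_if_kernel_converges:
  assumes setting: "ensemble_setting \<beta> V \<psi> a I"
    and form: "\<And>N m t. 1 \<le> m \<Longrightarrow> m \<le> N \<Longrightarrow> scaled_corr \<beta> V \<psi> a N m t = \<Phi> m (E N t)"
    and \<kappa>: "\<kappa> \<longlonglongrightarrow> 0"
    and E: "\<And>N m t x y. 1 \<le> N \<Longrightarrow> \<forall>i<m. t i \<in> rescale \<psi> a N ` I N \<Longrightarrow> x < \<iota> * m \<Longrightarrow> y < \<iota> * m \<Longrightarrow>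
        \<bar>E N t x y - kernel_entry t x y\<bar> \<le> K * \<bar>\<kappa> N :: real\<bar>"
  shows "clustering_process (scaled_corr \<beta> V \<psi> a) limit_corr (rescaled_spectrum_law \<beta> V \<psi> a)
    (\<lambda>N. rescale \<psi> a N ` I N) (\<lambda>N. real N * \<psi> a * measure lborel (I N) / 2) (real \<iota> * (M + 1))"
proof (rule ensemble_setting.clustering_process_ensemble[OF setting])
  have M1: "1 \<le> M + 1" using M by simp
  have K0: "(\<lambda>N. \<bar>K\<bar> * \<bar>\<kappa> N\<bar>) \<longlonglongrightarrow> 0"
    using tendsto_mult_right_zero[OF tendsto_rabs_zero[OF \<kappa>]] .
  have E': "\<bar>E N t x y - kernel_entry t x y\<bar> \<le> \<bar>K\<bar> * \<bar>\<kappa> N\<bar>"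
    if "1 \<le> N" "\<forall>i<m. t i \<in> rescale \<psi> a N ` I N" "x < \<iota> * m" "y < \<iota> * m" for N m t x y
  proof -
    have "K * \<bar>\<kappa> N\<bar> \<le> \<bar>K\<bar> * \<bar>\<kappa> N\<bar>" by (intro mult_right_mono) auto
    then show ?thesis using E[OF that] by linarith
  qed
  have small: "\<forall>\<^sub>F N in sequentially. \<bar>K\<bar> * \<bar>\<kappa> N\<bar> < b" if "0 < b" for b
    using order_tendstoD(2)[OF K0 that] .
  show "0 < real \<iota> * (M + 1)" using \<iota> M by simp
  show "\<forall>\<^sub>F N in sequentially. \<forall>m\<in>{1..N}. \<forall>t. (\<forall>i<m. t i \<in> rescale \<psi> a N ` I N) \<longrightarrow>
      scaled_corr \<beta> V \<psi> a N m t \<le> (real \<iota> * (M + 1)) ^ m * fact m"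
    using small[of 1, simplified]
  proof eventually_elim
    case (elim N)
    show ?case
    proof (intro ballI allI impI)
      fix m t assume m: "m \<in> {1..N}" and t: "\<forall>i<m. t i \<in> rescale \<psi> a N ` I N"
      have "\<bar>\<Phi> m (E N t)\<bar> \<le> (real \<iota> * (M + 1)) ^ m * fact m"
      proof (rule bounded[OF M1])
        fix x y assume xy: "x < \<iota> * m" "y < \<iota> * m"
        have "\<bar>E N t x y - kernel_entry t x y\<bar> \<le> 1" using E'[of N m t x y, OF _ t xy] m elim by simp
        then show "\<bar>E N t x y\<bar> \<le> M + 1" using kernel_entry_bound[of t x y] by linarith
      qed
      then show "scaled_corr \<beta> V \<psi> a N m t \<le> (real \<iota> * (M + 1)) ^ m * fact m"
        using form[of m N t] m by simp
    qed
  qed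
  show "\<forall>\<^sub>F N in sequentially. \<forall>t. (\<forall>i<m. t i \<in> rescale \<psi> a N ` I N) \<longrightarrow>
      \<bar>scaled_corr \<beta> V \<psi> a N m t - limit_corr m t\<bar> \<le> e" if m: "1 \<le> m" and e: "0 < e" for m e
  proof -
    define L where "L = real m * (real \<iota> * (M + 1)) ^ m * fact m"
    have L: "0 < L" unfolding L_def using \<iota> M m by (intro mult_pos_pos zero_less_power) auto
    show ?thesis using small[of 1, simplified] small[of "e / L", OF divide_pos_pos[OF e L]] eventually_ge_at_top[of m]
    proof eventually_elim
      case (elim N)
      show ?case
      proof (intro allI impI)
        fix t assume t: "\<forall>i<m. t i \<in> rescale \<psi> a N ` I N"
        have "\<bar>\<Phi> m (E N t) - \<Phi> m (kernel_entry t)\<bar> \<le> real m * (real \<iota> * (M + 1)) ^ m * fact m * (e / L)"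
        proof (rule lipschitz[OF M1])
          fix x y assume xy: "x < \<iota> * m" "y < \<iota> * m"
          have "\<bar>E N t x y - kernel_entry t x y\<bar> \<le> \<bar>K\<bar> * \<bar>\<kappa> N\<bar>" using E'[of N m t x y, OF _ t xy] m elim by simp
          then show "\<bar>E N t x y\<bar> \<le> M + 1 \<and> \<bar>kernel_entry t x y\<bar> \<le> M + 1 \<and> \<bar>E N t x y - kernel_entry t x y\<bar> \<le> e / L"
            using kernel_entry_bound[of t x y] elim(1,2) by linarith
        qed (use e L in simp)
        also have "\<dots> = e" using L unfolding L_def[symmetric] by simp
        finally show "\<bar>scaled_corr \<beta> V \<psi> a N m t - limit_corr m t\<bar> \<le> e"
          using form[OF m elim(3), of t] by (simp add: limit_corr_def)
      qed
    qed
  qed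
qed (fact limit_corr_measurable limit_corr_one limit_corr_shift limit_corr_cluster)+

theorem spacing_limit_exists:
  "\<exists>\<mu>. prob_space \<mu> \<and> sets \<mu> = sets borel \<and>
    (\<forall>\<beta> V \<psi> a I E \<kappa> K. 1 \<le> \<beta> \<and> setting \<beta> V \<psi> a I \<and>
      (\<forall>N m t. 1 \<le> m \<and> m \<le> N \<longrightarrow> scaled_corr \<beta> V \<psi> a N m t = \<Phi> m (E N t)) \<and> \<kappa> \<longlonglongrightarrow> 0 \<and>
      (\<forall>N m t x y. 1 \<le> N \<and> (\<forall>i<m. t i \<in> rescale \<psi> a N ` I N) \<and> x < \<iota> * m \<and> y < \<iota> * m \<longrightarrow>
        \<bar>E N t x y - kernel_entry t x y\<bar> \<le> K * \<bar>\<kappa> N :: real\<bar>) \<longrightarrow>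
      expected_discrepancy \<beta> V \<psi> a I \<mu> \<longlonglongrightarrow> 0)"
proof -
  obtain \<mu> where \<mu>: "prob_space \<mu>" "sets \<mu> = sets borel" and lim: "\<And>B D A r e.
      clustering_process B limit_corr D A r (real \<iota> * (M + 1)) \<Longrightarrow> 0 < e \<Longrightarrow>
      \<forall>\<^sub>F N in sequentially. \<exists>g\<in>borel_measurable (D N).
        (AE x in D N. (SUP s\<in>{0..}. ennreal \<bar>gap_fraction (A N) N (2 * r N) s x - measure \<mu> {0..s}\<bar>) \<le> g x) \<and>
        (\<integral>\<^sup>+x. g x \<partial>D N) \<le> ennreal e"
    using gap_distribution_exists[of limit_corr "real \<iota> * (M + 1)"] by blast
  show ?thesis
  proof (intro exI[of _ \<mu>] conjI \<mu> allI impI)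
    fix \<beta> V \<psi> a I E \<kappa> K
    assume *: "1 \<le> \<beta> \<and> setting \<beta> V \<psi> a I \<and>
      (\<forall>N m t. 1 \<le> m \<and> m \<le> N \<longrightarrow> scaled_corr \<beta> V \<psi> a N m t = \<Phi> m (E N t)) \<and> \<kappa> \<longlonglongrightarrow> 0 \<and>
      (\<forall>N m t x y. 1 \<le> N \<and> (\<forall>i<m. t i \<in> rescale \<psi> a N ` I N) \<and> x < \<iota> * m \<and> y < \<iota> * m \<longrightarrow>
        \<bar>E N t x y - kernel_entry t x y\<bar> \<le> K * \<bar>\<kappa> N :: real\<bar>)"
    then have es: "ensemble_setting \<beta> V \<psi> a I" by (simp add: ensemble_setting_def)
    have "clustering_process (scaled_corr \<beta> V \<psi> a) limit_corr (rescaled_spectrum_law \<beta> V \<psi> a)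
        (\<lambda>N. rescale \<psi> a N ` I N) (\<lambda>N. real N * \<psi> a * measure lborel (I N) / 2) (real \<iota> * (M + 1))"
      by (rule clustering_process_if_kernel_converges[OF es, where E = E and \<kappa> = \<kappa> and K = K]) (use * in simp_all)
    from ensemble_setting.expected_discrepancy_limit[OF es lim[OF this]]
    show "expected_discrepancy \<beta> V \<psi> a I \<mu> \<longlonglongrightarrow> 0" .
  qed
qed

end

section \<open>The sine kernels\<close>

lemma abs_sinc_le_one: "\<bar>sinc x\<bar> \<le> 1" for x :: real
  using abs_sin_x_le_abs_x[of x] by (auto simp: divide_le_eq_1)

lemma inverse_at_infinity: "((\<lambda>d. 1 / d) \<longlongrightarrow> (0 :: real)) at_infinity"
proof -
  have "(\<lambda>d. 1 / d) = (inverse :: real \<Rightarrow> real)" by (rule ext) (rule inverse_eq_divide[symmetric])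
  then show ?thesis using tendsto_inverse_0[where 'a = real] by (simp only:)
qed

lemma sinc_scaled_limit:
  fixes b :: real
  assumes "0 < b" shows "((\<lambda>d. sinc (b * d)) \<longlongrightarrow> 0) at_infinity"
proof (rule Lim_null_comparison)
  show "\<forall>\<^sub>F d in at_infinity. norm (sinc (b * d)) \<le> norm (1 / b * (1 / d))"
    unfolding eventually_at_infinity
  proof (intro exI[of _ 1] allI impI)
    fix d :: real assume "1 \<le> norm d"
    then have "d \<noteq> 0" by auto
    then show "norm (sinc (b * d)) \<le> norm (1 / b * (1 / d))"
      using assms abs_sin_le_one[of "b * d"] by (simp add: abs_mult field_simps)
  qed
  show "((\<lambda>d. norm (1 / b * (1 / d))) \<longlongrightarrow> 0) at_infinity"
    by (intro tendsto_norm_zero tendsto_mult_right_zero inverse_at_infinity)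
qed

text \<open>
  The mean value theorem, as the derivative of \<open>z * cos z - sin z\<close> is \<open>- z * sin z\<close>. This bounds the derivative of
  \<open>sinc\<close> near its removable singularity.
\<close>

lemma mult_cos_minus_sin_bound: "\<bar>z * cos z - sin z\<bar> \<le> z\<^sup>2" for z :: real
proof (cases "z = 0")
  case False
  have der: "((\<lambda>z. z * cos z - sin z) has_real_derivative - (x * sin x)) (at x)" for x :: real
    by (auto intro!: derivative_eq_intros)
  have "\<exists>x. \<bar>x\<bar> \<le> \<bar>z\<bar> \<and> z * cos z - sin z = z * - (x * sin x)"
  proof (cases "0 < z")
    case True
    from MVT2[OF True der] obtain x where
      "0 < x" "x < z" "z * cos z - sin z - (0 * cos 0 - sin 0) = (z - 0) * - (x * sin x)" by blast
    then show ?thesis by (intro exI[of _ x]) simp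
  next
    case neg: False
    then have "z < 0" using False by simp
    from MVT2[OF this der] obtain x where
      "z < x" "x < 0" "0 * cos 0 - sin 0 - (z * cos z - sin z) = (0 - z) * - (x * sin x)" by blast
    then show ?thesis by (intro exI[of _ x]) simp
  qed
  then obtain x where x: "\<bar>x\<bar> \<le> \<bar>z\<bar>" "z * cos z - sin z = z * - (x * sin x)" by blast
  have "\<bar>z * cos z - sin z\<bar> = \<bar>z\<bar> * (\<bar>x\<bar> * \<bar>sin x\<bar>)" unfolding x(2) by (simp add: abs_mult)
  also have "\<dots> \<le> \<bar>z\<bar> * (\<bar>z\<bar> * 1)" using x(1) by (intro mult_mono) auto
  finally show ?thesis by (simp add: power2_eq_square)
qed simp

lemma deriv_sinc_scaled:
  assumes "0 < b" "d \<noteq> 0"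
  shows "deriv (\<lambda>d. sinc (b * d)) d = cos (b * d) / d - sin (b * d) / (b * d\<^sup>2)"
proof (rule DERIV_imp_deriv)
  have "((\<lambda>d. sin (b * d) / (b * d)) has_real_derivative cos (b * d) / d - sin (b * d) / (b * d\<^sup>2)) (at d)"
    using assms by (auto intro!: derivative_eq_intros simp: field_simps power2_eq_square)
  then show "((\<lambda>d. sinc (b * d)) has_real_derivative cos (b * d) / d - sin (b * d) / (b * d\<^sup>2)) (at d)"
    by (rule has_field_derivative_transform_within[where d = "\<bar>d\<bar>"]) (use assms in \<open>auto simp: dist_real_def\<close>)
qed

lemma deriv_sinc_bound:
  assumes "0 < b" "d \<noteq> 0"
  shows "\<bar>deriv (\<lambda>d. sinc (b * d)) d\<bar> \<le> b"
proof -
  have "cos (b * d) / d - sin (b * d) / (b * d\<^sup>2) = b * ((b * d * cos (b * d) - sin (b * d)) / (b * d)\<^sup>2)"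
    using assms by (simp add: field_simps power2_eq_square)
  also have "\<bar>\<dots>\<bar> \<le> b * 1"
    using mult_cos_minus_sin_bound[of "b * d"] assms by (simp add: abs_mult divide_le_eq)
  finally show ?thesis unfolding deriv_sinc_scaled[OF assms] by simp
qed

lemma deriv_sinc_limit:
  assumes "0 < b" shows "(deriv (\<lambda>d. sinc (b * d)) \<longlongrightarrow> 0) at_infinity"
proof (rule Lim_null_comparison)
  show "\<forall>\<^sub>F d in at_infinity. norm (deriv (\<lambda>d. sinc (b * d)) d) \<le> norm ((1 + 1 / b) * (1 / d))"
    unfolding eventually_at_infinity
  proof (intro exI[of _ 1] allI impI)
    fix d :: real assume d: "1 \<le> norm d"
    then have d0: "d \<noteq> 0" by auto
    have 1: "\<bar>cos (b * d) / d\<bar> \<le> 1 / \<bar>d\<bar>"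
      using d by (simp add: divide_right_mono)
    have "\<bar>d\<bar> \<le> d\<^sup>2" using d self_le_power[of "\<bar>d\<bar>" 2] by simp
    then have "\<bar>sin (b * d)\<bar> / (b * d\<^sup>2) \<le> 1 / (b * \<bar>d\<bar>)"
      using assms d0 by (intro frac_le) auto
    moreover have "\<bar>sin (b * d) / (b * d\<^sup>2)\<bar> = \<bar>sin (b * d)\<bar> / (b * d\<^sup>2)" using assms by simp
    ultimately have "\<bar>cos (b * d) / d - sin (b * d) / (b * d\<^sup>2)\<bar> \<le> 1 / \<bar>d\<bar> + 1 / (b * \<bar>d\<bar>)"
      using 1 by linarith
    also have "\<dots> = norm ((1 + 1 / b) * (1 / d))"
      using assms d0 by (simp add: abs_mult field_simps)
    finally show "norm (deriv (\<lambda>d. sinc (b * d)) d) \<le> norm ((1 + 1 / b) * (1 / d))"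
      unfolding deriv_sinc_scaled[OF assms d0] by simp
  qed
  show "((\<lambda>d. norm ((1 + 1 / b) * (1 / d))) \<longlongrightarrow> 0) at_infinity"
    by (intro tendsto_norm_zero tendsto_mult_right_zero inverse_at_infinity)
qed

lemma deriv_sinc_measurable:
  assumes "0 < b" shows "deriv (\<lambda>d. sinc (b * d)) \<in> borel_measurable borel"
proof -
  have "deriv (\<lambda>d. sinc (b * d)) =
      (\<lambda>d. if d = 0 then deriv (\<lambda>d. sinc (b * d)) 0 else cos (b * d) / d - sin (b * d) / (b * d\<^sup>2))"
    using deriv_sinc_scaled[OF assms] by (simp add: fun_eq_iff)
  also have "\<dots> \<in> borel_measurable borel" by measurable
  finally show ?thesis .
qed

text \<open>
  Valid as an equation of \<open>deriv\<close> whether or not the derivatives exist.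
\<close>

lemma deriv_translate: "deriv (\<lambda>u. f (u - y)) x = deriv f (x - y)" for f :: "real \<Rightarrow> real"
  unfolding deriv_def using DERIV_shift[of f _ x "- y"] by simp

lemma integral_sinc_scaled:
  assumes "0 < b" shows "(LBINT t=0..ereal d. sinc (b * t)) = Si (b * d) / b"
proof -
  have "(LBINT t=ereal 0..ereal d. sinc (b * t)) = Si (b * d) / b - Si (b * 0) / b"
  proof (rule interval_integral_FTC_finite)
    show "continuous_on {min 0 d..max 0 d} (\<lambda>t. sinc (b * t))" by (intro continuous_intros)
    fix x
    have "((\<lambda>t. Si (b * t)) has_real_derivative sinc (b * x) * b) (at x)"
      by (rule DERIV_chain2[OF DERIV_Si]) (auto intro!: derivative_eq_intros)
    from DERIV_cdivide[OF this, of b]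
    have "((\<lambda>t. Si (b * t) / b) has_real_derivative sinc (b * x)) (at x)" using assms by simp
    then show "((\<lambda>t. Si (b * t) / b) has_vector_derivative sinc (b * x)) (at x within {min 0 d..max 0 d})"
      unfolding has_real_derivative_iff_has_vector_derivative by (rule has_vector_derivative_at_within)
  qed
  moreover have "Si 0 = 0" using Si_neg[of 0] by simp
  ultimately show ?thesis by (simp add: zero_ereal_def)
qed

lemma Si_scaled_limit:
  assumes "0 < b" shows "((\<lambda>d. Si (b * d) - pi / 2 * sgn d) \<longlongrightarrow> 0) at_infinity"
  unfolding at_infinity_eq_at_top_bot
proof (rule filterlim_sup)
  have lim: "((\<lambda>d. Si (b * d) - pi / 2) \<longlongrightarrow> pi / 2 - pi / 2) at_top"
    by (intro tendsto_diff tendsto_const filterlim_compose[OF Si_at_top]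
        filterlim_tendsto_pos_mult_at_top[OF tendsto_const assms filterlim_ident])
  then have lim: "((\<lambda>d. Si (b * d) - pi / 2) \<longlongrightarrow> 0) at_top" by simp
  have ev: "\<forall>\<^sub>F d in at_top. Si (b * d) - pi / 2 = Si (b * d) - pi / 2 * sgn d"
    using eventually_gt_at_top[of 0] by eventually_elim simp
  show "((\<lambda>d. Si (b * d) - pi / 2 * sgn d) \<longlongrightarrow> 0) at_top" by (rule Lim_transform_eventually[OF lim ev])
  have ev': "\<forall>\<^sub>F d in at_top. - (Si (b * d) - pi / 2) = Si (b * - d) - pi / 2 * sgn (- d)"
    using eventually_gt_at_top[of 0]
  proof eventually_elim
    case (elim d)
    then have "Si (- (b * d)) = - Si (b * d)" using assms by (intro Si_neg) simp
    then show ?case using elim by simp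
  qed
  have "((\<lambda>d. Si (b * - d) - pi / 2 * sgn (- d)) \<longlongrightarrow> - 0) at_top"
    by (rule Lim_transform_eventually[OF tendsto_minus[OF lim] ev'])
  then show "((\<lambda>d. Si (b * d) - pi / 2 * sgn d) \<longlongrightarrow> 0) at_bot"
    unfolding filterlim_at_bot_mirror by simp
qed

lemma symplectic_J_carrier: "symplectic_J k \<in> carrier_mat (2 * k) (2 * k)"
proof -
  have "sum_list (map dim_row (replicate k (mat_of_rows_list 2 [[0, 1], [-1, 0 :: real]]))) = 2 * k"
    "sum_list (map dim_col (replicate k (mat_of_rows_list 2 [[0, 1], [-1, 0 :: real]]))) = 2 * k"
    by (simp_all add: map_replicate sum_list_replicate mat_of_rows_list_def)
  then show ?thesis unfolding symplectic_J_def by (intro carrier_matI) (simp_all only: dim_diag_block_mat)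
qed

lemma symplectic_J_index:
  "i < 2 * k \<Longrightarrow> j < 2 * k \<Longrightarrow>
    symplectic_J k $$ (i, j) = (if even j then (if i = Suc j then - 1 else 0) else (if Suc i = j then 1 else 0))"
proof (induction k arbitrary: i j)
  case (Suc k)
  let ?B = "mat_of_rows_list 2 [[0, 1], [-1, 0 :: real]]"
  have B: "?B \<in> carrier_mat 2 2" by (simp add: mat_of_rows_list_def numeral_2_eq_2)
  have dimJ: "dim_row (symplectic_J k) = 2 * k" "dim_col (symplectic_J k) = 2 * k"
    using symplectic_J_carrier[of k] by auto
  have dimB: "dim_row ?B = 2" "dim_col ?B = 2" using B by auto
  have JS: "symplectic_J (Suc k) = four_block_mat ?B (0\<^sub>m 2 (2 * k)) (0\<^sub>m (2 * k) 2) (symplectic_J k)"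
    unfolding symplectic_J_def using dimJ[unfolded symplectic_J_def] by (simp add: Let_def dimB)
  have idx: "symplectic_J (Suc k) $$ (i, j) = (if i < 2 then if j < 2 then ?B $$ (i, j) else 0
      else if j < 2 then 0 else symplectic_J k $$ (i - 2, j - 2))"
    unfolding JS using Suc.prems by (subst index_mat_four_block) (simp_all add: dimB dimJ)
  show ?case
  proof (cases "i < 2"; cases "j < 2")
    assume "i < 2" "j < 2"
    then have "i = 0 \<or> i = 1" "j = 0 \<or> j = 1" by auto
    then show ?thesis unfolding idx by (auto simp: mat_of_rows_list_def)
  next
    assume "i < 2" "\<not> j < 2"
    then show ?thesis unfolding idx by (cases "j = 2") auto
  next
    assume "\<not> i < 2" "j < 2"
    then show ?thesis unfolding idx by (cases "j = 0") auto
  next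
    assume ij: "\<not> i < 2" "\<not> j < 2"
    then have "symplectic_J k $$ (i - 2, j - 2) =
        (if even (j - 2) then (if i - 2 = Suc (j - 2) then - 1 else 0) else (if Suc (i - 2) = j - 2 then 1 else 0))"
      using Suc.prems by (intro Suc.IH) auto
    moreover have "even (j - 2) = even j" using ij by simp
    moreover have "i - 2 = Suc (j - 2) \<longleftrightarrow> i = Suc j" "Suc (i - 2) = j - 2 \<longleftrightarrow> Suc i = j" using ij by auto
    ultimately show ?thesis unfolding idx using ij by simp
  qed
qed simp

text \<open>
  The entries of the product of a block matrix with \<open>symplectic_J\<close>: multiplication by \<open>\<sigma>\<close> from the right exchanges the two columns
  of each block, with a sign.
\<close>

definition symplectic_entry :: "(real \<Rightarrow> real \<Rightarrow> real mat) \<Rightarrow> (nat \<Rightarrow> real) \<Rightarrow> nat \<Rightarrow> nat \<Rightarrow> real" where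
  "symplectic_entry K x r s =
     (if even s then - K (x (r div 2)) (x (s div 2)) $$ (r mod 2, 1)
      else K (x (r div 2)) (x (s div 2)) $$ (r mod 2, 0))"

lemma block_matrix_symplectic_index:
  assumes r: "r < 2 * k" and s: "s < 2 * k"
  shows "(block_matrix K k x * symplectic_J k) $$ (r, s) = symplectic_entry K x r s"
proof -
  have Jd: "dim_row (symplectic_J k) = 2 * k" "dim_col (symplectic_J k) = 2 * k"
    using symplectic_J_carrier[of k] by auto
  define l0 where "l0 = (if even s then Suc s else s - 1)"
  have l0: "l0 < 2 * k"
  proof (cases "even s")
    case True
    then have "Suc s \<noteq> 2 * k" by (metis even_Suc even_mult_iff even_numeral)
    then show ?thesis using True s by (simp add: l0_def)
  qed (use s in \<open>simp add: l0_def\<close>)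
  have "(block_matrix K k x * symplectic_J k) $$ (r, s) =
      (\<Sum>l = 0..<2 * k. block_matrix K k x $$ (r, l) * symplectic_J k $$ (l, s))"
    using r s by (simp add: Jd block_matrix_def scalar_prod_def)
  also have "\<dots> = (\<Sum>l = 0..<2 * k. if l = l0 then block_matrix K k x $$ (r, l0) * (if even s then - 1 else 1) else 0)"
  proof (rule sum.cong[OF refl])
    fix l assume "l \<in> {0..<2 * k}"
    moreover have "odd s \<Longrightarrow> Suc l = s \<longleftrightarrow> l = s - 1" using odd_pos[of s] by auto
    ultimately show "block_matrix K k x $$ (r, l) * symplectic_J k $$ (l, s) =
        (if l = l0 then block_matrix K k x $$ (r, l0) * (if even s then - 1 else 1) else 0)"
      using symplectic_J_index[of l k s] s by (auto simp: l0_def)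
  qed
  also have "\<dots> = block_matrix K k x $$ (r, l0) * (if even s then - 1 else 1)" using l0 by simp
  also have "block_matrix K k x $$ (r, l0) = K (x (r div 2)) (x (l0 div 2)) $$ (r mod 2, l0 mod 2)"
    using r l0 by (simp add: block_matrix_def)
  also have "l0 div 2 = s div 2" by (cases "even s") (auto simp: l0_def elim!: oddE evenE)
  also have "l0 mod 2 = (if even s then 1 else 0)" by (cases "even s") (auto simp: l0_def elim!: oddE evenE)
  finally show ?thesis by (simp add: symplectic_entry_def)
qed

section \<open>Spacing limits of the three ensembles\<close>

text \<open>
  The entries of \<open>K * \<sigma>\<close> for the limiting kernels of frequency \<open>b\<close>, where \<open>\<eta>\<close> is the coefficient of
  \<open>sgn\<close>. As \<open>Si\<close> tends to \<open>\<plusminus> pi / 2\<close>, the last entry tends to \<open>\<plusminus> (pi / (2 * b) - \<eta>)\<close>, which is \<open>0\<close> for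
  \<open>\<beta> = 1\<close> and \<open>1 / 4\<close> for \<open>\<beta> = 4\<close>.
\<close>

definition sine_entry :: "real \<Rightarrow> real \<Rightarrow> nat \<Rightarrow> nat \<Rightarrow> real \<Rightarrow> real" where
  "sine_entry b \<eta> p q d =
     (if p = 0 then (if q = 0 then - deriv (\<lambda>z. sinc (b * z)) d else sinc (b * d))
      else (if q = 0 then - sinc (b * d) else Si (b * d) / b - \<eta> * sgn d))"

lemma stationary_kernel_sine: "stationary_kernel det_form 1 (\<lambda>p q d. sinc (pi * d)) 1 0"
proof (intro stationary_kernel.intro kernel_functional_det stationary_kernel_axioms.intro)
  show "((\<lambda>d. sinc (pi * d) - (if p = 1 \<and> q = 1 then 0 * sgn d else 0)) \<longlongrightarrow> 0) at_infinity" for p q :: nat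
    using sinc_scaled_limit[of pi] by (cases "p = 1"; cases "q = 1") simp_all
  show "\<bar>sinc (pi * d)\<bar> \<le> 1" for d by (rule abs_sinc_le_one)
  show "det_form 1 (\<lambda>x y. sinc (pi * 0)) = 1"
    by (simp add: det_form_def det_single)
qed simp_all

lemma pfaffian_form_one: "pfaffian_form 1 f = (f 0 1 - f 1 0) / 2"
proof -
  have two: "{..<2 * 1} = {0, 1 :: nat}" by auto
  have "{p. p permutes {0, 1 :: nat}} = {id, Transposition.transpose 0 1}"
    by (auto simp: permutes_doubleton_iff)
  moreover have "id \<noteq> Transposition.transpose (0 :: nat) 1" by (metis id_apply transpose_apply_first zero_neq_one)
  ultimately have "pfaffian_sum 1 f = f 0 1 - f 1 0"
    unfolding pfaffian_sum_def two by (simp add: sign_swap_id)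
  then show ?thesis by (simp add: pfaffian_form_def)
qed

lemma stationary_kernel_pfaffian:
  assumes b: "0 < b"
  shows "\<exists>M. stationary_kernel pfaffian_form 2 (sine_entry b \<eta>) M (pi / (2 * b) - \<eta>)"
proof -
  obtain B where B: "\<And>z. \<bar>Si z\<bar> \<le> B" using bounded_Si by blast
  define v where "v = deriv (\<lambda>z. sinc (b * z)) 0"
  define M where "M = 1 + b + \<bar>v\<bar> + B / b + \<bar>\<eta>\<bar>"
  have B0: "0 \<le> B / b" using B[of 0] b by (intro divide_nonneg_nonneg) auto
  have D: "\<bar>deriv (\<lambda>z. sinc (b * z)) d\<bar> \<le> b + \<bar>v\<bar>" for d
    using deriv_sinc_bound[OF b, of d] b by (cases "d = 0") (auto simp: v_def)
  have I: "\<bar>Si (b * d) / b - \<eta> * sgn d\<bar> \<le> B / b + \<bar>\<eta>\<bar>" for d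
  proof -
    have "\<bar>Si (b * d) / b\<bar> \<le> B / b" using B[of "b * d"] b by (simp add: divide_right_mono)
    moreover have "\<bar>\<eta> * sgn d\<bar> \<le> \<bar>\<eta>\<bar>" by (simp add: abs_mult abs_sgn_eq)
    ultimately show ?thesis by linarith
  qed
  have le: "b + \<bar>v\<bar> \<le> M" "B / b + \<bar>\<eta>\<bar> \<le> M" "1 \<le> M" using B0 b by (simp_all add: M_def)
  have "stationary_kernel pfaffian_form 2 (sine_entry b \<eta>) M (pi / (2 * b) - \<eta>)"
  proof (intro stationary_kernel.intro kernel_functional_pfaffian stationary_kernel_axioms.intro)
    show "1 \<le> M" by fact
    show "\<bar>sine_entry b \<eta> p q d\<bar> \<le> M" for p q d
      using order_trans[OF D[of d] le(1)] order_trans[OF I[of d] le(2)] order_trans[OF abs_sinc_le_one[of "b * d"] le(3)]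
      unfolding sine_entry_def by (cases "p = 0"; cases "q = 0"; simp only: if_True if_False abs_minus_cancel simp_thms)
    show "sine_entry b \<eta> p q \<in> borel_measurable borel" for p q
    proof -
      show ?thesis unfolding sine_entry_def[abs_def]
        using deriv_sinc_measurable[OF b] by (cases "p = 0"; cases "q = 0") simp_all
    qed
    have "((\<lambda>d. (Si (b * d) - pi / 2 * sgn d) / b) \<longlongrightarrow> 0) at_infinity"
      using tendsto_divide[OF Si_scaled_limit[OF b] tendsto_const[of b]] b by simp
    moreover have "(\<lambda>d. (Si (b * d) - pi / 2 * sgn d) / b) = (\<lambda>d. Si (b * d) / b - \<eta> * sgn d - (pi / (2 * b) - \<eta>) * sgn d)"
      using b by (simp add: fun_eq_iff field_simps)
    ultimately have I_lim: "((\<lambda>d. Si (b * d) / b - \<eta> * sgn d - (pi / (2 * b) - \<eta>) * sgn d) \<longlongrightarrow> 0) at_infinity"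
      by simp
    show "((\<lambda>d. sine_entry b \<eta> p q d - (if p = 1 \<and> q = 1 then (pi / (2 * b) - \<eta>) * sgn d else 0)) \<longlongrightarrow> 0) at_infinity"
      if pq: "p < 2" "q < 2" for p q
    proof -
      consider "p = 0" "q = 0" | "p = 0" "q = 1" | "p = 1" "q = 0" | "p = 1" "q = 1"
        using pq by (auto simp: less_2_cases_iff)
      then show ?thesis
      proof cases
        case 1
        then show ?thesis using tendsto_minus[OF deriv_sinc_limit[OF b]] by (simp add: sine_entry_def)
      next
        case 2
        then show ?thesis using sinc_scaled_limit[OF b] by (simp add: sine_entry_def)
      next
        case 3
        then show ?thesis using tendsto_minus[OF sinc_scaled_limit[OF b]] by (simp add: sine_entry_def)
      next
        case 4
        then show ?thesis using I_lim by (simp add: sine_entry_def)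
      qed
    qed
    show "pfaffian_form 1 (\<lambda>x y. sine_entry b \<eta> (x mod 2) (y mod 2) 0) = 1"
      unfolding pfaffian_form_one by (simp add: sine_entry_def)
  qed
  then show ?thesis ..
qed

text \<open>
  Every index other than \<open>1\<close> is treated like \<open>4\<close>, as in \<open>limit_kernel\<close>.
\<close>

definition frequency :: "nat \<Rightarrow> real" where "frequency \<beta> = (if \<beta> = 1 then pi else 2 * pi)"

definition jump :: "nat \<Rightarrow> real" where "jump \<beta> = (if \<beta> = 1 then 1 / 2 else 0)"

lemma frequency_pos: "0 < frequency \<beta>"
  by (simp add: frequency_def)

lemma limit_kernel_entries:
  fixes x y :: real
  shows "limit_kernel \<beta> x y $$ (0, 0) = sinc (frequency \<beta> * (x - y))"
    "limit_kernel \<beta> x y $$ (1, 1) = sinc (frequency \<beta> * (x - y))"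
    "limit_kernel \<beta> x y $$ (0, 1) = deriv (\<lambda>z. sinc (frequency \<beta> * z)) (x - y)"
    "limit_kernel \<beta> x y $$ (1, 0) = Si (frequency \<beta> * (x - y)) / frequency \<beta> - jump \<beta> * sgn (x - y)"
proof -
  define k :: real where "k = (if \<beta> = 1 then 1 else 2)"
  have f: "frequency \<beta> = k * pi" by (simp add: frequency_def k_def)
  have K: "K2 (k * u) (k * w) = sinc (frequency \<beta> * (u - w))" for u w
    unfolding f K2_def by (simp add: algebra_simps)
  have L: "limit_kernel \<beta> x y = mat_of_rows_list 2
     [[K2 (k * x) (k * y), deriv (\<lambda>u. K2 (k * u) (k * y)) x],
      [(LBINT t=0..ereal (x - y). K2 (k * t) (k * 0)) - jump \<beta> * sgn (x - y), K2 (k * x) (k * y)]]"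
    by (simp add: limit_kernel_def K1_mat_def K4_mat_def k_def jump_def)
  note entries = L mat_of_rows_list_def
  show "limit_kernel \<beta> x y $$ (0, 0) = sinc (frequency \<beta> * (x - y))"
    "limit_kernel \<beta> x y $$ (1, 1) = sinc (frequency \<beta> * (x - y))"
    unfolding entries K by simp_all
  have "deriv (\<lambda>u. K2 (k * u) (k * y)) x = deriv (\<lambda>z. sinc (frequency \<beta> * z)) (x - y)"
    unfolding K by (rule deriv_translate)
  then show "limit_kernel \<beta> x y $$ (0, 1) = deriv (\<lambda>z. sinc (frequency \<beta> * z)) (x - y)"
    unfolding entries by simp
  have "(LBINT t=0..ereal (x - y). K2 (k * t) (k * 0)) = Si (frequency \<beta> * (x - y)) / frequency \<beta>"
    unfolding K diff_0_right by (rule integral_sinc_scaled[OF frequency_pos])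
  then show "limit_kernel \<beta> x y $$ (1, 0) = Si (frequency \<beta> * (x - y)) / frequency \<beta> - jump \<beta> * sgn (x - y)"
    unfolding entries by simp
qed

lemma symplectic_entry_limit_kernel:
  "symplectic_entry (limit_kernel \<beta>) t r s =
     sine_entry (frequency \<beta>) (jump \<beta>) (r mod 2) (s mod 2) (t (r div 2) - t (s div 2))"
proof -
  consider "r mod 2 = 0" | "r mod 2 = 1" by linarith
  then show ?thesis
    by cases (simp_all add: symplectic_entry_def sine_entry_def limit_kernel_entries limit_kernel_entries[simplified] even_iff_mod_2_eq_zero)
qed

lemma pfaffian_block_matrix: "pfaffian (block_matrix K k x * symplectic_J k) = pfaffian_form k (symplectic_entry K x)"
proof -
  have "dim_row (block_matrix K k x * symplectic_J k) div 2 = k" by (simp add: block_matrix_def)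
  then have "pfaffian (block_matrix K k x * symplectic_J k) =
      pfaffian_form k (\<lambda>r s. (block_matrix K k x * symplectic_J k) $$ (r, s))"
    by (simp add: pfaffian_def pfaffian_form_def pfaffian_sum_def Let_def)
  also have "\<dots> = pfaffian_form k (symplectic_entry K x)"
    by (rule kernel_functional.cong[OF kernel_functional_pfaffian]) (rule block_matrix_symplectic_index)
  finally show ?thesis .
qed

lemma determinantal_spacing_limit:
  "\<exists>\<mu>. prob_space \<mu> \<and> sets \<mu> = sets borel \<and>
    (\<forall>V \<psi> a I K. setting 2 V \<psi> a I \<and> is_det_kernel V \<psi> a K \<and> scalar_kernel_convergence \<psi> a I K \<longrightarrow>
       expected_discrepancy 2 V \<psi> a I \<mu> \<longlonglongrightarrow> 0)"
proof -
  interpret stationary_kernel det_form 1 "\<lambda>p q d. sinc (pi * d)" 1 0 by (rule stationary_kernel_sine)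
  obtain \<mu> where \<mu>: "prob_space \<mu>" "sets \<mu> = sets borel"
    and lim: "\<And>\<beta> V \<psi> a I E \<kappa> K. 1 \<le> \<beta> \<and> setting \<beta> V \<psi> a I \<and>
      (\<forall>N m t. 1 \<le> m \<and> m \<le> N \<longrightarrow> scaled_corr \<beta> V \<psi> a N m t = det_form m (E N t)) \<and> \<kappa> \<longlonglongrightarrow> 0 \<and>
      (\<forall>N m t x y. 1 \<le> N \<and> (\<forall>i<m. t i \<in> rescale \<psi> a N ` I N) \<and> x < 1 * m \<and> y < 1 * m \<longrightarrow>
        \<bar>E N t x y - kernel_entry t x y\<bar> \<le> K * \<bar>\<kappa> N :: real\<bar>) \<Longrightarrow>
      expected_discrepancy \<beta> V \<psi> a I \<mu> \<longlonglongrightarrow> 0"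
    using spacing_limit_exists by blast
  have main: "expected_discrepancy 2 V \<psi> a I \<mu> \<longlonglongrightarrow> 0"
    if s: "setting 2 V \<psi> a I" and K: "is_det_kernel V \<psi> a K" and conv: "scalar_kernel_convergence \<psi> a I K" for V \<psi> a I K
  proof -
    obtain \<kappa> C where \<kappa>: "\<kappa> \<longlonglongrightarrow> 0" and C: "\<And>N x y. 1 \<le> N \<Longrightarrow> x \<in> rescale \<psi> a N ` I N \<Longrightarrow> y \<in> rescale \<psi> a N ` I N \<Longrightarrow>
        \<bar>K N (unscale \<psi> a N x) (unscale \<psi> a N y) - K2 x y\<bar> \<le> C * \<bar>\<kappa> N :: real\<bar>"
      using conv unfolding scalar_kernel_convergence_def by blast
    show ?thesis
    proof (rule lim[where E = "\<lambda>N t i j. K N (unscale \<psi> a N (t i)) (unscale \<psi> a N (t j))" and \<kappa> = \<kappa> and K = C],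
        intro conjI allI impI s \<kappa>)
      fix N m :: nat and t :: "nat \<Rightarrow> real" assume m: "1 \<le> m \<and> m \<le> N"
      then have "scaled_corr 2 V \<psi> a N m t =
          Determinant.det (Matrix.mat m m (\<lambda>(i, j). K N (unscale \<psi> a N (t i)) (unscale \<psi> a N (t j))))"
        using K unfolding is_det_kernel_def by auto
      then show "scaled_corr 2 V \<psi> a N m t = det_form m (\<lambda>i j. K N (unscale \<psi> a N (t i)) (unscale \<psi> a N (t j)))"
        by (simp only: det_form_def)
    next
      fix N m x y :: nat and t :: "nat \<Rightarrow> real"
      assume *: "1 \<le> N \<and> (\<forall>i<m. t i \<in> rescale \<psi> a N ` I N) \<and> x < 1 * m \<and> y < 1 * m"
      then have "\<bar>K N (unscale \<psi> a N (t x)) (unscale \<psi> a N (t y)) - K2 (t x) (t y)\<bar> \<le> C * \<bar>\<kappa> N\<bar>"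
        by (intro C) auto
      moreover have "kernel_entry t x y = K2 (t x) (t y)"
        by (simp only: kernel_entry_def K2_def div_by_1)
      ultimately show "\<bar>K N (unscale \<psi> a N (t x)) (unscale \<psi> a N (t y)) - kernel_entry t x y\<bar> \<le> C * \<bar>\<kappa> N\<bar>"
        by (simp only:)
    qed simp
  qed
  show ?thesis
    by (rule exI[of _ \<mu>], intro conjI allI impI \<mu>) (elim conjE, rule main, assumption+)
qed

lemma pfaffian_spacing_limit:
  assumes \<beta>: "1 \<le> \<beta>"
  shows "\<exists>\<mu>. prob_space \<mu> \<and> sets \<mu> = sets borel \<and>
    (\<forall>V \<psi> a I K. setting \<beta> V \<psi> a I \<and> is_pfaffian_kernel \<beta> V \<psi> a K \<and> matrix_kernel_convergence \<beta> \<psi> a I K \<longrightarrow>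
       expected_discrepancy \<beta> V \<psi> a I \<mu> \<longlonglongrightarrow> 0)"
proof -
  obtain M where sk: "stationary_kernel pfaffian_form 2 (sine_entry (frequency \<beta>) (jump \<beta>)) M (pi / (2 * frequency \<beta>) - jump \<beta>)"
    using stationary_kernel_pfaffian[OF frequency_pos] by blast
  interpret stationary_kernel pfaffian_form 2 "sine_entry (frequency \<beta>) (jump \<beta>)" M "pi / (2 * frequency \<beta>) - jump \<beta>"
    by (rule sk)
  obtain \<mu> where \<mu>: "prob_space \<mu>" "sets \<mu> = sets borel"
    and lim: "\<And>\<beta> V \<psi> a I E \<kappa> K. 1 \<le> \<beta> \<and> setting \<beta> V \<psi> a I \<and>
      (\<forall>N m t. 1 \<le> m \<and> m \<le> N \<longrightarrow> scaled_corr \<beta> V \<psi> a N m t = pfaffian_form m (E N t)) \<and> \<kappa> \<longlonglongrightarrow> 0 \<and>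
      (\<forall>N m t x y. 1 \<le> N \<and> (\<forall>i<m. t i \<in> rescale \<psi> a N ` I N) \<and> x < 2 * m \<and> y < 2 * m \<longrightarrow>
        \<bar>E N t x y - kernel_entry t x y\<bar> \<le> K * \<bar>\<kappa> N :: real\<bar>) \<Longrightarrow>
      expected_discrepancy \<beta> V \<psi> a I \<mu> \<longlonglongrightarrow> 0"
    using spacing_limit_exists by blast
  have main: "expected_discrepancy \<beta> V \<psi> a I \<mu> \<longlonglongrightarrow> 0"
    if s: "setting \<beta> V \<psi> a I" and K: "is_pfaffian_kernel \<beta> V \<psi> a K"
      and conv: "matrix_kernel_convergence \<beta> \<psi> a I K" for V \<psi> a I K
  proof -
    obtain \<kappa> C where \<kappa>: "\<kappa> \<longlonglongrightarrow> 0" and C: "\<And>N x y p q. 1 \<le> N \<Longrightarrow> x \<in> rescale \<psi> a N ` I N \<Longrightarrow> y \<in> rescale \<psi> a N ` I N \<Longrightarrow>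
        p < 2 \<Longrightarrow> q < 2 \<Longrightarrow>
        \<bar>K N (unscale \<psi> a N x) (unscale \<psi> a N y) $$ (p, q) - limit_kernel \<beta> x y $$ (p, q)\<bar> \<le> C * \<bar>\<kappa> N :: real\<bar>"
      using conv unfolding matrix_kernel_convergence_def by blast
    show ?thesis
    proof (rule lim[where E = "\<lambda>N t. symplectic_entry (K N) (\<lambda>i. unscale \<psi> a N (t i))" and \<kappa> = \<kappa> and K = C],
        intro conjI allI impI \<beta> s \<kappa>)
      fix N m :: nat and t :: "nat \<Rightarrow> real" assume m: "1 \<le> m \<and> m \<le> N"
      then have "scaled_corr \<beta> V \<psi> a N m t =
          pfaffian (block_matrix (K N) m (\<lambda>i. unscale \<psi> a N (t i)) * symplectic_J m)"
        using K unfolding is_pfaffian_kernel_def by auto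
      then show "scaled_corr \<beta> V \<psi> a N m t = pfaffian_form m (symplectic_entry (K N) (\<lambda>i. unscale \<psi> a N (t i)))"
        by (simp only: pfaffian_block_matrix)
    next
      fix N m x y :: nat and t :: "nat \<Rightarrow> real"
      assume *: "1 \<le> N \<and> (\<forall>i<m. t i \<in> rescale \<psi> a N ` I N) \<and> x < 2 * m \<and> y < 2 * m"
      then have "x div 2 < m" "y div 2 < m" by auto
      then have C': "\<bar>K N (unscale \<psi> a N (t (x div 2))) (unscale \<psi> a N (t (y div 2))) $$ (x mod 2, q) -
          limit_kernel \<beta> (t (x div 2)) (t (y div 2)) $$ (x mod 2, q)\<bar> \<le> C * \<bar>\<kappa> N\<bar>" if "q < 2" for q
        using * that by (intro C) auto
      have "kernel_entry t x y = symplectic_entry (limit_kernel \<beta>) t x y"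
        unfolding kernel_entry_def by (rule symplectic_entry_limit_kernel[symmetric])
      then show "\<bar>symplectic_entry (K N) (\<lambda>i. unscale \<psi> a N (t i)) x y - kernel_entry t x y\<bar> \<le> C * \<bar>\<kappa> N\<bar>"
        using C'[of 0] C'[of 1] by (simp add: symplectic_entry_def abs_minus_commute)
    qed
  qed
  show ?thesis
    by (rule exI[of _ \<mu>], intro conjI allI impI \<mu>) (elim conjE, rule main, assumption+)
qed

theorem theorem3p4:
  shows "\<exists>\<mu> :: nat \<Rightarrow> real measure.
    (\<forall>\<beta>\<in>{1, 2, 4}. prob_space (\<mu> \<beta>) \<and> sets (\<mu> \<beta>) = sets borel) \<and>
    (\<forall>V \<psi> a I K.
       setting 2 V \<psi> a I \<and> is_det_kernel V \<psi> a K \<and> scalar_kernel_convergence \<psi> a I K \<longrightarrow>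
       expected_discrepancy 2 V \<psi> a I (\<mu> 2) \<longlonglongrightarrow> 0) \<and>
    (\<forall>\<beta>\<in>{1, 4}. \<forall>V \<psi> a I K.
       setting \<beta> V \<psi> a I \<and> is_pfaffian_kernel \<beta> V \<psi> a K \<and> matrix_kernel_convergence \<beta> \<psi> a I K \<longrightarrow>
       expected_discrepancy \<beta> V \<psi> a I (\<mu> \<beta>) \<longlonglongrightarrow> 0)"
proof -
  have four: "1 \<le> (4 :: nat)" by simp
  obtain \<mu>1 where "prob_space \<mu>1" "sets \<mu>1 = sets borel"
    "\<And>V \<psi> a I K. setting 1 V \<psi> a I \<and> is_pfaffian_kernel 1 V \<psi> a K \<and> matrix_kernel_convergence 1 \<psi> a I K \<Longrightarrow>
       expected_discrepancy 1 V \<psi> a I \<mu>1 \<longlonglongrightarrow> 0"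
    using pfaffian_spacing_limit[OF order_refl] by blast
  moreover obtain \<mu>2 where "prob_space \<mu>2" "sets \<mu>2 = sets borel"
    "\<And>V \<psi> a I K. setting 2 V \<psi> a I \<and> is_det_kernel V \<psi> a K \<and> scalar_kernel_convergence \<psi> a I K \<Longrightarrow>
       expected_discrepancy 2 V \<psi> a I \<mu>2 \<longlonglongrightarrow> 0"
    using determinantal_spacing_limit by blast
  moreover obtain \<mu>4 where "prob_space \<mu>4" "sets \<mu>4 = sets borel"
    "\<And>V \<psi> a I K. setting 4 V \<psi> a I \<and> is_pfaffian_kernel 4 V \<psi> a K \<and> matrix_kernel_convergence 4 \<psi> a I K \<Longrightarrow>
       expected_discrepancy 4 V \<psi> a I \<mu>4 \<longlonglongrightarrow> 0"
    using pfaffian_spacing_limit[OF four] by blast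
  ultimately show ?thesis
    by (intro exI[of _ "\<lambda>\<beta>. if \<beta> = 1 then \<mu>1 else if \<beta> = 2 then \<mu>2 else \<mu>4"]) (auto simp del: One_nat_def)
qed

end
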